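(* Let $\mathsf{A}$ be an algebra with bracket (AWB) over a field $\mathbb{K}$. Then there is an isomorphism of vector spaces $$\mathsf{H}^{AWB}_n(\mathsf{A}) \cong H^{Q}_n(\mathsf{A}) \quad\text{for all } n \geq 0,$$ where $\mathsf{H}^{AWB}_*(\mathsf{A})$ is the homology with trivial coefficients of $\mathsf{A}$ and $H^Q_*(\mathsf{A})$ is the Quillen homology of $\mathsf{A}$.
   Context: $\mathbb{K}$ is a fixed field; all vector spaces, algebras and tensor products are over $\mathbb{K}$. An algebra with bracket (AWB) is an associative, not necessarily commutative (and not necessarily unital) algebra $\mathsf{A}$ with a bilinear map $[-,-]:\mathsf{A}\times\mathsf{A}\to\mathsf{A}$ such that $[ab,c]=[a,c]b+a[b,c]$ for all $a,b,c$. Homomorphisms of AWBs are homomorphisms of associative algebras preserving the bracket. A two-sided ideal is a subspace $\mathsf{B}$ with $\mathsf{A}\mathsf{B},\mathsf{B}\mathsf{A},[\mathsf{A},\mathsf{B}],[\mathsf{B},\mathsf{A}]\subseteq\mathsf{B}$. Let $[[\mathsf{A},\mathsf{A}]]$ be the two-sided ideal generated by all $aa'$ and $[a,a']$ with $a,a'\in\mathsf{A}$, and put $\mathsf{A}^{ab}=\mathsf{A}/[[\mathsf{A},\mathsf{A}]]$ (a vector space); this is the abelianization functor. Homology with trivial coefficients: put $C_0(\mathsf{A})=\mathsf{A}$ and $C_n(\mathsf{A})=\mathsf{A}^{\otimes(n+1)}\oplus\mathsf{A}^{\otimes(n+1)}$ for $n\ge1$. Elements of the first summand are written $a_1\otimes\cdots\otimes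 a_{n+1}$ and elements of the second summand $a_1\circ\cdots\circ a_{n+1}$ (in degree $0$ there is only one copy). For $n\geq 1$ the boundary $d_n:C_n(\mathsf{A})\to C_{n-1}(\mathsf{A})$ is $$d_n(a_1\otimes\cdots\otimes a_{n+1})=\sum_{i=1}^{n}(-1)^{i+1}a_1\otimes\cdots\otimes a_ia_{i+1}\otimes\cdots\otimes a_{n+1},$$ $$d_n(a_1\circ\cdots\circ a_{n+1})=\sum_{i=1}^{n}a_1\otimes\cdots\otimes[a_i,a_{n+1}]\otimes\cdots\otimes a_n+\sum_{i=1}^{n-1}(-1)^i a_1\circ\cdots\circ a_ia_{i+1}\circ\cdots\circ a_{n+1},$$ and $d_0=0$. $\mathsf{H}^{AWB}_*(\mathsf{A})$ is the homology of this complex. Quillen homology: choose a free simplicial resolution of $\mathsf{A}$, i.e. an augmented simplicial AWB $\mathsf{F}_*\xrightarrow{\epsilon}\mathsf{A}$ such that each $\mathsf{F}_n$ ($n\ge0$) is a free AWB, $\pi_n(\mathsf{F}_* )=0$ for $n\geq1$, and $\epsilon$ induces an isomorphism $\pi_0(\mathsf{F}_* )\cong\mathsf{A}$. Then $H^Q_n(\mathsf{A})=H_n(\mathsf{F}_*^{ab})$, where $\mathsf{F}_*^{ab}$ is the simplicial vector space obtained by applying $(-)^{ab}$ dimensionwise. *)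

theory Defs
  imports "HOL-Algebra.Module" "HOL-Algebra.QuotRing"
begin

section \<open>Linear algebra over a field, with explicit carriers\<close>

text \<open>
  A vector space over \<open>K\<close> is a \<^locale>\<open>module\<close> over a \<^locale>\<open>field\<close> \<open>K\<close>.  The fields
  \<^const>\<open>mult\<close> and \<^const>\<open>one\<close> of the record type of modules play no role for vector spaces and
  are left unspecified.
\<close>

definition lin_hom ::
  "('k, 'r) ring_scheme \<Rightarrow> ('k, 'v, 'm) module_scheme \<Rightarrow> ('k, 'w, 'n) module_scheme \<Rightarrow> ('v \<Rightarrow> 'w) set"
  where "lin_hom K V W =
    {h \<in> carrier V \<rightarrow> carrier W.
       (\<forall>x\<in>carrier V. \<forall>y\<in>carrier V. h (x \<oplus>\<^bsub>V\<^esub> y) = h x \<oplus>\<^bsub>W\<^esub> h y) \<and>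
       (\<forall>k\<in>carrier K. \<forall>x\<in>carrier V. h (k \<odot>\<^bsub>V\<^esub> x) = k \<odot>\<^bsub>W\<^esub> h x)}"

definition lin_iso ::
  "('k, 'r) ring_scheme \<Rightarrow> ('k, 'v, 'm) module_scheme \<Rightarrow> ('k, 'w, 'n) module_scheme \<Rightarrow> bool"
  where "lin_iso K V W \<longleftrightarrow> (\<exists>h \<in> lin_hom K V W. bij_betw h (carrier V) (carrier W))"

definition lin_span :: "('k, 'r) ring_scheme \<Rightarrow> ('k, 'v, 'm) module_scheme \<Rightarrow> 'v set \<Rightarrow> 'v set"
  where "lin_span K V S = \<Inter>{N. submodule N K V \<and> S \<subseteq> N}"

text \<open>The quotient \<open>V / N\<close>; its elements are the cosets of \<open>N\<close>.\<close>

definition quot_space :: "('k, 'v, 'm) module_scheme \<Rightarrow> 'v set \<Rightarrow> ('k, 'v set) module"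
  where "quot_space V N =
    \<lparr>carrier = a_rcosets\<^bsub>V\<^esub> N, mult = undefined, one = undefined,
     zero = N, add = set_add V,
     smult = (\<lambda>k S. \<Union>x\<in>S. N +>\<^bsub>V\<^esub> (k \<odot>\<^bsub>V\<^esub> x))\<rparr>"

text \<open>The map induced on cosets by a map \<open>h\<close> that is constant on each coset.\<close>

definition quot_lift :: "('v \<Rightarrow> 'w) \<Rightarrow> 'v set \<Rightarrow> 'w"
  where "quot_lift h S = the_elem (h ` S)"

definition dsum ::
  "('k, 'v, 'm) module_scheme \<Rightarrow> ('k, 'w, 'n) module_scheme \<Rightarrow> ('k, 'v \<times> 'w) module"
  where "dsum V W =
    \<lparr>carrier = carrier V \<times> carrier W, mult = undefined, one = undefined,
     zero = (\<zero>\<^bsub>V\<^esub>, \<zero>\<^bsub>W\<^esub>),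
     add = (\<lambda>(x, y) (x', y'). (x \<oplus>\<^bsub>V\<^esub> x', y \<oplus>\<^bsub>W\<^esub> y')),
     smult = (\<lambda>k (x, y). (k \<odot>\<^bsub>V\<^esub> x, k \<odot>\<^bsub>W\<^esub> y))\<rparr>"

definition free_space :: "('k, 'r) ring_scheme \<Rightarrow> 'x set \<Rightarrow> ('k, 'x \<Rightarrow> 'k) module"
  where "free_space K S =
    \<lparr>carrier = {f. range f \<subseteq> carrier K \<and> finite {x. f x \<noteq> \<zero>\<^bsub>K\<^esub>} \<and> {x. f x \<noteq> \<zero>\<^bsub>K\<^esub>} \<subseteq> S},
     mult = undefined, one = undefined,
     zero = (\<lambda>_. \<zero>\<^bsub>K\<^esub>),
     add = (\<lambda>f g x. f x \<oplus>\<^bsub>K\<^esub> g x),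
     smult = (\<lambda>k f x. k \<otimes>\<^bsub>K\<^esub> f x)\<rparr>"

definition basis_elem :: "('k, 'r) ring_scheme \<Rightarrow> 'x \<Rightarrow> 'x \<Rightarrow> 'k"
  where "basis_elem K x = (\<lambda>y. if y = x then \<one>\<^bsub>K\<^esub> else \<zero>\<^bsub>K\<^esub>)"

text \<open>Linear extension of a map on basis elements to the free vector space.\<close>

definition lin_ext ::
  "('k, 'r) ring_scheme \<Rightarrow> ('k, 'w, 'n) module_scheme \<Rightarrow> ('x \<Rightarrow> 'w) \<Rightarrow> ('x \<Rightarrow> 'k) \<Rightarrow> 'w"
  where "lin_ext K W g f = (\<Oplus>\<^bsub>W\<^esub> x \<in> {x. f x \<noteq> \<zero>\<^bsub>K\<^esub>}. f x \<odot>\<^bsub>W\<^esub> g x)"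


subsection \<open>Tensor powers\<close>

text \<open>
  The tensor power \<open>V\<^sup>\<otimes>\<^sup>n\<close> is the vector space freely generated by the \<open>n\<close>-tuples of elements of
  \<open>V\<close>, modulo the relations of multilinearity.  Tuples are lists, indexed from \<open>0\<close>.
\<close>

definition tuples :: "('k, 'v, 'm) module_scheme \<Rightarrow> nat \<Rightarrow> 'v list set"
  where "tuples V n = {xs. length xs = n \<and> set xs \<subseteq> carrier V}"

definition multilinear_rels ::
  "('k, 'r) ring_scheme \<Rightarrow> ('k, 'v, 'm) module_scheme \<Rightarrow> nat \<Rightarrow> ('v list \<Rightarrow> 'k) set"
  where "multilinear_rels K V n =
    (let F = free_space K (tuples V n); e = basis_elem K in
      {e (xs[i := a \<oplus>\<^bsub>V\<^esub> b]) \<ominus>\<^bsub>F\<^esub> (e (xs[i := a]) \<oplus>\<^bsub>F\<^esub> e (xs[i := b])) | xs i a b.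
         xs \<in> tuples V n \<and> i < n \<and> a \<in> carrier V \<and> b \<in> carrier V} \<union>
      {e (xs[i := k \<odot>\<^bsub>V\<^esub> a]) \<ominus>\<^bsub>F\<^esub> k \<odot>\<^bsub>F\<^esub> e (xs[i := a]) | xs i k a.
         xs \<in> tuples V n \<and> i < n \<and> k \<in> carrier K \<and> a \<in> carrier V})"

definition multilinear_span ::
  "('k, 'r) ring_scheme \<Rightarrow> ('k, 'v, 'm) module_scheme \<Rightarrow> nat \<Rightarrow> ('v list \<Rightarrow> 'k) set"
  where "multilinear_span K V n =
    lin_span K (free_space K (tuples V n)) (multilinear_rels K V n)"

definition tensor_power ::
  "('k, 'r) ring_scheme \<Rightarrow> ('k, 'v, 'm) module_scheme \<Rightarrow> nat \<Rightarrow> ('k, ('v list \<Rightarrow> 'k) set) module"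
  where "tensor_power K V n =
    quot_space (free_space K (tuples V n)) (multilinear_span K V n)"

text \<open>\<open>pure_tensor K V [x\<^sub>1, \<dots>, x\<^sub>n]\<close> is \<open>x\<^sub>1 \<otimes> \<cdots> \<otimes> x\<^sub>n\<close>.\<close>

definition pure_tensor ::
  "('k, 'r) ring_scheme \<Rightarrow> ('k, 'v, 'm) module_scheme \<Rightarrow> 'v list \<Rightarrow> ('v list \<Rightarrow> 'k) set"
  where "pure_tensor K V xs =
    multilinear_span K V (length xs) +>\<^bsub>free_space K (tuples V (length xs))\<^esub> basis_elem K xs"

text \<open>The linear map on a tensor power determined by a multilinear map \<open>g\<close> on tuples
  (see \<open>multilinear_lift\<close> below).\<close>

definition tensor_lift ::
  "('k, 'r) ring_scheme \<Rightarrow> ('k, 'w, 'n) module_scheme \<Rightarrow> ('v list \<Rightarrow> 'w) \<Rightarrow> ('v list \<Rightarrow> 'k) set \<Rightarrow> 'w"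
  where "tensor_lift K W g = quot_lift (lin_ext K W g)"


subsection \<open>Homology\<close>

text \<open>
  A chain complex \<open>(C, d)\<close> has \<open>d n : C n \<rightarrow> C (n - 1)\<close>; in degree \<open>0\<close>, where \<open>0 - 1 = 0\<close>, the map
  \<open>d 0\<close> is required to be zero, so that \<open>homology C d 0\<close> is the cokernel of \<open>d 1\<close>.
\<close>

definition homology ::
  "(nat \<Rightarrow> ('k, 'c, 'm) module_scheme) \<Rightarrow> (nat \<Rightarrow> 'c \<Rightarrow> 'c) \<Rightarrow> nat \<Rightarrow> ('k, 'c set) module"
  where "homology C d n =
    quot_space ((C n)\<lparr>carrier := {x \<in> carrier (C n). d n x = \<zero>\<^bsub>C (n - 1)\<^esub>}\<rparr>)
               (d (n + 1) ` carrier (C (n + 1)))"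

definition sgn_pow :: "('k, 'r) ring_scheme \<Rightarrow> nat \<Rightarrow> 'k"
  where "sgn_pow K i = (\<ominus>\<^bsub>K\<^esub> \<one>\<^bsub>K\<^esub>) [^]\<^bsub>K\<^esub> i"

text \<open>The boundary \<open>\<Sum>\<^sub>i (-1)\<^sup>i d\<^sub>i\<close> of a simplicial vector space with faces \<open>\<delta> n i : V n \<rightarrow> V (n - 1)\<close>.\<close>

definition alternating_boundary ::
  "('k, 'r) ring_scheme \<Rightarrow> (nat \<Rightarrow> ('k, 'v, 'm) module_scheme) \<Rightarrow> (nat \<Rightarrow> nat \<Rightarrow> 'v \<Rightarrow> 'v) \<Rightarrow>
   nat \<Rightarrow> 'v \<Rightarrow> 'v"
  where "alternating_boundary K V \<delta> n x =
    (if n = 0 then \<zero>\<^bsub>V 0\<^esub>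
     else (\<Oplus>\<^bsub>V (n - 1)\<^esub> i \<in> {..n}. sgn_pow K i \<odot>\<^bsub>V (n - 1)\<^esub> \<delta> n i x))"


section \<open>Algebras with bracket\<close>

text \<open>The algebras are not assumed to be unital: the field \<^const>\<open>one\<close> of the record is irrelevant.\<close>

record ('k, 'a) awb = "('k, 'a) module" +
  bracket :: "'a \<Rightarrow> 'a \<Rightarrow> 'a"

locale bilinear_pair = field K + module K A
  for K (structure) and A :: "('k, 'a, 'm) awb_scheme" (structure) +
  assumes mult_closed:
      "\<lbrakk>x \<in> carrier A; y \<in> carrier A\<rbrakk> \<Longrightarrow> x \<otimes>\<^bsub>A\<^esub> y \<in> carrier A"
    and mult_add_left:
      "\<lbrakk>x \<in> carrier A; y \<in> carrier A; z \<in> carrier A\<rbrakk> \<Longrightarrow>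
        (x \<oplus>\<^bsub>A\<^esub> y) \<otimes>\<^bsub>A\<^esub> z = x \<otimes>\<^bsub>A\<^esub> z \<oplus>\<^bsub>A\<^esub> y \<otimes>\<^bsub>A\<^esub> z"
    and mult_add_right:
      "\<lbrakk>x \<in> carrier A; y \<in> carrier A; z \<in> carrier A\<rbrakk> \<Longrightarrow>
        x \<otimes>\<^bsub>A\<^esub> (y \<oplus>\<^bsub>A\<^esub> z) = x \<otimes>\<^bsub>A\<^esub> y \<oplus>\<^bsub>A\<^esub> x \<otimes>\<^bsub>A\<^esub> z"
    and mult_smult_left:
      "\<lbrakk>k \<in> carrier K; x \<in> carrier A; y \<in> carrier A\<rbrakk> \<Longrightarrow>
        (k \<odot>\<^bsub>A\<^esub> x) \<otimes>\<^bsub>A\<^esub> y = k \<odot>\<^bsub>A\<^esub> (x \<otimes>\<^bsub>A\<^esub> y)"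
    and mult_smult_right:
      "\<lbrakk>k \<in> carrier K; x \<in> carrier A; y \<in> carrier A\<rbrakk> \<Longrightarrow>
        x \<otimes>\<^bsub>A\<^esub> (k \<odot>\<^bsub>A\<^esub> y) = k \<odot>\<^bsub>A\<^esub> (x \<otimes>\<^bsub>A\<^esub> y)"
    and bracket_closed:
      "\<lbrakk>x \<in> carrier A; y \<in> carrier A\<rbrakk> \<Longrightarrow> bracket A x y \<in> carrier A"
    and bracket_add_left:
      "\<lbrakk>x \<in> carrier A; y \<in> carrier A; z \<in> carrier A\<rbrakk> \<Longrightarrow>
        bracket A (x \<oplus>\<^bsub>A\<^esub> y) z = bracket A x z \<oplus>\<^bsub>A\<^esub> bracket A y z"
    and bracket_add_right:
      "\<lbrakk>x \<in> carrier A; y \<in> carrier A; z \<in> carrier A\<rbrakk> \<Longrightarrow>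
        bracket A x (y \<oplus>\<^bsub>A\<^esub> z) = bracket A x y \<oplus>\<^bsub>A\<^esub> bracket A x z"
    and bracket_smult_left:
      "\<lbrakk>k \<in> carrier K; x \<in> carrier A; y \<in> carrier A\<rbrakk> \<Longrightarrow>
        bracket A (k \<odot>\<^bsub>A\<^esub> x) y = k \<odot>\<^bsub>A\<^esub> bracket A x y"
    and bracket_smult_right:
      "\<lbrakk>k \<in> carrier K; x \<in> carrier A; y \<in> carrier A\<rbrakk> \<Longrightarrow>
        bracket A x (k \<odot>\<^bsub>A\<^esub> y) = k \<odot>\<^bsub>A\<^esub> bracket A x y"

locale awb = bilinear_pair +
  assumes mult_assoc:
      "\<lbrakk>x \<in> carrier A; y \<in> carrier A; z \<in> carrier A\<rbrakk> \<Longrightarrow>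
        (x \<otimes>\<^bsub>A\<^esub> y) \<otimes>\<^bsub>A\<^esub> z = x \<otimes>\<^bsub>A\<^esub> (y \<otimes>\<^bsub>A\<^esub> z)"
    and bracket_mult:
      "\<lbrakk>x \<in> carrier A; y \<in> carrier A; z \<in> carrier A\<rbrakk> \<Longrightarrow>
        bracket A (x \<otimes>\<^bsub>A\<^esub> y) z = bracket A x z \<otimes>\<^bsub>A\<^esub> y \<oplus>\<^bsub>A\<^esub> x \<otimes>\<^bsub>A\<^esub> bracket A y z"

definition awb_hom ::
  "('k, 'r) ring_scheme \<Rightarrow> ('k, 'a, 'm) awb_scheme \<Rightarrow> ('k, 'b, 'n) awb_scheme \<Rightarrow> ('a \<Rightarrow> 'b) set"
  where "awb_hom K A B =
    {h \<in> lin_hom K A B. \<forall>x\<in>carrier A. \<forall>y\<in>carrier A.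
       h (x \<otimes>\<^bsub>A\<^esub> y) = h x \<otimes>\<^bsub>B\<^esub> h y \<and> h (bracket A x y) = bracket B (h x) (h y)}"

definition awb_ideal :: "('k, 'r) ring_scheme \<Rightarrow> ('k, 'a, 'm) awb_scheme \<Rightarrow> 'a set \<Rightarrow> bool"
  where "awb_ideal K A I \<longleftrightarrow> submodule I K A \<and>
    (\<forall>a\<in>carrier A. \<forall>b\<in>I. a \<otimes>\<^bsub>A\<^esub> b \<in> I \<and> b \<otimes>\<^bsub>A\<^esub> a \<in> I \<and> bracket A a b \<in> I \<and> bracket A b a \<in> I)"

definition awb_genideal :: "('k, 'r) ring_scheme \<Rightarrow> ('k, 'a, 'm) awb_scheme \<Rightarrow> 'a set \<Rightarrow> 'a set"
  where "awb_genideal K A S = \<Inter>{I. awb_ideal K A I \<and> S \<subseteq> I}"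

definition quot_awb :: "('k, 'a, 'm) awb_scheme \<Rightarrow> 'a set \<Rightarrow> ('k, 'a set) awb"
  where "quot_awb A I =
    \<lparr>carrier = a_rcosets\<^bsub>A\<^esub> I, mult = rcoset_mult A I, one = undefined,
     zero = I, add = set_add A,
     smult = (\<lambda>k S. \<Union>x\<in>S. I +>\<^bsub>A\<^esub> (k \<odot>\<^bsub>A\<^esub> x)),
     bracket = (\<lambda>S T. \<Union>x\<in>S. \<Union>y\<in>T. I +>\<^bsub>A\<^esub> bracket A x y)\<rparr>"


subsection \<open>Abelianization\<close>

definition awb_commutator :: "('k, 'r) ring_scheme \<Rightarrow> ('k, 'a, 'm) awb_scheme \<Rightarrow> 'a set"
  where "awb_commutator K A = awb_genideal K A
    ({x \<otimes>\<^bsub>A\<^esub> y | x y. x \<in> carrier A \<and> y \<in> carrier A} \<union>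
     {bracket A x y | x y. x \<in> carrier A \<and> y \<in> carrier A})"

definition awb_ab :: "('k, 'r) ring_scheme \<Rightarrow> ('k, 'a, 'm) awb_scheme \<Rightarrow> ('k, 'a set) module"
  where "awb_ab K A = quot_space A (awb_commutator K A)"

text \<open>The action of the abelianization functor on a homomorphism \<open>f\<close> into \<open>B\<close>.\<close>

definition awb_ab_map ::
  "('k, 'r) ring_scheme \<Rightarrow> ('k, 'b, 'n) awb_scheme \<Rightarrow> ('a \<Rightarrow> 'b) \<Rightarrow> 'a set \<Rightarrow> 'b set"
  where "awb_ab_map K B f = quot_lift (\<lambda>x. awb_commutator K B +>\<^bsub>B\<^esub> f x)"


subsection \<open>Free algebras with bracket\<close>

text \<open>
  The free algebra with bracket on \<open>S\<close> is the free algebra with two arbitrary bilinear operations,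
  whose basis consists of the non-associative monomials \<open>mono\<close> in the elements of \<open>S\<close>, modulo the
  ideal generated by the two identities that define algebras with bracket.  Its universal property,
  with respect to algebras with bracket over arbitrary types, is \<open>free_awb_universal\<close> below.
\<close>

datatype 'x mono = Gen 'x | Mul "'x mono" "'x mono" | Brk "'x mono" "'x mono"

definition monomials :: "'x set \<Rightarrow> 'x mono set"
  where "monomials S = {m. set_mono m \<subseteq> S}"

definition free_bimagma :: "('k, 'r) ring_scheme \<Rightarrow> 'x set \<Rightarrow> ('k, 'x mono \<Rightarrow> 'k) awb"
  where "free_bimagma K S =
    module.extend (free_space K (monomials S)
        \<lparr>mult := (\<lambda>f g m. case m of Mul u v \<Rightarrow> f u \<otimes>\<^bsub>K\<^esub> g v | _ \<Rightarrow> \<zero>\<^bsub>K\<^esub>)\<rparr>)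
      \<lparr>bracket = (\<lambda>f g m. case m of Brk u v \<Rightarrow> f u \<otimes>\<^bsub>K\<^esub> g v | _ \<Rightarrow> \<zero>\<^bsub>K\<^esub>)\<rparr>"

definition free_awb_rels :: "('k, 'r) ring_scheme \<Rightarrow> 'x set \<Rightarrow> ('x mono \<Rightarrow> 'k) set"
  where "free_awb_rels K S =
    (let P = free_bimagma K S in
      {((f \<otimes>\<^bsub>P\<^esub> g) \<otimes>\<^bsub>P\<^esub> h) \<ominus>\<^bsub>P\<^esub> (f \<otimes>\<^bsub>P\<^esub> (g \<otimes>\<^bsub>P\<^esub> h)) | f g h.
         f \<in> carrier P \<and> g \<in> carrier P \<and> h \<in> carrier P} \<union>
      {bracket P (f \<otimes>\<^bsub>P\<^esub> g) h \<ominus>\<^bsub>P\<^esub> (bracket P f h \<otimes>\<^bsub>P\<^esub> g \<oplus>\<^bsub>P\<^esub> f \<otimes>\<^bsub>P\<^esub> bracket P g h) | f g h.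
         f \<in> carrier P \<and> g \<in> carrier P \<and> h \<in> carrier P})"

definition free_awb_ideal :: "('k, 'r) ring_scheme \<Rightarrow> 'x set \<Rightarrow> ('x mono \<Rightarrow> 'k) set"
  where "free_awb_ideal K S = awb_genideal K (free_bimagma K S) (free_awb_rels K S)"

definition free_awb :: "('k, 'r) ring_scheme \<Rightarrow> 'x set \<Rightarrow> ('k, ('x mono \<Rightarrow> 'k) set) awb"
  where "free_awb K S = quot_awb (free_bimagma K S) (free_awb_ideal K S)"

definition free_awb_gen :: "('k, 'r) ring_scheme \<Rightarrow> 'x set \<Rightarrow> 'x \<Rightarrow> ('x mono \<Rightarrow> 'k) set"
  where "free_awb_gen K S x = free_awb_ideal K S +>\<^bsub>free_bimagma K S\<^esub> basis_elem K (Gen x)"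

text \<open>
  It is no restriction to take the generating set from the type of the elements of \<open>F\<close>, as a set of
  free generators injects into \<open>F\<close>.
\<close>

definition is_free_awb :: "('k, 'r) ring_scheme \<Rightarrow> ('k, 'a, 'm) awb_scheme \<Rightarrow> bool"
  where "is_free_awb K F \<longleftrightarrow>
    (\<exists>(S :: 'a set) h. h \<in> awb_hom K (free_awb K S) F \<and> bij_betw h (carrier (free_awb K S)) (carrier F))"


section \<open>Homology with trivial coefficients\<close>

text \<open>
  The complex of \<open>A\<close> is \<open>A\<^sup>\<otimes>\<^sup>(\<^sup>n\<^sup>+\<^sup>1\<^sup>) \<oplus> A\<^sup>\<otimes>\<^sup>(\<^sup>n\<^sup>+\<^sup>1\<^sup>)\<close> in degree \<open>n \<ge> 1\<close> and \<open>A\<close>, identified with the tensor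
  power \<open>A\<^sup>\<otimes>\<^sup>1\<close> by \<open>tensor_power_1\<close> below (and with zero second summand), in degree \<open>0\<close>.
\<close>

definition awb_chain ::
  "('k, 'r) ring_scheme \<Rightarrow> ('k, 'a, 'm) awb_scheme \<Rightarrow> nat \<Rightarrow>
   ('k, ('a list \<Rightarrow> 'k) set \<times> ('a list \<Rightarrow> 'k) set) module"
  where "awb_chain K A n =
    (let T = tensor_power K A (n + 1) in
     if n = 0 then (dsum T T)\<lparr>carrier := carrier T \<times> {\<zero>\<^bsub>T\<^esub>}\<rparr> else dsum T T)"

text \<open>The generators \<open>a\<^sub>1 \<otimes> \<cdots> \<otimes> a\<^sub>n\<^sub>+\<^sub>1\<close> and \<open>a\<^sub>1 \<circ> \<cdots> \<circ> a\<^sub>n\<^sub>+\<^sub>1\<close> of the first and second summand.\<close>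

definition tens ::
  "('k, 'r) ring_scheme \<Rightarrow> ('k, 'a, 'm) awb_scheme \<Rightarrow> 'a list \<Rightarrow>
   ('a list \<Rightarrow> 'k) set \<times> ('a list \<Rightarrow> 'k) set"
  where "tens K A xs = (pure_tensor K A xs, \<zero>\<^bsub>tensor_power K A (length xs)\<^esub>)"

definition circ ::
  "('k, 'r) ring_scheme \<Rightarrow> ('k, 'a, 'm) awb_scheme \<Rightarrow> 'a list \<Rightarrow>
   ('a list \<Rightarrow> 'k) set \<times> ('a list \<Rightarrow> 'k) set"
  where "circ K A xs = (\<zero>\<^bsub>tensor_power K A (length xs)\<^esub>, pure_tensor K A xs)"

text \<open>\<open>merge A i\<close> multiplies the entries at positions \<open>i\<close> and \<open>i + 1\<close>; \<open>act A i\<close> removes the last entry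
  and brackets the entry at position \<open>i\<close> with it.\<close>

definition merge :: "('k, 'a, 'm) awb_scheme \<Rightarrow> nat \<Rightarrow> 'a list \<Rightarrow> 'a list"
  where "merge A i xs = take i xs @ [xs ! i \<otimes>\<^bsub>A\<^esub> xs ! (i + 1)] @ drop (i + 2) xs"

definition act :: "('k, 'a, 'm) awb_scheme \<Rightarrow> nat \<Rightarrow> 'a list \<Rightarrow> 'a list"
  where "act A i xs = (butlast xs)[i := bracket A (xs ! i) (last xs)]"

text \<open>The boundary on generators; as positions are counted from \<open>0\<close>, the sign of the summand that
  merges \<open>a\<^sub>i\<close> and \<open>a\<^sub>i\<^sub>+\<^sub>1\<close> is shifted by one.\<close>

definition boundary_tens ::
  "('k, 'r) ring_scheme \<Rightarrow> ('k, 'a, 'm) awb_scheme \<Rightarrow> nat \<Rightarrow> 'a list \<Rightarrow>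
   ('a list \<Rightarrow> 'k) set \<times> ('a list \<Rightarrow> 'k) set"
  where "boundary_tens K A n xs =
    (let C = awb_chain K A (n - 1) in
      (\<Oplus>\<^bsub>C\<^esub> i \<in> {..<n}. sgn_pow K i \<odot>\<^bsub>C\<^esub> tens K A (merge A i xs)))"

definition boundary_circ ::
  "('k, 'r) ring_scheme \<Rightarrow> ('k, 'a, 'm) awb_scheme \<Rightarrow> nat \<Rightarrow> 'a list \<Rightarrow>
   ('a list \<Rightarrow> 'k) set \<times> ('a list \<Rightarrow> 'k) set"
  where "boundary_circ K A n xs =
    (let C = awb_chain K A (n - 1) in
      (\<Oplus>\<^bsub>C\<^esub> i \<in> {..<n}. tens K A (act A i xs)) \<oplus>\<^bsub>C\<^esub>
      (\<Oplus>\<^bsub>C\<^esub> i \<in> {..<n - 1}. sgn_pow K (i + 1) \<odot>\<^bsub>C\<^esub> circ K A (merge A i xs)))"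

definition awb_boundary ::
  "('k, 'r) ring_scheme \<Rightarrow> ('k, 'a, 'm) awb_scheme \<Rightarrow> nat \<Rightarrow>
   ('a list \<Rightarrow> 'k) set \<times> ('a list \<Rightarrow> 'k) set \<Rightarrow> ('a list \<Rightarrow> 'k) set \<times> ('a list \<Rightarrow> 'k) set"
  where "awb_boundary K A n = (\<lambda>(u, v).
    (let C = awb_chain K A (n - 1) in
     if n = 0 then \<zero>\<^bsub>C\<^esub>
     else tensor_lift K C (boundary_tens K A n) u \<oplus>\<^bsub>C\<^esub> tensor_lift K C (boundary_circ K A n) v))"

definition awb_homology ::
  "('k, 'r) ring_scheme \<Rightarrow> ('k, 'a, 'm) awb_scheme \<Rightarrow> nat \<Rightarrow>
   ('k, (('a list \<Rightarrow> 'k) set \<times> ('a list \<Rightarrow> 'k) set) set) module"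
  where "awb_homology K A = homology (awb_chain K A) (awb_boundary K A)"


section \<open>Simplicial algebras with bracket and Quillen homology\<close>

text \<open>\<open>face F n i : level F n \<rightarrow> level F (n - 1)\<close> for \<open>n \<ge> 1\<close>, and
  \<open>degen F n i : level F n \<rightarrow> level F (n + 1)\<close>, where \<open>i \<le> n\<close>.\<close>

record ('k, 'f) simplicial_awb =
  level :: "nat \<Rightarrow> ('k, 'f) awb"
  face :: "nat \<Rightarrow> nat \<Rightarrow> 'f \<Rightarrow> 'f"
  degen :: "nat \<Rightarrow> nat \<Rightarrow> 'f \<Rightarrow> 'f"

locale simplicial_awb =
  fixes K :: "('k, 'r) ring_scheme" and F :: "('k, 'f) simplicial_awb"
  assumes level_awb: "awb K (level F n)"
    and face_hom:
      "\<lbrakk>1 \<le> n; i \<le> n\<rbrakk> \<Longrightarrow> face F n i \<in> awb_hom K (level F n) (level F (n - 1))"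
    and degen_hom:
      "i \<le> n \<Longrightarrow> degen F n i \<in> awb_hom K (level F n) (level F (n + 1))"
    and face_face:
      "\<lbrakk>i < j; j \<le> n + 2; x \<in> carrier (level F (n + 2))\<rbrakk> \<Longrightarrow>
        face F (n + 1) i (face F (n + 2) j x) = face F (n + 1) (j - 1) (face F (n + 2) i x)"
    and degen_degen:
      "\<lbrakk>i \<le> j; j \<le> n; x \<in> carrier (level F n)\<rbrakk> \<Longrightarrow>
        degen F (n + 1) i (degen F n j x) = degen F (n + 1) (j + 1) (degen F n i x)"
    and face_degen_less:
      "\<lbrakk>i < j; j \<le> n; x \<in> carrier (level F n)\<rbrakk> \<Longrightarrow>
        face F (n + 1) i (degen F n j x) = degen F (n - 1) (j - 1) (face F n i x)"
    and face_degen_same: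
      "\<lbrakk>i = j \<or> i = j + 1; j \<le> n; x \<in> carrier (level F n)\<rbrakk> \<Longrightarrow>
        face F (n + 1) i (degen F n j x) = x"
    and face_degen_greater:
      "\<lbrakk>j + 1 < i; i \<le> n + 1; x \<in> carrier (level F n)\<rbrakk> \<Longrightarrow>
        face F (n + 1) i (degen F n j x) = degen F (n - 1) j (face F n (i - 1) x)"

text \<open>
  The homotopy groups are the homology of the Moore complex, which is
  \<open>\<Inter>\<^sub>1\<^sub>\<le>\<^sub>i\<^sub>\<le>\<^sub>n ker d\<^sub>i\<close> in degree \<open>n\<close>, with boundary induced by \<open>d\<^sub>0\<close>.
\<close>

definition moore_chain :: "('k, 'f) simplicial_awb \<Rightarrow> nat \<Rightarrow> ('k, 'f) awb"
  where "moore_chain F n = (level F n)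
    \<lparr>carrier := {x \<in> carrier (level F n). \<forall>i\<in>{1..n}. face F n i x = \<zero>\<^bsub>level F (n - 1)\<^esub>}\<rparr>"

definition moore_boundary :: "('k, 'f) simplicial_awb \<Rightarrow> nat \<Rightarrow> 'f \<Rightarrow> 'f"
  where "moore_boundary F n x = (if n = 0 then \<zero>\<^bsub>level F 0\<^esub> else face F n 0 x)"

definition homotopy_group :: "('k, 'f) simplicial_awb \<Rightarrow> nat \<Rightarrow> ('k, 'f set) module"
  where "homotopy_group F = homology (moore_chain F) (moore_boundary F)"

text \<open>
  Since \<open>\<epsilon>\<close> is a homomorphism of algebras with bracket, bijectivity of the map it induces on
  \<open>\<pi>\<^sub>0(F)\<close> says that this map is an isomorphism.
\<close>

locale free_simplicial_resolution = simplicial_awb K F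
  for K :: "('k, 'r) ring_scheme" and F :: "('k, 'f) simplicial_awb" +
  fixes A :: "('k, 'a) awb" and \<epsilon> :: "'f \<Rightarrow> 'a"
  assumes target_awb: "awb K A"
    and augmentation_hom: "\<epsilon> \<in> awb_hom K (level F 0) A"
    and augmentation: "x \<in> carrier (level F 1) \<Longrightarrow> \<epsilon> (face F 1 0 x) = \<epsilon> (face F 1 1 x)"
    and level_free: "is_free_awb K (level F n)"
    and homotopy_trivial:
      "1 \<le> n \<Longrightarrow> carrier (homotopy_group F n) = {\<zero>\<^bsub>homotopy_group F n\<^esub>}"
    and homotopy_zero:
      "bij_betw (quot_lift \<epsilon>) (carrier (homotopy_group F 0)) (carrier A)"

text \<open>The homology of the simplicial vector space \<open>F\<^sup>a\<^sup>b\<close>.  For a free simplicial resolution \<open>F\<close> of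
  \<open>A\<close> this is the Quillen homology of \<open>A\<close>.\<close>

definition quillen_homology ::
  "('k, 'r) ring_scheme \<Rightarrow> ('k, 'f) simplicial_awb \<Rightarrow> nat \<Rightarrow> ('k, 'f set set) module"
  where "quillen_homology K F =
    (let V = (\<lambda>n. awb_ab K (level F n)) in
     homology V (alternating_boundary K V (\<lambda>n i. awb_ab_map K (level F (n - 1)) (face F n i))))"

section \<open>Consistency of the definitions\<close>

text \<open>
  Quotients, free vector spaces and tensor powers are vector spaces with the expected universal
  properties; \<open>free_awb\<close> has the universal property of the free algebra with bracket; and the
  boundary takes the prescribed values on generators (\<open>awb_boundary_generators\<close>).
\<close>

lemma free_space_simps [simp]:
  "\<zero>\<^bsub>free_space K S\<^esub> = (\<lambda>_. \<zero>\<^bsub>K\<^esub>)"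
  "f \<oplus>\<^bsub>free_space K S\<^esub> g = (\<lambda>x. f x \<oplus>\<^bsub>K\<^esub> g x)"
  "k \<odot>\<^bsub>free_space K S\<^esub> f = (\<lambda>x. k \<otimes>\<^bsub>K\<^esub> f x)"
  by (simp_all add: free_space_def)

lemma free_space_carrier:
  "f \<in> carrier (free_space K S) \<longleftrightarrow>
    (\<forall>x. f x \<in> carrier K) \<and> finite {x. f x \<noteq> \<zero>\<^bsub>K\<^esub>} \<and> (\<forall>x. f x \<noteq> \<zero>\<^bsub>K\<^esub> \<longrightarrow> x \<in> S)"
  by (auto simp: free_space_def)

lemma free_space_module:
  fixes K (structure)
  assumes "field K"
  shows "module K (free_space K S)"
proof -
  interpret field K by fact
  let ?F = "free_space K S"
  have add: "f \<oplus>\<^bsub>?F\<^esub> g \<in> carrier ?F" if "f \<in> carrier ?F" "g \<in> carrier ?F" for f g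
  proof -
    have "{x. f x \<oplus> g x \<noteq> \<zero>} \<subseteq> {x. f x \<noteq> \<zero>} \<union> {x. g x \<noteq> \<zero>}" by auto
    then show ?thesis using that
      by (auto simp: free_space_carrier intro: finite_subset)
  qed
  have sm: "k \<odot>\<^bsub>?F\<^esub> f \<in> carrier ?F" if "k \<in> carrier K" "f \<in> carrier ?F" for k f
  proof -
    have "{x. k \<otimes> f x \<noteq> \<zero>} \<subseteq> {x. f x \<noteq> \<zero>}" using that by auto
    then show ?thesis using that
      by (auto simp: free_space_carrier intro: finite_subset)
  qed
  show ?thesis
  proof (rule moduleI)
    show "cring K" by unfold_locales
    show "abelian_group ?F"
    proof (rule abelian_groupI)
      fix f assume f: "f \<in> carrier ?F"
      have "(\<ominus> \<one>) \<odot>\<^bsub>?F\<^esub> f \<in> carrier ?F" using f by (intro sm) auto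
      moreover have "((\<ominus> \<one>) \<odot>\<^bsub>?F\<^esub> f) \<oplus>\<^bsub>?F\<^esub> f = \<zero>\<^bsub>?F\<^esub>"
        using f by (auto simp: free_space_carrier l_minus l_neg)
      ultimately show "\<exists>g\<in>carrier ?F. g \<oplus>\<^bsub>?F\<^esub> f = \<zero>\<^bsub>?F\<^esub>" by blast
    next
      fix f g assume "f \<in> carrier ?F" "g \<in> carrier ?F"
      then show "f \<oplus>\<^bsub>?F\<^esub> g \<in> carrier ?F" by (rule add)
    qed (auto simp: free_space_carrier a_ac)
  next
    fix k f assume "k \<in> carrier K" "f \<in> carrier ?F"
    then show "k \<odot>\<^bsub>?F\<^esub> f \<in> carrier ?F" by (rule sm)
  qed (auto simp: free_space_carrier l_distr r_distr m_assoc)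
qed

lemma basis_elem_carrier:
  fixes K (structure)
  assumes "field K" "x \<in> S"
  shows "basis_elem K x \<in> carrier (free_space K S)"
proof -
  interpret field K by fact
  have "{y. basis_elem K x y \<noteq> \<zero>} \<subseteq> {x}" by (auto simp: basis_elem_def)
  then show ?thesis using assms
    by (auto simp: free_space_carrier basis_elem_def intro: finite_subset)
qed

lemma free_space_induct [consumes 2, case_names zero step]:
  fixes K :: "('k, 'r) ring_scheme" (structure) and S :: "'x set"
  assumes K: "field K" and f: "f \<in> carrier (free_space K S)"
    and zero: "P \<zero>\<^bsub>free_space K S\<^esub>"
    and step: "\<And>k x f. \<lbrakk>k \<in> carrier K; x \<in> S; f \<in> carrier (free_space K S); P f\<rbrakk> \<Longrightarrow>
      P ((k \<odot>\<^bsub>free_space K S\<^esub> basis_elem K x) \<oplus>\<^bsub>free_space K S\<^esub> f)"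
  shows "P f"
proof -
  interpret field K by fact
  have "\<forall>f. f \<in> carrier (free_space K S) \<longrightarrow> {x. f x \<noteq> \<zero>} \<subseteq> D \<longrightarrow> P f" if "finite D" for D
    using that
  proof (induction D rule: finite_induct)
    case empty
    have "f = \<zero>\<^bsub>free_space K S\<^esub>" if "{x. f x \<noteq> \<zero>} \<subseteq> {}" for f :: "'x \<Rightarrow> 'k"
      using that by auto
    then show ?case using zero by metis
  next
    case (insert x D)
    show ?case
    proof (intro allI impI)
      fix f assume f: "f \<in> carrier (free_space K S)" and sub: "{x. f x \<noteq> \<zero>} \<subseteq> insert x D"
      show "P f"
      proof (cases "f x = \<zero>")
        case True
        then have "{x. f x \<noteq> \<zero>} \<subseteq> D" using sub by auto
        then show ?thesis using insert.IH f by blast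
      next
        case False
        define g where "g = f(x := \<zero>)"
        have sg: "{x. g x \<noteq> \<zero>} \<subseteq> D" "{x. g x \<noteq> \<zero>} \<subseteq> {x. f x \<noteq> \<zero>}" using sub by (auto simp: g_def)
        then have g: "g \<in> carrier (free_space K S)"
          using f by (auto simp: free_space_carrier g_def intro: finite_subset)
        have x: "f x \<in> carrier K" "x \<in> S" using f False by (auto simp: free_space_carrier)
        have "f = (f x \<odot>\<^bsub>free_space K S\<^esub> basis_elem K x) \<oplus>\<^bsub>free_space K S\<^esub> g"
          using f x by (auto simp: fun_eq_iff g_def basis_elem_def free_space_carrier)
        moreover have "P g" using insert.IH g sg by blast
        ultimately show ?thesis using step[OF x g] by metis
      qed
    qed
  qed
  moreover have "finite {x. f x \<noteq> \<zero>}" using f by (auto simp: free_space_carrier)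
  ultimately show ?thesis using f by blast
qed

lemma lin_ext_superset:
  fixes K (structure)
  assumes "field K" "module K W" "f \<in> carrier (free_space K S)" "g \<in> S \<rightarrow> carrier W"
    and "finite D" "{x. f x \<noteq> \<zero>\<^bsub>K\<^esub>} \<subseteq> D" "D \<subseteq> S"
  shows "lin_ext K W g f = (\<Oplus>\<^bsub>W\<^esub>x\<in>D. f x \<odot>\<^bsub>W\<^esub> g x)"
proof -
  interpret field K by fact
  interpret W: module K W by fact
  show ?thesis unfolding lin_ext_def
    using assms by (intro W.add.finprod_mono_neutral_cong_left) (auto simp: free_space_carrier Pi_iff subset_iff)
qed

lemma lin_ext_hom:
  fixes K (structure)
  assumes K: "field K" and W: "module K W" and g: "g \<in> S \<rightarrow> carrier W"
  shows "lin_ext K W g \<in> lin_hom K (free_space K S) W"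
proof -
  interpret field K by fact
  interpret W: module K W by fact
  interpret F: module K "free_space K S" by (rule free_space_module) fact
  note ext = lin_ext_superset[OF K W _ g]
  show ?thesis unfolding lin_hom_def
  proof (intro CollectI conjI ballI funcsetI)
    fix f assume f: "f \<in> carrier (free_space K S)"
    then show "lin_ext K W g f \<in> carrier W" unfolding lin_ext_def
      using g by (intro W.finsum_closed) (auto simp: free_space_carrier)
    fix f' assume f': "f' \<in> carrier (free_space K S)"
    let ?D = "{x. f x \<noteq> \<zero>} \<union> {x. f' x \<noteq> \<zero>}"
    have D: "finite ?D" "?D \<subseteq> S" using f f' by (auto simp: free_space_carrier)
    have s: "{x. f x \<oplus> f' x \<noteq> \<zero>} \<subseteq> ?D" by auto
    have "lin_ext K W g (f \<oplus>\<^bsub>free_space K S\<^esub> f') = (\<Oplus>\<^bsub>W\<^esub>x\<in>?D. (f x \<oplus> f' x) \<odot>\<^bsub>W\<^esub> g x)"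
      using ext[of "f \<oplus>\<^bsub>free_space K S\<^esub> f'" ?D] D s F.a_closed[OF f f'] by simp
    also have "\<dots> = (\<Oplus>\<^bsub>W\<^esub>x\<in>?D. f x \<odot>\<^bsub>W\<^esub> g x \<oplus>\<^bsub>W\<^esub> f' x \<odot>\<^bsub>W\<^esub> g x)"
      using f f' g D by (intro W.finsum_cong')
        (auto simp: free_space_carrier W.smult_l_distr Pi_iff subset_iff)
    also have "\<dots> = (\<Oplus>\<^bsub>W\<^esub>x\<in>?D. f x \<odot>\<^bsub>W\<^esub> g x) \<oplus>\<^bsub>W\<^esub> (\<Oplus>\<^bsub>W\<^esub>x\<in>?D. f' x \<odot>\<^bsub>W\<^esub> g x)"
      using f f' g D by (intro W.finsum_addf) (auto simp: free_space_carrier Pi_iff subset_iff)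
    also have "\<dots> = lin_ext K W g f \<oplus>\<^bsub>W\<^esub> lin_ext K W g f'"
      using ext[of f ?D] ext[of f' ?D] f f' D by simp
    finally show "lin_ext K W g (f \<oplus>\<^bsub>free_space K S\<^esub> f') = lin_ext K W g f \<oplus>\<^bsub>W\<^esub> lin_ext K W g f'" .
  next
    fix k f assume k: "k \<in> carrier K" and f: "f \<in> carrier (free_space K S)"
    let ?D = "{x. f x \<noteq> \<zero>}"
    have D: "finite ?D" "?D \<subseteq> S" using f by (auto simp: free_space_carrier)
    have s: "{x. k \<otimes> f x \<noteq> \<zero>} \<subseteq> ?D" using k by auto
    have "lin_ext K W g (k \<odot>\<^bsub>free_space K S\<^esub> f) = (\<Oplus>\<^bsub>W\<^esub>x\<in>?D. (k \<otimes> f x) \<odot>\<^bsub>W\<^esub> g x)"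
      using ext[of "k \<odot>\<^bsub>free_space K S\<^esub> f" ?D] D s F.smult_closed[OF k f] by simp
    also have "\<dots> = (\<Oplus>\<^bsub>W\<^esub>x\<in>?D. k \<odot>\<^bsub>W\<^esub> (f x \<odot>\<^bsub>W\<^esub> g x))"
      using f g D k by (intro W.finsum_cong')
        (auto simp: free_space_carrier W.smult_assoc1 Pi_iff subset_iff)
    also have "\<dots> = k \<odot>\<^bsub>W\<^esub> (\<Oplus>\<^bsub>W\<^esub>x\<in>?D. f x \<odot>\<^bsub>W\<^esub> g x)"
      using f g D k by (intro W.finsum_smult_ldistr[symmetric])
        (auto simp: free_space_carrier Pi_iff subset_iff)
    finally show "lin_ext K W g (k \<odot>\<^bsub>free_space K S\<^esub> f) = k \<odot>\<^bsub>W\<^esub> lin_ext K W g f"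
      by (simp add: lin_ext_def)
  qed
qed

lemma lin_ext_basis:
  fixes K (structure)
  assumes K: "field K" and W: "module K W" and g: "g \<in> S \<rightarrow> carrier W" and x: "x \<in> S"
  shows "lin_ext K W g (basis_elem K x) = g x"
proof -
  interpret field K by fact
  interpret W: module K W by fact
  have "lin_ext K W g (basis_elem K x) = (\<Oplus>\<^bsub>W\<^esub>y\<in>{x}. basis_elem K x y \<odot>\<^bsub>W\<^esub> g y)"
    using basis_elem_carrier[OF K x] x
    by (intro lin_ext_superset[OF K W _ g]) (auto simp: basis_elem_def)
  also have "\<dots> = basis_elem K x x \<odot>\<^bsub>W\<^esub> g x"
    using g x by (subst W.finsum_insert) (auto simp: basis_elem_def Pi_iff)
  also have "\<dots> = g x" using g x by (auto simp: basis_elem_def Pi_iff)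
  finally show ?thesis .
qed

subsection \<open>Quotients\<close>

lemma submodule_abelian_subgroup:
  assumes "module K V" "submodule N K V" shows "abelian_subgroup N V"
proof -
  interpret V: module K V by fact
  show ?thesis
    using assms(2) V.abelian_group_axioms
    by (intro abelian_subgroupI3 additive_subgroupI submodule.axioms(1))
qed

lemma coset_smult:
  assumes "module K V" "submodule N K V" "k \<in> carrier K" "x \<in> carrier V"
  shows "(\<Union>y\<in>N +>\<^bsub>V\<^esub> x. N +>\<^bsub>V\<^esub> (k \<odot>\<^bsub>V\<^esub> y)) = N +>\<^bsub>V\<^esub> (k \<odot>\<^bsub>V\<^esub> x)"
proof -
  interpret V: module K V by fact
  interpret abelian_subgroup N V by (rule submodule_abelian_subgroup) fact+
  interpret N: submodule N K V by fact
  have "N +>\<^bsub>V\<^esub> (k \<odot>\<^bsub>V\<^esub> y) = N +>\<^bsub>V\<^esub> (k \<odot>\<^bsub>V\<^esub> x)" if "y \<in> N +>\<^bsub>V\<^esub> x" for y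
  proof -
    obtain n where n: "n \<in> N" "y = n \<oplus>\<^bsub>V\<^esub> x" using \<open>y \<in> N +>\<^bsub>V\<^esub> x\<close> by (auto simp: a_r_coset_def')
    have nc: "n \<in> carrier V" "k \<odot>\<^bsub>V\<^esub> n \<in> N" using n a_subset assms by auto
    have "k \<odot>\<^bsub>V\<^esub> y = k \<odot>\<^bsub>V\<^esub> n \<oplus>\<^bsub>V\<^esub> k \<odot>\<^bsub>V\<^esub> x"
      using n assms nc by (simp add: V.smult_r_distr)
    then have "k \<odot>\<^bsub>V\<^esub> y \<in> N +>\<^bsub>V\<^esub> (k \<odot>\<^bsub>V\<^esub> x)" using nc by (auto simp: a_r_coset_def')
    then show ?thesis using V.a_repr_independence assms a_subgroup by (metis V.smult_closed)
  qed
  moreover have "x \<in> N +>\<^bsub>V\<^esub> x" using assms a_rcos_self by blast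
  ultimately show ?thesis by blast
qed

lemma quot_module_aux:
  fixes K (structure) and Q :: "('k, 'v set, 'n) module_scheme"
  assumes K: "field K" and V: "module K V" and N: "submodule N K V"
    and Q: "carrier Q = a_rcosets\<^bsub>V\<^esub> N" "zero Q = N" "add Q = set_add V"
      "smult Q = (\<lambda>k T. \<Union>x\<in>T. N +>\<^bsub>V\<^esub> (k \<odot>\<^bsub>V\<^esub> x))"
  shows "module K Q"
proof -
  interpret field K by fact
  interpret V: module K V by fact
  interpret abelian_subgroup N V by (rule submodule_abelian_subgroup) fact+
  have car: "carrier Q = (\<lambda>x. N +>\<^bsub>V\<^esub> x) ` carrier V"
    by (auto simp: Q A_RCOSETS_def')
  have zero: "\<zero>\<^bsub>Q\<^esub> = N +>\<^bsub>V\<^esub> \<zero>\<^bsub>V\<^esub>" using a_subset by (simp add: Q)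
  have add: "(N +>\<^bsub>V\<^esub> x) \<oplus>\<^bsub>Q\<^esub> (N +>\<^bsub>V\<^esub> y) = N +>\<^bsub>V\<^esub> (x \<oplus>\<^bsub>V\<^esub> y)"
    if "x \<in> carrier V" "y \<in> carrier V" for x y
    using that by (simp add: Q a_rcos_sum)
  have sm: "k \<odot>\<^bsub>Q\<^esub> (N +>\<^bsub>V\<^esub> x) = N +>\<^bsub>V\<^esub> (k \<odot>\<^bsub>V\<^esub> x)"
    if "k \<in> carrier K" "x \<in> carrier V" for k x
    using that coset_smult[OF V N] by (simp add: Q)
  show ?thesis
  proof (rule moduleI)
    show "cring K" by unfold_locales
    show "abelian_group Q"
    proof (rule abelian_groupI)
      fix u assume "u \<in> carrier Q"
      then obtain x where x: "x \<in> carrier V" "u = N +>\<^bsub>V\<^esub> x" by (auto simp: car)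
      have "(N +>\<^bsub>V\<^esub> (\<ominus>\<^bsub>V\<^esub> x)) \<oplus>\<^bsub>Q\<^esub> u = \<zero>\<^bsub>Q\<^esub>"
        using x by (simp add: add zero V.l_neg)
      then show "\<exists>w\<in>carrier Q. w \<oplus>\<^bsub>Q\<^esub> u = \<zero>\<^bsub>Q\<^esub>" using x by (auto simp: car)
    qed (auto simp: car zero add V.a_ac)
  qed (auto simp: car zero add sm V.smult_l_distr V.smult_r_distr V.smult_assoc1)
qed

lemma quot_space_module:
  assumes "field K" "module K V" "submodule N K V"
  shows "module K (quot_space V N)"
  using assms by (rule quot_module_aux) (simp_all add: quot_space_def)

lemma quot_space_carrier:
  "carrier (quot_space V N) = (\<lambda>x. N +>\<^bsub>V\<^esub> x) ` carrier V"
  by (auto simp: quot_space_def A_RCOSETS_def')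

lemma lin_span_submodule:
  assumes "module K V" "S \<subseteq> carrier V"
  shows "submodule (lin_span K V S) K V"
proof -
  interpret V: module K V by fact
  show ?thesis unfolding lin_span_def
  proof (intro V.submoduleI)
    show "\<Inter>{N. submodule N K V \<and> S \<subseteq> N} \<subseteq> carrier V"
      using V.carrier_is_submodule assms(2) by blast
    show "\<zero>\<^bsub>V\<^esub> \<in> \<Inter>{N. submodule N K V \<and> S \<subseteq> N}"
      using subgroup.one_closed[OF submodule.axioms(1)] by fastforce
  next
    fix a b assume "a \<in> \<Inter>{N. submodule N K V \<and> S \<subseteq> N}" "b \<in> \<Inter>{N. submodule N K V \<and> S \<subseteq> N}"
    then show "a \<oplus>\<^bsub>V\<^esub> b \<in> \<Inter>{N. submodule N K V \<and> S \<subseteq> N}"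
      using V.submoduleE(5) by auto
  next
    fix a assume "a \<in> \<Inter>{N. submodule N K V \<and> S \<subseteq> N}"
    then show "\<ominus>\<^bsub>V\<^esub> a \<in> \<Inter>{N. submodule N K V \<and> S \<subseteq> N}"
      using V.submoduleE(3) by auto
  next
    fix k a assume "k \<in> carrier K" "a \<in> \<Inter>{N. submodule N K V \<and> S \<subseteq> N}"
    then show "k \<odot>\<^bsub>V\<^esub> a \<in> \<Inter>{N. submodule N K V \<and> S \<subseteq> N}"
      using V.submoduleE(4) by auto
  qed
qed

lemma lin_kernel_submodule:
  assumes "module K V" "module K W" "h \<in> lin_hom K V W"
  shows "submodule {x \<in> carrier V. h x = \<zero>\<^bsub>W\<^esub>} K V"
proof -
  interpret V: module K V by fact
  interpret W: module K W by fact
  have h: "h x \<in> carrier W" "h (x \<oplus>\<^bsub>V\<^esub> y) = h x \<oplus>\<^bsub>W\<^esub> h y"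
     "k \<in> carrier K \<Longrightarrow> h (k \<odot>\<^bsub>V\<^esub> x) = k \<odot>\<^bsub>W\<^esub> h x" if "x \<in> carrier V" "y \<in> carrier V" for x y k
    using assms that by (auto simp: lin_hom_def)
  have z: "h \<zero>\<^bsub>V\<^esub> = \<zero>\<^bsub>W\<^esub>"
    using h[of "\<zero>\<^bsub>V\<^esub>" "\<zero>\<^bsub>V\<^esub>"] by (metis V.l_zero V.zero_closed W.add.l_cancel_one')
  have n: "h (\<ominus>\<^bsub>V\<^esub> x) = \<zero>\<^bsub>W\<^esub>" if "x \<in> carrier V" "h x = \<zero>\<^bsub>W\<^esub>" for x
    using h(2)[of "\<ominus>\<^bsub>V\<^esub> x" x] h(1)[of "\<ominus>\<^bsub>V\<^esub> x" x] that z by (simp add: V.l_neg)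
  show ?thesis
    by (intro V.submoduleI) (auto simp: z n h)
qed

lemma quot_lift_coset:
  assumes V: "module K V" and N: "submodule N K V" and W: "module K W" and h: "h \<in> lin_hom K V W"
    and ker: "\<And>x. x \<in> N \<Longrightarrow> h x = \<zero>\<^bsub>W\<^esub>" and x: "x \<in> carrier V"
  shows "quot_lift h (N +>\<^bsub>V\<^esub> x) = h x"
proof -
  interpret V: module K V by fact
  interpret W: module K W by fact
  interpret abelian_subgroup N V by (rule submodule_abelian_subgroup) fact+
  have "h y = h x" if "y \<in> N +>\<^bsub>V\<^esub> x" for y
  proof -
    obtain n where n: "n \<in> N" "y = n \<oplus>\<^bsub>V\<^esub> x" using \<open>y \<in> N +>\<^bsub>V\<^esub> x\<close> by (auto simp: a_r_coset_def')
    then have "n \<in> carrier V" using a_subset by auto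
    then have "h y = h n \<oplus>\<^bsub>W\<^esub> h x" "h x \<in> carrier W"
      using n x h by (auto simp: lin_hom_def Pi_iff)
    then show ?thesis using ker[OF n(1)] by simp
  qed
  moreover have "x \<in> N +>\<^bsub>V\<^esub> x" using x a_rcos_self by blast
  ultimately have "h ` (N +>\<^bsub>V\<^esub> x) = {h x}" by blast
  then show ?thesis by (simp add: quot_lift_def)
qed

lemma lin_hom_quot_lift:
  fixes K (structure)
  assumes K: "field K" and V: "module K V" and N: "submodule N K V" and W: "module K W"
    and h: "h \<in> lin_hom K V W" and ker: "\<And>x. x \<in> N \<Longrightarrow> h x = \<zero>\<^bsub>W\<^esub>"
  shows "quot_lift h \<in> lin_hom K (quot_space V N) W"
proof -
  interpret V: module K V by fact
  interpret W: module K W by fact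
  interpret abelian_subgroup N V by (rule submodule_abelian_subgroup) fact+
  note l = quot_lift_coset[OF V N W h ker]
  have add: "(N +>\<^bsub>V\<^esub> x) \<oplus>\<^bsub>quot_space V N\<^esub> (N +>\<^bsub>V\<^esub> y) = N +>\<^bsub>V\<^esub> (x \<oplus>\<^bsub>V\<^esub> y)"
    if "x \<in> carrier V" "y \<in> carrier V" for x y
    using that by (simp add: quot_space_def a_rcos_sum)
  have sm: "k \<odot>\<^bsub>quot_space V N\<^esub> (N +>\<^bsub>V\<^esub> x) = N +>\<^bsub>V\<^esub> (k \<odot>\<^bsub>V\<^esub> x)"
    if "k \<in> carrier K" "x \<in> carrier V" for k x
    using that coset_smult[OF V N] by (simp add: quot_space_def)
  show ?thesis unfolding lin_hom_def quot_space_carrier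
    using h by (auto simp: add sm l lin_hom_def Pi_iff)
qed

lemma lin_span_least:
  assumes "submodule N K V" "S \<subseteq> N"
  shows "lin_span K V S \<subseteq> N"
  using assms by (auto simp: lin_span_def)

lemma lin_span_superset: "S \<subseteq> lin_span K V S"
  by (auto simp: lin_span_def)

subsection \<open>Tensor powers\<close>

lemma tuples_update: "\<lbrakk>xs \<in> tuples V n; a \<in> carrier V\<rbrakk> \<Longrightarrow> xs[i := a] \<in> tuples V n"
  by (auto simp: tuples_def dest: set_update_subset_insert[THEN subsetD])

lemma multilinear_rels_subset:
  assumes K: "field K" and V: "module K V"
  shows "multilinear_rels K V n \<subseteq> carrier (free_space K (tuples V n))"
proof -
  interpret V: module K V by fact
  interpret F: module K "free_space K (tuples V n)" by (rule free_space_module) fact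
  note b = basis_elem_carrier[OF K, of _ "tuples V n"]
  show ?thesis unfolding multilinear_rels_def Let_def
    by (auto intro!: F.minus_closed F.a_closed F.smult_closed b tuples_update
        simp del: free_space_simps)
qed

lemma multilinear_span_submodule:
  assumes K: "field K" and V: "module K V"
  shows "submodule (multilinear_span K V n) K (free_space K (tuples V n))"
  unfolding multilinear_span_def
  by (intro lin_span_submodule free_space_module multilinear_rels_subset assms)

lemma tensor_power_module:
  assumes K: "field K" and V: "module K V"
  shows "module K (tensor_power K V n)"
  unfolding tensor_power_def
  by (intro quot_space_module free_space_module multilinear_span_submodule assms)

lemma pure_tensor_carrier:
  assumes K: "field K" and xs: "xs \<in> tuples V n"
  shows "pure_tensor K V xs \<in> carrier (tensor_power K V n)"
  using xs basis_elem_carrier[OF K xs]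
  by (auto simp: pure_tensor_def tensor_power_def quot_space_carrier tuples_def)

lemma tensor_lift:
  fixes K (structure)
  assumes K: "field K" and V: "module K V" and W: "module K W"
    and g: "g \<in> tuples V n \<rightarrow> carrier W"
    and add: "\<And>xs i a b. \<lbrakk>xs \<in> tuples V n; i < n; a \<in> carrier V; b \<in> carrier V\<rbrakk> \<Longrightarrow>
      g (xs[i := a \<oplus>\<^bsub>V\<^esub> b]) = g (xs[i := a]) \<oplus>\<^bsub>W\<^esub> g (xs[i := b])"
    and smult: "\<And>xs i k a. \<lbrakk>xs \<in> tuples V n; i < n; k \<in> carrier K; a \<in> carrier V\<rbrakk> \<Longrightarrow>
      g (xs[i := k \<odot>\<^bsub>V\<^esub> a]) = k \<odot>\<^bsub>W\<^esub> g (xs[i := a])"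
  shows "tensor_lift K W g \<in> lin_hom K (tensor_power K V n) W"
    and "xs \<in> tuples V n \<Longrightarrow> tensor_lift K W g (pure_tensor K V xs) = g xs"
proof -
  interpret K: field K by fact
  interpret V: module K V by fact
  interpret W: module K W by fact
  let ?F = "free_space K (tuples V n)"
  interpret F: module K ?F by (rule free_space_module) fact
  have h: "lin_ext K W g \<in> lin_hom K ?F W" (is "?h \<in> _") by (rule lin_ext_hom) fact+
  have h_add: "?h (x \<oplus>\<^bsub>?F\<^esub> y) = ?h x \<oplus>\<^bsub>W\<^esub> ?h y" and h_c: "?h x \<in> carrier W"
    if "x \<in> carrier ?F" "y \<in> carrier ?F" for x y using h that by (auto simp: lin_hom_def)
  have h_sm: "?h (k \<odot>\<^bsub>?F\<^esub> x) = k \<odot>\<^bsub>W\<^esub> ?h x"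
    if "x \<in> carrier ?F" "k \<in> carrier K" for x k using h that by (auto simp: lin_hom_def)
  have h_minus: "?h (x \<ominus>\<^bsub>?F\<^esub> y) = \<zero>\<^bsub>W\<^esub>" if "x \<in> carrier ?F" "y \<in> carrier ?F" "?h x = ?h y" for x y
  proof -
    have "x \<ominus>\<^bsub>?F\<^esub> y = x \<oplus>\<^bsub>?F\<^esub> ((\<ominus> \<one>) \<odot>\<^bsub>?F\<^esub> y)"
      using that by (subst F.smult_l_minus) (auto simp: a_minus_def simp del: free_space_simps)
    then have "?h (x \<ominus>\<^bsub>?F\<^esub> y) = ?h x \<oplus>\<^bsub>W\<^esub> ((\<ominus> \<one>) \<odot>\<^bsub>W\<^esub> ?h y)"
      using that by (simp add: h_add h_sm F.smult_closed del: free_space_simps)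
    also have "\<dots> = \<zero>\<^bsub>W\<^esub>" using that h_c
      by (subst W.smult_l_minus) (auto simp: W.r_neg)
    finally show ?thesis .
  qed
  note b = basis_elem_carrier[OF K, of _ "tuples V n"]
  note hb = lin_ext_basis[OF K W g]
  have "multilinear_rels K V n \<subseteq> {x \<in> carrier ?F. ?h x = \<zero>\<^bsub>W\<^esub>}"
  proof
    fix x assume "x \<in> multilinear_rels K V n"
    then consider (1) xs i a c where "xs \<in> tuples V n" "i < n" "a \<in> carrier V" "c \<in> carrier V"
        "x = basis_elem K (xs[i := a \<oplus>\<^bsub>V\<^esub> c]) \<ominus>\<^bsub>?F\<^esub>
          (basis_elem K (xs[i := a]) \<oplus>\<^bsub>?F\<^esub> basis_elem K (xs[i := c]))"
      | (2) xs i k a where "xs \<in> tuples V n" "i < n" "a \<in> carrier V" "k \<in> carrier K"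
        "x = basis_elem K (xs[i := k \<odot>\<^bsub>V\<^esub> a]) \<ominus>\<^bsub>?F\<^esub> k \<odot>\<^bsub>?F\<^esub> basis_elem K (xs[i := a])"
      unfolding multilinear_rels_def Let_def by blast
    then have "?h x = \<zero>\<^bsub>W\<^esub>"
    proof cases
      case 1
      then show ?thesis
        by (auto intro!: h_minus F.a_closed b tuples_update
            simp: h_add hb b tuples_update add simp del: free_space_simps)
    next
      case 2
      then show ?thesis
        by (auto intro!: h_minus F.smult_closed b tuples_update
            simp: h_sm hb b tuples_update smult simp del: free_space_simps)
    qed
    moreover have "x \<in> carrier ?F"
      using \<open>x \<in> multilinear_rels K V n\<close> multilinear_rels_subset[OF K V] by blast
    ultimately show "x \<in> {x \<in> carrier ?F. ?h x = \<zero>\<^bsub>W\<^esub>}" by simp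
  qed
  then have ker: "?h x = \<zero>\<^bsub>W\<^esub>" if "x \<in> multilinear_span K V n" for x
    using that lin_span_least[OF lin_kernel_submodule[OF F.module_axioms W h]]
    unfolding multilinear_span_def by blast
  show "tensor_lift K W g \<in> lin_hom K (tensor_power K V n) W"
    unfolding tensor_lift_def tensor_power_def
    by (rule lin_hom_quot_lift[OF K F.module_axioms multilinear_span_submodule[OF K V] W h ker])
  assume xs: "xs \<in> tuples V n"
  have "tensor_lift K W g (pure_tensor K V xs) = ?h (basis_elem K xs)"
    using quot_lift_coset[OF F.module_axioms multilinear_span_submodule[OF K V] W h ker b[OF xs]] xs
    by (simp add: tensor_lift_def pure_tensor_def tuples_def)
  then show "tensor_lift K W g (pure_tensor K V xs) = g xs" using xs by (simp add: hb)
qed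

lemma coset_eqI:
  assumes "module K V" "submodule N K V" "x \<in> carrier V" "y \<in> carrier V" "x \<ominus>\<^bsub>V\<^esub> y \<in> N"
  shows "N +>\<^bsub>V\<^esub> x = N +>\<^bsub>V\<^esub> y"
proof -
  interpret V: module K V by fact
  interpret abelian_subgroup N V by (rule submodule_abelian_subgroup) fact+
  have "(x \<ominus>\<^bsub>V\<^esub> y) \<oplus>\<^bsub>V\<^esub> y \<in> N +>\<^bsub>V\<^esub> y"
    using assms(5) by (auto simp: a_r_coset_def')
  moreover have "(x \<ominus>\<^bsub>V\<^esub> y) \<oplus>\<^bsub>V\<^esub> y = x"
    using assms by (simp add: a_minus_def V.a_assoc V.l_neg)
  ultimately have "x \<in> N +>\<^bsub>V\<^esub> y" by simp
  then show ?thesis using V.a_repr_independence[of x N y] assms a_subgroup by simp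
qed

lemma pure_tensor_add:
  fixes K (structure)
  assumes K: "field K" and V: "module K V" and xs: "xs \<in> tuples V n" "i < n"
    and ab: "a \<in> carrier V" "b \<in> carrier V"
  shows "pure_tensor K V (xs[i := a \<oplus>\<^bsub>V\<^esub> b]) =
    pure_tensor K V (xs[i := a]) \<oplus>\<^bsub>tensor_power K V n\<^esub> pure_tensor K V (xs[i := b])"
proof -
  interpret V: module K V by fact
  let ?F = "free_space K (tuples V n)" and ?N = "multilinear_span K V n"
  interpret F: module K ?F by (rule free_space_module) fact
  note N = multilinear_span_submodule[OF K V, of n]
  interpret abelian_subgroup ?N ?F by (rule submodule_abelian_subgroup[OF F.module_axioms N])
  note b = basis_elem_carrier[OF K tuples_update[OF xs(1)]]
  have "basis_elem K (xs[i := a \<oplus>\<^bsub>V\<^esub> b]) \<ominus>\<^bsub>?F\<^esub>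
      (basis_elem K (xs[i := a]) \<oplus>\<^bsub>?F\<^esub> basis_elem K (xs[i := b])) \<in> multilinear_rels K V n"
    unfolding multilinear_rels_def Let_def using xs ab by blast
  then have "?N +>\<^bsub>?F\<^esub> basis_elem K (xs[i := a \<oplus>\<^bsub>V\<^esub> b]) =
      ?N +>\<^bsub>?F\<^esub> (basis_elem K (xs[i := a]) \<oplus>\<^bsub>?F\<^esub> basis_elem K (xs[i := b]))"
    using ab xs b
    by (intro coset_eqI[OF F.module_axioms N] F.a_closed)
       (auto simp: multilinear_span_def intro: subsetD[OF lin_span_superset] simp del: free_space_simps)
  also have "\<dots> = (?N +>\<^bsub>?F\<^esub> basis_elem K (xs[i := a])) <+>\<^bsub>?F\<^esub> (?N +>\<^bsub>?F\<^esub> basis_elem K (xs[i := b]))"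
    using a_rcos_sum[OF b[OF ab(1)] b[OF ab(2)]] by simp
  finally show ?thesis using xs
    by (simp add: pure_tensor_def tensor_power_def tuples_def quot_space_def)
qed

lemma pure_tensor_smult:
  fixes K (structure)
  assumes K: "field K" and V: "module K V" and xs: "xs \<in> tuples V n" "i < n"
    and ka: "k \<in> carrier K" "a \<in> carrier V"
  shows "pure_tensor K V (xs[i := k \<odot>\<^bsub>V\<^esub> a]) =
    k \<odot>\<^bsub>tensor_power K V n\<^esub> pure_tensor K V (xs[i := a])"
proof -
  interpret V: module K V by fact
  let ?F = "free_space K (tuples V n)" and ?N = "multilinear_span K V n"
  interpret F: module K ?F by (rule free_space_module) fact
  note N = multilinear_span_submodule[OF K V, of n]
  note b = basis_elem_carrier[OF K tuples_update[OF xs(1)]]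
  have "basis_elem K (xs[i := k \<odot>\<^bsub>V\<^esub> a]) \<ominus>\<^bsub>?F\<^esub> (k \<odot>\<^bsub>?F\<^esub> basis_elem K (xs[i := a]))
      \<in> multilinear_rels K V n"
    unfolding multilinear_rels_def Let_def using xs ka by blast
  then have "?N +>\<^bsub>?F\<^esub> basis_elem K (xs[i := k \<odot>\<^bsub>V\<^esub> a]) =
      ?N +>\<^bsub>?F\<^esub> (k \<odot>\<^bsub>?F\<^esub> basis_elem K (xs[i := a]))"
    using ka xs b
    by (intro coset_eqI[OF F.module_axioms N] F.smult_closed)
       (auto simp: multilinear_span_def intro: subsetD[OF lin_span_superset] simp del: free_space_simps)
  also have "\<dots> = (\<Union>y\<in>?N +>\<^bsub>?F\<^esub> basis_elem K (xs[i := a]). ?N +>\<^bsub>?F\<^esub> (k \<odot>\<^bsub>?F\<^esub> y))"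
    using coset_smult[OF F.module_axioms N ka(1) b[OF ka(2)]] by simp
  finally show ?thesis using xs
    by (simp add: pure_tensor_def tensor_power_def tuples_def quot_space_def)
qed

subsection \<open>The universal property of free algebras with bracket\<close>

lemma free_bimagma_simps [simp]:
  "carrier (free_bimagma K S) = carrier (free_space K (monomials S))"
  "\<zero>\<^bsub>free_bimagma K S\<^esub> = (\<lambda>_. \<zero>\<^bsub>K\<^esub>)"
  "f \<oplus>\<^bsub>free_bimagma K S\<^esub> g = (\<lambda>x. f x \<oplus>\<^bsub>K\<^esub> g x)"
  "k \<odot>\<^bsub>free_bimagma K S\<^esub> f = (\<lambda>x. k \<otimes>\<^bsub>K\<^esub> f x)"
  "f \<otimes>\<^bsub>free_bimagma K S\<^esub> g = (\<lambda>m. case m of Mul u v \<Rightarrow> f u \<otimes>\<^bsub>K\<^esub> g v | _ \<Rightarrow> \<zero>\<^bsub>K\<^esub>)"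
  "bracket (free_bimagma K S) f g = (\<lambda>m. case m of Brk u v \<Rightarrow> f u \<otimes>\<^bsub>K\<^esub> g v | _ \<Rightarrow> \<zero>\<^bsub>K\<^esub>)"
  by (simp_all add: free_bimagma_def free_space_def module.defs awb.defs)

lemma mono_fun_eqI:
  "\<lbrakk>\<And>x. p (Gen x) = q (Gen x); \<And>u v. p (Mul u v) = q (Mul u v); \<And>u v. p (Brk u v) = q (Brk u v)\<rbrakk> \<Longrightarrow>
    p = q"
  by (metis ext mono.exhaust)

lemma bilinear_pair_free_bimagma:
  fixes K (structure)
  assumes K: "field K"
  shows "bilinear_pair K (free_bimagma K S)"
proof -
  interpret K: field K by fact
  let ?F = "free_space K (monomials S)"
  interpret F: module K ?F by (rule free_space_module) fact
  have car: "(\<lambda>m. case m of Mul u v \<Rightarrow> f u \<otimes> g v | _ \<Rightarrow> \<zero>) \<in> carrier ?F"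
    "(\<lambda>m. case m of Brk u v \<Rightarrow> f u \<otimes> g v | _ \<Rightarrow> \<zero>) \<in> carrier ?F"
    if "f \<in> carrier ?F" "g \<in> carrier ?F" for f g
  proof -
    let ?D = "{x. f x \<noteq> \<zero>} \<times> {x. g x \<noteq> \<zero>}"
    have c: "f u \<in> carrier K" "g u \<in> carrier K" for u using that by (auto simp: free_space_carrier)
    have D: "finite ?D" using that by (auto simp: free_space_carrier)
    have I: "p \<in> carrier ?F"
      if "\<And>m. p m \<in> carrier K" "{m. p m \<noteq> \<zero>} \<subseteq> D" "finite D" "D \<subseteq> monomials S" for p D
      using that unfolding free_space_carrier by (blast intro: finite_subset)
    show "(\<lambda>m. case m of Mul u v \<Rightarrow> f u \<otimes> g v | _ \<Rightarrow> \<zero>) \<in> carrier ?F"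
    proof (rule I)
      show "(case m of Mul u v \<Rightarrow> f u \<otimes> g v | _ \<Rightarrow> \<zero>) \<in> carrier K" for m
        using c by (cases m) simp_all
      show "{m. (case m of Mul u v \<Rightarrow> f u \<otimes> g v | _ \<Rightarrow> \<zero>) \<noteq> \<zero>} \<subseteq> (\<lambda>(u, v). Mul u v) ` ?D"
        by (rule subsetI, case_tac x; use c in force)
      show "(\<lambda>(u, v). Mul u v) ` ?D \<subseteq> monomials S"
        using that by (fastforce simp: free_space_carrier monomials_def)
    qed (use D in simp)
    show "(\<lambda>m. case m of Brk u v \<Rightarrow> f u \<otimes> g v | _ \<Rightarrow> \<zero>) \<in> carrier ?F"
    proof (rule I)
      show "(case m of Brk u v \<Rightarrow> f u \<otimes> g v | _ \<Rightarrow> \<zero>) \<in> carrier K" for m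
        using c by (cases m) simp_all
      show "{m. (case m of Brk u v \<Rightarrow> f u \<otimes> g v | _ \<Rightarrow> \<zero>) \<noteq> \<zero>} \<subseteq> (\<lambda>(u, v). Brk u v) ` ?D"
        by (rule subsetI, case_tac x; use c in force)
      show "(\<lambda>(u, v). Brk u v) ` ?D \<subseteq> monomials S"
        using that by (fastforce simp: free_space_carrier monomials_def)
    qed (use D in simp)
  qed
  have eq: "carrier (free_bimagma K S) = carrier ?F" "add (free_bimagma K S) = add ?F"
    "zero (free_bimagma K S) = zero ?F" "smult (free_bimagma K S) = smult ?F"
    by (simp_all add: free_bimagma_def free_space_def module.defs awb.defs)
  have inv: "\<exists>g\<in>carrier ?F. g \<oplus>\<^bsub>?F\<^esub> f = \<zero>\<^bsub>?F\<^esub>" if "f \<in> carrier ?F" for f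
    using that F.a_inv_closed F.l_neg by blast
  have ab: "abelian_group (free_bimagma K S)"
    by (rule abelian_groupI; unfold eq)
      (rule F.a_closed F.zero_closed F.a_assoc F.a_comm F.l_zero inv; assumption)+
  have m: "module K (free_bimagma K S)"
    by (rule moduleI[OF K.is_cring ab]; unfold eq)
      (rule F.smult_closed F.smult_l_distr F.smult_r_distr F.smult_assoc1 F.smult_one; assumption)+
  have c: "f u \<in> carrier K" if "f \<in> carrier ?F" for f u using that by (simp add: free_space_carrier)
  show ?thesis
    by (intro bilinear_pair.intro bilinear_pair_axioms.intro K m)
      (simp_all add: car, (rule mono_fun_eqI; simp add: c K.l_distr K.r_distr K.m_assoc K.m_lcomm)+)
qed

lemma genideal_ideal:
  assumes A: "bilinear_pair K A" and S: "S \<subseteq> carrier A"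
  shows "awb_ideal K A (awb_genideal K A S)"
proof -
  interpret A: bilinear_pair K A by fact
  let ?P = "\<lambda>I. awb_ideal K A I \<and> S \<subseteq> I"
  have car: "?P (carrier A)"
    using S A.carrier_is_submodule by (auto simp: awb_ideal_def A.mult_closed A.bracket_closed)
  have sub: "submodule I K A" if "?P I" for I using that by (simp add: awb_ideal_def)
  have "submodule (awb_genideal K A S) K A"
    unfolding awb_genideal_def
  proof (intro A.submoduleI)
    show "\<Inter>{I. ?P I} \<subseteq> carrier A" using car by blast
    show "\<zero>\<^bsub>A\<^esub> \<in> \<Inter>{I. ?P I}"
      using subgroup.one_closed[OF submodule.axioms(1)[OF sub]] by fastforce
    show "a \<oplus>\<^bsub>A\<^esub> b \<in> \<Inter>{I. ?P I}" if "a \<in> \<Inter>{I. ?P I}" "b \<in> \<Inter>{I. ?P I}" for a b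
      using that A.submoduleE(5)[OF sub] by auto
    show "\<ominus>\<^bsub>A\<^esub> a \<in> \<Inter>{I. ?P I}" if "a \<in> \<Inter>{I. ?P I}" for a
      using that A.submoduleE(3)[OF sub] by auto
    show "k \<odot>\<^bsub>A\<^esub> a \<in> \<Inter>{I. ?P I}" if "k \<in> carrier K" "a \<in> \<Inter>{I. ?P I}" for k a
      using that A.submoduleE(4)[OF sub] by auto
  qed
  then show ?thesis
    by (auto simp: awb_ideal_def awb_genideal_def)
qed

lemma genideal_least: "\<lbrakk>awb_ideal K A I; S \<subseteq> I\<rbrakk> \<Longrightarrow> awb_genideal K A S \<subseteq> I"
  by (auto simp: awb_genideal_def)

lemma genideal_superset: "S \<subseteq> awb_genideal K A S"
  by (auto simp: awb_genideal_def)

lemma coset_bilinear: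
  assumes A: "module K A" and N: "submodule N K A"
    and xy: "x \<in> carrier A" "y \<in> carrier A"
    and closed: "\<And>x y. \<lbrakk>x \<in> carrier A; y \<in> carrier A\<rbrakk> \<Longrightarrow> p x y \<in> carrier A"
    and addl: "\<And>x y z. \<lbrakk>x \<in> carrier A; y \<in> carrier A; z \<in> carrier A\<rbrakk> \<Longrightarrow> p (x \<oplus>\<^bsub>A\<^esub> y) z = p x z \<oplus>\<^bsub>A\<^esub> p y z"
    and addr: "\<And>x y z. \<lbrakk>x \<in> carrier A; y \<in> carrier A; z \<in> carrier A\<rbrakk> \<Longrightarrow> p x (y \<oplus>\<^bsub>A\<^esub> z) = p x y \<oplus>\<^bsub>A\<^esub> p x z"
    and id: "\<And>x y. \<lbrakk>x \<in> carrier A; y \<in> N\<rbrakk> \<Longrightarrow> p x y \<in> N \<and> p y x \<in> N"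
  shows "(\<Union>x'\<in>N +>\<^bsub>A\<^esub> x. \<Union>y'\<in>N +>\<^bsub>A\<^esub> y. N +>\<^bsub>A\<^esub> p x' y') = N +>\<^bsub>A\<^esub> p x y"
proof -
  interpret A: module K A by fact
  interpret abelian_subgroup N A by (rule submodule_abelian_subgroup) fact+
  have "N +>\<^bsub>A\<^esub> p x' y' = N +>\<^bsub>A\<^esub> p x y" if x': "x' \<in> N +>\<^bsub>A\<^esub> x" and y': "y' \<in> N +>\<^bsub>A\<^esub> y" for x' y'
  proof -
    obtain m where m: "m \<in> N" "x' = m \<oplus>\<^bsub>A\<^esub> x" using x' by (auto simp: a_r_coset_def')
    obtain n where n: "n \<in> N" "y' = n \<oplus>\<^bsub>A\<^esub> y" using y' by (auto simp: a_r_coset_def')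
    have c: "m \<in> carrier A" "n \<in> carrier A" using m n a_subset by auto
    have "p x' y' = (p m (n \<oplus>\<^bsub>A\<^esub> y) \<oplus>\<^bsub>A\<^esub> p x n) \<oplus>\<^bsub>A\<^esub> p x y"
      using c m n xy by (simp add: addl addr closed A.a_ac)
    moreover have "p m (n \<oplus>\<^bsub>A\<^esub> y) \<oplus>\<^bsub>A\<^esub> p x n \<in> N"
      using c m n xy id by (intro a_closed) auto
    ultimately have "p x' y' \<in> N +>\<^bsub>A\<^esub> p x y" by (auto simp: a_r_coset_def')
    then show ?thesis using A.a_repr_independence[of "p x' y'" N "p x y"] closed xy a_subgroup by simp
  qed
  moreover have "x \<in> N +>\<^bsub>A\<^esub> x" "y \<in> N +>\<^bsub>A\<^esub> y" using xy a_rcos_self by blast+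
  ultimately show ?thesis by blast
qed

lemma quot_awb_simps:
  assumes A: "bilinear_pair K A" and I: "awb_ideal K A I"
  shows "carrier (quot_awb A I) = (\<lambda>x. I +>\<^bsub>A\<^esub> x) ` carrier A"
    and "\<lbrakk>x \<in> carrier A; y \<in> carrier A\<rbrakk> \<Longrightarrow>
      (I +>\<^bsub>A\<^esub> x) \<oplus>\<^bsub>quot_awb A I\<^esub> (I +>\<^bsub>A\<^esub> y) = I +>\<^bsub>A\<^esub> (x \<oplus>\<^bsub>A\<^esub> y)"
    and "\<lbrakk>k \<in> carrier K; x \<in> carrier A\<rbrakk> \<Longrightarrow>
      k \<odot>\<^bsub>quot_awb A I\<^esub> (I +>\<^bsub>A\<^esub> x) = I +>\<^bsub>A\<^esub> (k \<odot>\<^bsub>A\<^esub> x)"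
    and "\<lbrakk>x \<in> carrier A; y \<in> carrier A\<rbrakk> \<Longrightarrow>
      (I +>\<^bsub>A\<^esub> x) \<otimes>\<^bsub>quot_awb A I\<^esub> (I +>\<^bsub>A\<^esub> y) = I +>\<^bsub>A\<^esub> (x \<otimes>\<^bsub>A\<^esub> y)"
    and "\<lbrakk>x \<in> carrier A; y \<in> carrier A\<rbrakk> \<Longrightarrow>
      bracket (quot_awb A I) (I +>\<^bsub>A\<^esub> x) (I +>\<^bsub>A\<^esub> y) = I +>\<^bsub>A\<^esub> bracket A x y"
proof -
  interpret A: bilinear_pair K A by fact
  have N: "submodule I K A" using I by (simp add: awb_ideal_def)
  interpret abelian_subgroup I A by (rule submodule_abelian_subgroup[OF A.module_axioms N])
  show "carrier (quot_awb A I) = (\<lambda>x. I +>\<^bsub>A\<^esub> x) ` carrier A"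
    by (auto simp: quot_awb_def A_RCOSETS_def')
  show "\<lbrakk>x \<in> carrier A; y \<in> carrier A\<rbrakk> \<Longrightarrow>
      (I +>\<^bsub>A\<^esub> x) \<oplus>\<^bsub>quot_awb A I\<^esub> (I +>\<^bsub>A\<^esub> y) = I +>\<^bsub>A\<^esub> (x \<oplus>\<^bsub>A\<^esub> y)"
    by (simp add: quot_awb_def a_rcos_sum)
  show "\<lbrakk>k \<in> carrier K; x \<in> carrier A\<rbrakk> \<Longrightarrow>
      k \<odot>\<^bsub>quot_awb A I\<^esub> (I +>\<^bsub>A\<^esub> x) = I +>\<^bsub>A\<^esub> (k \<odot>\<^bsub>A\<^esub> x)"
    using coset_smult[OF A.module_axioms N] by (simp add: quot_awb_def)
  show "\<lbrakk>x \<in> carrier A; y \<in> carrier A\<rbrakk> \<Longrightarrow>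
      (I +>\<^bsub>A\<^esub> x) \<otimes>\<^bsub>quot_awb A I\<^esub> (I +>\<^bsub>A\<^esub> y) = I +>\<^bsub>A\<^esub> (x \<otimes>\<^bsub>A\<^esub> y)"
    unfolding quot_awb_def rcoset_mult_def using I
    by (simp add: coset_bilinear[OF A.module_axioms N] A.mult_closed A.mult_add_left
        A.mult_add_right awb_ideal_def)
  show "\<lbrakk>x \<in> carrier A; y \<in> carrier A\<rbrakk> \<Longrightarrow>
      bracket (quot_awb A I) (I +>\<^bsub>A\<^esub> x) (I +>\<^bsub>A\<^esub> y) = I +>\<^bsub>A\<^esub> bracket A x y"
    unfolding quot_awb_def using I
    by (simp add: coset_bilinear[OF A.module_axioms N] A.bracket_closed A.bracket_add_left
        A.bracket_add_right awb_ideal_def)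
qed

lemma bilinear_pair_quot_awb:
  assumes A: "bilinear_pair K A" and I: "awb_ideal K A I"
  shows "bilinear_pair K (quot_awb A I)"
proof -
  interpret A: bilinear_pair K A by fact
  note s = quot_awb_simps[OF A I]
  have N: "submodule I K A" using I by (simp add: awb_ideal_def)
  have "module K (quot_awb A I)"
    by (rule quot_module_aux[OF A.field_axioms A.module_axioms N]) (simp_all add: quot_awb_def)
  then show ?thesis
    by (intro bilinear_pair.intro bilinear_pair_axioms.intro A.field_axioms)
      (auto simp: s A.mult_closed A.bracket_closed A.mult_add_left A.mult_add_right
        A.mult_smult_left A.mult_smult_right A.bracket_add_left A.bracket_add_right
        A.bracket_smult_left A.bracket_smult_right)
qed

lemma free_awb_rels_subset:
  assumes K: "field K"
  shows "free_awb_rels K S \<subseteq> carrier (free_bimagma K S)"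
proof -
  interpret P: bilinear_pair K "free_bimagma K S" by (rule bilinear_pair_free_bimagma) fact
  show ?thesis unfolding free_awb_rels_def Let_def
    by (auto intro!: P.minus_closed P.mult_closed P.a_closed P.bracket_closed simp del: free_bimagma_simps)
qed

lemma free_awb_ideal:
  assumes K: "field K"
  shows "awb_ideal K (free_bimagma K S) (free_awb_ideal K S)"
  unfolding free_awb_ideal_def
  by (intro genideal_ideal bilinear_pair_free_bimagma free_awb_rels_subset K)

lemma awb_free_awb:
  assumes K: "field K"
  shows "awb K (free_awb K S)"
proof -
  let ?P = "free_bimagma K S" and ?I = "free_awb_ideal K S"
  note P = bilinear_pair_free_bimagma[OF K, of S]
  note I = free_awb_ideal[OF K, of S]
  interpret P: bilinear_pair K ?P by (rule P)
  note s = quot_awb_simps[OF P I]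
  have N: "submodule ?I K ?P" using I by (simp add: awb_ideal_def)
  have assoc: "?I +>\<^bsub>?P\<^esub> ((f \<otimes>\<^bsub>?P\<^esub> g) \<otimes>\<^bsub>?P\<^esub> h) = ?I +>\<^bsub>?P\<^esub> (f \<otimes>\<^bsub>?P\<^esub> (g \<otimes>\<^bsub>?P\<^esub> h))"
    if "f \<in> carrier ?P" "g \<in> carrier ?P" "h \<in> carrier ?P" for f g h
  proof (rule coset_eqI[OF P.module_axioms N])
    have "((f \<otimes>\<^bsub>?P\<^esub> g) \<otimes>\<^bsub>?P\<^esub> h) \<ominus>\<^bsub>?P\<^esub> (f \<otimes>\<^bsub>?P\<^esub> (g \<otimes>\<^bsub>?P\<^esub> h)) \<in> free_awb_rels K S"
      unfolding free_awb_rels_def Let_def using that by blast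
    then show "((f \<otimes>\<^bsub>?P\<^esub> g) \<otimes>\<^bsub>?P\<^esub> h) \<ominus>\<^bsub>?P\<^esub> (f \<otimes>\<^bsub>?P\<^esub> (g \<otimes>\<^bsub>?P\<^esub> h)) \<in> ?I"
      unfolding free_awb_ideal_def by (rule subsetD[OF genideal_superset])
  qed (intro P.mult_closed that)+
  have brk: "?I +>\<^bsub>?P\<^esub> bracket ?P (f \<otimes>\<^bsub>?P\<^esub> g) h =
      ?I +>\<^bsub>?P\<^esub> (bracket ?P f h \<otimes>\<^bsub>?P\<^esub> g \<oplus>\<^bsub>?P\<^esub> f \<otimes>\<^bsub>?P\<^esub> bracket ?P g h)"
    if "f \<in> carrier ?P" "g \<in> carrier ?P" "h \<in> carrier ?P" for f g h
  proof (rule coset_eqI[OF P.module_axioms N])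
    have "bracket ?P (f \<otimes>\<^bsub>?P\<^esub> g) h \<ominus>\<^bsub>?P\<^esub>
        (bracket ?P f h \<otimes>\<^bsub>?P\<^esub> g \<oplus>\<^bsub>?P\<^esub> f \<otimes>\<^bsub>?P\<^esub> bracket ?P g h) \<in> free_awb_rels K S"
      unfolding free_awb_rels_def Let_def using that by blast
    then show "bracket ?P (f \<otimes>\<^bsub>?P\<^esub> g) h \<ominus>\<^bsub>?P\<^esub>
        (bracket ?P f h \<otimes>\<^bsub>?P\<^esub> g \<oplus>\<^bsub>?P\<^esub> f \<otimes>\<^bsub>?P\<^esub> bracket ?P g h) \<in> ?I"
      unfolding free_awb_ideal_def by (rule subsetD[OF genideal_superset])
  qed (intro P.mult_closed P.bracket_closed P.a_closed that)+
  show ?thesis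
    unfolding free_awb_def
    by (intro awb.intro awb_axioms.intro bilinear_pair_quot_awb P I)
      (auto simp: s P.mult_closed P.bracket_closed assoc brk simp del: free_bimagma_simps)
qed

primrec eval_mono :: "('k, 'b, 'n) awb_scheme \<Rightarrow> ('x \<Rightarrow> 'b) \<Rightarrow> 'x mono \<Rightarrow> 'b" where
  "eval_mono B g (Gen x) = g x"
| "eval_mono B g (Mul u v) = eval_mono B g u \<otimes>\<^bsub>B\<^esub> eval_mono B g v"
| "eval_mono B g (Brk u v) = bracket B (eval_mono B g u) (eval_mono B g v)"

lemma bilinear_ext:
  assumes K: "field K" and B: "module K B" and h: "h \<in> lin_hom K (free_space K S) B"
    and f: "f \<in> carrier (free_space K S)" and g: "g \<in> carrier (free_space K S)"
    and p: "\<And>f g. \<lbrakk>f \<in> carrier (free_space K S); g \<in> carrier (free_space K S)\<rbrakk> \<Longrightarrow> p f g \<in> carrier (free_space K S)"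
    "\<And>f f' g. \<lbrakk>f \<in> carrier (free_space K S); f' \<in> carrier (free_space K S); g \<in> carrier (free_space K S)\<rbrakk> \<Longrightarrow>
       p (f \<oplus>\<^bsub>free_space K S\<^esub> f') g = p f g \<oplus>\<^bsub>free_space K S\<^esub> p f' g \<and>
       p g (f \<oplus>\<^bsub>free_space K S\<^esub> f') = p g f \<oplus>\<^bsub>free_space K S\<^esub> p g f'"
    "\<And>k f g. \<lbrakk>k \<in> carrier K; f \<in> carrier (free_space K S); g \<in> carrier (free_space K S)\<rbrakk> \<Longrightarrow>
       p (k \<odot>\<^bsub>free_space K S\<^esub> f) g = k \<odot>\<^bsub>free_space K S\<^esub> p f g \<and>
       p f (k \<odot>\<^bsub>free_space K S\<^esub> g) = k \<odot>\<^bsub>free_space K S\<^esub> p f g"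
    and q: "\<And>f g. \<lbrakk>f \<in> carrier B; g \<in> carrier B\<rbrakk> \<Longrightarrow> q f g \<in> carrier B"
    "\<And>f f' g. \<lbrakk>f \<in> carrier B; f' \<in> carrier B; g \<in> carrier B\<rbrakk> \<Longrightarrow>
       q (f \<oplus>\<^bsub>B\<^esub> f') g = q f g \<oplus>\<^bsub>B\<^esub> q f' g \<and> q g (f \<oplus>\<^bsub>B\<^esub> f') = q g f \<oplus>\<^bsub>B\<^esub> q g f'"
    "\<And>k f g. \<lbrakk>k \<in> carrier K; f \<in> carrier B; g \<in> carrier B\<rbrakk> \<Longrightarrow>
       q (k \<odot>\<^bsub>B\<^esub> f) g = k \<odot>\<^bsub>B\<^esub> q f g \<and> q f (k \<odot>\<^bsub>B\<^esub> g) = k \<odot>\<^bsub>B\<^esub> q f g"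
    and basis: "\<And>u v. \<lbrakk>u \<in> S; v \<in> S\<rbrakk> \<Longrightarrow>
       h (p (basis_elem K u) (basis_elem K v)) = q (h (basis_elem K u)) (h (basis_elem K v))"
  shows "h (p f g) = q (h f) (h g)"
proof -
  interpret K: field K by fact
  interpret B: module K B by fact
  let ?F = "free_space K S"
  interpret F: module K ?F by (rule free_space_module) fact
  note b = basis_elem_carrier[OF K, of _ S]
  have h_c: "h x \<in> carrier B" and h_add: "h (x \<oplus>\<^bsub>?F\<^esub> y) = h x \<oplus>\<^bsub>B\<^esub> h y"
    if "x \<in> carrier ?F" "y \<in> carrier ?F" for x y using h that by (auto simp: lin_hom_def)
  have h_sm: "h (k \<odot>\<^bsub>?F\<^esub> x) = k \<odot>\<^bsub>B\<^esub> h x"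
    if "x \<in> carrier ?F" "k \<in> carrier K" for x k using h that by (auto simp: lin_hom_def)
  have zF: "x \<oplus>\<^bsub>?F\<^esub> x = x \<Longrightarrow> x = \<zero>\<^bsub>?F\<^esub>" if "x \<in> carrier ?F" for x
    using that by (metis F.add.r_cancel_one' F.zero_closed)
  have zB: "x \<oplus>\<^bsub>B\<^esub> x = x \<Longrightarrow> x = \<zero>\<^bsub>B\<^esub>" if "x \<in> carrier B" for x
    using that by (metis B.add.r_cancel_one')
  have h0: "h \<zero>\<^bsub>?F\<^esub> = \<zero>\<^bsub>B\<^esub>"
    using h_add[OF F.zero_closed F.zero_closed] h_c[OF F.zero_closed F.zero_closed]
    by (intro zB) (simp_all only: F.l_zero[OF F.zero_closed])
  have p0: "p \<zero>\<^bsub>?F\<^esub> x = \<zero>\<^bsub>?F\<^esub>" "p x \<zero>\<^bsub>?F\<^esub> = \<zero>\<^bsub>?F\<^esub>" if "x \<in> carrier ?F" for x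
    using p(2)[OF F.zero_closed F.zero_closed that] p(1)[OF F.zero_closed that] p(1)[OF that F.zero_closed]
    by (intro zF; metis F.l_zero F.zero_closed)+
  have q0: "q \<zero>\<^bsub>B\<^esub> x = \<zero>\<^bsub>B\<^esub>" "q x \<zero>\<^bsub>B\<^esub> = \<zero>\<^bsub>B\<^esub>" if "x \<in> carrier B" for x
    using q(2)[OF B.zero_closed B.zero_closed that] q(1)[OF B.zero_closed that] q(1)[OF that B.zero_closed]
    by (intro zB; metis B.l_zero B.zero_closed)+
  have 1: "h (p (basis_elem K u) g) = q (h (basis_elem K u)) (h g)" if u: "u \<in> S" for u
    using K g
  proof (induction rule: free_space_induct)
    case zero
    then show ?case using b[OF u] by (simp only: h0 p0 q0 h_c)
  next
    case (step k x g)
    then show ?case using b[OF u] b[of x]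
      by (simp add: p q h_add h_sm h_c basis u F.smult_closed F.a_closed del: free_space_simps)
  qed
  show ?thesis
    using K f
  proof (induction rule: free_space_induct)
    case zero
    then show ?case using g by (simp only: h0 p0 q0 h_c)
  next
    case (step k x f)
    then show ?case using g b[of x]
      by (simp add: p q h_add h_sm h_c 1 F.smult_closed F.a_closed del: free_space_simps)
  qed
qed

lemma free_space_basis_mult:
  fixes K (structure)
  assumes K: "field K"
  shows "basis_elem K u \<otimes>\<^bsub>free_bimagma K S\<^esub> basis_elem K v = basis_elem K (Mul u v)"
    and "bracket (free_bimagma K S) (basis_elem K u) (basis_elem K v) = basis_elem K (Brk u v)"
proof -
  interpret K: field K by fact
  show "basis_elem K u \<otimes>\<^bsub>free_bimagma K S\<^esub> basis_elem K v = basis_elem K (Mul u v)"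
    "bracket (free_bimagma K S) (basis_elem K u) (basis_elem K v) = basis_elem K (Brk u v)"
    by (auto simp: basis_elem_def fun_eq_iff split: mono.splits)
qed

lemma lin_hom_free_bimagma:
  "lin_hom K (free_bimagma K S) B = lin_hom K (free_space K (monomials S)) B"
  by (simp add: lin_hom_def)

lemma field_zero_closed: "field K \<Longrightarrow> \<zero>\<^bsub>K\<^esub> \<in> carrier K"
proof -
  assume "field K"
  then interpret field K .
  show ?thesis by simp
qed

lemma free_awb_universal:
  fixes K (structure)
  assumes B: "awb K B" and g: "g \<in> S \<rightarrow> carrier B"
  shows "\<exists>h \<in> awb_hom K (free_awb K S) B. \<forall>x\<in>S. h (free_awb_gen K S x) = g x"
    and "\<lbrakk>h \<in> awb_hom K (free_awb K S) B; h' \<in> awb_hom K (free_awb K S) B;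
      \<forall>x\<in>S. h (free_awb_gen K S x) = h' (free_awb_gen K S x)\<rbrakk> \<Longrightarrow>
      \<forall>x\<in>carrier (free_awb K S). h x = h' x"
proof -
  interpret B: awb K B by fact
  note K = B.field_axioms
  note K0 = field_zero_closed[OF K]
  let ?P = "free_bimagma K S" and ?I = "free_awb_ideal K S" and ?F = "free_space K (monomials S)"
  note P = bilinear_pair_free_bimagma[OF K, of S]
  note I = free_awb_ideal[OF K, of S]
  interpret P: bilinear_pair K ?P by (rule P)
  interpret F: module K ?F by (rule free_space_module[OF K])
  note s = quot_awb_simps[OF P I]
  have N: "submodule ?I K ?P" using I by (simp add: awb_ideal_def)
  interpret Q: awb K "free_awb K S" by (rule awb_free_awb[OF K])
  let ?e = "eval_mono B g"
  have e: "?e m \<in> carrier B" if "m \<in> monomials S" for m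
    using that g by (induction m) (auto simp: monomials_def B.mult_closed B.bracket_closed Pi_iff)
  define h where "h = lin_ext K B ?e"
  have e': "?e \<in> monomials S \<rightarrow> carrier B" using e by simp
  have hF: "h \<in> lin_hom K ?F B" unfolding h_def
    by (rule lin_ext_hom[OF K B.module_axioms e'])
  then have hP: "h \<in> lin_hom K ?P B" by (simp add: lin_hom_free_bimagma)
  have hb: "h (basis_elem K m) = ?e m" if "m \<in> monomials S" for m
    unfolding h_def using that by (rule lin_ext_basis[OF K B.module_axioms e'])
  have mm: "Mul u v \<in> monomials S" "Brk u v \<in> monomials S" if "u \<in> monomials S" "v \<in> monomials S" for u v
    using that by (auto simp: monomials_def)
  have hc: "h x \<in> carrier B" if "x \<in> carrier ?P" for x
    using hP that by (auto simp: lin_hom_def)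
  have hadd: "h (x \<oplus>\<^bsub>?P\<^esub> y) = h x \<oplus>\<^bsub>B\<^esub> h y" if "x \<in> carrier ?P" "y \<in> carrier ?P" for x y
    using hP that unfolding lin_hom_def by blast
  have hsm: "h (k \<odot>\<^bsub>?P\<^esub> x) = k \<odot>\<^bsub>B\<^esub> h x" if "k \<in> carrier K" "x \<in> carrier ?P" for k x
    using hP that unfolding lin_hom_def by blast
  have hmult: "h (x \<otimes>\<^bsub>?P\<^esub> y) = h x \<otimes>\<^bsub>B\<^esub> h y" if "x \<in> carrier ?P" "y \<in> carrier ?P" for x y
  proof (rule bilinear_ext[OF K B.module_axioms hF, where p = "mult ?P" and q = "mult B"])
    fix u v assume "u \<in> monomials S" "v \<in> monomials S"
    then show "h (basis_elem K u \<otimes>\<^bsub>?P\<^esub> basis_elem K v) = h (basis_elem K u) \<otimes>\<^bsub>B\<^esub> h (basis_elem K v)"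
      unfolding free_space_basis_mult(1)[OF K] by (simp add: hb mm)
  qed (use that P.mult_closed P.mult_add_left P.mult_add_right P.mult_smult_left P.mult_smult_right
      B.mult_closed B.mult_add_left B.mult_add_right B.mult_smult_left B.mult_smult_right in auto)
  have hbrk: "h (bracket ?P x y) = bracket B (h x) (h y)" if "x \<in> carrier ?P" "y \<in> carrier ?P" for x y
  proof (rule bilinear_ext[OF K B.module_axioms hF, where p = "bracket ?P" and q = "bracket B"])
    fix u v assume "u \<in> monomials S" "v \<in> monomials S"
    then show "h (bracket ?P (basis_elem K u) (basis_elem K v)) = bracket B (h (basis_elem K u)) (h (basis_elem K v))"
      unfolding free_space_basis_mult(2)[OF K] by (simp add: hb mm)
  qed (use that P.bracket_closed P.bracket_add_left P.bracket_add_right P.bracket_smult_left P.bracket_smult_right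
      B.bracket_closed B.bracket_add_left B.bracket_add_right B.bracket_smult_left B.bracket_smult_right in auto)
  let ?ker = "{x \<in> carrier ?P. h x = \<zero>\<^bsub>B\<^esub>}"
  have B0: "\<zero>\<^bsub>B\<^esub> \<otimes>\<^bsub>B\<^esub> x = \<zero>\<^bsub>B\<^esub>" "x \<otimes>\<^bsub>B\<^esub> \<zero>\<^bsub>B\<^esub> = \<zero>\<^bsub>B\<^esub>"
    "bracket B \<zero>\<^bsub>B\<^esub> x = \<zero>\<^bsub>B\<^esub>" "bracket B x \<zero>\<^bsub>B\<^esub> = \<zero>\<^bsub>B\<^esub>" if "x \<in> carrier B" for x
    using B.mult_smult_left[OF K0 that that] B.mult_smult_right[OF K0 that that]
      B.bracket_smult_left[OF K0 that that] B.bracket_smult_right[OF K0 that that]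
      that by (simp_all add: B.mult_closed B.bracket_closed)
  have kerI: "awb_ideal K ?P ?ker"
    unfolding awb_ideal_def
  proof (intro conjI ballI)
    show "submodule ?ker K ?P"
      by (rule lin_kernel_submodule[OF P.module_axioms B.module_axioms hP])
  qed (auto simp: hmult hbrk hc B0 P.mult_closed P.bracket_closed simp del: free_bimagma_simps)
  have hminus: "h (x \<ominus>\<^bsub>?P\<^esub> y) = \<zero>\<^bsub>B\<^esub>" if "x \<in> carrier ?P" "y \<in> carrier ?P" "h x = h y" for x y
  proof -
    have "h x = h ((x \<ominus>\<^bsub>?P\<^esub> y) \<oplus>\<^bsub>?P\<^esub> y)"
      using that by (simp add: a_minus_def P.a_assoc P.l_neg del: free_bimagma_simps)
    also have "\<dots> = h (x \<ominus>\<^bsub>?P\<^esub> y) \<oplus>\<^bsub>B\<^esub> h y"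
      using that by (intro hadd P.minus_closed)
    finally show ?thesis using that hc[of y] hc[of "x \<ominus>\<^bsub>?P\<^esub> y"] P.minus_closed
      by (metis B.add.r_cancel_one')
  qed
  have "free_awb_rels K S \<subseteq> ?ker"
    unfolding free_awb_rels_def Let_def
    by (auto intro!: hminus P.minus_closed P.mult_closed P.bracket_closed P.a_closed
        simp: hmult hbrk hadd hc P.mult_closed P.bracket_closed B.mult_assoc B.bracket_mult
        simp del: free_bimagma_simps)
  then have ker: "h x = \<zero>\<^bsub>B\<^esub>" if "x \<in> ?I" for x
    using that genideal_least[OF kerI] unfolding free_awb_ideal_def by blast
  note l = quot_lift_coset[OF P.module_axioms N B.module_axioms hP ker]
  have bG: "basis_elem K (Gen x) \<in> carrier ?P" if "x \<in> S" for x
    using that basis_elem_carrier[OF K, of "Gen x" "monomials S"] by (simp add: monomials_def)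
  have "quot_lift h \<in> awb_hom K (free_awb K S) B"
    unfolding awb_hom_def lin_hom_def free_awb_def
    by (auto simp: s l hc hadd hsm hmult hbrk P.mult_closed P.bracket_closed P.a_closed P.smult_closed
        simp del: free_bimagma_simps)
  moreover have "quot_lift h (free_awb_gen K S x) = g x" if "x \<in> S" for x
    unfolding free_awb_gen_def using that by (simp add: l bG hb monomials_def del: free_bimagma_simps)
  ultimately show "\<exists>h \<in> awb_hom K (free_awb K S) B. \<forall>x\<in>S. h (free_awb_gen K S x) = g x"
    by blast

  fix h h' assume h: "h \<in> awb_hom K (free_awb K S) B" and h': "h' \<in> awb_hom K (free_awb K S) B"
    and eq: "\<forall>x\<in>S. h (free_awb_gen K S x) = h' (free_awb_gen K S x)"
  let ?c = "\<lambda>x. ?I +>\<^bsub>?P\<^esub> x"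
  note s' = s[folded free_awb_def]
  have cc: "?c x \<in> carrier (free_awb K S)" if "x \<in> carrier ?P" for x
    using that by (auto simp: s')
  have hm: "j (x \<oplus>\<^bsub>free_awb K S\<^esub> y) = j x \<oplus>\<^bsub>B\<^esub> j y"
    "j (x \<otimes>\<^bsub>free_awb K S\<^esub> y) = j x \<otimes>\<^bsub>B\<^esub> j y"
    "j (bracket (free_awb K S) x y) = bracket B (j x) (j y)"
    "k \<in> carrier K \<Longrightarrow> j (k \<odot>\<^bsub>free_awb K S\<^esub> x) = k \<odot>\<^bsub>B\<^esub> j x"
    if "j \<in> awb_hom K (free_awb K S) B" "x \<in> carrier (free_awb K S)" "y \<in> carrier (free_awb K S)" for j x y k
    using that unfolding awb_hom_def lin_hom_def by blast+
  have bm: "basis_elem K m \<in> carrier ?P" if "m \<in> monomials S" for m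
    using that basis_elem_carrier[OF K, of m "monomials S"] by simp
  have mono: "h (?c (basis_elem K m)) = h' (?c (basis_elem K m))" if "m \<in> monomials S" for m
    using that
  proof (induction m)
    case (Gen x)
    then show ?case using eq by (simp add: free_awb_gen_def monomials_def)
  next
    case (Mul u v)
    then have uv: "u \<in> monomials S" "v \<in> monomials S" by (auto simp: monomials_def)
    have "?c (basis_elem K (Mul u v)) = ?c (basis_elem K u) \<otimes>\<^bsub>free_awb K S\<^esub> ?c (basis_elem K v)"
      unfolding s'(4)[OF bm[OF uv(1)] bm[OF uv(2)]] free_space_basis_mult(1)[OF K] ..
    then show ?case using Mul.IH uv hm(2)[OF h cc[OF bm] cc[OF bm]] hm(2)[OF h' cc[OF bm] cc[OF bm]]
      by simp
  next
    case (Brk u v)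
    then have uv: "u \<in> monomials S" "v \<in> monomials S" by (auto simp: monomials_def)
    have "?c (basis_elem K (Brk u v)) = bracket (free_awb K S) (?c (basis_elem K u)) (?c (basis_elem K v))"
      unfolding s'(5)[OF bm[OF uv(1)] bm[OF uv(2)]] free_space_basis_mult(2)[OF K] ..
    then show ?case using Brk.IH uv hm(3)[OF h cc[OF bm] cc[OF bm]] hm(3)[OF h' cc[OF bm] cc[OF bm]]
      by simp
  qed
  have "h (?c f) = h' (?c f)" if "f \<in> carrier ?F" for f
    using K that
  proof (induction rule: free_space_induct)
    case zero
    have zP: "\<zero>\<^bsub>?F\<^esub> = \<zero>\<^bsub>?P\<^esub>" by simp
    have z: "?c \<zero>\<^bsub>?F\<^esub> = \<zero> \<odot>\<^bsub>free_awb K S\<^esub> ?c \<zero>\<^bsub>?F\<^esub>" "?c \<zero>\<^bsub>?F\<^esub> \<in> carrier (free_awb K S)"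
      unfolding zP by (simp_all only: s'(3)[OF K0 P.zero_closed] P.smult_l_null[OF P.zero_closed] cc P.zero_closed)
    have j: "j (?c \<zero>\<^bsub>?F\<^esub>) = \<zero>\<^bsub>B\<^esub>" if j: "j \<in> awb_hom K (free_awb K S) B" for j
    proof -
      have "j (?c \<zero>\<^bsub>?F\<^esub>) = \<zero> \<odot>\<^bsub>B\<^esub> j (?c \<zero>\<^bsub>?F\<^esub>)"
        using hm(4)[OF j z(2) z(2) K0] z(1) by metis
      also have "\<dots> = \<zero>\<^bsub>B\<^esub>" using j z(2) by (intro B.smult_l_null) (auto simp: awb_hom_def lin_hom_def)
      finally show ?thesis .
    qed
    show ?case using j[OF h] j[OF h'] by metis
  next
    case (step k m f)
    have f: "f \<in> carrier ?P" using step by simp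
    have km: "k \<odot>\<^bsub>?P\<^esub> basis_elem K m \<in> carrier ?P" using step bm by (intro P.smult_closed)
    have "?c (k \<odot>\<^bsub>?F\<^esub> basis_elem K m \<oplus>\<^bsub>?F\<^esub> f) = ?c (k \<odot>\<^bsub>?P\<^esub> basis_elem K m \<oplus>\<^bsub>?P\<^esub> f)" by simp
    also have "\<dots> = (k \<odot>\<^bsub>free_awb K S\<^esub> ?c (basis_elem K m)) \<oplus>\<^bsub>free_awb K S\<^esub> ?c f"
      unfolding s'(2)[OF km f, symmetric] s'(3)[OF step(1) bm[OF step(2)]] ..
    finally have c: "?c (k \<odot>\<^bsub>?F\<^esub> basis_elem K m \<oplus>\<^bsub>?F\<^esub> f) = \<dots>" .
    have jc: "j (?c (k \<odot>\<^bsub>?F\<^esub> basis_elem K m \<oplus>\<^bsub>?F\<^esub> f)) = (k \<odot>\<^bsub>B\<^esub> j (?c (basis_elem K m))) \<oplus>\<^bsub>B\<^esub> j (?c f)"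
      if "j \<in> awb_hom K (free_awb K S) B" for j
      unfolding c using hm(1)[OF that Q.smult_closed[OF step(1) cc[OF bm[OF step(2)]]] cc[OF f]]
        hm(4)[OF that cc[OF bm[OF step(2)]] cc[OF f] step(1)] by simp
    show ?case unfolding jc[OF h] jc[OF h'] mono[OF step(2)] step(4) ..
  qed
  then show "\<forall>x\<in>carrier (free_awb K S). h x = h' x"
    by (auto simp: s')
qed

subsection \<open>The boundary on generators\<close>

definition multilinear ::
  "('k, 'r) ring_scheme \<Rightarrow> ('k, 'v, 'm) module_scheme \<Rightarrow> nat \<Rightarrow> ('k, 'w, 'n) module_scheme \<Rightarrow>
   ('v list \<Rightarrow> 'w) \<Rightarrow> bool"
  where "multilinear K V n W g \<longleftrightarrow>
    g \<in> tuples V n \<rightarrow> carrier W \<and>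
    (\<forall>xs\<in>tuples V n. \<forall>i<n. \<forall>a\<in>carrier V. \<forall>b\<in>carrier V.
      g (xs[i := a \<oplus>\<^bsub>V\<^esub> b]) = g (xs[i := a]) \<oplus>\<^bsub>W\<^esub> g (xs[i := b])) \<and>
    (\<forall>xs\<in>tuples V n. \<forall>i<n. \<forall>k\<in>carrier K. \<forall>a\<in>carrier V.
      g (xs[i := k \<odot>\<^bsub>V\<^esub> a]) = k \<odot>\<^bsub>W\<^esub> g (xs[i := a]))"

lemma multilinear_lift:
  assumes "field K" "module K V" "module K W" "multilinear K V n W g"
  shows "tensor_lift K W g \<in> lin_hom K (tensor_power K V n) W"
    and "xs \<in> tuples V n \<Longrightarrow> tensor_lift K W g (pure_tensor K V xs) = g xs"
  using assms tensor_lift[of K V W g n] by (simp_all add: multilinear_def)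

lemma multilinear_sum:
  assumes V: "module K V" and W: "module K W" and D: "finite D"
    and g: "\<And>d. d \<in> D \<Longrightarrow> multilinear K V n W (g d)"
  shows "multilinear K V n W (\<lambda>xs. \<Oplus>\<^bsub>W\<^esub>d\<in>D. g d xs)"
proof -
  interpret V: module K V by fact
  interpret W: module K W by fact
  have c: "g d xs \<in> carrier W" if "xs \<in> tuples V n" "d \<in> D" for d xs
    using g[OF that(2)] that by (auto simp: multilinear_def)
  have add: "g d (xs[i := a \<oplus>\<^bsub>V\<^esub> b]) = g d (xs[i := a]) \<oplus>\<^bsub>W\<^esub> g d (xs[i := b])"
    if "xs \<in> tuples V n" "d \<in> D" "i < n" "a \<in> carrier V" "b \<in> carrier V" for d xs i a b
    using g[OF that(2)] that by (simp add: multilinear_def)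
  have sm: "g d (xs[i := k \<odot>\<^bsub>V\<^esub> a]) = k \<odot>\<^bsub>W\<^esub> g d (xs[i := a])"
    if "xs \<in> tuples V n" "d \<in> D" "i < n" "a \<in> carrier V" "k \<in> carrier K" for d xs i a k
    using g[OF that(2)] that by (simp add: multilinear_def)
  show ?thesis unfolding multilinear_def
  proof (intro conjI ballI allI impI)
    show "(\<lambda>xs. \<Oplus>\<^bsub>W\<^esub>d\<in>D. g d xs) \<in> tuples V n \<rightarrow> carrier W"
      using c by (intro funcsetI W.finsum_closed) auto
    fix xs i a assume xs: "xs \<in> tuples V n" "i < n" "a \<in> carrier V"
    note u = tuples_update[OF xs(1)]
    show "(\<Oplus>\<^bsub>W\<^esub>d\<in>D. g d (xs[i := a \<oplus>\<^bsub>V\<^esub> b])) =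
        (\<Oplus>\<^bsub>W\<^esub>d\<in>D. g d (xs[i := a])) \<oplus>\<^bsub>W\<^esub> (\<Oplus>\<^bsub>W\<^esub>d\<in>D. g d (xs[i := b]))" if "b \<in> carrier V" for b
    proof -
      have "(\<Oplus>\<^bsub>W\<^esub>d\<in>D. g d (xs[i := a \<oplus>\<^bsub>V\<^esub> b])) = (\<Oplus>\<^bsub>W\<^esub>d\<in>D. g d (xs[i := a]) \<oplus>\<^bsub>W\<^esub> g d (xs[i := b]))"
        using xs that c u by (intro W.finsum_cong') (auto simp: add)
      also have "\<dots> = (\<Oplus>\<^bsub>W\<^esub>d\<in>D. g d (xs[i := a])) \<oplus>\<^bsub>W\<^esub> (\<Oplus>\<^bsub>W\<^esub>d\<in>D. g d (xs[i := b]))"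
        using xs that c u by (intro W.finsum_addf) auto
      finally show ?thesis .
    qed
  next
    fix xs i k a assume xs: "xs \<in> tuples V n" "i < n" and ka: "k \<in> carrier K" "a \<in> carrier V"
    note u = tuples_update[OF xs(1)]
    have "(\<Oplus>\<^bsub>W\<^esub>d\<in>D. g d (xs[i := k \<odot>\<^bsub>V\<^esub> a])) = (\<Oplus>\<^bsub>W\<^esub>d\<in>D. k \<odot>\<^bsub>W\<^esub> g d (xs[i := a]))"
      using xs ka c u by (intro W.finsum_cong') (auto simp: sm)
    also have "\<dots> = k \<odot>\<^bsub>W\<^esub> (\<Oplus>\<^bsub>W\<^esub>d\<in>D. g d (xs[i := a]))"
      using xs ka c u D by (intro W.finsum_smult_ldistr[symmetric]) auto
    finally show "(\<Oplus>\<^bsub>W\<^esub>d\<in>D. g d (xs[i := k \<odot>\<^bsub>V\<^esub> a])) = k \<odot>\<^bsub>W\<^esub> (\<Oplus>\<^bsub>W\<^esub>d\<in>D. g d (xs[i := a]))" .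
  qed
qed

lemma multilinear_scale:
  assumes V: "module K V" and W: "module K W" and c: "c \<in> carrier K"
    and g: "multilinear K V n W g"
  shows "multilinear K V n W (\<lambda>xs. c \<odot>\<^bsub>W\<^esub> g xs)"
proof -
  interpret V: module K V by fact
  interpret W: module K W by fact
  have gc: "g xs \<in> carrier W" if "xs \<in> tuples V n" for xs
    using g that by (auto simp: multilinear_def)
  show ?thesis
    using g c tuples_update[of _ V n] gc unfolding multilinear_def
    by (simp add: W.smult_r_distr Pi_iff W.smult_assoc1[symmetric] V.m_comm)
qed

lemma multilinear_add:
  assumes V: "module K V" and W: "module K W"
    and g: "multilinear K V n W g" and h: "multilinear K V n W h"
  shows "multilinear K V n W (\<lambda>xs. g xs \<oplus>\<^bsub>W\<^esub> h xs)"
proof -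
  interpret V: module K V by fact
  interpret W: module K W by fact
  have gc: "g xs \<in> carrier W" "h xs \<in> carrier W" if "xs \<in> tuples V n" for xs
    using g h that by (auto simp: multilinear_def)
  show ?thesis
    using g h tuples_update[of _ V n] gc unfolding multilinear_def
    by (simp add: W.smult_r_distr Pi_iff W.a_ac)
qed

lemma dsum_simps [simp]:
  "carrier (dsum V W) = carrier V \<times> carrier W"
  "\<zero>\<^bsub>dsum V W\<^esub> = (\<zero>\<^bsub>V\<^esub>, \<zero>\<^bsub>W\<^esub>)"
  "(x, y) \<oplus>\<^bsub>dsum V W\<^esub> (x', y') = (x \<oplus>\<^bsub>V\<^esub> x', y \<oplus>\<^bsub>W\<^esub> y')"
  "k \<odot>\<^bsub>dsum V W\<^esub> (x, y) = (k \<odot>\<^bsub>V\<^esub> x, k \<odot>\<^bsub>W\<^esub> y)"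
  by (simp_all add: dsum_def)

lemma dsum_module:
  assumes "module K V" "module K W"
  shows "module K (dsum V W)"
proof -
  interpret V: module K V by fact
  interpret W: module K W by fact
  have "abelian_group (dsum V W)"
  proof (rule abelian_groupI)
    fix z assume "z \<in> carrier (dsum V W)"
    then obtain x y where z: "z = (x, y)" "x \<in> carrier V" "y \<in> carrier W" by auto
    then have "(\<ominus>\<^bsub>V\<^esub> x, \<ominus>\<^bsub>W\<^esub> y) \<oplus>\<^bsub>dsum V W\<^esub> z = \<zero>\<^bsub>dsum V W\<^esub>" by (simp add: V.l_neg W.l_neg)
    then show "\<exists>w\<in>carrier (dsum V W). w \<oplus>\<^bsub>dsum V W\<^esub> z = \<zero>\<^bsub>dsum V W\<^esub>"
      using z by (intro bexI[of _ "(\<ominus>\<^bsub>V\<^esub> x, \<ominus>\<^bsub>W\<^esub> y)"]) auto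
  qed (auto simp: V.a_ac W.a_ac)
  then show ?thesis
    by (rule moduleI[OF V.is_cring])
      (auto simp: V.smult_l_distr W.smult_l_distr V.smult_r_distr W.smult_r_distr
        V.smult_assoc1 W.smult_assoc1)
qed

lemma awb_chain_simps:
  "\<zero>\<^bsub>awb_chain K A n\<^esub> = (\<zero>\<^bsub>tensor_power K A (n + 1)\<^esub>, \<zero>\<^bsub>tensor_power K A (n + 1)\<^esub>)"
  "(x, y) \<oplus>\<^bsub>awb_chain K A n\<^esub> (x', y') =
    (x \<oplus>\<^bsub>tensor_power K A (n + 1)\<^esub> x', y \<oplus>\<^bsub>tensor_power K A (n + 1)\<^esub> y')"
  "k \<odot>\<^bsub>awb_chain K A n\<^esub> (x, y) =
    (k \<odot>\<^bsub>tensor_power K A (n + 1)\<^esub> x, k \<odot>\<^bsub>tensor_power K A (n + 1)\<^esub> y)"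
  "(x, y) \<in> carrier (awb_chain K A n) \<longleftrightarrow>
    x \<in> carrier (tensor_power K A (n + 1)) \<and> y \<in> carrier (tensor_power K A (n + 1)) \<and>
    (n = 0 \<longrightarrow> y = \<zero>\<^bsub>tensor_power K A (n + 1)\<^esub>)" if "module K (tensor_power K A (n + 1))"
proof -
  interpret T: module K "tensor_power K A (n + 1)" by fact
  show "(x, y) \<in> carrier (awb_chain K A n) \<longleftrightarrow>
    x \<in> carrier (tensor_power K A (n + 1)) \<and> y \<in> carrier (tensor_power K A (n + 1)) \<and>
    (n = 0 \<longrightarrow> y = \<zero>\<^bsub>tensor_power K A (n + 1)\<^esub>)"
    using T.zero_closed by (auto simp: awb_chain_def Let_def simp del: T.zero_closed)
qed (simp_all add: awb_chain_def Let_def dsum_def)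

lemma awb_chain_module:
  assumes K: "field K" and A: "module K A"
  shows "module K (awb_chain K A n)"
proof -
  define T where "T = tensor_power K A (n + 1)"
  interpret T: module K T unfolding T_def by (rule tensor_power_module[OF K A])
  interpret D: module K "dsum T T" by (intro dsum_module T.module_axioms)
  have "submodule (carrier T \<times> {\<zero>\<^bsub>T\<^esub>}) K (dsum T T)"
  proof (intro D.submoduleI)
    fix z assume "z \<in> carrier T \<times> {\<zero>\<^bsub>T\<^esub>}"
    then obtain x where z: "z = (x, \<zero>\<^bsub>T\<^esub>)" "x \<in> carrier T" by auto
    have "\<ominus>\<^bsub>dsum T T\<^esub> z = (\<ominus>\<^bsub>T\<^esub> x, \<zero>\<^bsub>T\<^esub>)"
      using z by (intro D.minus_equality) (auto simp: T.l_neg)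
    then show "\<ominus>\<^bsub>dsum T T\<^esub> z \<in> carrier T \<times> {\<zero>\<^bsub>T\<^esub>}" using z by auto
  qed auto
  then show ?thesis
    using submodule.submodule_is_module[OF _ D.module_axioms] D.module_axioms
    unfolding awb_chain_def Let_def T_def[symmetric] by simp
qed

lemma tuples_length: "xs \<in> tuples V n \<Longrightarrow> length xs = n"
  by (simp add: tuples_def)

lemma multilinear_tens:
  assumes K: "field K" and A: "module K A"
  shows "multilinear K A (n + 1) (awb_chain K A n) (tens K A)"
proof -
  interpret T: module K "tensor_power K A (n + 1)" by (rule tensor_power_module[OF K A])
  note pc = pure_tensor_carrier[OF K]
  show ?thesis
    unfolding multilinear_def tens_def
    using pure_tensor_add[OF K A] pure_tensor_smult[OF K A] pc
    by (auto simp: awb_chain_simps[OF T.module_axioms] tuples_length Pi_iff simp del: One_nat_def)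
qed

lemma multilinear_circ:
  assumes K: "field K" and A: "module K A" and n: "n \<noteq> 0"
  shows "multilinear K A (n + 1) (awb_chain K A n) (circ K A)"
proof -
  interpret T: module K "tensor_power K A (n + 1)" by (rule tensor_power_module[OF K A])
  note pc = pure_tensor_carrier[OF K]
  show ?thesis
    unfolding multilinear_def circ_def
    using pure_tensor_add[OF K A] pure_tensor_smult[OF K A] pc n
    by (auto simp: awb_chain_simps[OF T.module_axioms] tuples_length Pi_iff simp del: One_nat_def)
qed

lemma tuples_nth: "\<lbrakk>xs \<in> tuples V n; i < n\<rbrakk> \<Longrightarrow> xs ! i \<in> carrier V"
  by (auto simp: tuples_def)

lemma merge_tuples:
  assumes A: "awb K A" and xs: "xs \<in> tuples A (n + 1)" and i: "i < n"
  shows "merge A i xs \<in> tuples A n"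
proof -
  interpret A: awb K A by fact
  have "xs ! i \<otimes>\<^bsub>A\<^esub> xs ! (i + 1) \<in> carrier A"
    using tuples_nth[OF xs] i by (intro A.mult_closed) auto
  then show ?thesis
    using xs i by (auto simp: tuples_def merge_def dest: in_set_takeD in_set_dropD)
qed

lemma merge_update:
  assumes "i + 1 < length xs" "j < length xs"
  shows "merge A i (xs[j := c]) =
    (if j < i then (merge A i xs)[j := c]
     else if j = i then (merge A i xs)[i := c \<otimes>\<^bsub>A\<^esub> xs ! (i + 1)]
     else if j = i + 1 then (merge A i xs)[i := xs ! i \<otimes>\<^bsub>A\<^esub> c]
     else (merge A i xs)[j - 1 := c])"
  using assms
  by (intro nth_equalityI)
    (auto simp: merge_def nth_append nth_list_update take_update_swap drop_update_swap nth_Cons split: nat.splits)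

lemma multilinear_merge:
  assumes A: "awb K A" and g: "multilinear K A n W g" and i: "i < n"
  shows "multilinear K A (n + 1) W (\<lambda>xs. g (merge A i xs))"
proof -
  interpret A: awb K A by fact
  note m = merge_tuples[OF A _ i]
  have gc: "g ys \<in> carrier W" if "ys \<in> tuples A n" for ys using g that by (auto simp: multilinear_def)
  have ga: "g (ys[j := a \<oplus>\<^bsub>A\<^esub> b]) = g (ys[j := a]) \<oplus>\<^bsub>W\<^esub> g (ys[j := b])"
    if "ys \<in> tuples A n" "j < n" "a \<in> carrier A" "b \<in> carrier A" for ys j a b
    using g that by (simp add: multilinear_def)
  have gs: "g (ys[j := k \<odot>\<^bsub>A\<^esub> a]) = k \<odot>\<^bsub>W\<^esub> g (ys[j := a])"
    if "ys \<in> tuples A n" "j < n" "a \<in> carrier A" "k \<in> carrier K" for ys j a k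
    using g that by (simp add: multilinear_def)
  have u: "merge A i (xs[j := c]) =
    (if j < i then (merge A i xs)[j := c]
     else if j = i then (merge A i xs)[i := c \<otimes>\<^bsub>A\<^esub> xs ! (i + 1)]
     else if j = i + 1 then (merge A i xs)[i := xs ! i \<otimes>\<^bsub>A\<^esub> c]
     else (merge A i xs)[j - 1 := c])" if "xs \<in> tuples A (n + 1)" "j < n + 1" for xs j c
    using merge_update[of i xs j A c] that i by (simp add: tuples_length)
  show ?thesis
    unfolding multilinear_def
  proof (intro conjI ballI allI impI)
    show "(\<lambda>xs. g (merge A i xs)) \<in> tuples A (n + 1) \<rightarrow> carrier W" using m gc by blast
    fix xs j a assume xs: "xs \<in> tuples A (n + 1)" and j: "j < n + 1" and a: "a \<in> carrier A"
    have c: "xs ! i \<in> carrier A" "xs ! (i + 1) \<in> carrier A" using tuples_nth[OF xs] i by auto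
    show "g (merge A i (xs[j := a \<oplus>\<^bsub>A\<^esub> b])) = g (merge A i (xs[j := a])) \<oplus>\<^bsub>W\<^esub> g (merge A i (xs[j := b]))"
      if b: "b \<in> carrier A" for b
      unfolding u[OF xs j]
      using i j a b c m[OF xs] by (auto simp: A.mult_add_left A.mult_add_right A.mult_closed ga)
  next
    fix xs j k a assume xs: "xs \<in> tuples A (n + 1)" and j: "j < n + 1" and a: "k \<in> carrier K" "a \<in> carrier A"
    have c: "xs ! i \<in> carrier A" "xs ! (i + 1) \<in> carrier A" using tuples_nth[OF xs] i by auto
    show "g (merge A i (xs[j := k \<odot>\<^bsub>A\<^esub> a])) = k \<odot>\<^bsub>W\<^esub> g (merge A i (xs[j := a]))"
      unfolding u[OF xs j]
      using i j a c m[OF xs] by (auto simp: A.mult_smult_left A.mult_smult_right A.mult_closed gs)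
  qed
qed

lemma act_tuples:
  assumes A: "awb K A" and xs: "xs \<in> tuples A (n + 1)" and i: "i < n"
  shows "act A i xs \<in> tuples A n"
proof -
  interpret A: awb K A by fact
  have "last xs = xs ! n" using xs by (subst last_conv_nth) (auto simp: tuples_def)
  then have "bracket A (xs ! i) (last xs) \<in> carrier A"
    using tuples_nth[OF xs] i by (simp add: A.bracket_closed)
  moreover have "butlast xs \<in> tuples A n" using xs by (auto simp: tuples_def dest: in_set_butlastD)
  ultimately show ?thesis unfolding act_def by (intro tuples_update)
qed

lemma act_update:
  assumes "i < n" "j < n + 1" "length xs = n + 1"
  shows "act A i (xs[j := c]) =
    (if j = n then (act A i xs)[i := bracket A (xs ! i) c]
     else if j = i then (act A i xs)[i := bracket A c (last xs)]
     else (act A i xs)[j := c])"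
proof -
  have l: "last xs = xs ! n" using assms by (subst last_conv_nth) auto
  have l': "last (xs[j := c]) = xs[j := c] ! n" using assms by (subst last_conv_nth) auto
  show ?thesis
    using assms unfolding act_def l l'
    by (intro nth_equalityI) (auto simp: nth_list_update nth_butlast)
qed

lemma multilinear_act:
  assumes A: "awb K A" and g: "multilinear K A n W g" and i: "i < n"
  shows "multilinear K A (n + 1) W (\<lambda>xs. g (act A i xs))"
proof -
  interpret A: awb K A by fact
  note m = act_tuples[OF A _ i]
  have gc: "g ys \<in> carrier W" if "ys \<in> tuples A n" for ys using g that by (auto simp: multilinear_def)
  have ga: "g (ys[j := a \<oplus>\<^bsub>A\<^esub> b]) = g (ys[j := a]) \<oplus>\<^bsub>W\<^esub> g (ys[j := b])"
    if "ys \<in> tuples A n" "j < n" "a \<in> carrier A" "b \<in> carrier A" for ys j a b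
    using g that by (simp add: multilinear_def)
  have gs: "g (ys[j := k \<odot>\<^bsub>A\<^esub> a]) = k \<odot>\<^bsub>W\<^esub> g (ys[j := a])"
    if "ys \<in> tuples A n" "j < n" "a \<in> carrier A" "k \<in> carrier K" for ys j a k
    using g that by (simp add: multilinear_def)
  have l: "last xs \<in> carrier A" if "xs \<in> tuples A (n + 1)" for xs
    using tuples_nth[OF that, of n] that by (subst last_conv_nth) (auto simp: tuples_def)
  show ?thesis
    unfolding multilinear_def
  proof (intro conjI ballI allI impI)
    show "(\<lambda>xs. g (act A i xs)) \<in> tuples A (n + 1) \<rightarrow> carrier W" using m gc by blast
    fix xs j a assume xs: "xs \<in> tuples A (n + 1)" and j: "j < n + 1" and a: "a \<in> carrier A"
    note c = l[OF xs] tuples_nth[OF xs, of i]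
    show "g (act A i (xs[j := a \<oplus>\<^bsub>A\<^esub> b])) = g (act A i (xs[j := a])) \<oplus>\<^bsub>W\<^esub> g (act A i (xs[j := b]))"
      if b: "b \<in> carrier A" for b
      unfolding act_update[OF i j tuples_length[OF xs]]
      using i j a b c m[OF xs] by (auto simp: A.bracket_add_left A.bracket_add_right A.bracket_closed ga)
  next
    fix xs j k a assume xs: "xs \<in> tuples A (n + 1)" and j: "j < n + 1" and a: "k \<in> carrier K" "a \<in> carrier A"
    note c = l[OF xs] tuples_nth[OF xs, of i]
    show "g (act A i (xs[j := k \<odot>\<^bsub>A\<^esub> a])) = k \<odot>\<^bsub>W\<^esub> g (act A i (xs[j := a]))"
      unfolding act_update[OF i j tuples_length[OF xs]]
      using i j a c m[OF xs] by (auto simp: A.bracket_smult_left A.bracket_smult_right A.bracket_closed gs)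
  qed
qed

lemma sgn_pow_carrier:
  assumes "field K" shows "sgn_pow K i \<in> carrier K"
proof -
  interpret field K by fact
  show ?thesis by (simp add: sgn_pow_def)
qed

lemma multilinear_boundary:
  assumes A: "awb K A" and n: "n \<noteq> 0"
  shows "multilinear K A (n + 1) (awb_chain K A (n - 1)) (boundary_tens K A n)"
    and "multilinear K A (n + 1) (awb_chain K A (n - 1)) (boundary_circ K A n)"
proof -
  interpret A: awb K A by fact
  note K = A.field_axioms
  note M = A.module_axioms
  note C = awb_chain_module[OF K M, of "n - 1"]
  have t: "multilinear K A n (awb_chain K A (n - 1)) (tens K A)"
    using multilinear_tens[OF K M, of "n - 1"] n by simp
  have c: "multilinear K A n (awb_chain K A (n - 1)) (circ K A)" if "n - 1 \<noteq> 0"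
    using multilinear_circ[OF K M, of "n - 1"] that by simp
  show "multilinear K A (n + 1) (awb_chain K A (n - 1)) (boundary_tens K A n)"
    unfolding boundary_tens_def Let_def
    by (intro multilinear_sum[OF M C] multilinear_scale[OF M C] sgn_pow_carrier[OF K]
        multilinear_merge[OF A t]) auto
  show "multilinear K A (n + 1) (awb_chain K A (n - 1)) (boundary_circ K A n)"
    unfolding boundary_circ_def Let_def
    by (intro multilinear_add[OF M C] multilinear_sum[OF M C] multilinear_scale[OF M C]
        sgn_pow_carrier[OF K] multilinear_act[OF A t] multilinear_merge[OF A c]) auto
qed

lemma awb_boundary_generators:
  assumes A: "awb K A" and n: "n \<noteq> 0" and xs: "xs \<in> tuples A (n + 1)"
  shows "awb_boundary K A n (tens K A xs) = boundary_tens K A n xs"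
    and "awb_boundary K A n (circ K A xs) = boundary_circ K A n xs"
proof -
  interpret A: awb K A by fact
  note K = A.field_axioms
  note M = A.module_axioms
  note C = awb_chain_module[OF K M, of "n - 1"]
  interpret C: module K "awb_chain K A (n - 1)" by (rule C)
  interpret T: module K "tensor_power K A (n + 1)" by (rule tensor_power_module[OF K M])
  note b = multilinear_boundary[OF A n]
  have z: "tensor_lift K (awb_chain K A (n - 1)) g \<zero>\<^bsub>tensor_power K A (n + 1)\<^esub> = \<zero>\<^bsub>awb_chain K A (n - 1)\<^esub>"
    if g: "multilinear K A (n + 1) (awb_chain K A (n - 1)) g" for g
  proof -
    let ?h = "tensor_lift K (awb_chain K A (n - 1)) g" and ?z = "\<zero>\<^bsub>tensor_power K A (n + 1)\<^esub>"
    have "?h \<in> lin_hom K (tensor_power K A (n + 1)) (awb_chain K A (n - 1))"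
      by (rule multilinear_lift[OF K M C g])
    then have "?h (?z \<oplus>\<^bsub>tensor_power K A (n + 1)\<^esub> ?z) = ?h ?z \<oplus>\<^bsub>awb_chain K A (n - 1)\<^esub> ?h ?z"
      "?h ?z \<in> carrier (awb_chain K A (n - 1))"
      unfolding lin_hom_def using T.zero_closed by blast+
    then show ?thesis by (metis C.add.r_cancel_one' T.l_zero T.zero_closed)
  qed
  have c: "boundary_tens K A n xs \<in> carrier (awb_chain K A (n - 1))"
    "boundary_circ K A n xs \<in> carrier (awb_chain K A (n - 1))"
    using b xs by (auto simp: multilinear_def)
  show "awb_boundary K A n (tens K A xs) = boundary_tens K A n xs"
    "awb_boundary K A n (circ K A xs) = boundary_circ K A n xs"
    using n xs z[OF b(1)] z[OF b(2)] multilinear_lift(2)[OF K M C b(1) xs]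
      multilinear_lift(2)[OF K M C b(2) xs] C.r_zero[OF c(1)] C.l_zero[OF c(2)]
    by (simp_all add: awb_boundary_def tens_def circ_def tuples_length Let_def)
qed

lemma tensor_power_1:
  assumes K: "field K" and V: "module K V"
  shows "(\<lambda>x. pure_tensor K V [x]) \<in> lin_hom K V (tensor_power K V 1)"
    and "bij_betw (\<lambda>x. pure_tensor K V [x]) (carrier V) (carrier (tensor_power K V 1))"
proof -
  let ?T = "tensor_power K V 1"
  interpret V: module K V by fact
  interpret T: module K ?T by (rule tensor_power_module[OF K V])
  let ?F = "free_space K (tuples V 1)" and ?N = "multilinear_span K V 1"
  interpret F: module K ?F by (rule free_space_module[OF K])
  have t: "[x] \<in> tuples V 1" if "x \<in> carrier V" for x using that by (simp add: tuples_def)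
  have add: "pure_tensor K V [x \<oplus>\<^bsub>V\<^esub> y] = pure_tensor K V [x] \<oplus>\<^bsub>?T\<^esub> pure_tensor K V [y]"
    if "x \<in> carrier V" "y \<in> carrier V" for x y
    using pure_tensor_add[OF K V t[OF that(1)], of 0 x y] that by simp
  have sm: "pure_tensor K V [k \<odot>\<^bsub>V\<^esub> x] = k \<odot>\<^bsub>?T\<^esub> pure_tensor K V [x]"
    if "k \<in> carrier K" "x \<in> carrier V" for k x
    using pure_tensor_smult[OF K V t[OF that(2)], of 0 k x] that by simp
  show hom: "(\<lambda>x. pure_tensor K V [x]) \<in> lin_hom K V ?T"
    using pure_tensor_carrier[OF K t] by (auto simp: lin_hom_def add sm)
  have "multilinear K V 1 V hd"
    by (auto simp: multilinear_def tuples_def length_Suc_conv)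
  note l = multilinear_lift(2)[OF K V V this]
  have "inj_on (\<lambda>x. pure_tensor K V [x]) (carrier V)"
    using l[OF t] by (metis (no_types, lifting) inj_onI list.sel(1))
  moreover have "?N +>\<^bsub>?F\<^esub> f \<in> (\<lambda>x. pure_tensor K V [x]) ` carrier V" if "f \<in> carrier ?F" for f
    using K that
  proof (induction rule: free_space_induct)
    case zero
    have "pure_tensor K V [\<zero>\<^bsub>V\<^esub>] = \<zero>\<^bsub>?T\<^esub>"
      using add[OF V.zero_closed V.zero_closed] pure_tensor_carrier[OF K t[OF V.zero_closed]]
      by (metis T.add.r_cancel_one' V.l_zero V.zero_closed)
    also have "\<dots> = ?N" by (simp add: tensor_power_def quot_space_def)
    also have "\<dots> = ?N +>\<^bsub>?F\<^esub> \<zero>\<^bsub>?F\<^esub>"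
      using multilinear_span_submodule[OF K V, of 1] F.submoduleE(1)
      by (metis F.a_coset_add_zero)
    finally show ?case by blast
  next
    case (step k xs f)
    then obtain x where x: "xs = [x]" "x \<in> carrier V" by (auto simp: tuples_def length_Suc_conv)
    obtain y where y: "y \<in> carrier V" "?N +>\<^bsub>?F\<^esub> f = pure_tensor K V [y]" using step by auto
    note N = multilinear_span_submodule[OF K V, of 1]
    interpret N: abelian_subgroup ?N ?F by (rule submodule_abelian_subgroup[OF F.module_axioms N])
    note b = basis_elem_carrier[OF K t[OF x(2)]]
    have kb: "k \<odot>\<^bsub>?F\<^esub> basis_elem K [x] \<in> carrier ?F" by (intro F.smult_closed step(1) b)
    have "?N +>\<^bsub>?F\<^esub> ((k \<odot>\<^bsub>?F\<^esub> basis_elem K xs) \<oplus>\<^bsub>?F\<^esub> f) =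
      (?N +>\<^bsub>?F\<^esub> (k \<odot>\<^bsub>?F\<^esub> basis_elem K [x])) <+>\<^bsub>?F\<^esub> (?N +>\<^bsub>?F\<^esub> f)"
      unfolding x(1) using N.a_rcos_sum[OF kb step(3)] by simp
    also have "?N +>\<^bsub>?F\<^esub> (k \<odot>\<^bsub>?F\<^esub> basis_elem K [x]) = k \<odot>\<^bsub>?T\<^esub> pure_tensor K V [x]"
      using coset_smult[OF F.module_axioms N step(1) b]
      by (simp add: tensor_power_def quot_space_def pure_tensor_def)
    also have "\<dots> <+>\<^bsub>?F\<^esub> (?N +>\<^bsub>?F\<^esub> f) = pure_tensor K V [k \<odot>\<^bsub>V\<^esub> x \<oplus>\<^bsub>V\<^esub> y]"
      using step(1) x y add[of "k \<odot>\<^bsub>V\<^esub> x" y] sm[of k x]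
      by (simp add: tensor_power_def quot_space_def)
    finally show ?case using step(1) x y by auto
  qed
  ultimately show "bij_betw (\<lambda>x. pure_tensor K V [x]) (carrier V) (carrier ?T)"
    using hom by (auto simp: bij_betw_def lin_hom_def tensor_power_def quot_space_carrier)
qed

declare free_space_simps [simp del] free_bimagma_simps [simp del] dsum_simps [simp del]

end

theory Submission
  imports Defs
begin

text \<open>
  Both homologies are computed by one double complex.  Applying the complex \<open>C\<^sub>*\<close> of homology with
  trivial coefficients to every level of a free simplicial resolution \<open>F\<close> of \<open>A\<close> gives the double
  complex \<open>C\<^sub>p(F\<^sub>q)\<close>.  Its columns resolve \<open>C\<^sub>p(A)\<close> and its rows resolve \<open>F\<^sub>q\<^sup>a\<^sup>b\<close>, and two complexes
  resolved by the columns and the rows of the same double complex have isomorphic homology: zigzags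
  through the double complex match their cycles
  (\<open>lin_iso_homology_of_double_complex\<close>).

  \<^bold>\<open>Columns.\<close>  \<open>C\<^sub>p\<close> depends on the underlying vector space only, through its tensor powers.  Over a
  field, the acyclic augmented simplicial vector space \<open>F \<rightarrow> A\<close> has a linear extra degeneracy \<open>h\<close>,
  with \<open>d\<^sub>0 h = id\<close> and \<open>d\<^sub>i\<^sub>+\<^sub>1 h = h d\<^sub>i\<close> (\<open>extra_degeneracy\<close>): in each degree the values of \<open>h\<close>
  are fillers of compatible families of faces, and such fillers can be chosen linearly
  (\<open>linear_choice\<close>).  These identities do not involve sums of faces, so that they survive the tensor
  powers, and \<open>C\<^sub>p(h)\<close> contracts the column (\<open>columns_exact\<close>).

  \<^bold>\<open>Rows.\<close>  As an associative algebra, the free algebra with bracket on \<open>S\<close> is the tensor algebra on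
  the space \<open>W\<close> spanned by the letters \<open>s \<in> S\<close> and \<open>[w, x]\<close>, where \<open>w\<close> is a letter and \<open>x\<close> a word; in
  other words, \<open>W\<close> is the sum of the span of \<open>S\<close> and of \<open>W \<otimes> F\<close>.  The complex \<open>C\<^sub>*(F)\<close> is the cone of a
  map \<open>B \<otimes> F \<rightarrow> B\<close>, where \<open>B\<close> is the bar complex of \<open>F\<close>.  The homology of \<open>B\<close> is \<open>W\<close>, so that only the
  cokernel of the injection \<open>W \<otimes> F \<rightarrow> W\<close>, \<open>w \<otimes> x \<mapsto> [w, x]\<close>, is left, which is \<open>F\<^sup>a\<^sup>b\<close>.  The
  formal argument avoids bases: three linear maps, which express that a word splits uniquely into its
  first letter and the rest and that a letter \<open>[w, x]\<close> determines \<open>w \<otimes> x\<close>, are obtained together as a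
  section of one extension of \<open>F\<close> by the projectivity of free algebras (\<open>free_awb_split\<close>), and they
  give an explicit contraction of the rows (\<open>rows_exact\<close>, \<open>rows_exact_0\<close>).
\<close>


section \<open>Linear maps, linear choice, and isomorphisms of quotients\<close>

lemma (in abelian_group) minus_zero_iff:
  assumes "x \<in> carrier G" "y \<in> carrier G"
  shows "x \<ominus> y = \<zero> \<longleftrightarrow> x = y"
  using assms by (metis a_minus_def add.inv_closed add.inv_solve_right l_zero r_neg zero_closed)

lemma lin_homI:
  assumes "\<And>x. x \<in> carrier V \<Longrightarrow> h x \<in> carrier W"
    and "\<And>x y. \<lbrakk>x \<in> carrier V; y \<in> carrier V\<rbrakk> \<Longrightarrow> h (x \<oplus>\<^bsub>V\<^esub> y) = h x \<oplus>\<^bsub>W\<^esub> h y"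
    and "\<And>k x. \<lbrakk>k \<in> carrier K; x \<in> carrier V\<rbrakk> \<Longrightarrow> h (k \<odot>\<^bsub>V\<^esub> x) = k \<odot>\<^bsub>W\<^esub> h x"
  shows "h \<in> lin_hom K V W"
  using assms by (simp add: lin_hom_def)

lemma
  assumes "h \<in> lin_hom K V W"
  shows lin_hom_closed: "x \<in> carrier V \<Longrightarrow> h x \<in> carrier W"
    and lin_hom_add: "\<lbrakk>x \<in> carrier V; y \<in> carrier V\<rbrakk> \<Longrightarrow> h (x \<oplus>\<^bsub>V\<^esub> y) = h x \<oplus>\<^bsub>W\<^esub> h y"
    and lin_hom_smult: "\<lbrakk>k \<in> carrier K; x \<in> carrier V\<rbrakk> \<Longrightarrow> h (k \<odot>\<^bsub>V\<^esub> x) = k \<odot>\<^bsub>W\<^esub> h x"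
  using assms by (auto simp: lin_hom_def)

locale linear_map = V: module K V + W: module K W
  for K (structure) and V (structure) and W (structure) +
  fixes h
  assumes lin: "h \<in> lin_hom K V W"
begin

lemma closed [simp, intro]: "x \<in> carrier V \<Longrightarrow> h x \<in> carrier W"
  by (rule lin_hom_closed[OF lin])

lemma add [simp]: "\<lbrakk>x \<in> carrier V; y \<in> carrier V\<rbrakk> \<Longrightarrow> h (x \<oplus>\<^bsub>V\<^esub> y) = h x \<oplus>\<^bsub>W\<^esub> h y"
  by (rule lin_hom_add[OF lin])

lemma smult [simp]: "\<lbrakk>k \<in> carrier K; x \<in> carrier V\<rbrakk> \<Longrightarrow> h (k \<odot>\<^bsub>V\<^esub> x) = k \<odot>\<^bsub>W\<^esub> h x"
  by (rule lin_hom_smult[OF lin])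

lemma zero [simp]: "h \<zero>\<^bsub>V\<^esub> = \<zero>\<^bsub>W\<^esub>"
proof -
  have "h \<zero>\<^bsub>V\<^esub> \<oplus>\<^bsub>W\<^esub> h \<zero>\<^bsub>V\<^esub> = h \<zero>\<^bsub>V\<^esub>" using add[of "\<zero>\<^bsub>V\<^esub>" "\<zero>\<^bsub>V\<^esub>"] by simp
  then show ?thesis using W.add.r_cancel_one' closed by (metis V.zero_closed)
qed

lemma neg [simp]:
  assumes x: "x \<in> carrier V" shows "h (\<ominus>\<^bsub>V\<^esub> x) = \<ominus>\<^bsub>W\<^esub> h x"
proof -
  have "h (\<ominus>\<^bsub>V\<^esub> x) \<oplus>\<^bsub>W\<^esub> h x = \<zero>\<^bsub>W\<^esub>" using add[of "\<ominus>\<^bsub>V\<^esub> x" x] x by (simp add: V.l_neg)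
  then show ?thesis using x W.minus_equality by (metis V.a_inv_closed closed)
qed

lemma minus [simp]: "\<lbrakk>x \<in> carrier V; y \<in> carrier V\<rbrakk> \<Longrightarrow> h (x \<ominus>\<^bsub>V\<^esub> y) = h x \<ominus>\<^bsub>W\<^esub> h y"
  by (simp add: a_minus_def)

lemma finsum:
  assumes "finite I" "\<And>i. i \<in> I \<Longrightarrow> f i \<in> carrier V"
  shows "h (\<Oplus>\<^bsub>V\<^esub>i\<in>I. f i) = (\<Oplus>\<^bsub>W\<^esub>i\<in>I. h (f i))"
  using assms by (induction I rule: finite_induct) (auto simp: Pi_iff)

end

lemma linear_mapI:
  "\<lbrakk>module K V; module K W; h \<in> lin_hom K V W\<rbrakk> \<Longrightarrow> linear_map K V W h"
  by (simp add: linear_map_def linear_map_axioms_def)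

lemma lin_hom_compose:
  "\<lbrakk>f \<in> lin_hom K U V; g \<in> lin_hom K V W\<rbrakk> \<Longrightarrow> (\<lambda>x. g (f x)) \<in> lin_hom K U W"
  by (simp add: lin_hom_def Pi_iff)

text \<open>
  A total linear relation contains a linear map: a maximal single-valued linear subrelation is total,
  since over a point outside of its domain it could be prolonged to the line through that point.
\<close>

lemma linear_choice:
  fixes K (structure) and V :: "('k, 'v, 'm) module_scheme" and W :: "('k, 'w, 'n) module_scheme"
  assumes K: "field K" and V: "module K V" and W: "module K W"
    and add: "\<And>x y x' y'. \<lbrakk>x \<in> carrier V; x' \<in> carrier V; y \<in> carrier W; y' \<in> carrier W; R x y; R x' y'\<rbrakk> \<Longrightarrow>
      R (x \<oplus>\<^bsub>V\<^esub> x') (y \<oplus>\<^bsub>W\<^esub> y')"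
    and smult: "\<And>k x y. \<lbrakk>k \<in> carrier K; x \<in> carrier V; y \<in> carrier W; R x y\<rbrakk> \<Longrightarrow>
      R (k \<odot>\<^bsub>V\<^esub> x) (k \<odot>\<^bsub>W\<^esub> y)"
    and total: "\<And>x. x \<in> carrier V \<Longrightarrow> \<exists>y\<in>carrier W. R x y"
  shows "\<exists>h\<in>lin_hom K V W. \<forall>x\<in>carrier V. R x (h x)"
proof -
  interpret K: field K by fact
  interpret V: module K V by fact
  interpret W: module K W by fact
  \<comment> \<open>For a linear relation, being single-valued at zero is being single-valued.\<close>
  define single where "single G \<longleftrightarrow> (\<forall>y. (\<zero>\<^bsub>V\<^esub>, y) \<in> G \<longrightarrow> y = \<zero>\<^bsub>W\<^esub>)" for G
  define linear where "linear G \<longleftrightarrow> (\<zero>\<^bsub>V\<^esub>, \<zero>\<^bsub>W\<^esub>) \<in> G \<and>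
      (\<forall>x y x' y'. (x, y) \<in> G \<longrightarrow> (x', y') \<in> G \<longrightarrow> (x \<oplus>\<^bsub>V\<^esub> x', y \<oplus>\<^bsub>W\<^esub> y') \<in> G) \<and>
      (\<forall>k x y. k \<in> carrier K \<longrightarrow> (x, y) \<in> G \<longrightarrow> (k \<odot>\<^bsub>V\<^esub> x, k \<odot>\<^bsub>W\<^esub> y) \<in> G)" for G
  define U where "U = {(x, y). x \<in> carrier V \<and> y \<in> carrier W \<and> R x y}"
  define \<G> where "\<G> = {G. G \<subseteq> U \<and> linear G \<and> single G}"
  have "R \<zero>\<^bsub>V\<^esub> \<zero>\<^bsub>W\<^esub>"
    using total[OF V.zero_closed] smult[of \<zero> "\<zero>\<^bsub>V\<^esub>"] by (metis K.zero_closed V.zero_closed V.smult_l_null W.smult_l_null)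
  then have ne: "{(\<zero>\<^bsub>V\<^esub>, \<zero>\<^bsub>W\<^esub>)} \<in> \<G>" by (simp add: \<G>_def single_def linear_def U_def)
  have chain: "\<Union>C \<in> \<G>" if C: "C \<noteq> {}" "subset.chain \<G> C" for C
  proof -
    have m: "G \<subseteq> U" "linear G" "single G" if "G \<in> C" for G
      using that C by (auto simp: subset.chain_def \<G>_def)
    have both: "\<exists>G\<in>C. p \<in> G \<and> q \<in> G" if "p \<in> \<Union>C" "q \<in> \<Union>C" for p q
      using that C(2) unfolding subset_chain_def by blast
    have "linear (\<Union>C)" unfolding linear_def
    proof (intro conjI allI impI)
      show "(\<zero>\<^bsub>V\<^esub>, \<zero>\<^bsub>W\<^esub>) \<in> \<Union>C" using C(1) m(2) unfolding linear_def by blast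
      fix x y x' y' assume "(x, y) \<in> \<Union>C" "(x', y') \<in> \<Union>C"
      then obtain G where "G \<in> C" "(x, y) \<in> G" "(x', y') \<in> G" using both by blast
      then show "(x \<oplus>\<^bsub>V\<^esub> x', y \<oplus>\<^bsub>W\<^esub> y') \<in> \<Union>C" using m(2)[of G] unfolding linear_def by blast
    next
      fix k x y assume k: "k \<in> carrier K" and "(x, y) \<in> \<Union>C"
      then obtain G where "G \<in> C" "(x, y) \<in> G" by blast
      then show "(k \<odot>\<^bsub>V\<^esub> x, k \<odot>\<^bsub>W\<^esub> y) \<in> \<Union>C" using m(2)[of G] k unfolding linear_def by blast
    qed
    moreover have "single (\<Union>C)" using m(3) unfolding single_def by blast
    moreover have "\<Union>C \<subseteq> U" using m(1) by blast
    ultimately show ?thesis by (simp add: \<G>_def)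
  qed
  obtain G where G: "G \<in> \<G>" and max: "\<And>G'. \<lbrakk>G' \<in> \<G>; G \<subseteq> G'\<rbrakk> \<Longrightarrow> G' = G"
    using subset_Zorn_nonempty[of \<G>] ne chain by blast
  have G0: "(\<zero>\<^bsub>V\<^esub>, \<zero>\<^bsub>W\<^esub>) \<in> G" using G by (simp add: \<G>_def linear_def)
  have Ga: "(x \<oplus>\<^bsub>V\<^esub> x', y \<oplus>\<^bsub>W\<^esub> y') \<in> G" if "(x, y) \<in> G" "(x', y') \<in> G" for x y x' y'
    using G that by (simp add: \<G>_def linear_def)
  have Gs: "(k \<odot>\<^bsub>V\<^esub> x, k \<odot>\<^bsub>W\<^esub> y) \<in> G" if "k \<in> carrier K" "(x, y) \<in> G" for k x y
    using G that by (simp add: \<G>_def linear_def)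
  have Gc: "x \<in> carrier V" "y \<in> carrier W" "R x y" if "(x, y) \<in> G" for x y
    using G that by (auto simp: \<G>_def U_def)
  have Gz: "y = \<zero>\<^bsub>W\<^esub>" if "(\<zero>\<^bsub>V\<^esub>, y) \<in> G" for y
    using G that by (simp add: \<G>_def single_def)
  have dom: "\<exists>y. (a, y) \<in> G" if a: "a \<in> carrier V" for a
  proof (rule ccontr)
    assume no: "\<nexists>y. (a, y) \<in> G"
    obtain b where b: "b \<in> carrier W" "R a b" using total[OF a] by blast
    \<comment> \<open>The span of \<open>G\<close> and \<open>(a, b)\<close> contradicts the maximality of \<open>G\<close>.\<close>
    define G' where "G' = {(x \<oplus>\<^bsub>V\<^esub> k \<odot>\<^bsub>V\<^esub> a, y \<oplus>\<^bsub>W\<^esub> k \<odot>\<^bsub>W\<^esub> b) | x y k. (x, y) \<in> G \<and> k \<in> carrier K}"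
    have sub: "G \<subseteq> G'"
    proof
      fix p assume "p \<in> G"
      moreover obtain x y where "p = (x, y)" by fastforce
      ultimately have "p = (x \<oplus>\<^bsub>V\<^esub> \<zero> \<odot>\<^bsub>V\<^esub> a, y \<oplus>\<^bsub>W\<^esub> \<zero> \<odot>\<^bsub>W\<^esub> b)" "(x, y) \<in> G"
        using a b Gc by auto
      then show "p \<in> G'" unfolding G'_def using K.zero_closed by blast
    qed
    have ab: "(a, b) \<in> G'"
    proof -
      have "(a, b) = (\<zero>\<^bsub>V\<^esub> \<oplus>\<^bsub>V\<^esub> \<one> \<odot>\<^bsub>V\<^esub> a, \<zero>\<^bsub>W\<^esub> \<oplus>\<^bsub>W\<^esub> \<one> \<odot>\<^bsub>W\<^esub> b)" using a b by simp
      then show ?thesis unfolding G'_def using G0 K.one_closed by blast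
    qed
    have U': "G' \<subseteq> U"
      using Gc a b by (auto simp: G'_def U_def intro!: add smult)
    have "linear G'" unfolding linear_def
    proof (intro conjI allI impI)
      show "(\<zero>\<^bsub>V\<^esub>, \<zero>\<^bsub>W\<^esub>) \<in> G'" using sub G0 by blast
      fix x y x' y' assume "(x, y) \<in> G'" "(x', y') \<in> G'"
      then obtain u v k u' v' k' where
        e: "x = u \<oplus>\<^bsub>V\<^esub> k \<odot>\<^bsub>V\<^esub> a" "y = v \<oplus>\<^bsub>W\<^esub> k \<odot>\<^bsub>W\<^esub> b" "(u, v) \<in> G" "k \<in> carrier K"
           "x' = u' \<oplus>\<^bsub>V\<^esub> k' \<odot>\<^bsub>V\<^esub> a" "y' = v' \<oplus>\<^bsub>W\<^esub> k' \<odot>\<^bsub>W\<^esub> b" "(u', v') \<in> G" "k' \<in> carrier K"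
        unfolding G'_def by blast
      have "(x \<oplus>\<^bsub>V\<^esub> x', y \<oplus>\<^bsub>W\<^esub> y') =
          ((u \<oplus>\<^bsub>V\<^esub> u') \<oplus>\<^bsub>V\<^esub> (k \<oplus> k') \<odot>\<^bsub>V\<^esub> a, (v \<oplus>\<^bsub>W\<^esub> v') \<oplus>\<^bsub>W\<^esub> (k \<oplus> k') \<odot>\<^bsub>W\<^esub> b)"
        using e a b Gc by (simp add: V.smult_l_distr W.smult_l_distr V.a_ac W.a_ac)
      then show "(x \<oplus>\<^bsub>V\<^esub> x', y \<oplus>\<^bsub>W\<^esub> y') \<in> G'"
        unfolding G'_def using e Ga K.add.m_closed by blast
    next
      fix c x y assume c: "c \<in> carrier K" and "(x, y) \<in> G'"
      then obtain u v k where
        e: "x = u \<oplus>\<^bsub>V\<^esub> k \<odot>\<^bsub>V\<^esub> a" "y = v \<oplus>\<^bsub>W\<^esub> k \<odot>\<^bsub>W\<^esub> b" "(u, v) \<in> G" "k \<in> carrier K"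
        unfolding G'_def by blast
      have "(c \<odot>\<^bsub>V\<^esub> x, c \<odot>\<^bsub>W\<^esub> y) = (c \<odot>\<^bsub>V\<^esub> u \<oplus>\<^bsub>V\<^esub> (c \<otimes> k) \<odot>\<^bsub>V\<^esub> a, c \<odot>\<^bsub>W\<^esub> v \<oplus>\<^bsub>W\<^esub> (c \<otimes> k) \<odot>\<^bsub>W\<^esub> b)"
        using e a b c Gc by (simp add: V.smult_r_distr W.smult_r_distr V.smult_assoc1 W.smult_assoc1)
      then show "(c \<odot>\<^bsub>V\<^esub> x, c \<odot>\<^bsub>W\<^esub> y) \<in> G'"
        unfolding G'_def using e Gs c K.m_closed by blast
    qed
    moreover have "single G'" unfolding single_def
    proof (intro allI impI)
      fix z assume "(\<zero>\<^bsub>V\<^esub>, z) \<in> G'"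
      then obtain x y k where e: "\<zero>\<^bsub>V\<^esub> = x \<oplus>\<^bsub>V\<^esub> k \<odot>\<^bsub>V\<^esub> a" "z = y \<oplus>\<^bsub>W\<^esub> k \<odot>\<^bsub>W\<^esub> b" "(x, y) \<in> G" "k \<in> carrier K"
        unfolding G'_def by blast
      have "k = \<zero>"
      proof (rule ccontr)
        assume k: "k \<noteq> \<zero>"
        then have ik: "inv k \<in> carrier K" "inv k \<otimes> k = \<one>" using e K.field_Units by auto
        have "k \<odot>\<^bsub>V\<^esub> a = \<ominus>\<^bsub>V\<^esub> x" using e a Gc by (metis V.add.inv_equality V.add.m_comm V.smult_closed V.minus_equality)
        then have "(inv k \<otimes> k) \<odot>\<^bsub>V\<^esub> a = inv k \<odot>\<^bsub>V\<^esub> (\<ominus>\<^bsub>V\<^esub> x)"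
          using V.smult_assoc1[OF ik(1) e(4) a] by simp
        then have "a = (\<ominus> (inv k)) \<odot>\<^bsub>V\<^esub> x" using ik a e Gc by (simp add: V.smult_r_minus V.smult_l_minus)
        then show False using no Gs[of "\<ominus> (inv k)" x y] e ik by auto
      qed
      then show "z = \<zero>\<^bsub>W\<^esub>" using e a b Gc[OF e(3)] Gz by simp
    qed
    ultimately have "G' = G" using U' sub by (intro max) (simp_all add: \<G>_def)
    then show False using ab no by blast
  qed
  have unique: "y = y'" if "(x, y) \<in> G" "(x, y') \<in> G" for x y y'
  proof -
    note c = Gc(1)[OF that(1)] Gc(2)[OF that(1)] Gc(2)[OF that(2)]
    have "((\<ominus> \<one>) \<odot>\<^bsub>V\<^esub> x, (\<ominus> \<one>) \<odot>\<^bsub>W\<^esub> y') \<in> G" using that by (intro Gs) auto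
    then have "(\<ominus>\<^bsub>V\<^esub> x, \<ominus>\<^bsub>W\<^esub> y') \<in> G" using c by (simp add: V.smult_l_minus W.smult_l_minus)
    from Ga[OF that(1) this] have "(\<zero>\<^bsub>V\<^esub>, y \<ominus>\<^bsub>W\<^esub> y') \<in> G" using c by (simp add: V.r_neg a_minus_def)
    then show ?thesis using Gz c W.minus_zero_iff by blast
  qed
  define h where "h x = (THE y. (x, y) \<in> G)" for x
  have h: "(x, h x) \<in> G" if "x \<in> carrier V" for x
    unfolding h_def using dom[OF that] unique by (metis theI)
  have "h \<in> lin_hom K V W"
  proof (rule lin_homI)
    fix x assume x: "x \<in> carrier V"
    show "h x \<in> carrier W" using Gc h[OF x] by blast
    show "h (x \<oplus>\<^bsub>V\<^esub> y) = h x \<oplus>\<^bsub>W\<^esub> h y" if y: "y \<in> carrier V" for y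
      using unique[OF h[OF V.a_closed[OF x y]] Ga[OF h[OF x] h[OF y]]] .
    show "h (k \<odot>\<^bsub>V\<^esub> x) = k \<odot>\<^bsub>W\<^esub> h x" if k: "k \<in> carrier K" for k
      using unique[OF h[OF V.smult_closed[OF k x]] Gs[OF k h[OF x]]] .
  qed
  then show ?thesis using h Gc by blast
qed

lemma quot_proj:
  assumes K: "field K" and V: "module K V" and N: "submodule N K V"
  shows "(\<lambda>x. N +>\<^bsub>V\<^esub> x) \<in> lin_hom K V (quot_space V N)"
proof -
  interpret V: module K V by fact
  interpret abelian_subgroup N V by (rule submodule_abelian_subgroup) fact+
  show ?thesis
    using coset_smult[OF V N]
    by (intro lin_homI) (auto simp: quot_space_carrier quot_space_def[of V N] a_rcos_sum A_RCOSETS_def')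
qed

lemma quot_zero_iff:
  assumes V: "module K V" and N: "submodule N K V" and x: "x \<in> carrier V"
  shows "N +>\<^bsub>V\<^esub> x = \<zero>\<^bsub>quot_space V N\<^esub> \<longleftrightarrow> x \<in> N"
proof -
  interpret V: module K V by fact
  interpret abelian_subgroup N V by (rule submodule_abelian_subgroup) fact+
  show ?thesis using a_rcos_self[OF x] a_rcos_const by (auto simp: quot_space_def)
qed

text \<open>Two quotients are isomorphic as soon as they are linked by a linear correspondence that is
  total on both sides and relates the two denominators exactly to each other.\<close>

lemma lin_iso_quot_of_relation:
  fixes K (structure) and V :: "('k, 'v, 'm) module_scheme" and W :: "('k, 'w, 'n) module_scheme"
  assumes K: "field K" and V: "module K V" and W: "module K W"
    and N: "submodule N K V" and M: "submodule M K W"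
    and add: "\<And>x y x' y'. \<lbrakk>R x y; R x' y'\<rbrakk> \<Longrightarrow> R (x \<oplus>\<^bsub>V\<^esub> x') (y \<oplus>\<^bsub>W\<^esub> y')"
    and smult: "\<And>k x y. \<lbrakk>k \<in> carrier K; R x y\<rbrakk> \<Longrightarrow> R (k \<odot>\<^bsub>V\<^esub> x) (k \<odot>\<^bsub>W\<^esub> y)"
    and total: "\<And>x. x \<in> carrier V \<Longrightarrow> \<exists>y\<in>carrier W. R x y"
    and surj: "\<And>y. y \<in> carrier W \<Longrightarrow> \<exists>x\<in>carrier V. R x y"
    and iff: "\<And>x y. \<lbrakk>x \<in> carrier V; y \<in> carrier W; R x y\<rbrakk> \<Longrightarrow> x \<in> N \<longleftrightarrow> y \<in> M"
  shows "lin_iso K (quot_space V N) (quot_space W M)"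
proof -
  interpret K: field K by fact
  interpret V: module K V by fact
  interpret W: module K W by fact
  let ?Q = "quot_space W M"
  note Q = quot_space_module[OF K W M]
  interpret Q: module K ?Q by (rule Q)
  \<comment> \<open>A linear selection \<open>h\<close> of the correspondence induces the isomorphism on the quotients.\<close>
  obtain h where h: "h \<in> lin_hom K V W" and hR: "\<And>x. x \<in> carrier V \<Longrightarrow> R x (h x)"
    using linear_choice[OF K V W, of R] add smult total by blast
  define g where "g x = M +>\<^bsub>W\<^esub> h x" for x
  have g: "g \<in> lin_hom K V ?Q"
    unfolding g_def by (rule lin_hom_compose[OF h quot_proj[OF K W M]])
  interpret g: linear_map K V ?Q g by (rule linear_mapI[OF V Q g])
  interpret h: linear_map K V W h by (rule linear_mapI[OF V W h])
  have ker: "g x = \<zero>\<^bsub>?Q\<^esub> \<longleftrightarrow> x \<in> N" if "x \<in> carrier V" for x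
    using quot_zero_iff[OF W M, of "h x"] iff[OF that _ hR[OF that]] that by (simp add: g_def)
  have NV: "N \<subseteq> carrier V" using N V.submoduleE(1) by blast
  have l: "quot_lift g (N +>\<^bsub>V\<^esub> x) = g x" if "x \<in> carrier V" for x
    by (rule quot_lift_coset[OF V N Q g _ that]) (use ker NV in blast)
  have lh: "quot_lift g \<in> lin_hom K (quot_space V N) ?Q"
    by (rule lin_hom_quot_lift[OF K V N Q g]) (use ker NV in blast)
  have "inj_on (quot_lift g) (carrier (quot_space V N))"
  proof (rule inj_onI)
    fix u v assume "u \<in> carrier (quot_space V N)" "v \<in> carrier (quot_space V N)"
      and e: "quot_lift g u = quot_lift g v"
    then obtain x y where x: "x \<in> carrier V" "u = N +>\<^bsub>V\<^esub> x" and y: "y \<in> carrier V" "v = N +>\<^bsub>V\<^esub> y"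
      by (auto simp: quot_space_carrier)
    then have "g (x \<ominus>\<^bsub>V\<^esub> y) = \<zero>\<^bsub>?Q\<^esub>" using e by (simp add: l Q.minus_zero_iff)
    then show "u = v" using ker[of "x \<ominus>\<^bsub>V\<^esub> y"] x y coset_eqI[OF V N, of x y] V.minus_closed by blast
  qed
  moreover have "u \<in> quot_lift g ` carrier (quot_space V N)" if "u \<in> carrier ?Q" for u
  proof -
    obtain y where y: "y \<in> carrier W" "u = M +>\<^bsub>W\<^esub> y" using \<open>u \<in> carrier ?Q\<close> by (auto simp: quot_space_carrier)
    obtain x where x: "x \<in> carrier V" "R x y" using surj[OF y(1)] by blast
    \<comment> \<open>\<open>y\<close> and \<open>h x\<close> both correspond to \<open>x\<close>, so their difference corresponds to zero.\<close>
    have "R (x \<oplus>\<^bsub>V\<^esub> (\<ominus> \<one>) \<odot>\<^bsub>V\<^esub> x) (y \<oplus>\<^bsub>W\<^esub> (\<ominus> \<one>) \<odot>\<^bsub>W\<^esub> h x)"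
      by (intro add smult x hR) auto
    then have "R \<zero>\<^bsub>V\<^esub> (y \<ominus>\<^bsub>W\<^esub> h x)"
      using x y by (simp add: V.smult_l_minus W.smult_l_minus V.r_neg a_minus_def)
    then have "y \<ominus>\<^bsub>W\<^esub> h x \<in> M"
      using iff[of "\<zero>\<^bsub>V\<^esub>" "y \<ominus>\<^bsub>W\<^esub> h x"] ker[of "\<zero>\<^bsub>V\<^esub>"] x y by auto
    then have "u = g x" using coset_eqI[OF W M y(1), of "h x"] x y by (simp add: g_def)
    then show ?thesis using l[OF x(1)] x(1) by (auto simp: quot_space_carrier intro!: image_eqI)
  qed
  ultimately have "bij_betw (quot_lift g) (carrier (quot_space V N)) (carrier ?Q)"
    using lh lin_hom_closed[OF lh] by (auto simp: bij_betw_def)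
  then show ?thesis using lh by (auto simp: lin_iso_def)
qed

section \<open>Double complexes with exact augmented columns\<close>

text \<open>
  The maps \<open>dh p q\<close> and \<open>dv p q\<close> are indexed by their targets, \<open>dv\<close> runs along the columns, and \<open>a\<close>
  augments them to \<open>X\<close>.  The squares commute rather than anticommute, so that no signs occur below.
\<close>

locale resolved_double_complex =
  fixes K :: "('k, 'r) ring_scheme"
    and E :: "nat \<Rightarrow> nat \<Rightarrow> ('k, 'e, 'm) module_scheme" and X :: "nat \<Rightarrow> ('k, 'x, 'n) module_scheme"
    and dh dv :: "nat \<Rightarrow> nat \<Rightarrow> 'e \<Rightarrow> 'e" and dX :: "nat \<Rightarrow> 'x \<Rightarrow> 'x" and a :: "nat \<Rightarrow> 'e \<Rightarrow> 'x"
  assumes E_module: "module K (E p q)" and X_module: "module K (X p)"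
    and dh_hom: "dh p q \<in> lin_hom K (E (Suc p) q) (E p q)"
    and dv_hom: "dv p q \<in> lin_hom K (E p (Suc q)) (E p q)"
    and a_hom: "a p \<in> lin_hom K (E p 0) (X p)"
    and dh_dh: "x \<in> carrier (E (Suc (Suc p)) q) \<Longrightarrow> dh p q (dh (Suc p) q x) = \<zero>\<^bsub>E p q\<^esub>"
    and dh_dv: "x \<in> carrier (E (Suc p) (Suc q)) \<Longrightarrow> dh p q (dv (Suc p) q x) = dv p q (dh p (Suc q) x)"
    and a_dh: "x \<in> carrier (E (Suc p) 0) \<Longrightarrow> a p (dh p 0 x) = dX p (a (Suc p) x)"
    and exact: "\<lbrakk>x \<in> carrier (E p (Suc q)); dv p q x = \<zero>\<^bsub>E p q\<^esub>\<rbrakk> \<Longrightarrow>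
      \<exists>y\<in>carrier (E p (Suc (Suc q))). dv p (Suc q) y = x"
    and exact_0: "\<lbrakk>x \<in> carrier (E p 0); a p x = \<zero>\<^bsub>X p\<^esub>\<rbrakk> \<Longrightarrow> \<exists>y\<in>carrier (E p (Suc 0)). dv p 0 y = x"
    and a_surj: "z \<in> carrier (X p) \<Longrightarrow> \<exists>x\<in>carrier (E p 0). a p x = z"

text \<open>Up to signs, zigzags are the cycles of the total complex in degree \<open>n\<close>: only the entries of \<open>x\<close>
  on the antidiagonal \<open>p + q = n\<close> matter, and the form of the condition makes it stable under
  transposition of the double complex.\<close>

definition zigzag ::
  "(nat \<Rightarrow> nat \<Rightarrow> ('k, 'e, 'm) module_scheme) \<Rightarrow> (nat \<Rightarrow> nat \<Rightarrow> 'e \<Rightarrow> 'e) \<Rightarrow> (nat \<Rightarrow> nat \<Rightarrow> 'e \<Rightarrow> 'e) \<Rightarrow>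
   nat \<Rightarrow> (nat \<Rightarrow> nat \<Rightarrow> 'e) \<Rightarrow> bool"
  where "zigzag E dh dv n x \<longleftrightarrow>
    (\<forall>p q. p + q = n \<longrightarrow> x p q \<in> carrier (E p q)) \<and>
    (\<forall>p q. Suc (p + q) = n \<longrightarrow> dh p q (x (Suc p) q) = dv p q (x p (Suc q)))"

context resolved_double_complex
begin

lemma dh_map: "linear_map K (E (Suc p) q) (E p q) (dh p q)"
  and dv_map: "linear_map K (E p (Suc q)) (E p q) (dv p q)"
  and a_map: "linear_map K (E p 0) (X p) (a p)"
  by (intro linear_mapI E_module X_module dh_hom dv_hom a_hom)+

text \<open>Starting from a lift of the cycle \<open>z\<close> at \<open>q = 0\<close>, exactness of the columns yields the entries of the
  zigzag one after the other.\<close>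

lemma zigzag_exists:
  assumes z: "z \<in> carrier (X n)" and cyc: "\<And>m. n = Suc m \<Longrightarrow> dX m z = \<zero>\<^bsub>X m\<^esub>"
  shows "\<exists>x. zigzag E dh dv n x \<and> a n (x n 0) = z"
proof -
  \<comment> \<open>The invariant includes that the next entry exists, because this is seen from the entry before:
    \<open>dv\<close> kills \<open>dh v\<close> as \<open>dh \<circ> dh = 0\<close>.\<close>
  let ?P = "\<lambda>q v. q \<le> n \<longrightarrow> v \<in> carrier (E (n - q) q) \<and> (q = 0 \<longrightarrow> a n v = z) \<and>
    (q < n \<longrightarrow> (\<exists>y\<in>carrier (E (n - Suc q) (Suc q)). dv (n - Suc q) q y = dh (n - Suc q) q v))"
  let ?Q = "\<lambda>q v w. q < n \<longrightarrow> dv (n - Suc q) q w = dh (n - Suc q) q v"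
  have "\<exists>f. \<forall>q. ?P q (f q) \<and> ?Q q (f q) (f (Suc q))"
  proof (rule dependent_nat_choice)
    obtain v where v: "v \<in> carrier (E n 0)" "a n v = z" using a_surj[OF z] by blast
    have "\<exists>y\<in>carrier (E (n - Suc 0) (Suc 0)). dv (n - Suc 0) 0 y = dh (n - Suc 0) 0 v" if n: "0 < n"
    proof -
      obtain m where m: "n = Suc m" using n gr0_implies_Suc by blast
      have "dh m 0 v \<in> carrier (E m 0)" using v(1) lin_hom_closed[OF dh_hom] m by simp
      moreover have "a m (dh m 0 v) = \<zero>\<^bsub>X m\<^esub>" using a_dh v m cyc by simp
      ultimately show ?thesis using exact_0 m by simp
    qed
    then show "\<exists>v. ?P 0 v" using v by auto
  next
    fix v q assume P: "?P q v"
    show "\<exists>w. ?P (Suc q) w \<and> ?Q q v w"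
    proof (cases "q < n")
      case True
      then obtain p where n: "n = Suc (p + q)" using less_imp_Suc_add by (metis add.commute)
      obtain y where y: "y \<in> carrier (E p (Suc q))" "dv p q y = dh p q v" and v: "v \<in> carrier (E (Suc p) q)"
        using P n by (auto simp: Suc_diff_le)
      have "\<exists>y'\<in>carrier (E r (Suc (Suc q))). dv r (Suc q) y' = dh r (Suc q) y" if r: "p = Suc r" for r
      proof (rule exact)
        show "dh r (Suc q) y \<in> carrier (E r (Suc q))" using y r lin_hom_closed[OF dh_hom] by simp
        show "dv r q (dh r (Suc q) y) = \<zero>\<^bsub>E r q\<^esub>"
          using dh_dv[of y r q] dh_dh[of v r q] y v r by simp
      qed
      then show ?thesis using y n by (intro exI[of _ y]) (cases p; auto)
    qed auto
  qed
  then obtain f where f: "\<And>q. ?P q (f q)" "\<And>q. ?Q q (f q) (f (Suc q))" by blast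
  have "zigzag E dh dv n (\<lambda>p q. f q)"
    unfolding zigzag_def
  proof (intro conjI allI impI)
    fix p q :: nat assume "p + q = n"
    then show "f q \<in> carrier (E p q)" using f(1)[of q] by auto
  next
    fix p q :: nat assume "Suc (p + q) = n"
    then show "dh p q (f q) = dv p q (f (Suc q))" using f(2)[of q] by auto
  qed
  then show ?thesis using f(1)[of 0] by auto
qed

text \<open>If the end of a zigzag in \<open>X\<close> bounds, exactness of the columns writes one entry after the other
  as a sum of values of \<open>dh\<close> and \<open>dv\<close>.  For the last entry this says that the other end of the zigzag
  bounds as well, because the augmentation of the rows kills the values of \<open>dh\<close>.\<close>

lemma zigzag_boundary:
  assumes x: "zigzag E dh dv n x" and z: "z \<in> carrier (X (Suc n))" "a n (x n 0) = dX n z"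
  shows "\<exists>u\<in>carrier (E 1 n). \<exists>v\<in>carrier (E 0 (Suc n)). x 0 n = dh 0 n u \<oplus>\<^bsub>E 0 n\<^esub> dv 0 n v"
proof -
  have xc: "x p q \<in> carrier (E p q)" if "p + q = n" for p q using x that by (simp add: zigzag_def)
  have xz: "dh p q (x (Suc p) q) = dv p q (x p (Suc q))" if "Suc (p + q) = n" for p q
    using x that by (simp add: zigzag_def)
  let ?P = "\<lambda>q u. q \<le> n \<longrightarrow> u \<in> carrier (E (Suc (n - q)) q) \<and>
    (\<exists>v\<in>carrier (E (n - q) (Suc q)). x (n - q) q = dh (n - q) q u \<oplus>\<^bsub>E (n - q) q\<^esub> dv (n - q) q v)"
  have "\<exists>u. ?P q u" for q
  proof (induction q)
    case 0
    interpret a: linear_map K "E n 0" "X n" "a n" by (rule a_map)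
    obtain u where u: "u \<in> carrier (E (Suc n) 0)" "a (Suc n) u = z" using a_surj[OF z(1)] by blast
    have c: "x n 0 \<in> carrier (E n 0)" "dh n 0 u \<in> carrier (E n 0)"
      using xc u lin_hom_closed[OF dh_hom] by auto
    moreover have "a n (x n 0 \<ominus>\<^bsub>E n 0\<^esub> dh n 0 u) = \<zero>\<^bsub>X n\<^esub>"
      using c u z a_dh[OF u(1)] a.closed[OF c(1)] by (simp add: a.W.minus_zero_iff)
    ultimately obtain v where v: "v \<in> carrier (E n (Suc 0))" "dv n 0 v = x n 0 \<ominus>\<^bsub>E n 0\<^esub> dh n 0 u"
      using exact_0[of "x n 0 \<ominus>\<^bsub>E n 0\<^esub> dh n 0 u" n] a.V.minus_closed by blast
    have "x n 0 = dh n 0 u \<oplus>\<^bsub>E n 0\<^esub> dv n 0 v" using c v by (simp add: a_minus_def a.V.a_comm a.V.a_lcomm a.V.r_neg)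
    then show ?case using u(1) v(1) by auto
  next
    case (Suc q)
    show ?case
    proof (cases "Suc q \<le> n")
      case True
      then obtain p where n: "n = Suc (p + q)" using less_imp_Suc_add by (metis Suc_le_eq add.commute)
      obtain u v where u: "u \<in> carrier (E (Suc (Suc p)) q)" and v: "v \<in> carrier (E (Suc p) (Suc q))"
        and e: "x (Suc p) q = dh (Suc p) q u \<oplus>\<^bsub>E (Suc p) q\<^esub> dv (Suc p) q v"
        using Suc n by (auto simp: Suc_diff_le)
      interpret dh: linear_map K "E (Suc p) q" "E p q" "dh p q" by (rule dh_map)
      interpret dv: linear_map K "E p (Suc q)" "E p q" "dv p q" by (rule dv_map)
      have c: "dh (Suc p) q u \<in> carrier (E (Suc p) q)" "dv (Suc p) q v \<in> carrier (E (Suc p) q)"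
        "dh p (Suc q) v \<in> carrier (E p (Suc q))" "x p (Suc q) \<in> carrier (E p (Suc q))"
        using u v xc n lin_hom_closed[OF dh_hom] lin_hom_closed[OF dv_hom] by auto
      have "dv p q (x p (Suc q)) = dh p q (x (Suc p) q)" using xz n by simp
      also have "\<dots> = dv p q (dh p (Suc q) v)" using c dh_dh[OF u] dh_dv[OF v] unfolding e by simp
      finally have "dv p q (x p (Suc q) \<ominus>\<^bsub>E p (Suc q)\<^esub> dh p (Suc q) v) = \<zero>\<^bsub>E p q\<^esub>"
        using c by (simp add: dh.W.minus_zero_iff)
      then obtain w where w: "w \<in> carrier (E p (Suc (Suc q)))"
        "dv p (Suc q) w = x p (Suc q) \<ominus>\<^bsub>E p (Suc q)\<^esub> dh p (Suc q) v"
        using exact[of "x p (Suc q) \<ominus>\<^bsub>E p (Suc q)\<^esub> dh p (Suc q) v" p q] c dv.V.minus_closed by blast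
      have "x p (Suc q) = dh p (Suc q) v \<oplus>\<^bsub>E p (Suc q)\<^esub> dv p (Suc q) w"
        using c w by (simp add: a_minus_def dv.V.a_comm dv.V.a_lcomm dv.V.r_neg)
      then show ?thesis using v w(1) n by (intro exI[of _ v]) auto
    qed auto
  qed
  from this[of n] show ?thesis by auto
qed

end

lemma image_submodule:
  fixes K (structure) and U :: "('k, 'u, 'i) module_scheme" and V :: "('k, 'v, 'j) module_scheme"
  assumes f: "linear_map K U V f" and Z: "submodule Z K V" and sub: "f ` carrier U \<subseteq> Z"
  shows "submodule (f ` carrier U) K (V\<lparr>carrier := Z\<rparr>)"
proof -
  interpret f: linear_map K U V f by fact
  interpret Z: module K "V\<lparr>carrier := Z\<rparr>" by (rule submodule.submodule_is_module[OF Z f.W.module_axioms])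
  have neg: "\<ominus>\<^bsub>V\<lparr>carrier := Z\<rparr>\<^esub> f x = f (\<ominus>\<^bsub>U\<^esub> x)" if "x \<in> carrier U" for x
  proof (intro Z.minus_equality)
    show "f (\<ominus>\<^bsub>U\<^esub> x) \<in> carrier (V\<lparr>carrier := Z\<rparr>)" "f x \<in> carrier (V\<lparr>carrier := Z\<rparr>)"
      using sub f.V.a_inv_closed[OF that] that by (auto simp del: f.neg)
  qed (use that in \<open>simp add: f.W.l_neg\<close>)
  have "\<ominus>\<^bsub>V\<lparr>carrier := Z\<rparr>\<^esub> f x \<in> f ` carrier U" if "x \<in> carrier U" for x
    using neg[OF that] f.V.a_inv_closed[OF that] by (metis imageI)
  moreover have "f x \<oplus>\<^bsub>V\<^esub> f y \<in> f ` carrier U" if "x \<in> carrier U" "y \<in> carrier U" for x y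
    using that f.add[OF that] f.V.a_closed[OF that] by (metis imageI)
  moreover have "k \<odot>\<^bsub>V\<^esub> f x \<in> f ` carrier U" if "k \<in> carrier K" "x \<in> carrier U" for x k
    using that f.smult[OF that] f.V.smult_closed[OF that] by (metis imageI)
  moreover have "\<zero>\<^bsub>V\<^esub> \<in> f ` carrier U" using f.zero f.V.zero_closed by (metis imageI)
  ultimately show ?thesis using sub by (intro Z.submoduleI) auto
qed

text \<open>
  If rows and columns of a double complex are resolutions, the complexes \<open>X\<close> and \<open>Y\<close> they resolve
  have the same homology: zigzags are a linear correspondence between the cycles of \<open>X\<close> and of \<open>Y\<close>.
  The hypotheses on the rows are those on the columns of the transposed double complex.
\<close>

lemma lin_iso_homology_of_double_complex:
  fixes K (structure)
  assumes K: "field K"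
    and cols: "resolved_double_complex K E X dh dv dX a"
    and rows: "resolved_double_complex K (\<lambda>p q. E q p) Y (\<lambda>p q. dv q p) (\<lambda>p q. dh q p) dY b"
    and b_dh: "\<And>q x. x \<in> carrier (E 1 q) \<Longrightarrow> b q (dh 0 q x) = \<zero>\<^bsub>Y q\<^esub>"
    and a_dv: "\<And>p x. x \<in> carrier (E p 1) \<Longrightarrow> a p (dv p 0 x) = \<zero>\<^bsub>X p\<^esub>"
    and DX: "\<And>n x. x \<in> carrier (X n) \<Longrightarrow> DX n x = (case n of 0 \<Rightarrow> \<zero>\<^bsub>X 0\<^esub> | Suc m \<Rightarrow> dX m x)"
    and DY: "\<And>n y. y \<in> carrier (Y n) \<Longrightarrow> DY n y = (case n of 0 \<Rightarrow> \<zero>\<^bsub>Y 0\<^esub> | Suc m \<Rightarrow> dY m y)"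
    and dX_hom: "\<And>n. dX n \<in> lin_hom K (X (Suc n)) (X n)"
    and dY_hom: "\<And>n. dY n \<in> lin_hom K (Y (Suc n)) (Y n)"
  shows "lin_iso K (homology X DX n) (homology Y DY n)"
proof -
  interpret K: field K by fact
  interpret C: resolved_double_complex K E X dh dv dX a by (rule cols)
  interpret R: resolved_double_complex K "\<lambda>p q. E q p" Y "\<lambda>p q. dv q p" "\<lambda>p q. dh q p" dY b by (rule rows)
  define ZX where "ZX = {x \<in> carrier (X n). DX n x = \<zero>\<^bsub>X (n - 1)\<^esub>}"
  define ZY where "ZY = {y \<in> carrier (Y n). DY n y = \<zero>\<^bsub>Y (n - 1)\<^esub>}"
  define BX where "BX = DX (n + 1) ` carrier (X (n + 1))"
  define BY where "BY = DY (n + 1) ` carrier (Y (n + 1))"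
  have ZX: "submodule ZX K (X n)"
  proof (cases n)
    case 0
    then have "ZX = carrier (X n)" by (auto simp: ZX_def DX)
    then show ?thesis using module.carrier_is_submodule[OF C.X_module] by metis
  next
    case (Suc m)
    then have "ZX = {x \<in> carrier (X n). dX m x = \<zero>\<^bsub>X m\<^esub>}" by (auto simp: ZX_def DX)
    then show ?thesis using lin_kernel_submodule[OF C.X_module C.X_module dX_hom, of m] Suc by simp
  qed
  have ZY: "submodule ZY K (Y n)"
  proof (cases n)
    case 0
    then have "ZY = carrier (Y n)" by (auto simp: ZY_def DY)
    then show ?thesis using module.carrier_is_submodule[OF R.X_module] by metis
  next
    case (Suc m)
    then have "ZY = {x \<in> carrier (Y n). dY m x = \<zero>\<^bsub>Y m\<^esub>}" by (auto simp: ZY_def DY)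
    then show ?thesis using lin_kernel_submodule[OF R.X_module R.X_module dY_hom, of m] Suc by simp
  qed
  have "dX m (dX (Suc m) z) = \<zero>\<^bsub>X m\<^esub>" if z: "z \<in> carrier (X (Suc (Suc m)))" for m z
  proof -
    obtain x where x: "x \<in> carrier (E (Suc (Suc m)) 0)" "a (Suc (Suc m)) x = z" using C.a_surj[OF z] by blast
    have "dX m (dX (Suc m) z) = a m (dh m 0 (dh (Suc m) 0 x))"
      using C.a_dh x lin_hom_closed[OF C.dh_hom] by metis
    then show ?thesis using C.dh_dh[OF x(1)] linear_map.zero[OF C.a_map] by simp
  qed
  then have BZX: "BX \<subseteq> ZX"
    using lin_hom_closed[OF dX_hom] by (auto simp: BX_def ZX_def DX split: nat.split)
  have "dY m (dY (Suc m) z) = \<zero>\<^bsub>Y m\<^esub>" if z: "z \<in> carrier (Y (Suc (Suc m)))" for m z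
  proof -
    obtain x where x: "x \<in> carrier (E 0 (Suc (Suc m)))" "b (Suc (Suc m)) x = z" using R.a_surj[OF z] by blast
    have "dY m (dY (Suc m) z) = b m (dv 0 m (dv 0 (Suc m) x))"
      using R.a_dh x lin_hom_closed[OF R.dh_hom] by metis
    then show ?thesis using R.dh_dh[OF x(1)] linear_map.zero[OF R.a_map] by simp
  qed
  then have BZY: "BY \<subseteq> ZY"
    using lin_hom_closed[OF dY_hom] by (auto simp: BY_def ZY_def DY split: nat.split)
  have BX: "BX = dX n ` carrier (X (Suc n))" by (auto simp: BX_def DX)
  have BY: "BY = dY n ` carrier (Y (Suc n))" by (auto simp: BY_def DY)
  define rel where "rel z w \<longleftrightarrow> (\<exists>x. zigzag E dh dv n x \<and> a n (x n 0) = z \<and> b n (x 0 n) = w)" for z w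
  have flip: "zigzag (\<lambda>p q. E q p) (\<lambda>p q. dv q p) (\<lambda>p q. dh q p) n (\<lambda>p q. x q p) \<longleftrightarrow> zigzag E dh dv n x" for x
    by (auto simp: zigzag_def add.commute)
  have cX: "a n (x n 0) \<in> ZX" if x: "zigzag E dh dv n x" for x
  proof (cases n)
    case (Suc m)
    have "x n 0 \<in> carrier (E n 0)" "x m 1 \<in> carrier (E m 1)" "dh m 0 (x n 0) = dv m 0 (x m 1)"
      using x Suc by (auto simp: zigzag_def)
    then show ?thesis using C.a_dh[of "x n 0" m] a_dv[of "x m 1" m] Suc lin_hom_closed[OF C.a_hom]
      by (auto simp: ZX_def DX)
  qed (use x lin_hom_closed[OF C.a_hom] in \<open>auto simp: ZX_def DX zigzag_def\<close>)
  have cY: "b n (x 0 n) \<in> ZY" if x: "zigzag E dh dv n x" for x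
  proof (cases n)
    case (Suc m)
    have "x 0 n \<in> carrier (E 0 n)" "x 1 m \<in> carrier (E 1 m)" "dh 0 m (x 1 m) = dv 0 m (x 0 n)"
      using x Suc by (auto simp: zigzag_def)
    then show ?thesis using R.a_dh[of "x 0 n" m] b_dh[of "x 1 m" m] Suc lin_hom_closed[OF R.a_hom]
      by (auto simp: ZY_def DY)
  qed (use x lin_hom_closed[OF R.a_hom] in \<open>auto simp: ZY_def DY zigzag_def\<close>)
  have "lin_iso K (quot_space ((X n)\<lparr>carrier := ZX\<rparr>) BX) (quot_space ((Y n)\<lparr>carrier := ZY\<rparr>) BY)"
  proof (rule lin_iso_quot_of_relation[OF K, where R = rel])
    show "module K ((X n)\<lparr>carrier := ZX\<rparr>)" by (rule submodule.submodule_is_module[OF ZX C.X_module])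
    show "module K ((Y n)\<lparr>carrier := ZY\<rparr>)" by (rule submodule.submodule_is_module[OF ZY R.X_module])
    show "submodule BX K ((X n)\<lparr>carrier := ZX\<rparr>)"
      unfolding BX by (rule image_submodule[OF linear_mapI[OF C.X_module C.X_module dX_hom] ZX]) (use BZX BX in simp)
    show "submodule BY K ((Y n)\<lparr>carrier := ZY\<rparr>)"
      unfolding BY by (rule image_submodule[OF linear_mapI[OF R.X_module R.X_module dY_hom] ZY]) (use BZY BY in simp)
  next
    fix z w z' w' assume "rel z w" "rel z' w'"
    then obtain x x' where x: "zigzag E dh dv n x" "a n (x n 0) = z" "b n (x 0 n) = w"
      and x': "zigzag E dh dv n x'" "a n (x' n 0) = z'" "b n (x' 0 n) = w'"
      unfolding rel_def by blast
    have "zigzag E dh dv n (\<lambda>p q. x p q \<oplus>\<^bsub>E p q\<^esub> x' p q)"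
      using x(1) x'(1) module.axioms(2)[OF C.E_module, THEN abelian_group.axioms(1), THEN abelian_monoid.a_closed]
      by (auto simp: zigzag_def linear_map.add[OF C.dh_map] linear_map.add[OF C.dv_map])
    then show "rel (z \<oplus>\<^bsub>(X n)\<lparr>carrier := ZX\<rparr>\<^esub> z') (w \<oplus>\<^bsub>(Y n)\<lparr>carrier := ZY\<rparr>\<^esub> w')"
      using x x' unfolding rel_def
      by (intro exI[of _ "\<lambda>p q. x p q \<oplus>\<^bsub>E p q\<^esub> x' p q"])
        (auto simp: zigzag_def linear_map.add[OF C.a_map] linear_map.add[OF R.a_map])
  next
    fix k z w assume k: "k \<in> carrier K" and "rel z w"
    then obtain x where x: "zigzag E dh dv n x" "a n (x n 0) = z" "b n (x 0 n) = w"
      unfolding rel_def by blast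
    have "zigzag E dh dv n (\<lambda>p q. k \<odot>\<^bsub>E p q\<^esub> x p q)"
      using x(1) k module.smult_closed[OF C.E_module]
      by (auto simp: zigzag_def linear_map.smult[OF C.dh_map] linear_map.smult[OF C.dv_map])
    then show "rel (k \<odot>\<^bsub>(X n)\<lparr>carrier := ZX\<rparr>\<^esub> z) (k \<odot>\<^bsub>(Y n)\<lparr>carrier := ZY\<rparr>\<^esub> w)"
      using x k unfolding rel_def
      by (intro exI[of _ "\<lambda>p q. k \<odot>\<^bsub>E p q\<^esub> x p q"])
        (auto simp: zigzag_def linear_map.smult[OF C.a_map] linear_map.smult[OF R.a_map])
  next
    fix z assume "z \<in> carrier ((X n)\<lparr>carrier := ZX\<rparr>)"
    then have z: "z \<in> carrier (X n)" "\<And>m. n = Suc m \<Longrightarrow> dX m z = \<zero>\<^bsub>X m\<^esub>" by (auto simp: ZX_def DX)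
    then show "\<exists>w\<in>carrier ((Y n)\<lparr>carrier := ZY\<rparr>). rel z w"
      using C.zigzag_exists[of z n] cY unfolding rel_def by auto
  next
    fix w assume "w \<in> carrier ((Y n)\<lparr>carrier := ZY\<rparr>)"
    then have w: "w \<in> carrier (Y n)" "\<And>m. n = Suc m \<Longrightarrow> dY m w = \<zero>\<^bsub>Y m\<^esub>" by (auto simp: ZY_def DY)
    then obtain x where "zigzag (\<lambda>p q. E q p) (\<lambda>p q. dv q p) (\<lambda>p q. dh q p) n x" "b n (x n 0) = w"
      using R.zigzag_exists[of w n] by blast
    then show "\<exists>z\<in>carrier ((X n)\<lparr>carrier := ZX\<rparr>). rel z w"
      using cX[of "\<lambda>p q. x q p"] flip[of "\<lambda>p q. x q p"] unfolding rel_def by auto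
  next
    fix z w assume "rel z w"
    then obtain x where x: "zigzag E dh dv n x" "a n (x n 0) = z" "b n (x 0 n) = w"
      unfolding rel_def by blast
    show "z \<in> BX \<longleftrightarrow> w \<in> BY"
    proof
      assume "z \<in> BX"
      then obtain t where t: "t \<in> carrier (X (Suc n))" "z = dX n t" unfolding BX by blast
      obtain u v where u: "u \<in> carrier (E 1 n)" and v: "v \<in> carrier (E 0 (Suc n))"
        and e: "x 0 n = dh 0 n u \<oplus>\<^bsub>E 0 n\<^esub> dv 0 n v"
        using C.zigzag_boundary[OF x(1) t(1)] x(2) t(2) by blast
      interpret b: linear_map K "E 0 n" "Y n" "b n" by (rule R.a_map)
      have "dh 0 n u \<in> carrier (E 0 n)" "dv 0 n v \<in> carrier (E 0 n)"
        using lin_hom_closed[OF C.dh_hom, of u] lin_hom_closed[OF C.dv_hom v] u by auto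
      then have "w = dY n (b (Suc n) v)" using x(3) e b_dh[OF u] R.a_dh[OF v] by (metis b.add b.W.l_zero b.closed)
      then show "w \<in> BY" unfolding BY using lin_hom_closed[OF R.a_hom v] by blast
    next
      assume "w \<in> BY"
      then obtain t where t: "t \<in> carrier (Y (Suc n))" "w = dY n t" unfolding BY by blast
      obtain u v where u: "u \<in> carrier (E n 1)" and v: "v \<in> carrier (E (Suc n) 0)"
        and e: "x n 0 = dv n 0 u \<oplus>\<^bsub>E n 0\<^esub> dh n 0 v"
        using R.zigzag_boundary[of n "\<lambda>p q. x q p" t] flip[of x] x t by auto
      interpret a: linear_map K "E n 0" "X n" "a n" by (rule C.a_map)
      have "dv n 0 u \<in> carrier (E n 0)" "dh n 0 v \<in> carrier (E n 0)"
        using lin_hom_closed[OF C.dv_hom, of u] lin_hom_closed[OF C.dh_hom v] u by auto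
      then have "z = dX n (a (Suc n) v)" using x(2) e a_dv[OF u] C.a_dh[OF v] by (metis a.add a.W.l_zero a.closed)
      then show "z \<in> BX" unfolding BX using lin_hom_closed[OF C.a_hom v] by blast
    qed
  qed
  then show ?thesis by (simp add: homology_def ZX_def ZY_def BX_def BY_def)
qed

section \<open>Linear contraction of an acyclic augmented simplicial vector space\<close>

lemma awb_hom_lin: "h \<in> awb_hom K A B \<Longrightarrow> h \<in> lin_hom K A B"
  by (simp add: awb_hom_def)

lemma awb_module: "awb K A \<Longrightarrow> module K A"
  by (simp add: awb_def bilinear_pair_def)

lemma awb_field: "awb K A \<Longrightarrow> field K"
  by (simp add: awb_def bilinear_pair_def)

context simplicial_awb
begin

lemma level_module: "module K (level F n)"
  by (rule awb_module[OF level_awb])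

lemma face_map:
  assumes "i \<le> Suc n" shows "linear_map K (level F (Suc n)) (level F n) (face F (Suc n) i)"
  using face_hom[of "Suc n" i] assms by (intro linear_mapI level_module awb_hom_lin) simp

lemma degen_map:
  assumes "i \<le> n" shows "linear_map K (level F n) (level F (Suc n)) (degen F n i)"
  using degen_hom[of i n] assms by (intro linear_mapI level_module awb_hom_lin) simp

lemma face_face':
  "\<lbrakk>i < j; j \<le> Suc (Suc n); x \<in> carrier (level F (Suc (Suc n)))\<rbrakk> \<Longrightarrow>
    face F (Suc n) i (face F (Suc (Suc n)) j x) = face F (Suc n) (j - 1) (face F (Suc (Suc n)) i x)"
  using face_face[of i j n x] by simp

text \<open>The Kan condition for the horn without face \<open>0\<close>: the faces are corrected one at a time, from
  the last to the first, by a degenerate element that does not disturb the faces already correct.\<close>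

lemma horn_filler:
  assumes x: "\<And>i. \<lbrakk>1 \<le> i; i \<le> Suc n\<rbrakk> \<Longrightarrow> x i \<in> carrier (level F n)"
    and compat: "\<And>i j m. \<lbrakk>n = Suc m; 1 \<le> i; i < j; j \<le> Suc n\<rbrakk> \<Longrightarrow> face F n i (x j) = face F n (j - 1) (x i)"
  shows "\<exists>y\<in>carrier (level F (Suc n)). \<forall>i. 1 \<le> i \<longrightarrow> i \<le> Suc n \<longrightarrow> face F (Suc n) i y = x i"
proof -
  interpret U: module K "level F (Suc n)" by (rule level_module)
  interpret L: module K "level F n" by (rule level_module)
  have "m \<le> Suc n \<Longrightarrow> \<exists>w\<in>carrier (level F (Suc n)). \<forall>i. Suc n - m < i \<longrightarrow> i \<le> Suc n \<longrightarrow> face F (Suc n) i w = x i" for m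
  proof (induction m)
    case 0
    then show ?case using U.zero_closed by auto
  next
    case (Suc m)
    define r where "r = n - m"
    have r: "Suc n - m = Suc r" "Suc n - Suc m = r" "r \<le> n" using Suc.prems by (auto simp: r_def)
    obtain w where w: "w \<in> carrier (level F (Suc n))" and wi: "\<And>i. \<lbrakk>Suc r < i; i \<le> Suc n\<rbrakk> \<Longrightarrow> face F (Suc n) i w = x i"
      using Suc r by auto
    interpret d: linear_map K "level F (Suc n)" "level F n" "face F (Suc n) (Suc r)" using r by (intro face_map) simp
    interpret s: linear_map K "level F n" "level F (Suc n)" "degen F n r" using r by (intro degen_map)
    define u where "u = x (Suc r) \<ominus>\<^bsub>level F n\<^esub> face F (Suc n) (Suc r) w"
    \<comment> \<open>Adding \<open>s\<^sub>r u\<close> corrects the face \<open>r + 1\<close>; as \<open>d\<^sub>i\<^sub>-\<^sub>1 u = 0\<close> for \<open>i > r + 1\<close>, it keeps the later faces.\<close>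
    have c: "x (Suc r) \<in> carrier (level F n)" "face F (Suc n) (Suc r) w \<in> carrier (level F n)"
      using x r w by auto
    then have u: "u \<in> carrier (level F n)" by (simp add: u_def)
    have "face F (Suc n) i (w \<oplus>\<^bsub>level F (Suc n)\<^esub> degen F n r u) = x i" if i: "r < i" "i \<le> Suc n" for i
    proof (cases "i = Suc r")
      case True
      have "face F (Suc n) (Suc r) (degen F n r u) = u" using face_degen_same[of "Suc r" r n u] r u by simp
      then have "face F (Suc n) (Suc r) (w \<oplus>\<^bsub>level F (Suc n)\<^esub> degen F n r u) = face F (Suc n) (Suc r) w \<oplus>\<^bsub>level F n\<^esub> u"
        using w u by simp
      also have "\<dots> = x (Suc r)" using c by (simp add: u_def a_minus_def L.a_comm L.a_lcomm L.r_neg)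
      finally show ?thesis using True by simp
    next
      case False
      then obtain k where n: "n = Suc k" using i by (cases n) auto
      interpret di: linear_map K "level F (Suc n)" "level F n" "face F (Suc n) i" using i by (intro face_map) simp
      interpret dk: linear_map K "level F n" "level F k" "face F n (i - 1)" unfolding n using i n by (intro face_map) simp
      interpret sk: linear_map K "level F k" "level F (Suc k)" "degen F k r" using i False n by (intro degen_map) simp
      have "face F n (i - 1) u = \<zero>\<^bsub>level F k\<^esub>"
      proof -
        have "face F n (i - 1) (face F (Suc n) (Suc r) w) = face F n (Suc r) (face F (Suc n) i w)"
          using face_face'[of "Suc r" i k w] False i w n by simp
        also have "\<dots> = face F n (i - 1) (x (Suc r))" using wi[of i] compat[OF n, of "Suc r" i] False i by simp
        finally show ?thesis using c dk.minus[OF c] dk.closed[OF c(1)] by (simp add: u_def dk.W.minus_zero_iff)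
      qed
      then have "face F (Suc n) i (degen F n r u) = \<zero>\<^bsub>level F n\<^esub>"
        using face_degen_greater[of r i n u] False i u sk.zero n by simp
      moreover have "face F (Suc n) i w = x i" using wi False i by simp
      ultimately show ?thesis using w u x[of i] i by simp
    qed
    then show ?case unfolding r(2) using w s.closed[OF u]
      by (intro bexI[of _ "w \<oplus>\<^bsub>level F (Suc n)\<^esub> degen F n r u"]) auto
  qed
  from this[of "Suc n"] show ?thesis by (auto simp: Suc_le_eq)
qed

end

context free_simplicial_resolution
begin

lemma target_module: "module K A"
  by (rule awb_module[OF target_awb])

lemma augmentation_lin: "\<epsilon> \<in> lin_hom K (level F 0) A"
  by (rule awb_hom_lin[OF augmentation_hom])

lemma augmentation_map: "linear_map K (level F 0) A \<epsilon>"
  by (intro linear_mapI level_module target_module augmentation_lin)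

text \<open>Here and in the next lemma the vanishing of \<open>\<pi>\<^sub>n(F)\<close> and the isomorphism \<open>\<pi>\<^sub>0(F) \<cong> A\<close> are turned
  from statements about cosets into statements about elements.\<close>

lemma moore_cycle_boundary:
  assumes z: "z \<in> carrier (level F (Suc n))" and "\<And>i. i \<le> Suc n \<Longrightarrow> face F (Suc n) i z = \<zero>\<^bsub>level F n\<^esub>"
  shows "\<exists>t\<in>carrier (moore_chain F (Suc (Suc n))). z = face F (Suc (Suc n)) 0 t"
proof -
  interpret L: module K "level F (Suc n)" by (rule level_module)
  interpret U: module K "level F (Suc (Suc n))" by (rule level_module)
  let ?B = "moore_boundary F (Suc n + 1) ` carrier (moore_chain F (Suc n + 1))"
  let ?H = "homotopy_group F (Suc n)"
  define M where "M = (moore_chain F (Suc n))\<lparr>carrier := {x \<in> carrier (moore_chain F (Suc n)).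
    moore_boundary F (Suc n) x = \<zero>\<^bsub>moore_chain F (Suc n - 1)\<^esub>}\<rparr>"
  have "z \<in> carrier M" using assms by (auto simp: M_def moore_chain_def moore_boundary_def)
  then have "?B +>\<^bsub>M\<^esub> z \<in> carrier ?H"
    by (auto simp: homotopy_group_def homology_def quot_space_carrier M_def)
  then have "?B +>\<^bsub>M\<^esub> z = ?B"
    using homotopy_trivial[of "Suc n"] by (auto simp: homotopy_group_def homology_def quot_space_def)
  moreover have "z \<in> ?B +>\<^bsub>M\<^esub> z"
  proof -
    have "\<zero>\<^bsub>level F (Suc (Suc n))\<^esub> \<in> carrier (moore_chain F (Suc (Suc n)))"
      using linear_map.zero[OF face_map] by (auto simp: moore_chain_def)
    moreover have "face F (Suc (Suc n)) 0 \<zero>\<^bsub>level F (Suc (Suc n))\<^esub> = \<zero>\<^bsub>level F (Suc n)\<^esub>"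
      using linear_map.zero[OF face_map[of 0 "Suc n"]] by simp
    ultimately have "\<zero>\<^bsub>level F (Suc n)\<^esub> \<in> ?B" by (auto simp: moore_boundary_def intro!: image_eqI)
    moreover have "\<zero>\<^bsub>level F (Suc n)\<^esub> \<oplus>\<^bsub>M\<^esub> z = z" using z by (simp add: M_def moore_chain_def)
    ultimately show ?thesis unfolding a_r_coset_def' by force
  qed
  ultimately show ?thesis by (auto simp: moore_boundary_def)
qed

lemma augmentation_surj: "a \<in> carrier A \<Longrightarrow> \<exists>x\<in>carrier (level F 0). \<epsilon> x = a"
  and augmentation_kernel: "\<lbrakk>x \<in> carrier (level F 0); y \<in> carrier (level F 0); \<epsilon> x = \<epsilon> y\<rbrakk> \<Longrightarrow>
    \<exists>t\<in>carrier (moore_chain F 1). x = face F 1 0 t \<oplus>\<^bsub>level F 0\<^esub> y"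
proof -
  interpret \<epsilon>: linear_map K "level F 0" A \<epsilon> by (rule augmentation_map)
  interpret U: module K "level F (Suc 0)" by (rule level_module)
  let ?B = "moore_boundary F 1 ` carrier (moore_chain F 1)" and ?H = "homotopy_group F 0"
  define M where "M = (moore_chain F 0)\<lparr>carrier := {x \<in> carrier (moore_chain F 0).
    moore_boundary F 0 x = \<zero>\<^bsub>moore_chain F (0 - 1)\<^esub>}\<rparr>"
  have M: "carrier M = carrier (level F 0)" "add M = add (level F 0)"
    by (auto simp: M_def moore_chain_def moore_boundary_def)
  have H: "carrier ?H = (\<lambda>x. ?B +>\<^bsub>M\<^esub> x) ` carrier (level F 0)"
    unfolding M(1)[symmetric] by (simp add: homotopy_group_def homology_def quot_space_carrier M_def)
  have cos: "?B +>\<^bsub>M\<^esub> x = {face F 1 0 t \<oplus>\<^bsub>level F 0\<^esub> x | t. t \<in> carrier (moore_chain F 1)}" for x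
    by (auto simp: a_r_coset_def' M moore_boundary_def)
  have z: "\<zero>\<^bsub>level F 1\<^esub> \<in> carrier (moore_chain F 1)" "face F 1 0 \<zero>\<^bsub>level F 1\<^esub> = \<zero>\<^bsub>level F 0\<^esub>"
    using linear_map.zero[OF face_map[of _ 0]] by (auto simp: moore_chain_def)
  have self: "x \<in> ?B +>\<^bsub>M\<^esub> x" if "x \<in> carrier (level F 0)" for x
  proof -
    have "x = face F 1 0 \<zero>\<^bsub>level F 1\<^esub> \<oplus>\<^bsub>level F 0\<^esub> x" unfolding z(2) using that by simp
    then show ?thesis unfolding cos using z(1) by blast
  qed
  have val: "quot_lift \<epsilon> (?B +>\<^bsub>M\<^esub> x) = \<epsilon> x" if x: "x \<in> carrier (level F 0)" for x
  proof -
    have "\<epsilon> (face F 1 0 t \<oplus>\<^bsub>level F 0\<^esub> x) = \<epsilon> x" if t: "t \<in> carrier (moore_chain F 1)" for t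
    proof -
      have t': "t \<in> carrier (level F 1)" "face F 1 1 t = \<zero>\<^bsub>level F 0\<^esub>" using t by (auto simp: moore_chain_def)
      then have "face F 1 0 t \<in> carrier (level F 0)" "\<epsilon> (face F 1 0 t) = \<zero>\<^bsub>A\<^esub>"
        using linear_map.closed[OF face_map[of 0 0], of t] augmentation[of t] by auto
      then show ?thesis using x by simp
    qed
    then have "\<epsilon> ` (?B +>\<^bsub>M\<^esub> x) = {\<epsilon> x}" using self[OF x] unfolding cos by blast
    then show ?thesis by (simp add: quot_lift_def)
  qed
  show "\<exists>x\<in>carrier (level F 0). \<epsilon> x = a" if "a \<in> carrier A"
  proof -
    have "a \<in> quot_lift \<epsilon> ` carrier ?H" using homotopy_zero \<open>a \<in> carrier A\<close> by (simp add: bij_betw_def)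
    then show ?thesis unfolding H using val by auto
  qed
  show "\<exists>t\<in>carrier (moore_chain F 1). x = face F 1 0 t \<oplus>\<^bsub>level F 0\<^esub> y"
    if x: "x \<in> carrier (level F 0)" and y: "y \<in> carrier (level F 0)" and e: "\<epsilon> x = \<epsilon> y"
  proof -
    have "?B +>\<^bsub>M\<^esub> x = ?B +>\<^bsub>M\<^esub> y"
      by (rule inj_onD[OF bij_betw_imp_inj_on[OF homotopy_zero]]) (use x y e in \<open>auto simp: val H simp del: One_nat_def\<close>)
    then show ?thesis using self[OF x] unfolding cos by blast
  qed
qed

text \<open>After a horn filler has taken care of all other faces, the error in face \<open>0\<close> is a cycle of the Moore
  complex, hence face \<open>0\<close> of an element whose other faces vanish.  In degree \<open>0\<close> the augmentation
  takes the place of the missing faces.\<close>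

lemma sphere_filler:
  assumes x: "\<And>i. i \<le> Suc n \<Longrightarrow> x i \<in> carrier (level F n)"
    and compat: "\<And>i j m. \<lbrakk>n = Suc m; i < j; j \<le> Suc n\<rbrakk> \<Longrightarrow> face F n i (x j) = face F n (j - 1) (x i)"
    and compat_0: "n = 0 \<Longrightarrow> \<epsilon> (x 0) = \<epsilon> (x 1)"
  shows "\<exists>y\<in>carrier (level F (Suc n)). \<forall>i\<le>Suc n. face F (Suc n) i y = x i"
proof -
  interpret U: module K "level F (Suc n)" by (rule level_module)
  interpret L: module K "level F n" by (rule level_module)
  interpret d0: linear_map K "level F (Suc n)" "level F n" "face F (Suc n) 0" by (intro face_map) simp
  obtain y where y: "y \<in> carrier (level F (Suc n))" and yi: "\<And>i. \<lbrakk>1 \<le> i; i \<le> Suc n\<rbrakk> \<Longrightarrow> face F (Suc n) i y = x i"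
    using horn_filler[of n x] x compat by auto
  have c: "x 0 \<in> carrier (level F n)" "face F (Suc n) 0 y \<in> carrier (level F n)" using x y by auto
  have "\<exists>t\<in>carrier (moore_chain F (Suc n)). x 0 = face F (Suc n) 0 t \<oplus>\<^bsub>level F n\<^esub> face F (Suc n) 0 y"
  proof (cases n)
    case 0
    have "\<epsilon> (face F 1 0 y) = \<epsilon> (x 0)" using augmentation[of y] yi[of 1] compat_0 y 0 by simp
    then show ?thesis using augmentation_kernel[of "x 0" "face F 1 0 y"] c 0 by simp
  next
    case (Suc m)
    have "face F n i (x 0 \<ominus>\<^bsub>level F n\<^esub> face F (Suc n) 0 y) = \<zero>\<^bsub>level F m\<^esub>" if i: "i \<le> n" for i
    proof -
      interpret di: linear_map K "level F n" "level F m" "face F n i" unfolding Suc using i Suc by (intro face_map) simp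
      have "face F n i (face F (Suc n) 0 y) = face F n 0 (face F (Suc n) (Suc i) y)"
        using face_face'[of 0 "Suc i" m y] i y Suc by simp
      also have "\<dots> = face F n i (x 0)" using yi[of "Suc i"] compat[OF Suc, of 0 "Suc i"] i by simp
      finally show ?thesis using c by (simp add: di.W.minus_zero_iff)
    qed
    then obtain t where t: "t \<in> carrier (moore_chain F (Suc n))"
      "x 0 \<ominus>\<^bsub>level F n\<^esub> face F (Suc n) 0 y = face F (Suc n) 0 t"
      using moore_cycle_boundary[of "x 0 \<ominus>\<^bsub>level F n\<^esub> face F (Suc n) 0 y" m] c Suc L.minus_closed by auto
    have "x 0 = face F (Suc n) 0 t \<oplus>\<^bsub>level F n\<^esub> face F (Suc n) 0 y"
      unfolding t(2)[symmetric] using c by (simp add: a_minus_def L.a_assoc L.l_neg)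
    then show ?thesis using t(1) by blast
  qed
  then obtain t where t: "t \<in> carrier (level F (Suc n))" "\<And>i. \<lbrakk>1 \<le> i; i \<le> Suc n\<rbrakk> \<Longrightarrow> face F (Suc n) i t = \<zero>\<^bsub>level F n\<^esub>"
    and t0: "x 0 = face F (Suc n) 0 t \<oplus>\<^bsub>level F n\<^esub> face F (Suc n) 0 y"
    by (auto simp: moore_chain_def)
  have "face F (Suc n) i (t \<oplus>\<^bsub>level F (Suc n)\<^esub> y) = x i" if i: "i \<le> Suc n" for i
    using linear_map.add[OF face_map[OF i] t(1) y] t(2)[of i] yi[of i] x[OF i] t0 i by (cases i) auto
  then show ?thesis using t(1) y by blast
qed

text \<open>
  The contraction is an extra degeneracy: besides the homotopy identity it satisfies the simplicial
  identities with all faces.  These are preserved by every functor applied in each degree, so the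
  tensor powers of the simplicial vector space are contracted as well.
\<close>

lemma extra_degeneracy:
  "\<exists>e h. e \<in> lin_hom K A (level F 0) \<and> (\<forall>x\<in>carrier A. \<epsilon> (e x) = x) \<and>
    (\<forall>n. h n \<in> lin_hom K (level F n) (level F (Suc n))) \<and>
    (\<forall>n. \<forall>x\<in>carrier (level F n). face F (Suc n) 0 (h n x) = x) \<and>
    (\<forall>x\<in>carrier (level F 0). face F 1 1 (h 0 x) = e (\<epsilon> x)) \<and>
    (\<forall>n. \<forall>x\<in>carrier (level F (Suc n)). \<forall>i\<le>Suc n.
      face F (Suc (Suc n)) (Suc i) (h (Suc n) x) = h n (face F (Suc n) i x))"
proof -
  note K = awb_field[OF target_awb]
  interpret \<epsilon>: linear_map K "level F 0" A \<epsilon> by (rule augmentation_map)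
  obtain e where e: "e \<in> lin_hom K A (level F 0)" "\<And>x. x \<in> carrier A \<Longrightarrow> \<epsilon> (e x) = x"
    using linear_choice[OF K target_module level_module[of 0], of "\<lambda>a x. \<epsilon> x = a"] augmentation_surj by auto
  have section_of_faces: "\<exists>h\<in>lin_hom K (level F n) (level F (Suc n)). \<forall>x\<in>carrier (level F n).
      face F (Suc n) 0 (h x) = x \<and> (\<forall>i\<le>n. face F (Suc n) (Suc i) (h x) = g i x)"
    if g: "\<And>i. i \<le> n \<Longrightarrow> g i \<in> lin_hom K (level F n) (level F n)"
      and compat: "\<And>i j x. \<lbrakk>n \<noteq> 0; i < j; j \<le> n; x \<in> carrier (level F n)\<rbrakk> \<Longrightarrow>
        face F n (Suc i) (g j x) = face F n j (g i x)"
      and compat_0: "\<And>j x. \<lbrakk>n \<noteq> 0; j \<le> n; x \<in> carrier (level F n)\<rbrakk> \<Longrightarrow> face F n 0 (g j x) = face F n j x"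
      and compat_\<epsilon>: "\<And>x. \<lbrakk>n = 0; x \<in> carrier (level F 0)\<rbrakk> \<Longrightarrow> \<epsilon> (g 0 x) = \<epsilon> x" for n g
  proof -
    have f: "face F (Suc n) i \<in> lin_hom K (level F (Suc n)) (level F n)" if "i \<le> Suc n" for i
      using face_map[OF that] by (simp add: linear_map.lin)
    let ?R = "\<lambda>x y. face F (Suc n) 0 y = x \<and> (\<forall>i\<le>n. face F (Suc n) (Suc i) y = g i x)"
    show ?thesis
    proof (rule linear_choice[OF K level_module level_module, of n "Suc n" ?R])
      fix x assume x: "x \<in> carrier (level F n)"
      have "\<exists>y\<in>carrier (level F (Suc n)). \<forall>i\<le>Suc n. face F (Suc n) i y = (case i of 0 \<Rightarrow> x | Suc j \<Rightarrow> g j x)"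
        using x lin_hom_closed[OF g x] compat[of _ _ x] compat_0[of _ x] compat_\<epsilon>[of x]
        by (intro sphere_filler) (auto split: nat.split)
      then obtain y where y: "y \<in> carrier (level F (Suc n))"
        "\<And>i. i \<le> Suc n \<Longrightarrow> face F (Suc n) i y = (case i of 0 \<Rightarrow> x | Suc j \<Rightarrow> g j x)" by blast
      have "?R x y" using y(2)[of 0] y(2)[of "Suc _"] by auto
      then show "\<exists>y\<in>carrier (level F (Suc n)). ?R x y" using y(1) by blast
    next
      fix x y x' y' assume c: "x \<in> carrier (level F n)" "x' \<in> carrier (level F n)"
          "y \<in> carrier (level F (Suc n))" "y' \<in> carrier (level F (Suc n))" and R: "?R x y" "?R x' y'"
      show "?R (x \<oplus>\<^bsub>level F n\<^esub> x') (y \<oplus>\<^bsub>level F (Suc n)\<^esub> y')"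
        using R by (auto simp: lin_hom_add[OF f c(3,4)] lin_hom_add[OF g c(1,2)])
    next
      fix k x y assume c: "k \<in> carrier K" "x \<in> carrier (level F n)" "y \<in> carrier (level F (Suc n))" and R: "?R x y"
      show "?R (k \<odot>\<^bsub>level F n\<^esub> x) (k \<odot>\<^bsub>level F (Suc n)\<^esub> y)"
        using R by (auto simp: lin_hom_smult[OF f c(1,3)] lin_hom_smult[OF g c(1,2)])
    qed
  qed
  \<comment> \<open>The last clause of the invariant is what the family of faces prescribed for the next map needs to
    be compatible; it follows from \<open>?Q\<close> for the step before.\<close>
  let ?P = "\<lambda>n h. h \<in> lin_hom K (level F n) (level F (Suc n)) \<and>
      (\<forall>x\<in>carrier (level F n). face F (Suc n) 0 (h x) = x) \<and>
      (n = 0 \<longrightarrow> (\<forall>x\<in>carrier (level F 0). face F 1 1 (h x) = e (\<epsilon> x))) \<and>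
      (\<forall>x\<in>carrier (level F (Suc n)). \<forall>i j. i < j \<longrightarrow> j \<le> Suc n \<longrightarrow>
        face F (Suc n) (Suc i) (h (face F (Suc n) j x)) = face F (Suc n) j (h (face F (Suc n) i x)))"
  let ?Q = "\<lambda>n h h'. \<forall>x\<in>carrier (level F (Suc n)). \<forall>i\<le>Suc n. face F (Suc (Suc n)) (Suc i) (h' x) = h (face F (Suc n) i x)"
  have "\<exists>h. \<forall>n. ?P n (h n) \<and> ?Q n (h n) (h (Suc n))"
  proof (rule dependent_nat_choice)
    obtain h where h: "h \<in> lin_hom K (level F 0) (level F (Suc 0))"
      "\<And>x. x \<in> carrier (level F 0) \<Longrightarrow> face F (Suc 0) 0 (h x) = x"
      "\<And>x. x \<in> carrier (level F 0) \<Longrightarrow> face F (Suc 0) (Suc 0) (h x) = e (\<epsilon> x)"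
      using section_of_faces[of 0 "\<lambda>i x. e (\<epsilon> x)"] lin_hom_compose[OF augmentation_lin e(1)] e(2) by auto
    have "face F (Suc 0) (Suc i) (h (face F (Suc 0) j x)) = face F (Suc 0) j (h (face F (Suc 0) i x))"
      if "x \<in> carrier (level F (Suc 0))" "i < j" "j \<le> Suc 0" for x i j
    proof -
      have ij: "i = 0" "j = Suc 0" using that by auto
      show ?thesis unfolding ij using h(3) augmentation[of x] that(1) linear_map.closed[OF face_map, of _ 0 x] by simp
    qed
    then show "\<exists>h. ?P 0 h" using h by auto
  next
    fix h n assume P: "?P n h"
    then have h: "h \<in> lin_hom K (level F n) (level F (Suc n))" by blast
    have f: "face F (Suc n) i \<in> lin_hom K (level F (Suc n)) (level F n)" if "i \<le> Suc n" for i
      using face_map[OF that] by (simp add: linear_map.lin)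
    obtain h' where h': "h' \<in> lin_hom K (level F (Suc n)) (level F (Suc (Suc n)))"
      "\<And>x. x \<in> carrier (level F (Suc n)) \<Longrightarrow> face F (Suc (Suc n)) 0 (h' x) = x"
      "?Q n h h'"
      using section_of_faces[of "Suc n" "\<lambda>i x. h (face F (Suc n) i x)"] lin_hom_compose[OF f h] P lin_hom_closed[OF f]
      by auto
    have "face F (Suc (Suc n)) (Suc i) (h' (face F (Suc (Suc n)) j x)) = face F (Suc (Suc n)) j (h' (face F (Suc (Suc n)) i x))"
      if x: "x \<in> carrier (level F (Suc (Suc n)))" "i < j" "j \<le> Suc (Suc n)" for x i j
    proof -
      have c: "face F (Suc (Suc n)) i x \<in> carrier (level F (Suc n))" "face F (Suc (Suc n)) j x \<in> carrier (level F (Suc n))"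
        using x linear_map.closed[OF face_map] by auto
      obtain j' where j: "j = Suc j'" using x by (cases j) auto
      show ?thesis using h'(3) c x face_face'[of i j n x] by (simp add: j)
    qed
    then show "\<exists>h'. ?P (Suc n) h' \<and> ?Q n h h'" using h' by auto
  qed
  then obtain h where h: "\<forall>n. ?P n (h n) \<and> ?Q n (h n) (h (Suc n))" by (elim exE)
  then have P: "?P n (h n)" and Q: "?Q n (h n) (h (Suc n))" for n by simp_all
  have "\<forall>x\<in>carrier (level F 0). face F 1 1 (h 0 x) = e (\<epsilon> x)" using P[of 0] by simp
  then show ?thesis using P Q e by (intro exI[of _ e] exI[of _ h]) simp
qed

end

section \<open>Tensor powers and the boundary in components\<close>

lemma multilinearI:
  assumes "\<And>xs. xs \<in> tuples V n \<Longrightarrow> g xs \<in> carrier W"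
    and "\<And>xs i a b. \<lbrakk>xs \<in> tuples V n; i < n; a \<in> carrier V; b \<in> carrier V\<rbrakk> \<Longrightarrow>
      g (xs[i := a \<oplus>\<^bsub>V\<^esub> b]) = g (xs[i := a]) \<oplus>\<^bsub>W\<^esub> g (xs[i := b])"
    and "\<And>xs i k a. \<lbrakk>xs \<in> tuples V n; i < n; k \<in> carrier K; a \<in> carrier V\<rbrakk> \<Longrightarrow>
      g (xs[i := k \<odot>\<^bsub>V\<^esub> a]) = k \<odot>\<^bsub>W\<^esub> g (xs[i := a])"
  shows "multilinear K V n W g"
  unfolding multilinear_def by (intro conjI ballI allI impI funcsetI; rule assms; assumption)

locale vector_space = field K + module K V
  for K (structure) and V (structure)

sublocale vector_space \<subseteq> T: module K "tensor_power K V n" for n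
  by (rule tensor_power_module[OF field_axioms module_axioms])

context vector_space
begin

abbreviation "T n \<equiv> tensor_power K V n"
abbreviation "pt \<equiv> pure_tensor K V"

lemma pure_closed: "xs \<in> tuples V n \<Longrightarrow> pt xs \<in> carrier (T n)"
  by (rule pure_tensor_carrier[OF field_axioms])

lemma multilinear_pure: "multilinear K V n (T n) pt"
  by (intro multilinearI pure_closed pure_tensor_add[OF field_axioms module_axioms]
      pure_tensor_smult[OF field_axioms module_axioms])

lemma tensor_induct [consumes 1, case_names pure add smult]:
  assumes u: "u \<in> carrier (T n)"
    and pure: "\<And>xs. xs \<in> tuples V n \<Longrightarrow> P (pt xs)"
    and add: "\<And>x y. \<lbrakk>x \<in> carrier (T n); y \<in> carrier (T n); P x; P y\<rbrakk> \<Longrightarrow> P (x \<oplus>\<^bsub>T n\<^esub> y)"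
    and smult: "\<And>k x. \<lbrakk>k \<in> carrier K; x \<in> carrier (T n); P x\<rbrakk> \<Longrightarrow> P (k \<odot>\<^bsub>T n\<^esub> x)"
  shows "P u"
proof -
  let ?F = "free_space K (tuples V n)" and ?N = "multilinear_span K V n"
  interpret F: module K ?F by (rule free_space_module[OF field_axioms])
  have q: "(\<lambda>f. ?N +>\<^bsub>?F\<^esub> f) \<in> lin_hom K ?F (T n)"
    unfolding tensor_power_def
    by (rule quot_proj[OF field_axioms F.module_axioms multilinear_span_submodule[OF field_axioms module_axioms]])
  interpret q: linear_map K ?F "T n" "\<lambda>f. ?N +>\<^bsub>?F\<^esub> f"
    by (rule linear_mapI[OF F.module_axioms T.module_axioms q])
  have "P (?N +>\<^bsub>?F\<^esub> f)" if "f \<in> carrier ?F" for f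
    using field_axioms that
  proof (induction rule: free_space_induct)
    case zero
    \<comment> \<open>Zero is the zero multiple of a pure tensor.\<close>
    have xs: "replicate n \<zero>\<^bsub>V\<^esub> \<in> tuples V n" by (auto simp: tuples_def)
    have "P (\<zero> \<odot>\<^bsub>T n\<^esub> pt (replicate n \<zero>\<^bsub>V\<^esub>))" by (intro smult pure pure_closed xs) simp
    then show ?case using pure_closed[OF xs] q.zero by simp
  next
    case (step k xs f)
    have b: "basis_elem K xs \<in> carrier ?F" by (rule basis_elem_carrier[OF field_axioms step(2)])
    have "?N +>\<^bsub>?F\<^esub> (k \<odot>\<^bsub>?F\<^esub> basis_elem K xs \<oplus>\<^bsub>?F\<^esub> f) = k \<odot>\<^bsub>T n\<^esub> pt xs \<oplus>\<^bsub>T n\<^esub> (?N +>\<^bsub>?F\<^esub> f)"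
      using step b by (simp add: pure_tensor_def tuples_length F.smult_closed)
    then show ?case using step pure_closed[OF step(2)] by (auto intro!: add smult pure)
  qed
  moreover obtain f where "f \<in> carrier ?F" "u = ?N +>\<^bsub>?F\<^esub> f"
    using u by (auto simp: tensor_power_def quot_space_carrier)
  ultimately show ?thesis by simp
qed

lemma tensor_ext:
  assumes W: "module K W" and f: "f \<in> lin_hom K (T n) W" and g: "g \<in> lin_hom K (T n) W"
    and eq: "\<And>xs. xs \<in> tuples V n \<Longrightarrow> f (pt xs) = g (pt xs)" and u: "u \<in> carrier (T n)"
  shows "f u = g u"
  using u by (induction rule: tensor_induct)
    (simp_all add: eq lin_hom_add[OF f] lin_hom_add[OF g] lin_hom_smult[OF f] lin_hom_smult[OF g])

lemma tensor_lift_map: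
  assumes "module K W" "multilinear K V n W g"
  shows "linear_map K (T n) W (tensor_lift K W g)"
  using assms by (intro linear_mapI T.module_axioms multilinear_lift(1)[OF field_axioms module_axioms])

lemma tensor_lift_pure:
  assumes "module K W" "multilinear K V n W g" "xs \<in> tuples V n"
  shows "tensor_lift K W g (pt xs) = g xs"
  using multilinear_lift(2)[OF field_axioms module_axioms assms(1,2)] assms(3) by simp

end

lemma multilinear_closed: "\<lbrakk>multilinear K V n W g; xs \<in> tuples V n\<rbrakk> \<Longrightarrow> g xs \<in> carrier W"
  by (auto simp: multilinear_def)

lemma
  assumes "multilinear K V n W g" "xs \<in> tuples V n" "i < n" "a \<in> carrier V"
  shows multilinear_addD: "b \<in> carrier V \<Longrightarrow> g (xs[i := a \<oplus>\<^bsub>V\<^esub> b]) = g (xs[i := a]) \<oplus>\<^bsub>W\<^esub> g (xs[i := b])"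
    and multilinear_smultD: "k \<in> carrier K \<Longrightarrow> g (xs[i := k \<odot>\<^bsub>V\<^esub> a]) = k \<odot>\<^bsub>W\<^esub> g (xs[i := a])"
  using assms by (simp_all add: multilinear_def)

lemma multilinear_lin_hom:
  assumes g: "multilinear K V n W g" and f: "f \<in> lin_hom K W W'"
  shows "multilinear K V n W' (\<lambda>xs. f (g xs))"
proof (rule multilinearI)
  note c = multilinear_closed[OF g] and u = tuples_update
  show "f (g xs) \<in> carrier W'" if "xs \<in> tuples V n" for xs using that by (intro lin_hom_closed[OF f] c)
  fix xs i assume xs: "xs \<in> tuples V n" "i < n"
  show "f (g (xs[i := a \<oplus>\<^bsub>V\<^esub> b])) = f (g (xs[i := a])) \<oplus>\<^bsub>W'\<^esub> f (g (xs[i := b]))"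
    if "a \<in> carrier V" "b \<in> carrier V" for a b
    unfolding multilinear_addD[OF g xs that] using xs that by (intro lin_hom_add[OF f] c u)
  show "f (g (xs[i := k \<odot>\<^bsub>V\<^esub> a])) = k \<odot>\<^bsub>W'\<^esub> f (g (xs[i := a]))"
    if "k \<in> carrier K" "a \<in> carrier V" for k a
    unfolding multilinear_smultD[OF g xs that(2,1)] using xs that by (intro lin_hom_smult[OF f] c u)
qed

lemma map_tuples: "\<lbrakk>xs \<in> tuples V n; f \<in> lin_hom K V W\<rbrakk> \<Longrightarrow> map f xs \<in> tuples W n"
  by (auto simp: tuples_def lin_hom_def Pi_iff)

lemma multilinear_map:
  assumes g: "multilinear K W n U g" and f: "f \<in> lin_hom K V W"
  shows "multilinear K V n U (\<lambda>xs. g (map f xs))"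
proof (rule multilinearI)
  note fc = lin_hom_closed[OF f]
  show "g (map f xs) \<in> carrier U" if "xs \<in> tuples V n" for xs
    using multilinear_closed[OF g map_tuples[OF that f]] .
  fix xs i assume xs: "xs \<in> tuples V n" "i < n"
  show "g (map f (xs[i := a \<oplus>\<^bsub>V\<^esub> b])) = g (map f (xs[i := a])) \<oplus>\<^bsub>U\<^esub> g (map f (xs[i := b]))"
    if "a \<in> carrier V" "b \<in> carrier V" for a b
    unfolding map_update lin_hom_add[OF f that]
    by (rule multilinear_addD[OF g map_tuples[OF xs(1) f] xs(2) fc[OF that(1)] fc[OF that(2)]])
  show "g (map f (xs[i := k \<odot>\<^bsub>V\<^esub> a])) = k \<odot>\<^bsub>U\<^esub> g (map f (xs[i := a]))"
    if "k \<in> carrier K" "a \<in> carrier V" for k a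
    unfolding map_update lin_hom_smult[OF f that]
    by (rule multilinear_smultD[OF g map_tuples[OF xs(1) f] xs(2) fc[OF that(2)] that(1)])
qed

definition tensor_map ::
  "('k, 'r) ring_scheme \<Rightarrow> ('k, 'w, 'n) module_scheme \<Rightarrow> nat \<Rightarrow> ('v \<Rightarrow> 'w) \<Rightarrow>
   ('v list \<Rightarrow> 'k) set \<Rightarrow> ('w list \<Rightarrow> 'k) set"
  where "tensor_map K W n f = tensor_lift K (tensor_power K W n) (\<lambda>xs. pure_tensor K W (map f xs))"

lemma
  assumes K: "field K" and V: "module K V" and W: "module K W" and f: "f \<in> lin_hom K V W"
  shows tensor_map_map: "linear_map K (tensor_power K V n) (tensor_power K W n) (tensor_map K W n f)"
    and tensor_map_pure: "xs \<in> tuples V n \<Longrightarrow>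
      tensor_map K W n f (pure_tensor K V xs) = pure_tensor K W (map f xs)"
proof -
  interpret V: vector_space K V using K V by (simp add: vector_space_def)
  interpret W: vector_space K W using K W by (simp add: vector_space_def)
  note m = multilinear_map[OF W.multilinear_pure f]
  show "linear_map K (tensor_power K V n) (tensor_power K W n) (tensor_map K W n f)"
    unfolding tensor_map_def by (rule V.tensor_lift_map[OF W.T.module_axioms m])
  show "xs \<in> tuples V n \<Longrightarrow> tensor_map K W n f (pure_tensor K V xs) = pure_tensor K W (map f xs)"
    unfolding tensor_map_def by (rule V.tensor_lift_pure[OF W.T.module_axioms m])
qed

lemma tensor_map_compose:
  assumes K: "field K" and U: "module K U" and V: "module K V" and W: "module K W"
    and f: "f \<in> lin_hom K U V" and g: "g \<in> lin_hom K V W" and h: "h \<in> lin_hom K U W"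
    and eq: "\<And>x. x \<in> carrier U \<Longrightarrow> g (f x) = h x" and u: "u \<in> carrier (tensor_power K U n)"
  shows "tensor_map K W n g (tensor_map K V n f u) = tensor_map K W n h u"
proof -
  interpret U: vector_space K U using K U by (simp add: vector_space_def)
  show ?thesis
  proof (rule U.tensor_ext[OF _ _ _ _ u])
    show "module K (tensor_power K W n)" by (rule tensor_power_module[OF K W])
    show "(\<lambda>u. tensor_map K W n g (tensor_map K V n f u)) \<in> lin_hom K (U.T n) (tensor_power K W n)"
      by (rule lin_hom_compose[OF linear_map.lin linear_map.lin,
            OF tensor_map_map[OF K U V f] tensor_map_map[OF K V W g]])
    show "tensor_map K W n h \<in> lin_hom K (U.T n) (tensor_power K W n)"
      by (rule linear_map.lin[OF tensor_map_map[OF K U W h]])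
    fix xs assume xs: "xs \<in> tuples U n"
    have "map g (map f xs) = map h xs" using xs eq by (auto simp: tuples_def)
    then show "tensor_map K W n g (tensor_map K V n f (pure_tensor K U xs)) = tensor_map K W n h (pure_tensor K U xs)"
      using xs map_tuples[OF xs f]
      by (simp add: tensor_map_pure[OF K U V f] tensor_map_pure[OF K V W g] tensor_map_pure[OF K U W h] del: map_map)
  qed
qed

lemma tensor_map_id:
  assumes K: "field K" and V: "module K V" and eq: "\<And>x. x \<in> carrier V \<Longrightarrow> f x = x"
    and u: "u \<in> carrier (tensor_power K V n)"
  shows "tensor_map K V n f u = u"
proof -
  interpret V: vector_space K V using K V by (simp add: vector_space_def)
  have f: "f \<in> lin_hom K V V" by (rule lin_homI) (simp_all add: eq)
  show ?thesis
  proof (rule V.tensor_ext[OF V.T.module_axioms _ _ _ u])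
    show "tensor_map K V n f \<in> lin_hom K (V.T n) (V.T n)" by (rule linear_map.lin[OF tensor_map_map[OF K V V f]])
    show "(\<lambda>u. u) \<in> lin_hom K (V.T n) (V.T n)" by (simp add: lin_hom_def)
    fix xs assume xs: "xs \<in> tuples V n"
    then have "map f xs = xs" using eq by (auto simp: tuples_def intro!: map_idI)
    then show "tensor_map K V n f (V.pt xs) = V.pt xs" using xs by (simp add: tensor_map_pure[OF K V V f])
  qed
qed

subsection \<open>Alternating sums\<close>

context
  fixes K (structure) assumes K: "field K"
begin

interpretation field K by (rule K)

lemma sgn_pow_closed [simp]: "sgn_pow K i \<in> carrier K"
  by (simp add: sgn_pow_def)

lemma sgn_pow_0 [simp]: "sgn_pow K 0 = \<one>"
  by (simp add: sgn_pow_def)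

lemma sgn_pow_Suc: "sgn_pow K (Suc i) = \<ominus> sgn_pow K i"
  by (simp add: sgn_pow_def r_minus)

lemma sgn_pow_add: "sgn_pow K i \<otimes> sgn_pow K j = sgn_pow K (i + j)"
  by (simp add: sgn_pow_def nat_pow_mult)

end

text \<open>The cancellation behind \<open>d \<circ> d = 0\<close> for alternating sums of faces: \<open>f i j\<close> with \<open>i < j\<close> occurs
  again as \<open>f (j - 1) i\<close>, with the opposite sign.  In the induction the new row \<open>i = p\<close> cancels against
  the new column \<open>j = p + 1\<close>.\<close>

lemma presimplicial_sum:
  fixes K (structure) and M (structure)
  assumes K: "field K" and M: "module K M"
    and closed: "\<And>i j. \<lbrakk>i < m; j \<le> m\<rbrakk> \<Longrightarrow> f i j \<in> carrier M"
    and eq: "\<And>i j. \<lbrakk>i < j; j \<le> m\<rbrakk> \<Longrightarrow> f i j = f (j - 1) i"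
  shows "(\<Oplus>\<^bsub>M\<^esub>j\<in>{..<Suc m}. sgn_pow K j \<odot>\<^bsub>M\<^esub> (\<Oplus>\<^bsub>M\<^esub>i\<in>{..<m}. sgn_pow K i \<odot>\<^bsub>M\<^esub> f i j)) = \<zero>\<^bsub>M\<^esub>"
proof -
  interpret K: field K by fact
  interpret M: module K M by fact
  define t where "t i j = sgn_pow K (i + j) \<odot>\<^bsub>M\<^esub> f i j" for i j
  have s: "sgn_pow K i \<in> carrier K" for i by (rule sgn_pow_closed[OF K])
  have tc: "t i j \<in> carrier M" if "i < m" "j \<le> m" for i j
    using closed that s by (simp add: t_def)
  have "p \<le> m \<Longrightarrow> (\<Oplus>\<^bsub>M\<^esub>j\<in>{..<Suc p}. \<Oplus>\<^bsub>M\<^esub>i\<in>{..<p}. t i j) = \<zero>\<^bsub>M\<^esub>" for p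
  proof (induction p)
    case 0
    then show ?case by simp
  next
    case (Suc p)
    have c: "t i j \<in> carrier M" if "i < Suc p" "j \<le> Suc p" for i j using tc that Suc.prems by simp
    have sum: "(\<Oplus>\<^bsub>M\<^esub>i\<in>{..<Suc p}. g i) = (\<Oplus>\<^bsub>M\<^esub>i\<in>{..<p}. g i) \<oplus>\<^bsub>M\<^esub> g p"
      if "\<And>i. i < Suc p \<Longrightarrow> g i \<in> carrier M" for g
      using that by (simp add: lessThan_Suc M.a_comm M.finsum_closed Pi_iff)
    have "(\<Oplus>\<^bsub>M\<^esub>j\<in>{..<Suc (Suc p)}. \<Oplus>\<^bsub>M\<^esub>i\<in>{..<Suc p}. t i j) =
      (\<Oplus>\<^bsub>M\<^esub>i\<in>{..<Suc p}. t i (Suc p)) \<oplus>\<^bsub>M\<^esub> (\<Oplus>\<^bsub>M\<^esub>j\<in>{..<Suc p}. \<Oplus>\<^bsub>M\<^esub>i\<in>{..<Suc p}. t i j)"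
      unfolding lessThan_Suc[of "Suc p"] using c
      by (intro M.finsum_insert) (auto intro!: M.finsum_closed)
    also have "(\<Oplus>\<^bsub>M\<^esub>j\<in>{..<Suc p}. \<Oplus>\<^bsub>M\<^esub>i\<in>{..<Suc p}. t i j) =
      (\<Oplus>\<^bsub>M\<^esub>j\<in>{..<Suc p}. (\<Oplus>\<^bsub>M\<^esub>i\<in>{..<p}. t i j) \<oplus>\<^bsub>M\<^esub> t p j)"
      using c sum by (intro M.finsum_cong') (auto intro!: M.finsum_closed M.a_closed)
    also have "\<dots> = (\<Oplus>\<^bsub>M\<^esub>j\<in>{..<Suc p}. \<Oplus>\<^bsub>M\<^esub>i\<in>{..<p}. t i j) \<oplus>\<^bsub>M\<^esub> (\<Oplus>\<^bsub>M\<^esub>j\<in>{..<Suc p}. t p j)"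
      using c by (intro M.finsum_addf) (auto intro!: M.finsum_closed)
    also have "\<dots> = (\<Oplus>\<^bsub>M\<^esub>j\<in>{..<Suc p}. t p j)"
      using Suc c by (simp add: M.finsum_closed Pi_iff)
    also have "(\<Oplus>\<^bsub>M\<^esub>i\<in>{..<Suc p}. t i (Suc p)) \<oplus>\<^bsub>M\<^esub> \<dots> = (\<Oplus>\<^bsub>M\<^esub>i\<in>{..<Suc p}. t i (Suc p) \<oplus>\<^bsub>M\<^esub> t p i)"
      using c by (intro M.finsum_addf[symmetric]) auto
    also have "\<dots> = (\<Oplus>\<^bsub>M\<^esub>i\<in>{..<Suc p}. \<zero>\<^bsub>M\<^esub>)"
    proof (intro M.finsum_cong' refl)
      fix i assume "i \<in> {..<Suc p}"
      then have i: "i < Suc p" by simp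
      have "t i (Suc p) = sgn_pow K (Suc (p + i)) \<odot>\<^bsub>M\<^esub> f p i"
        using eq[of i "Suc p"] i Suc.prems by (simp add: t_def add.commute)
      then show "t i (Suc p) \<oplus>\<^bsub>M\<^esub> t p i = \<zero>\<^bsub>M\<^esub>"
        using closed[of p i] i Suc.prems s by (simp add: t_def sgn_pow_Suc[OF K] M.smult_l_minus M.l_neg)
    qed auto
    finally show ?case by simp
  qed
  then have "(\<Oplus>\<^bsub>M\<^esub>j\<in>{..<Suc m}. \<Oplus>\<^bsub>M\<^esub>i\<in>{..<m}. t i j) = \<zero>\<^bsub>M\<^esub>" by simp
  moreover have "sgn_pow K j \<odot>\<^bsub>M\<^esub> (\<Oplus>\<^bsub>M\<^esub>i\<in>{..<m}. sgn_pow K i \<odot>\<^bsub>M\<^esub> f i j) = (\<Oplus>\<^bsub>M\<^esub>i\<in>{..<m}. t i j)"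
    if j: "j < Suc m" for j
  proof -
    have "sgn_pow K j \<odot>\<^bsub>M\<^esub> (\<Oplus>\<^bsub>M\<^esub>i\<in>{..<m}. sgn_pow K i \<odot>\<^bsub>M\<^esub> f i j) =
        (\<Oplus>\<^bsub>M\<^esub>i\<in>{..<m}. sgn_pow K j \<odot>\<^bsub>M\<^esub> (sgn_pow K i \<odot>\<^bsub>M\<^esub> f i j))"
      using j s closed by (intro M.finsum_smult_ldistr) auto
    also have "\<dots> = (\<Oplus>\<^bsub>M\<^esub>i\<in>{..<m}. t i j)"
      using j s closed
      by (intro M.finsum_cong')
        (auto simp: t_def M.smult_assoc1[symmetric] sgn_pow_add[OF K] add.commute)
    finally show ?thesis .
  qed
  then have "(\<Oplus>\<^bsub>M\<^esub>j\<in>{..<Suc m}. sgn_pow K j \<odot>\<^bsub>M\<^esub> (\<Oplus>\<^bsub>M\<^esub>i\<in>{..<m}. sgn_pow K i \<odot>\<^bsub>M\<^esub> f i j)) =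
      (\<Oplus>\<^bsub>M\<^esub>j\<in>{..<Suc m}. \<Oplus>\<^bsub>M\<^esub>i\<in>{..<m}. t i j)"
    using tc by (intro M.finsum_cong') (auto intro!: M.finsum_closed)
  ultimately show ?thesis by simp
qed

lemma (in abelian_monoid) finsum_swap:
  assumes "finite I" "finite J" "\<And>i j. \<lbrakk>i \<in> I; j \<in> J\<rbrakk> \<Longrightarrow> f i j \<in> carrier G"
  shows "(\<Oplus>i\<in>I. \<Oplus>j\<in>J. f i j) = (\<Oplus>j\<in>J. \<Oplus>i\<in>I. f i j)"
  using assms
proof (induction I rule: finite_induct)
  case (insert a I)
  have "(\<Oplus>i\<in>insert a I. \<Oplus>j\<in>J. f i j) = (\<Oplus>j\<in>J. f a j) \<oplus> (\<Oplus>i\<in>I. \<Oplus>j\<in>J. f i j)"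
    using insert by (intro finsum_insert) (auto intro!: finsum_closed)
  also have "\<dots> = (\<Oplus>j\<in>J. f a j) \<oplus> (\<Oplus>j\<in>J. \<Oplus>i\<in>I. f i j)" using insert by simp
  also have "\<dots> = (\<Oplus>j\<in>J. f a j \<oplus> (\<Oplus>i\<in>I. f i j))"
    using insert by (intro finsum_addf[symmetric]) (auto intro!: finsum_closed)
  also have "\<dots> = (\<Oplus>j\<in>J. \<Oplus>i\<in>insert a I. f i j)"
    using insert by (intro finsum_cong') (auto intro!: finsum_closed a_closed)
  finally show ?case .
qed (simp add: finsum_zero)

subsection \<open>The boundary of the complex of an algebra with bracket\<close>

text \<open>
  The complex of \<open>A\<close> is the mapping cone of the chain map \<open>bracket_map\<close>.  The differentials of both
  parts are bar differentials, but the one of the \<open>\<circ>\<close>-part does not touch the last factor: this is why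
  the number \<open>r\<close> of merged positions is a parameter independent of the length \<open>k + 1\<close> of the tensors.
\<close>

definition bar_map ::
  "('k, 'r) ring_scheme \<Rightarrow> ('k, 'a, 'm) awb_scheme \<Rightarrow> nat \<Rightarrow> nat \<Rightarrow> ('a list \<Rightarrow> 'k) set \<Rightarrow> ('a list \<Rightarrow> 'k) set"
  where "bar_map K A r k = tensor_lift K (tensor_power K A k)
    (\<lambda>xs. \<Oplus>\<^bsub>tensor_power K A k\<^esub> i\<in>{..<r}. sgn_pow K i \<odot>\<^bsub>tensor_power K A k\<^esub> pure_tensor K A (merge A i xs))"

definition bracket_map ::
  "('k, 'r) ring_scheme \<Rightarrow> ('k, 'a, 'm) awb_scheme \<Rightarrow> nat \<Rightarrow> ('a list \<Rightarrow> 'k) set \<Rightarrow> ('a list \<Rightarrow> 'k) set"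
  where "bracket_map K A n = tensor_lift K (tensor_power K A n)
    (\<lambda>xs. \<Oplus>\<^bsub>tensor_power K A n\<^esub> j\<in>{..<n}. pure_tensor K A (act A j xs))"

lemma merge_length: "i + 1 < length xs \<Longrightarrow> length (merge A i xs) = length xs - 1"
  by (simp add: merge_def)

lemma merge_nth:
  assumes "i + 1 < length xs" "p + 1 < length xs"
  shows "merge A i xs ! p = (if p < i then xs ! p else if p = i then xs ! i \<otimes>\<^bsub>A\<^esub> xs ! (i + 1) else xs ! (p + 1))"
  using assms by (auto simp: merge_def nth_append nth_Cons split: nat.split intro!: arg_cong[of _ _ "(!) xs"])

lemma act_nth:
  assumes "xs \<noteq> []" "p + 1 < length xs" "j + 1 < length xs"
  shows "act A j xs ! p = (if p = j then bracket A (xs ! j) (xs ! (length xs - 1)) else xs ! p)"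
  using assms by (auto simp: act_def nth_list_update nth_butlast last_conv_nth)

lemma act_length: "length (act A j xs) = length xs - 1"
  by (simp add: act_def)

sublocale bilinear_pair \<subseteq> vector_space K A
  by unfold_locales

context awb
begin

lemma A_awb: "awb K A" by unfold_locales

lemma sgn_closed [simp]: "sgn_pow K i \<in> carrier K"
  by (rule sgn_pow_closed[OF field_axioms])

lemma merge_merge:
  assumes xs: "xs \<in> tuples A n" and ij: "i < j" "j + 1 < n"
  shows "merge A i (merge A j xs) = merge A (j - 1) (merge A i xs)"
proof (rule nth_equalityI)
  have l: "length xs = n" using xs by (simp add: tuples_length)
  have c: "p < n \<Longrightarrow> xs ! p \<in> carrier A" for p using tuples_nth[OF xs] .
  show "length (merge A i (merge A j xs)) = length (merge A (j - 1) (merge A i xs))"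
    using ij l by (simp add: merge_length)
  fix p assume "p < length (merge A i (merge A j xs))"
  then have p: "p + 2 < n" using ij l by (simp add: merge_length)
  show "merge A i (merge A j xs) ! p = merge A (j - 1) (merge A i xs) ! p"
  proof (cases "j = Suc i")
    case True
    then show ?thesis using ij p l mult_assoc[OF c[of i] c[of "Suc i"] c[of "Suc (Suc i)"]]
      by (simp add: merge_nth merge_length)
  next
    case False
    then show ?thesis using ij p l by (auto simp: merge_nth merge_length)
  qed
qed

lemma multilinear_bar:
  assumes "r \<le> k"
  shows "multilinear K A (Suc k) (T k) (\<lambda>xs. \<Oplus>\<^bsub>T k\<^esub> i\<in>{..<r}. sgn_pow K i \<odot>\<^bsub>T k\<^esub> pt (merge A i xs))"
  using assms multilinear_merge[OF A_awb multilinear_pure]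
  by (intro multilinear_sum[OF module_axioms T.module_axioms] multilinear_scale[OF module_axioms T.module_axioms]) auto

lemma multilinear_bracket:
  "multilinear K A (Suc n) (T n) (\<lambda>xs. \<Oplus>\<^bsub>T n\<^esub> j\<in>{..<n}. pt (act A j xs))"
  using multilinear_act[OF A_awb multilinear_pure]
  by (intro multilinear_sum[OF module_axioms T.module_axioms]) auto

lemma bar_linear: "r \<le> k \<Longrightarrow> linear_map K (T (Suc k)) (T k) (bar_map K A r k)"
  unfolding bar_map_def by (intro tensor_lift_map T.module_axioms multilinear_bar)

lemma bracket_linear: "linear_map K (T (Suc n)) (T n) (bracket_map K A n)"
  unfolding bracket_map_def by (intro tensor_lift_map T.module_axioms multilinear_bracket)

lemma bar_pure: "\<lbrakk>r \<le> k; xs \<in> tuples A (Suc k)\<rbrakk> \<Longrightarrow>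
    bar_map K A r k (pt xs) = (\<Oplus>\<^bsub>T k\<^esub> i\<in>{..<r}. sgn_pow K i \<odot>\<^bsub>T k\<^esub> pt (merge A i xs))"
  unfolding bar_map_def by (rule tensor_lift_pure[OF T.module_axioms multilinear_bar])

lemma bracket_pure: "xs \<in> tuples A (Suc n) \<Longrightarrow>
    bracket_map K A n (pt xs) = (\<Oplus>\<^bsub>T n\<^esub> j\<in>{..<n}. pt (act A j xs))"
  unfolding bracket_map_def by (rule tensor_lift_pure[OF T.module_axioms multilinear_bracket])

lemma merge_tuples': "\<lbrakk>xs \<in> tuples A (Suc n); i < n\<rbrakk> \<Longrightarrow> merge A i xs \<in> tuples A n"
  using merge_tuples[OF A_awb, of xs n i] by simp

lemma act_tuples': "\<lbrakk>xs \<in> tuples A (Suc n); j < n\<rbrakk> \<Longrightarrow> act A j xs \<in> tuples A n"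
  using act_tuples[OF A_awb, of xs n j] by simp

lemma bar_zero: "u \<in> carrier (T (Suc k)) \<Longrightarrow> bar_map K A 0 k u = \<zero>\<^bsub>T k\<^esub>"
proof -
  assume u: "u \<in> carrier (T (Suc k))"
  interpret b: linear_map K "T (Suc k)" "T k" "bar_map K A 0 k" by (rule bar_linear) simp
  show ?thesis
    using u by (induction rule: tensor_induct) (simp_all add: bar_pure)
qed

lemma bar_bar:
  assumes r: "r \<le> k" and u: "u \<in> carrier (T (Suc (Suc k)))"
  shows "bar_map K A r k (bar_map K A (Suc r) (Suc k) u) = \<zero>\<^bsub>T k\<^esub>"
proof -
  interpret b: linear_map K "T (Suc k)" "T k" "bar_map K A r k" by (rule bar_linear[OF r])
  interpret b': linear_map K "T (Suc (Suc k))" "T (Suc k)" "bar_map K A (Suc r) (Suc k)" by (rule bar_linear) (use r in simp)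
  show ?thesis
    using u
  proof (induction rule: tensor_induct)
    case (pure xs)
    have m: "merge A j xs \<in> tuples A (Suc k)" if "j \<le> r" for j using merge_tuples'[OF pure] that r by simp
    have mm: "merge A i (merge A j xs) \<in> tuples A k" if "j \<le> r" "i < r" for i j
      using merge_tuples'[OF m] that r by simp
    have "bar_map K A r k (bar_map K A (Suc r) (Suc k) (pt xs)) =
      (\<Oplus>\<^bsub>T k\<^esub>j\<in>{..<Suc r}. bar_map K A r k (sgn_pow K j \<odot>\<^bsub>T (Suc k)\<^esub> pt (merge A j xs)))"
      using r pure m pure_closed by (simp only: bar_pure Suc_le_mono) (rule b.finsum; auto)
    also have "\<dots> = (\<Oplus>\<^bsub>T k\<^esub>j\<in>{..<Suc r}. sgn_pow K j \<odot>\<^bsub>T k\<^esub>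
        (\<Oplus>\<^bsub>T k\<^esub>i\<in>{..<r}. sgn_pow K i \<odot>\<^bsub>T k\<^esub> pt (merge A i (merge A j xs))))"
      using r m mm pure_closed by (intro T.finsum_cong') (auto simp: bar_pure intro!: T.finsum_closed)
    also have "\<dots> = \<zero>\<^bsub>T k\<^esub>"
      by (rule presimplicial_sum[OF field_axioms T.module_axioms])
        (use mm pure_closed merge_merge[OF pure] r in auto)
    finally show ?case .
  qed simp_all
qed

text \<open>The bracket with the last entry acts as a derivation: on the merged position, the two
  summands at that position and at the next one combine by the Leibniz rule.\<close>

lemma merge_act_sum:
  assumes xs: "xs \<in> tuples A (Suc (Suc n))" and i: "i < n"
  shows "(\<Oplus>\<^bsub>T n\<^esub>j\<in>{..<Suc n}. pt (merge A i (act A j xs))) = (\<Oplus>\<^bsub>T n\<^esub>j\<in>{..<n}. pt (act A j (merge A i xs)))"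
proof -
  define f where "f j = pt (merge A i (act A j xs))" for j
  define g where "g j = pt (act A j (merge A i xs))" for j
  have l: "length xs = Suc (Suc n)" "xs \<noteq> []" using xs by (auto simp: tuples_def)
  have c: "p \<le> Suc n \<Longrightarrow> xs ! p \<in> carrier A" for p using tuples_nth[OF xs] by simp
  have fc: "f j \<in> carrier (T n)" if "j \<le> n" for j
    unfolding f_def using merge_tuples'[OF act_tuples'[OF xs] i] that by (intro pure_closed) simp
  have gc: "g j \<in> carrier (T n)" if "j < n" for j
    unfolding g_def using act_tuples'[OF merge_tuples'[OF xs]] i that by (intro pure_closed) simp
  have len: "length (merge A i (act A j xs)) = n" "length (act A j' (merge A i xs)) = n" for j j'
    using l i by (simp_all add: merge_length act_length)
  have ne: "merge A i xs \<noteq> []" by (simp add: merge_def)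
  have N: "merge A i (act A j xs) ! p = (if p < i then act A j xs ! p
      else if p = i then act A j xs ! i \<otimes>\<^bsub>A\<^esub> act A j xs ! Suc i else act A j xs ! Suc p)" if "p < n" for j p
    using l i that by (simp add: merge_nth act_length)
  have M: "act A j (merge A i xs) ! p = (if p = j then bracket A (merge A i xs ! j) (xs ! Suc n) else merge A i xs ! p)"
    if "p < n" "j < n" for j p
    using l i that ne by (simp add: act_nth merge_length merge_nth)
  have 1: "f j = g j" if j: "j < i" for j
  proof -
    have "merge A i (act A j xs) = act A j (merge A i xs)"
      using j i l by (intro nth_equalityI) (auto simp: len N M act_nth merge_nth)
    then show ?thesis by (simp add: f_def g_def)
  qed
  have 2: "f (Suc j) = g j" if j: "i < j" "j < n" for j
  proof -
    have "merge A i (act A (Suc j) xs) = act A j (merge A i xs)"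
      using j i l by (intro nth_equalityI) (auto simp: len N M act_nth merge_nth)
    then show ?thesis by (simp add: f_def g_def)
  qed
  have 3: "f i \<oplus>\<^bsub>T n\<^esub> f (Suc i) = g i"
  proof -
    let ?m = "merge A i xs" and ?z = "xs ! Suc n"
    have a: "bracket A (xs ! i) ?z \<otimes>\<^bsub>A\<^esub> xs ! Suc i \<in> carrier A" "xs ! i \<otimes>\<^bsub>A\<^esub> bracket A (xs ! Suc i) ?z \<in> carrier A"
      using c i by (simp_all add: mult_closed bracket_closed)
    have m: "?m \<in> tuples A (Suc n)" using merge_tuples'[OF xs] i by simp
    have ai: "act A i ?m \<in> tuples A n" using act_tuples'[OF m i] .
    have "act A i ?m = (act A i ?m)[i := bracket A (xs ! i) ?z \<otimes>\<^bsub>A\<^esub> xs ! Suc i \<oplus>\<^bsub>A\<^esub> xs ! i \<otimes>\<^bsub>A\<^esub> bracket A (xs ! Suc i) ?z]"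
      using i l c bracket_mult[of "xs ! i" "xs ! Suc i" ?z]
      by (intro nth_equalityI) (auto simp: len M merge_nth nth_list_update)
    then have "g i = pt ((act A i ?m)[i := bracket A (xs ! i) ?z \<otimes>\<^bsub>A\<^esub> xs ! Suc i]) \<oplus>\<^bsub>T n\<^esub>
        pt ((act A i ?m)[i := xs ! i \<otimes>\<^bsub>A\<^esub> bracket A (xs ! Suc i) ?z])"
      unfolding g_def using pure_tensor_add[OF field_axioms module_axioms ai i a] by simp
    also have "(act A i ?m)[i := bracket A (xs ! i) ?z \<otimes>\<^bsub>A\<^esub> xs ! Suc i] = merge A i (act A i xs)"
      using i l by (intro nth_equalityI) (auto simp: len M N act_nth merge_nth nth_list_update)
    also have "(act A i ?m)[i := xs ! i \<otimes>\<^bsub>A\<^esub> bracket A (xs ! Suc i) ?z] = merge A i (act A (Suc i) xs)"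
      using i l by (intro nth_equalityI) (auto simp: len M N act_nth merge_nth nth_list_update)
    finally show ?thesis by (simp add: f_def)
  qed
  have "m < n \<Longrightarrow> (\<Oplus>\<^bsub>T n\<^esub>j\<in>{..<Suc (Suc m)}. f j) = (\<Oplus>\<^bsub>T n\<^esub>j\<in>{..<Suc m}. g j)" if "i \<le> m" for m
    using that
  proof (induction m rule: dec_induct)
    case base
    have "(\<Oplus>\<^bsub>T n\<^esub>j\<in>{..<Suc (Suc i)}. f j) = f (Suc i) \<oplus>\<^bsub>T n\<^esub> (f i \<oplus>\<^bsub>T n\<^esub> (\<Oplus>\<^bsub>T n\<^esub>j\<in>{..<i}. f j))"
      using fc i by (simp add: lessThan_Suc Pi_iff)
    also have "(\<Oplus>\<^bsub>T n\<^esub>j\<in>{..<i}. f j) = (\<Oplus>\<^bsub>T n\<^esub>j\<in>{..<i}. g j)"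
      using 1 gc i by (intro T.finsum_cong') auto
    also have "f (Suc i) \<oplus>\<^bsub>T n\<^esub> (f i \<oplus>\<^bsub>T n\<^esub> \<dots>) = (f i \<oplus>\<^bsub>T n\<^esub> f (Suc i)) \<oplus>\<^bsub>T n\<^esub> \<dots>"
      using fc gc i by (simp add: T.a_ac T.finsum_closed Pi_iff)
    also have "\<dots> = (\<Oplus>\<^bsub>T n\<^esub>j\<in>{..<Suc i}. g j)"
      unfolding 3 using gc i by (simp add: lessThan_Suc Pi_iff)
    finally show ?case .
  next
    case (step m)
    have "(\<Oplus>\<^bsub>T n\<^esub>j\<in>{..<Suc (Suc (Suc m))}. f j) = f (Suc (Suc m)) \<oplus>\<^bsub>T n\<^esub> (\<Oplus>\<^bsub>T n\<^esub>j\<in>{..<Suc (Suc m)}. f j)"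
      unfolding lessThan_Suc[of "Suc (Suc m)"] using fc step by (intro T.finsum_insert) auto
    also have "\<dots> = g (Suc m) \<oplus>\<^bsub>T n\<^esub> (\<Oplus>\<^bsub>T n\<^esub>j\<in>{..<Suc m}. g j)" using step 2[of "Suc m"] by simp
    also have "\<dots> = (\<Oplus>\<^bsub>T n\<^esub>j\<in>{..<Suc (Suc m)}. g j)"
      unfolding lessThan_Suc[of "Suc m"] using gc step by (intro T.finsum_insert[symmetric]) auto
    finally show ?case .
  qed
  from this[of "n - 1"] show ?thesis using i by (simp add: f_def g_def)
qed

text \<open>As the bracket with the last factor acts by derivations, \<open>bracket_map\<close> is a chain map from the bar
  complex whose differential does not touch the last factor to the full bar complex.\<close>

lemma bar_bracket:
  assumes v: "v \<in> carrier (T (Suc (Suc n)))"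
  shows "bar_map K A n n (bracket_map K A (Suc n) v) = bracket_map K A n (bar_map K A n (Suc n) v)"
proof -
  interpret b: linear_map K "T (Suc n)" "T n" "bar_map K A n n" by (rule bar_linear) simp
  interpret b': linear_map K "T (Suc (Suc n))" "T (Suc n)" "bar_map K A n (Suc n)" by (rule bar_linear) simp
  interpret d: linear_map K "T (Suc n)" "T n" "bracket_map K A n" by (rule bracket_linear)
  interpret d': linear_map K "T (Suc (Suc n))" "T (Suc n)" "bracket_map K A (Suc n)" by (rule bracket_linear)
  show ?thesis
    using v
  proof (induction rule: tensor_induct)
    case (pure xs)
    have m: "merge A i xs \<in> tuples A (Suc n)" if "i < Suc n" for i using merge_tuples'[OF pure that] .
    have a: "act A j xs \<in> tuples A (Suc n)" if "j < Suc n" for j using act_tuples'[OF pure that] .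
    have am: "act A j (merge A i xs) \<in> tuples A n" if "j < n" "i < Suc n" for i j
      using act_tuples'[OF m] that by simp
    have ma: "merge A i (act A j xs) \<in> tuples A n" if "i < n" "j < Suc n" for i j
      using merge_tuples'[OF a] that by simp
    have "bar_map K A n n (bracket_map K A (Suc n) (pt xs)) =
        (\<Oplus>\<^bsub>T n\<^esub>j\<in>{..<Suc n}. bar_map K A n n (pt (act A j xs)))"
      unfolding bracket_pure[OF pure] using a by (intro b.finsum) (auto intro!: pure_closed)
    also have "\<dots> = (\<Oplus>\<^bsub>T n\<^esub>j\<in>{..<Suc n}. \<Oplus>\<^bsub>T n\<^esub>i\<in>{..<n}. sgn_pow K i \<odot>\<^bsub>T n\<^esub> pt (merge A i (act A j xs)))"
      using a ma pure_closed by (intro T.finsum_cong') (auto simp: bar_pure intro!: T.finsum_closed)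
    also have "\<dots> = (\<Oplus>\<^bsub>T n\<^esub>i\<in>{..<n}. \<Oplus>\<^bsub>T n\<^esub>j\<in>{..<Suc n}. sgn_pow K i \<odot>\<^bsub>T n\<^esub> pt (merge A i (act A j xs)))"
      using ma pure_closed by (intro T.finsum_swap) auto
    also have "\<dots> = (\<Oplus>\<^bsub>T n\<^esub>i\<in>{..<n}. sgn_pow K i \<odot>\<^bsub>T n\<^esub> (\<Oplus>\<^bsub>T n\<^esub>j\<in>{..<Suc n}. pt (merge A i (act A j xs))))"
      using ma pure_closed
      by (intro T.finsum_cong' T.finsum_smult_ldistr[symmetric]) (auto intro!: T.finsum_closed T.smult_closed)
    also have "\<dots> = (\<Oplus>\<^bsub>T n\<^esub>i\<in>{..<n}. bracket_map K A n (sgn_pow K i \<odot>\<^bsub>T (Suc n)\<^esub> pt (merge A i xs)))"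
      using m am pure_closed
      by (intro T.finsum_cong') (auto simp: merge_act_sum[OF pure] bracket_pure)
    also have "\<dots> = bracket_map K A n (bar_map K A n (Suc n) (pt xs))"
      using m pure_closed by (subst bar_pure[OF _ pure]) (auto intro!: d.finsum[symmetric])
    finally show ?case .
  qed simp_all
qed

end

lemma (in abelian_group) neg_zero [simp]: "\<ominus> \<zero> = \<zero>"
  by (rule minus_equality) simp_all

context awb
begin

text \<open>The relative sign of the two bar differentials is the sign shift in the mapping cone.\<close>

lemma awb_boundary_Suc:
  assumes u: "u \<in> carrier (T (Suc (Suc m)))" and v: "v \<in> carrier (T (Suc (Suc m)))"
  shows "awb_boundary K A (Suc m) (u, v) =
    (bar_map K A (Suc m) (Suc m) u \<oplus>\<^bsub>T (Suc m)\<^esub> bracket_map K A (Suc m) v, \<ominus>\<^bsub>T (Suc m)\<^esub> bar_map K A m (Suc m) v)"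
proof -
  let ?C = "awb_chain K A m"
  note C = awb_chain_module[OF field_axioms module_axioms, of m]
  interpret C: module K ?C by (rule C)
  have s: "\<zero>\<^bsub>?C\<^esub> = (\<zero>\<^bsub>T (Suc m)\<^esub>, \<zero>\<^bsub>T (Suc m)\<^esub>)"
    "(x, y) \<oplus>\<^bsub>?C\<^esub> (x', y') = (x \<oplus>\<^bsub>T (Suc m)\<^esub> x', y \<oplus>\<^bsub>T (Suc m)\<^esub> y')"
    "k \<odot>\<^bsub>?C\<^esub> (x, y) = (k \<odot>\<^bsub>T (Suc m)\<^esub> x, k \<odot>\<^bsub>T (Suc m)\<^esub> y)"
    "(x, y) \<in> carrier ?C \<longleftrightarrow> x \<in> carrier (T (Suc m)) \<and> y \<in> carrier (T (Suc m)) \<and>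
      (m = 0 \<longrightarrow> y = \<zero>\<^bsub>T (Suc m)\<^esub>)" for x y x' y' k
    using awb_chain_simps[of K A m] T.module_axioms[of "Suc m"] by simp_all
  interpret b: linear_map K "T (Suc (Suc m))" "T (Suc m)" "bar_map K A (Suc m) (Suc m)" by (rule bar_linear) simp
  interpret b': linear_map K "T (Suc (Suc m))" "T (Suc m)" "bar_map K A m (Suc m)" by (rule bar_linear) simp
  interpret d: linear_map K "T (Suc (Suc m))" "T (Suc m)" "bracket_map K A (Suc m)" by (rule bracket_linear)
  have i: "linear_map K (T (Suc m)) ?C (\<lambda>x. (x, \<zero>\<^bsub>T (Suc m)\<^esub>))"
    by (intro linear_mapI C T.module_axioms lin_homI) (simp_all add: s)
  have j: "linear_map K (T (Suc m)) ?C (\<lambda>x. (\<zero>\<^bsub>T (Suc m)\<^esub>, x))" if "m \<noteq> 0"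
    using that by (intro linear_mapI C T.module_axioms lin_homI) (simp_all add: s)
  have bz: "bar_map K A m (Suc m) v = \<zero>\<^bsub>T (Suc m)\<^esub>" if "m = 0" "v \<in> carrier (T (Suc (Suc m)))" for v
    using bar_zero that by simp
  note mb = multilinear_boundary[OF A_awb, of "Suc m", simplified]
  have len: "length (merge A i xs) = Suc m" "length (act A i xs) = Suc m"
    if "xs \<in> tuples A (Suc (Suc m))" "i < Suc m" for xs i
    using that tuples_length[OF that(1)] by (simp_all add: merge_length act_length)
  have 1: "tensor_lift K ?C (boundary_tens K A (Suc m)) u = (bar_map K A (Suc m) (Suc m) u, \<zero>\<^bsub>T (Suc m)\<^esub>)"
  proof (rule tensor_ext[OF C _ _ _ u])
    show "tensor_lift K ?C (boundary_tens K A (Suc m)) \<in> lin_hom K (T (Suc (Suc m))) ?C"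
      using multilinear_lift(1)[OF field_axioms module_axioms C mb(1)] .
    show "(\<lambda>u. (bar_map K A (Suc m) (Suc m) u, \<zero>\<^bsub>T (Suc m)\<^esub>)) \<in> lin_hom K (T (Suc (Suc m))) ?C"
      by (rule lin_hom_compose[OF b.lin linear_map.lin[OF i]])
    fix xs assume xs: "xs \<in> tuples A (Suc (Suc m))"
    note c = pure_closed[OF merge_tuples'[OF xs]]
    have "boundary_tens K A (Suc m) xs = (\<Oplus>\<^bsub>?C\<^esub>i\<in>{..<Suc m}. (sgn_pow K i \<odot>\<^bsub>T (Suc m)\<^esub> pt (merge A i xs), \<zero>\<^bsub>T (Suc m)\<^esub>))"
      unfolding boundary_tens_def Let_def diff_Suc_1
      using c len[OF xs] by (intro C.finsum_cong') (auto simp: tens_def s)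
    also have "\<dots> = (\<Oplus>\<^bsub>T (Suc m)\<^esub>i\<in>{..<Suc m}. sgn_pow K i \<odot>\<^bsub>T (Suc m)\<^esub> pt (merge A i xs), \<zero>\<^bsub>T (Suc m)\<^esub>)"
      using c by (intro linear_map.finsum[OF i, symmetric]) auto
    finally show "tensor_lift K ?C (boundary_tens K A (Suc m)) (pt xs) = (bar_map K A (Suc m) (Suc m) (pt xs), \<zero>\<^bsub>T (Suc m)\<^esub>)"
      using xs by (simp add: tensor_lift_pure[OF C mb(1)] bar_pure)
  qed
  have 2: "tensor_lift K ?C (boundary_circ K A (Suc m)) v = (bracket_map K A (Suc m) v, \<ominus>\<^bsub>T (Suc m)\<^esub> bar_map K A m (Suc m) v)"
  proof (rule tensor_ext[OF C _ _ _ v])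
    show "tensor_lift K ?C (boundary_circ K A (Suc m)) \<in> lin_hom K (T (Suc (Suc m))) ?C"
      using multilinear_lift(1)[OF field_axioms module_axioms C mb(2)] .
    show "(\<lambda>v. (bracket_map K A (Suc m) v, \<ominus>\<^bsub>T (Suc m)\<^esub> bar_map K A m (Suc m) v)) \<in> lin_hom K (T (Suc (Suc m))) ?C"
      by (rule lin_homI) (auto simp: s bar_zero T.minus_add T.smult_r_minus T.neg_zero)
    fix xs assume xs: "xs \<in> tuples A (Suc (Suc m))"
    note c = pure_closed[OF merge_tuples'[OF xs]] and c' = pure_closed[OF act_tuples'[OF xs]]
    have "(\<Oplus>\<^bsub>?C\<^esub>i\<in>{..<Suc m}. tens K A (act A i xs)) = (\<Oplus>\<^bsub>?C\<^esub>i\<in>{..<Suc m}. (pt (act A i xs), \<zero>\<^bsub>T (Suc m)\<^esub>))"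
      using c' len[OF xs] by (intro C.finsum_cong') (auto simp: tens_def s)
    also have "\<dots> = (\<Oplus>\<^bsub>T (Suc m)\<^esub>i\<in>{..<Suc m}. pt (act A i xs), \<zero>\<^bsub>T (Suc m)\<^esub>)"
      using c' by (intro linear_map.finsum[OF i, symmetric]) auto
    finally have t: "(\<Oplus>\<^bsub>?C\<^esub>i\<in>{..<Suc m}. tens K A (act A i xs)) = (bracket_map K A (Suc m) (pt xs), \<zero>\<^bsub>T (Suc m)\<^esub>)"
      using xs by (simp add: bracket_pure)
    have o: "(\<Oplus>\<^bsub>?C\<^esub>i\<in>{..<m}. sgn_pow K (i + 1) \<odot>\<^bsub>?C\<^esub> circ K A (merge A i xs)) =
        (\<zero>\<^bsub>T (Suc m)\<^esub>, \<ominus>\<^bsub>T (Suc m)\<^esub> bar_map K A m (Suc m) (pt xs))"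
    proof (cases "m = 0")
      case True
      then have e: "{..<m} = {}" by simp
      show ?thesis unfolding e using bz[OF True pure_closed[OF xs]] by (simp add: s)
    next
      case False
      have "(\<Oplus>\<^bsub>?C\<^esub>i\<in>{..<m}. sgn_pow K (i + 1) \<odot>\<^bsub>?C\<^esub> circ K A (merge A i xs)) =
          (\<Oplus>\<^bsub>?C\<^esub>i\<in>{..<m}. (\<zero>\<^bsub>T (Suc m)\<^esub>, (\<ominus> \<one>) \<odot>\<^bsub>T (Suc m)\<^esub> (sgn_pow K i \<odot>\<^bsub>T (Suc m)\<^esub> pt (merge A i xs))))"
        using c len[OF xs] False
        by (intro C.finsum_cong')
          (auto simp: circ_def s sgn_pow_Suc[OF field_axioms] T.smult_l_minus)
      also have "\<dots> = (\<zero>\<^bsub>T (Suc m)\<^esub>, \<Oplus>\<^bsub>T (Suc m)\<^esub>i\<in>{..<m}. (\<ominus> \<one>) \<odot>\<^bsub>T (Suc m)\<^esub> (sgn_pow K i \<odot>\<^bsub>T (Suc m)\<^esub> pt (merge A i xs)))"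
        using c by (intro linear_map.finsum[OF j[OF False], symmetric]) auto
      also have "(\<Oplus>\<^bsub>T (Suc m)\<^esub>i\<in>{..<m}. (\<ominus> \<one>) \<odot>\<^bsub>T (Suc m)\<^esub> (sgn_pow K i \<odot>\<^bsub>T (Suc m)\<^esub> pt (merge A i xs))) =
          (\<ominus> \<one>) \<odot>\<^bsub>T (Suc m)\<^esub> (\<Oplus>\<^bsub>T (Suc m)\<^esub>i\<in>{..<m}. sgn_pow K i \<odot>\<^bsub>T (Suc m)\<^esub> pt (merge A i xs))"
        using c by (intro T.finsum_smult_ldistr[symmetric]) auto
      also have "\<dots> = \<ominus>\<^bsub>T (Suc m)\<^esub> bar_map K A m (Suc m) (pt xs)"
        using c xs by (simp add: bar_pure T.smult_l_minus T.finsum_closed Pi_iff)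
      finally show ?thesis .
    qed
    show "tensor_lift K ?C (boundary_circ K A (Suc m)) (pt xs) =
        (bracket_map K A (Suc m) (pt xs), \<ominus>\<^bsub>T (Suc m)\<^esub> bar_map K A m (Suc m) (pt xs))"
      using t o pure_closed[OF xs] xs by (simp add: tensor_lift_pure[OF C mb(2)] boundary_circ_def Let_def s)
  qed
  show ?thesis using u v by (simp add: awb_boundary_def Let_def 1 2 s)
qed

end

lemma
  assumes A: "awb K A" and B: "awb K B" and g: "g \<in> awb_hom K A B"
  shows tensor_map_bar: "\<lbrakk>r \<le> k; u \<in> carrier (tensor_power K A (Suc k))\<rbrakk> \<Longrightarrow>
      tensor_map K B k g (bar_map K A r k u) = bar_map K B r k (tensor_map K B (Suc k) g u)"
    and tensor_map_bracket: "u \<in> carrier (tensor_power K A (Suc k)) \<Longrightarrow>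
      tensor_map K B k g (bracket_map K A k u) = bracket_map K B k (tensor_map K B (Suc k) g u)"
proof -
  interpret A: awb K A by fact
  interpret B: awb K B by fact
  note f = A.field_axioms and gl = awb_hom_lin[OF g]
  interpret g: linear_map K "A.T k" "B.T k" "tensor_map K B k g"
    by (rule tensor_map_map[OF f A.module_axioms B.module_axioms gl])
  interpret g': linear_map K "A.T (Suc k)" "B.T (Suc k)" "tensor_map K B (Suc k) g"
    by (rule tensor_map_map[OF f A.module_axioms B.module_axioms gl])
  note p = tensor_map_pure[OF f A.module_axioms B.module_axioms gl] and mt = map_tuples[OF _ gl]
  have mult: "g (x \<otimes>\<^bsub>A\<^esub> y) = g x \<otimes>\<^bsub>B\<^esub> g y" "g (bracket A x y) = bracket B (g x) (g y)"
    if "x \<in> carrier A" "y \<in> carrier A" for x y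
    using g that by (auto simp: awb_hom_def)
  have mm: "map g (merge A i xs) = merge B i (map g xs)" if xs: "xs \<in> tuples A (Suc k)" and i: "i < k" for xs i
    using tuples_nth[OF xs] i tuples_length[OF xs] mult by (simp add: merge_def take_map drop_map)
  have ma: "map g (act A j xs) = act B j (map g xs)" if xs: "xs \<in> tuples A (Suc k)" and j: "j < k" for xs j
  proof -
    have "xs \<noteq> []" using xs by (auto simp: tuples_def)
    then show ?thesis using tuples_nth[OF xs] j tuples_length[OF xs] mult
      by (simp add: act_def map_update map_butlast last_map last_conv_nth)
  qed
  show "tensor_map K B k g (bar_map K A r k u) = bar_map K B r k (tensor_map K B (Suc k) g u)"
    if r: "r \<le> k" and u: "u \<in> carrier (A.T (Suc k))"
  proof -
    interpret b: linear_map K "A.T (Suc k)" "A.T k" "bar_map K A r k" by (rule A.bar_linear[OF r])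
    interpret b': linear_map K "B.T (Suc k)" "B.T k" "bar_map K B r k" by (rule B.bar_linear[OF r])
    show ?thesis
      using u
    proof (induction rule: A.tensor_induct)
      case (pure xs)
      note c = A.pure_closed[OF A.merge_tuples'[OF pure]]
      have "tensor_map K B k g (bar_map K A r k (A.pt xs)) =
          (\<Oplus>\<^bsub>B.T k\<^esub>i\<in>{..<r}. tensor_map K B k g (sgn_pow K i \<odot>\<^bsub>A.T k\<^esub> A.pt (merge A i xs)))"
        unfolding A.bar_pure[OF r pure] using c r by (intro g.finsum) auto
      also have "\<dots> = (\<Oplus>\<^bsub>B.T k\<^esub>i\<in>{..<r}. sgn_pow K i \<odot>\<^bsub>B.T k\<^esub> B.pt (merge B i (map g xs)))"
        using c r pure A.merge_tuples'[OF pure] B.pure_closed[OF B.merge_tuples'[OF mt[OF pure]]]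
        by (intro B.T.finsum_cong') (auto simp: p mm[symmetric])
      also have "\<dots> = bar_map K B r k (tensor_map K B (Suc k) g (A.pt xs))"
        using pure mt[OF pure] r by (simp add: p B.bar_pure)
      finally show ?case .
    qed simp_all
  qed
  show "tensor_map K B k g (bracket_map K A k u) = bracket_map K B k (tensor_map K B (Suc k) g u)"
    if u: "u \<in> carrier (A.T (Suc k))"
  proof -
    interpret b: linear_map K "A.T (Suc k)" "A.T k" "bracket_map K A k" by (rule A.bracket_linear)
    interpret b': linear_map K "B.T (Suc k)" "B.T k" "bracket_map K B k" by (rule B.bracket_linear)
    show ?thesis
      using u
    proof (induction rule: A.tensor_induct)
      case (pure xs)
      note c = A.pure_closed[OF A.act_tuples'[OF pure]]
      have "tensor_map K B k g (bracket_map K A k (A.pt xs)) =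
          (\<Oplus>\<^bsub>B.T k\<^esub>i\<in>{..<k}. tensor_map K B k g (A.pt (act A i xs)))"
        unfolding A.bracket_pure[OF pure] using c by (intro g.finsum) auto
      also have "\<dots> = (\<Oplus>\<^bsub>B.T k\<^esub>i\<in>{..<k}. B.pt (act B i (map g xs)))"
        using c pure A.act_tuples'[OF pure] B.pure_closed[OF B.act_tuples'[OF mt[OF pure]]]
        by (intro B.T.finsum_cong') (auto simp: p ma[symmetric])
      also have "\<dots> = bracket_map K B k (tensor_map K B (Suc k) g (A.pt xs))"
        using pure mt[OF pure] by (simp add: p B.bracket_pure)
      finally show ?case .
    qed simp_all
  qed
qed

section \<open>Free algebras with bracket have no higher homology\<close>

definition bilinear ::
  "('k, 'r) ring_scheme \<Rightarrow> ('k, 'v, 'm) module_scheme \<Rightarrow> ('k, 'w, 'n) module_scheme \<Rightarrow> ('v \<Rightarrow> 'v \<Rightarrow> 'w) \<Rightarrow> bool"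
  where "bilinear K V W p \<longleftrightarrow> (\<forall>x\<in>carrier V. p x \<in> lin_hom K V W \<and> (\<lambda>y. p y x) \<in> lin_hom K V W)"

definition bilinear_lift ::
  "('k, 'r) ring_scheme \<Rightarrow> ('k, 'w, 'n) module_scheme \<Rightarrow> ('v \<Rightarrow> 'v \<Rightarrow> 'w) \<Rightarrow> ('v list \<Rightarrow> 'k) set \<Rightarrow> 'w"
  where "bilinear_lift K W p = tensor_lift K W (\<lambda>xs. p (xs ! 0) (xs ! 1))"

lemma bilinearI:
  assumes "\<And>x y. \<lbrakk>x \<in> carrier V; y \<in> carrier V\<rbrakk> \<Longrightarrow> p x y \<in> carrier W"
    and "\<And>x x' y. \<lbrakk>x \<in> carrier V; x' \<in> carrier V; y \<in> carrier V\<rbrakk> \<Longrightarrow> p (x \<oplus>\<^bsub>V\<^esub> x') y = p x y \<oplus>\<^bsub>W\<^esub> p x' y"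
    and "\<And>x y y'. \<lbrakk>x \<in> carrier V; y \<in> carrier V; y' \<in> carrier V\<rbrakk> \<Longrightarrow> p x (y \<oplus>\<^bsub>V\<^esub> y') = p x y \<oplus>\<^bsub>W\<^esub> p x y'"
    and "\<And>k x y. \<lbrakk>k \<in> carrier K; x \<in> carrier V; y \<in> carrier V\<rbrakk> \<Longrightarrow> p (k \<odot>\<^bsub>V\<^esub> x) y = k \<odot>\<^bsub>W\<^esub> p x y"
    and "\<And>k x y. \<lbrakk>k \<in> carrier K; x \<in> carrier V; y \<in> carrier V\<rbrakk> \<Longrightarrow> p x (k \<odot>\<^bsub>V\<^esub> y) = k \<odot>\<^bsub>W\<^esub> p x y"
  shows "bilinear K V W p"
  unfolding bilinear_def by (intro ballI conjI lin_homI) (simp_all add: assms)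

context vector_space
begin

lemma multilinear_bilinear:
  assumes p: "bilinear K V W p"
  shows "multilinear K V 2 W (\<lambda>xs. p (xs ! 0) (xs ! 1))"
proof (rule multilinearI)
  have l: "p x \<in> lin_hom K V W" "(\<lambda>y. p y x) \<in> lin_hom K V W" if "x \<in> carrier V" for x
    using p that by (auto simp: bilinear_def)
  have n: "length xs = 2" "xs ! 0 \<in> carrier V" "xs ! 1 \<in> carrier V" if "xs \<in> tuples V 2" for xs
    using that tuples_nth[OF that] by (auto simp: tuples_length)
  show "p (xs ! 0) (xs ! 1) \<in> carrier W" if "xs \<in> tuples V 2" for xs
    using lin_hom_closed[OF l(1)] n[OF that] by blast
  fix xs i a assume xs: "xs \<in> tuples V 2" and "i < (2 :: nat)" and a: "a \<in> carrier V"
  then have "i = 0 \<or> i = 1" by auto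
  then show "p (xs[i := a \<oplus>\<^bsub>V\<^esub> b] ! 0) (xs[i := a \<oplus>\<^bsub>V\<^esub> b] ! 1) =
      p (xs[i := a] ! 0) (xs[i := a] ! 1) \<oplus>\<^bsub>W\<^esub> p (xs[i := b] ! 0) (xs[i := b] ! 1)" if "b \<in> carrier V" for b
    using lin_hom_add[OF l(1)[OF n(2)[OF xs]] a that] lin_hom_add[OF l(2)[OF n(3)[OF xs]] a that] n[OF xs] by auto
next
  have l: "p x \<in> lin_hom K V W" "(\<lambda>y. p y x) \<in> lin_hom K V W" if "x \<in> carrier V" for x
    using p that by (auto simp: bilinear_def)
  have n: "length xs = 2" "xs ! 0 \<in> carrier V" "xs ! 1 \<in> carrier V" if "xs \<in> tuples V 2" for xs
    using that tuples_nth[OF that] by (auto simp: tuples_length)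
  fix xs i k a assume xs: "xs \<in> tuples V 2" and "i < (2 :: nat)" and k: "k \<in> carrier K" and a: "a \<in> carrier V"
  then have "i = 0 \<or> i = 1" by auto
  then show "p (xs[i := k \<odot>\<^bsub>V\<^esub> a] ! 0) (xs[i := k \<odot>\<^bsub>V\<^esub> a] ! 1) = k \<odot>\<^bsub>W\<^esub> p (xs[i := a] ! 0) (xs[i := a] ! 1)"
    using lin_hom_smult[OF l(1)[OF n(2)[OF xs]] k a] lin_hom_smult[OF l(2)[OF n(3)[OF xs]] k a] n[OF xs] by auto
qed

lemma
  assumes W: "module K W" and p: "bilinear K V W p"
  shows bilinear_lift_map: "linear_map K (T 2) W (bilinear_lift K W p)"
    and bilinear_lift_pure: "\<lbrakk>a \<in> carrier V; b \<in> carrier V\<rbrakk> \<Longrightarrow> bilinear_lift K W p (pt [a, b]) = p a b"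
  using tensor_lift_map[OF W multilinear_bilinear[OF p]] tensor_lift_pure[OF W multilinear_bilinear[OF p], of "[a, b]"]
  by (simp_all add: bilinear_lift_def tuples_def)

lemma tuples_Cons [simp]: "x # xs \<in> tuples V (Suc n) \<longleftrightarrow> x \<in> carrier V \<and> xs \<in> tuples V n"
  by (auto simp: tuples_def)

lemma tuples_2 [simp]: "[a, b] \<in> tuples V 2 \<longleftrightarrow> a \<in> carrier V \<and> b \<in> carrier V"
  by (auto simp: tuples_def)

lemma tensor2_induct [consumes 1, case_names pure add smult]:
  assumes "u \<in> carrier (T 2)"
    and pure: "\<And>a b. \<lbrakk>a \<in> carrier V; b \<in> carrier V\<rbrakk> \<Longrightarrow> P (pt [a, b])"
    and "\<And>x y. \<lbrakk>x \<in> carrier (T 2); y \<in> carrier (T 2); P x; P y\<rbrakk> \<Longrightarrow> P (x \<oplus>\<^bsub>T 2\<^esub> y)"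
    and "\<And>k x. \<lbrakk>k \<in> carrier K; x \<in> carrier (T 2); P x\<rbrakk> \<Longrightarrow> P (k \<odot>\<^bsub>T 2\<^esub> x)"
  shows "P u"
  using assms(1)
proof (induction rule: tensor_induct)
  case (pure xs)
  then obtain a b where "xs = [a, b]" "a \<in> carrier V" "b \<in> carrier V"
    by (auto simp: tuples_def numeral_2_eq_2 length_Suc_conv)
  then show ?case using assms(2) by simp
qed (use assms in auto)

lemma pure_head_add:
  "\<lbrakk>x \<in> carrier V; y \<in> carrier V; zs \<in> tuples V n\<rbrakk> \<Longrightarrow>
    pt ((x \<oplus>\<^bsub>V\<^esub> y) # zs) = pt (x # zs) \<oplus>\<^bsub>T (Suc n)\<^esub> pt (y # zs)"
  using pure_tensor_add[OF field_axioms module_axioms, of "x # zs" "Suc n" 0 x y] by simp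

lemma pure_head_smult:
  "\<lbrakk>k \<in> carrier K; x \<in> carrier V; zs \<in> tuples V n\<rbrakk> \<Longrightarrow>
    pt ((k \<odot>\<^bsub>V\<^esub> x) # zs) = k \<odot>\<^bsub>T (Suc n)\<^esub> pt (x # zs)"
  using pure_tensor_smult[OF field_axioms module_axioms, of "x # zs" "Suc n" 0 k x] by simp

lemma pure_second_add:
  "\<lbrakk>a \<in> carrier V; x \<in> carrier V; y \<in> carrier V; zs \<in> tuples V n\<rbrakk> \<Longrightarrow>
    pt (a # (x \<oplus>\<^bsub>V\<^esub> y) # zs) = pt (a # x # zs) \<oplus>\<^bsub>T (Suc (Suc n))\<^esub> pt (a # y # zs)"
  using pure_tensor_add[OF field_axioms module_axioms, of "a # x # zs" "Suc (Suc n)" 1 x y] by simp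

lemma pure_second_smult:
  "\<lbrakk>k \<in> carrier K; a \<in> carrier V; x \<in> carrier V; zs \<in> tuples V n\<rbrakk> \<Longrightarrow>
    pt (a # (k \<odot>\<^bsub>V\<^esub> x) # zs) = k \<odot>\<^bsub>T (Suc (Suc n))\<^esub> pt (a # x # zs)"
  using pure_tensor_smult[OF field_axioms module_axioms, of "a # x # zs" "Suc (Suc n)" 1 k x] by simp

lemma tuples_Nil [simp]: "[] \<in> tuples V 0"
  by (simp add: tuples_def)

lemmas pure_add2 = pure_head_add[of _ _ "[_]" 1, simplified, folded numeral_2_eq_2]
  pure_second_add[of _ _ _ "[]" 0, simplified, folded numeral_2_eq_2]
lemmas pure_smult2 = pure_head_smult[of _ _ "[_]" 1, simplified, folded numeral_2_eq_2]
  pure_second_smult[of _ _ _ "[]" 0, simplified, folded numeral_2_eq_2]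

lemma pure2_closed: "\<lbrakk>a \<in> carrier V; b \<in> carrier V\<rbrakk> \<Longrightarrow> pt [a, b] \<in> carrier (T 2)"
  by (intro pure_closed) simp

text \<open>\<open>append_map k zs\<close> is \<open>m \<mapsto> m \<otimes> z\<^sub>1 \<otimes> \<cdots> \<otimes> z\<^sub>k\<close>.\<close>

definition append_map :: "nat \<Rightarrow> 'c list \<Rightarrow> ('c list \<Rightarrow> 'a) set \<Rightarrow> ('c list \<Rightarrow> 'a) set"
  where "append_map k zs = bilinear_lift K (T (Suc (Suc k))) (\<lambda>a b. pt (a # b # zs))"

lemma bilinear_append:
  assumes "zs \<in> tuples V k"
  shows "bilinear K V (T (Suc (Suc k))) (\<lambda>a b. pt (a # b # zs))"
  using assms by (intro bilinearI pure_head_add pure_second_add pure_head_smult pure_second_smult pure_closed) auto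

lemma append_linear: "zs \<in> tuples V k \<Longrightarrow> linear_map K (T 2) (T (Suc (Suc k))) (append_map k zs)"
  unfolding append_map_def by (rule bilinear_lift_map[OF T.module_axioms bilinear_append])

lemma append_pure:
  "\<lbrakk>zs \<in> tuples V k; a \<in> carrier V; b \<in> carrier V\<rbrakk> \<Longrightarrow> append_map k zs (pt [a, b]) = pt (a # b # zs)"
  unfolding append_map_def by (rule bilinear_lift_pure[OF T.module_axioms bilinear_append])

lemma multilinear_append:
  assumes m: "m \<in> carrier (T 2)"
  shows "multilinear K V k (T (Suc (Suc k))) (\<lambda>zs. append_map k zs m)"
proof (rule multilinearI)
  show "append_map k zs m \<in> carrier (T (Suc (Suc k)))" if "zs \<in> tuples V k" for zs
    using linear_map.closed[OF append_linear[OF that] m] .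
  fix zs i assume zs: "zs \<in> tuples V k" and i: "i < k"
  note u = tuples_update[OF zs]
  show "append_map k (zs[i := x \<oplus>\<^bsub>V\<^esub> y]) m = append_map k (zs[i := x]) m \<oplus>\<^bsub>T (Suc (Suc k))\<^esub> append_map k (zs[i := y]) m"
    if x: "x \<in> carrier V" and y: "y \<in> carrier V" for x y
  proof -
    have xy: "x \<oplus>\<^bsub>V\<^esub> y \<in> carrier V" using x y by simp
    interpret x: linear_map K "T 2" "T (Suc (Suc k))" "append_map k (zs[i := x])" by (rule append_linear[OF u[OF x]])
    interpret y: linear_map K "T 2" "T (Suc (Suc k))" "append_map k (zs[i := y])" by (rule append_linear[OF u[OF y]])
    interpret xy: linear_map K "T 2" "T (Suc (Suc k))" "append_map k (zs[i := x \<oplus>\<^bsub>V\<^esub> y])" by (rule append_linear[OF u[OF xy]])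
    show ?thesis using m
    proof (induction rule: tensor2_induct)
      case (pure a b)
      then have "a # b # zs \<in> tuples V (Suc (Suc k))" using zs by simp
      from pure_tensor_add[OF field_axioms module_axioms this, of "Suc (Suc i)" x y]
      show ?case using pure zs x y xy i u by (simp add: append_pure)
    qed (simp_all add: T.a_ac T.smult_r_distr)
  qed
  show "append_map k (zs[i := c \<odot>\<^bsub>V\<^esub> x]) m = c \<odot>\<^bsub>T (Suc (Suc k))\<^esub> append_map k (zs[i := x]) m"
    if c: "c \<in> carrier K" and x: "x \<in> carrier V" for c x
  proof -
    have cx: "c \<odot>\<^bsub>V\<^esub> x \<in> carrier V" using c x by simp
    interpret x: linear_map K "T 2" "T (Suc (Suc k))" "append_map k (zs[i := x])" by (rule append_linear[OF u[OF x]])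
    interpret cx: linear_map K "T 2" "T (Suc (Suc k))" "append_map k (zs[i := c \<odot>\<^bsub>V\<^esub> x])" by (rule append_linear[OF u[OF cx]])
    show ?thesis using m
    proof (induction rule: tensor2_induct)
      case (pure a b)
      then have "a # b # zs \<in> tuples V (Suc (Suc k))" using zs by simp
      from pure_tensor_smult[OF field_axioms module_axioms this, of "Suc (Suc i)" c x]
      show ?case using pure zs x c cx i u by (simp add: append_pure)
    qed (use c in \<open>simp_all add: T.smult_r_distr T.smult_assoc1[symmetric] m_comm\<close>)
  qed
qed

end

subsection \<open>The extension that splits over a free algebra\<close>

text \<open>
  \<open>A \<otimes> A\<close> is acted on by \<open>A\<close>: from the right by multiplication of the second factor, and by
  derivations through the bracket.
\<close>

context awb
begin

definition mult_map :: "('c list \<Rightarrow> 'a) set \<Rightarrow> 'c"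
  where "mult_map = bilinear_lift K A (mult A)"

definition brk_map :: "('c list \<Rightarrow> 'a) set \<Rightarrow> 'c"
  where "brk_map = bilinear_lift K A (bracket A)"

definition right_mult :: "'c \<Rightarrow> ('c list \<Rightarrow> 'a) set \<Rightarrow> ('c list \<Rightarrow> 'a) set"
  where "right_mult y = bilinear_lift K (T 2) (\<lambda>a b. pt [a, b \<otimes>\<^bsub>A\<^esub> y])"

definition derive_by :: "'c \<Rightarrow> ('c list \<Rightarrow> 'a) set \<Rightarrow> ('c list \<Rightarrow> 'a) set"
  where "derive_by c = bilinear_lift K (T 2) (\<lambda>a b. pt [bracket A a c, b] \<oplus>\<^bsub>T 2\<^esub> pt [a, bracket A b c])"

lemmas ops_closed = mult_closed bracket_closed
lemmas ops_linear = mult_add_left mult_add_right mult_smult_left mult_smult_right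
  bracket_add_left bracket_add_right bracket_smult_left bracket_smult_right

lemma bilinear_mult: "bilinear K A A (mult A)" and bilinear_bracket: "bilinear K A A (bracket A)"
  by (intro bilinearI; simp add: ops_closed ops_linear)+

lemma bilinear_right_mult: "y \<in> carrier A \<Longrightarrow> bilinear K A (T 2) (\<lambda>a b. pt [a, b \<otimes>\<^bsub>A\<^esub> y])"
  by (intro bilinearI) (simp_all add: ops_closed ops_linear pure_add2 pure_smult2 pure2_closed)

lemma bilinear_derive_by:
  "c \<in> carrier A \<Longrightarrow> bilinear K A (T 2) (\<lambda>a b. pt [bracket A a c, b] \<oplus>\<^bsub>T 2\<^esub> pt [a, bracket A b c])"
  by (intro bilinearI)
    (simp_all add: ops_closed ops_linear pure_add2 pure_smult2 pure2_closed T.a_ac T.smult_r_distr)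

lemma mult_map_linear: "linear_map K (T 2) A mult_map"
  and brk_map_linear: "linear_map K (T 2) A brk_map"
  unfolding mult_map_def brk_map_def
  by (rule bilinear_lift_map[OF module_axioms bilinear_mult] bilinear_lift_map[OF module_axioms bilinear_bracket])+

lemma right_mult_linear: "y \<in> carrier A \<Longrightarrow> linear_map K (T 2) (T 2) (right_mult y)"
  unfolding right_mult_def by (rule bilinear_lift_map[OF T.module_axioms bilinear_right_mult])

lemma derive_by_linear: "c \<in> carrier A \<Longrightarrow> linear_map K (T 2) (T 2) (derive_by c)"
  unfolding derive_by_def by (rule bilinear_lift_map[OF T.module_axioms bilinear_derive_by])

lemma ops_pure:
  assumes "a \<in> carrier A" "b \<in> carrier A"
  shows "mult_map (pt [a, b]) = a \<otimes>\<^bsub>A\<^esub> b" "brk_map (pt [a, b]) = bracket A a b"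
    "y \<in> carrier A \<Longrightarrow> right_mult y (pt [a, b]) = pt [a, b \<otimes>\<^bsub>A\<^esub> y]"
    "y \<in> carrier A \<Longrightarrow> derive_by y (pt [a, b]) = pt [bracket A a y, b] \<oplus>\<^bsub>T 2\<^esub> pt [a, bracket A b y]"
  unfolding mult_map_def brk_map_def right_mult_def derive_by_def
  using assms by (simp_all add: bilinear_lift_pure[OF module_axioms bilinear_mult]
      bilinear_lift_pure[OF module_axioms bilinear_bracket]
      bilinear_lift_pure[OF T.module_axioms bilinear_right_mult]
      bilinear_lift_pure[OF T.module_axioms bilinear_derive_by])

lemmas tensor_op_simps =
  linear_map.closed[OF mult_map_linear] linear_map.add[OF mult_map_linear] linear_map.smult[OF mult_map_linear]
  linear_map.closed[OF right_mult_linear] linear_map.add[OF right_mult_linear] linear_map.smult[OF right_mult_linear]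
  linear_map.closed[OF derive_by_linear] linear_map.add[OF derive_by_linear] linear_map.smult[OF derive_by_linear]
  linear_map.zero[OF mult_map_linear] linear_map.zero[OF right_mult_linear] linear_map.zero[OF derive_by_linear]

lemma right_mult_add:
  assumes m: "m \<in> carrier (T 2)" and y: "y \<in> carrier A" "y' \<in> carrier A"
  shows "right_mult (y \<oplus>\<^bsub>A\<^esub> y') m = right_mult y m \<oplus>\<^bsub>T 2\<^esub> right_mult y' m"
  using m y by (induction rule: tensor2_induct)
    (simp_all add: tensor_op_simps ops_pure ops_closed ops_linear pure_add2 pure_smult2 pure2_closed T.a_ac T.smult_r_distr)

lemma right_mult_smult:
  assumes m: "m \<in> carrier (T 2)" and y: "y \<in> carrier A" "k \<in> carrier K"
  shows "right_mult (k \<odot>\<^bsub>A\<^esub> y) m = k \<odot>\<^bsub>T 2\<^esub> right_mult y m"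
  using m y by (induction rule: tensor2_induct)
    (simp_all add: tensor_op_simps ops_pure ops_closed ops_linear pure_add2 pure_smult2 pure2_closed T.smult_r_distr T.smult_assoc1[symmetric] m_comm)

lemma right_mult_assoc:
  assumes m: "m \<in> carrier (T 2)" and y: "y \<in> carrier A" "y' \<in> carrier A"
  shows "right_mult y' (right_mult y m) = right_mult (y \<otimes>\<^bsub>A\<^esub> y') m"
  using m y by (induction rule: tensor2_induct)
    (simp_all add: tensor_op_simps ops_pure ops_closed ops_linear pure_add2 pure_smult2 pure2_closed mult_assoc)

lemma mult_map_right_mult:
  assumes m: "m \<in> carrier (T 2)" and y: "y \<in> carrier A"
  shows "mult_map (right_mult y m) = mult_map m \<otimes>\<^bsub>A\<^esub> y"
  using m y by (induction rule: tensor2_induct)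
    (simp_all add: tensor_op_simps ops_pure ops_closed ops_linear pure_add2 pure_smult2 pure2_closed mult_assoc)

lemma derive_by_add:
  assumes m: "m \<in> carrier (T 2)" and y: "c \<in> carrier A" "c' \<in> carrier A"
  shows "derive_by (c \<oplus>\<^bsub>A\<^esub> c') m = derive_by c m \<oplus>\<^bsub>T 2\<^esub> derive_by c' m"
  using m y by (induction rule: tensor2_induct)
    (simp_all add: tensor_op_simps ops_pure ops_closed ops_linear pure_add2 pure_smult2 pure2_closed T.a_ac T.smult_r_distr)

lemma derive_by_smult:
  assumes m: "m \<in> carrier (T 2)" and y: "c \<in> carrier A" "k \<in> carrier K"
  shows "derive_by (k \<odot>\<^bsub>A\<^esub> c) m = k \<odot>\<^bsub>T 2\<^esub> derive_by c m"
  using m y by (induction rule: tensor2_induct)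
    (simp_all add: tensor_op_simps ops_pure ops_closed ops_linear pure_add2 pure_smult2 pure2_closed T.smult_r_distr T.smult_assoc1[symmetric] m_comm)

lemma derive_by_right_mult:
  assumes m: "m \<in> carrier (T 2)" and y: "c \<in> carrier A" "y \<in> carrier A"
  shows "derive_by c (right_mult y m) = right_mult y (derive_by c m) \<oplus>\<^bsub>T 2\<^esub> right_mult (bracket A y c) m"
  using m y by (induction rule: tensor2_induct)
    (simp_all add: tensor_op_simps ops_pure ops_closed ops_linear pure_add2 pure_smult2 pure2_closed bracket_mult T.a_ac T.smult_r_distr)

lemma mult_map_derive_by:
  assumes m: "m \<in> carrier (T 2)" and y: "c \<in> carrier A"
  shows "mult_map (derive_by c m) = bracket A (mult_map m) c"
  using m y by (induction rule: tensor2_induct)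
    (simp_all add: tensor_op_simps ops_pure ops_closed ops_linear pure_add2 pure_smult2 pure2_closed bracket_mult)

end

lemma module_transfer:
  assumes D: "module K D" and eq: "carrier P = carrier D" "zero P = zero D" "add P = add D" "smult P = smult D"
  shows "module K P"
proof -
  interpret D: module K D by fact
  have inv: "\<exists>g\<in>carrier D. g \<oplus>\<^bsub>D\<^esub> f = \<zero>\<^bsub>D\<^esub>" if "f \<in> carrier D" for f
    using that D.a_inv_closed D.l_neg by blast
  have ab: "abelian_group P"
    by (rule abelian_groupI; unfold eq)
      (rule D.a_closed D.zero_closed D.a_assoc D.a_comm D.l_zero inv; assumption)+
  show ?thesis
    by (rule moduleI[OF D.is_cring ab]; unfold eq)
      (rule D.smult_closed D.smult_l_distr D.smult_r_distr D.smult_assoc1 D.smult_one; assumption)+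
qed

text \<open>Projectivity: preimages under \<open>q\<close> of the free generators determine a homomorphism from \<open>F\<close>, which is a
  section since two homomorphisms that agree on the generators are equal.  Freeness enters the proof
  that the rows are exact through this property alone.\<close>

lemma free_awb_projective:
  fixes F :: "('k, 'a, 'm) awb_scheme"
  assumes free: "is_free_awb K F" and F: "awb K F" and P: "awb K P" and q: "q \<in> awb_hom K P F"
    and surj: "\<And>x. x \<in> carrier F \<Longrightarrow> \<exists>z\<in>carrier P. q z = x"
  shows "\<exists>s\<in>awb_hom K F P. \<forall>x\<in>carrier F. q (s x) = x"
proof -
  interpret F: awb K F by fact
  interpret P: awb K P by fact
  obtain S :: "'a set" and h where h: "h \<in> awb_hom K (free_awb K S) F" and bij: "bij_betw h (carrier (free_awb K S)) (carrier F)"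
    using free unfolding is_free_awb_def by blast
  let ?G = "free_awb K S"
  interpret G: awb K ?G by (rule awb_free_awb[OF F.field_axioms])
  have gen: "free_awb_gen K S x \<in> carrier ?G" if "x \<in> S" for x
  proof -
    have "Gen x \<in> monomials S" using that by (simp add: monomials_def)
    then have "basis_elem K (Gen x) \<in> carrier (free_bimagma K S)"
      using basis_elem_carrier[OF F.field_axioms] by (simp add: free_bimagma_simps)
    then show ?thesis
      unfolding free_awb_def free_awb_gen_def
      by (subst quot_awb_simps(1)[OF bilinear_pair_free_bimagma[OF F.field_axioms] free_awb_ideal[OF F.field_axioms]]) blast
  qed
  have hc: "h y \<in> carrier F" if "y \<in> carrier ?G" for y using lin_hom_closed[OF awb_hom_lin[OF h] that] .
  have "\<forall>x\<in>S. \<exists>z\<in>carrier P. q z = h (free_awb_gen K S x)" using surj hc gen by blast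
  then obtain f where f: "f \<in> S \<rightarrow> carrier P" "\<And>x. x \<in> S \<Longrightarrow> q (f x) = h (free_awb_gen K S x)"
    unfolding Pi_def mem_Collect_eq by metis
  obtain g where g: "g \<in> awb_hom K ?G P" "\<forall>x\<in>S. g (free_awb_gen K S x) = f x"
    using free_awb_universal(1)[OF P f(1)] by blast
  have qg: "(\<lambda>y. q (g y)) \<in> awb_hom K ?G F"
    using q g(1) lin_hom_compose[OF awb_hom_lin[OF g(1)] awb_hom_lin[OF q]] lin_hom_closed[OF awb_hom_lin[OF g(1)]]
    by (simp add: awb_hom_def)
  have eq: "q (g y) = h y" if "y \<in> carrier ?G" for y
  proof -
    have "(\<lambda>x. h (free_awb_gen K S x)) \<in> S \<rightarrow> carrier F" using hc gen by blast
    moreover have "\<forall>x\<in>S. q (g (free_awb_gen K S x)) = h (free_awb_gen K S x)" using g(2) f(2) by simp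
    ultimately have "\<forall>y\<in>carrier ?G. q (g y) = h y" using free_awb_universal(2)[OF F _ qg h] by blast
    then show ?thesis using that by blast
  qed
  define k where "k = inv_into (carrier ?G) h"
  have k: "k x \<in> carrier ?G" "h (k x) = x" if "x \<in> carrier F" for x
    using bij that unfolding k_def bij_betw_def by (auto intro: inv_into_into f_inv_into_f)
  have kI: "k x = y" if "y \<in> carrier ?G" "h y = x" for x y
    using bij that unfolding k_def bij_betw_def by (auto intro: inv_into_f_f)
  note hD = h[unfolded awb_hom_def, simplified]
  note gD = g(1)[unfolded awb_hom_def, simplified]
  have hl: "h \<in> lin_hom K ?G F" and gl: "g \<in> lin_hom K ?G P" using hD gD by auto
  have kadd: "k (x \<oplus>\<^bsub>F\<^esub> y) = k x \<oplus>\<^bsub>?G\<^esub> k y" "k (x \<otimes>\<^bsub>F\<^esub> y) = k x \<otimes>\<^bsub>?G\<^esub> k y"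
    "k (bracket F x y) = bracket ?G (k x) (k y)" if "x \<in> carrier F" "y \<in> carrier F" for x y
    using k that hD
    by (intro kI; simp add: lin_hom_add[OF hl] G.mult_closed G.bracket_closed)+
  have ksm: "k (c \<odot>\<^bsub>F\<^esub> x) = c \<odot>\<^bsub>?G\<^esub> k x" if "c \<in> carrier K" "x \<in> carrier F" for c x
    using k that by (intro kI; simp add: lin_hom_smult[OF hl])
  have "(\<lambda>x. g (k x)) \<in> lin_hom K F P"
    using k(1) by (intro lin_homI) (simp_all add: kadd ksm lin_hom_closed[OF gl] lin_hom_add[OF gl] lin_hom_smult[OF gl])
  then have "(\<lambda>x. g (k x)) \<in> awb_hom K F P"
    using gD k(1) by (simp add: awb_hom_def kadd)
  then show ?thesis using eq k by (intro bexI[of _ "\<lambda>x. g (k x)"]) auto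
qed

context awb
begin

lemma pure2_zero:
  assumes "a \<in> carrier A" shows "pt [\<zero>\<^bsub>A\<^esub>, a] = \<zero>\<^bsub>T 2\<^esub>" "pt [a, \<zero>\<^bsub>A\<^esub>] = \<zero>\<^bsub>T 2\<^esub>"
  using pure_smult2(1)[of \<zero> "\<zero>\<^bsub>A\<^esub>" a] pure_smult2(2)[of \<zero> a "\<zero>\<^bsub>A\<^esub>"] assms pure2_closed by auto

lemma zero_mult [simp]:
  assumes "a \<in> carrier A"
  shows "\<zero>\<^bsub>A\<^esub> \<otimes>\<^bsub>A\<^esub> a = \<zero>\<^bsub>A\<^esub>" "a \<otimes>\<^bsub>A\<^esub> \<zero>\<^bsub>A\<^esub> = \<zero>\<^bsub>A\<^esub>" "bracket A \<zero>\<^bsub>A\<^esub> a = \<zero>\<^bsub>A\<^esub>" "bracket A a \<zero>\<^bsub>A\<^esub> = \<zero>\<^bsub>A\<^esub>"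
  using mult_smult_left[of \<zero> a a] mult_smult_right[of \<zero> a a] bracket_smult_left[of \<zero> a a]
    bracket_smult_right[of \<zero> a a] assms mult_closed[of a a] bracket_closed[of a a] by simp_all

text \<open>
  An element \<open>(p, m, r)\<close> stands for a decomposition of \<open>p + \<mu>(m)\<close>, its \<open>split_value\<close>, into a part \<open>p\<close> of
  words of length \<open>1\<close> and a part \<open>m\<close> that records longer words as first letter \<open>\<otimes>\<close> rest; \<open>r\<close> records
  \<open>w \<otimes> x\<close> for letters \<open>[w, x]\<close>.  In a product with an element of value \<open>y\<close>, the first letters are those of
  the left factor, which gives \<open>p \<otimes> y + m y\<close>.  The bracket with an element of value \<open>y\<close> is a
  derivation, keeps the number of letters, and turns a letter \<open>p\<close> into the letter \<open>[p, y]\<close>, recorded in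
  \<open>r\<close> as \<open>p \<otimes> y\<close>.
\<close>

definition split_ext :: "('a, 'c \<times> ('c list \<Rightarrow> 'a) set \<times> ('c list \<Rightarrow> 'a) set) awb"
  where "split_ext = (let D = dsum A (dsum (T 2) (T 2)) in
    \<lparr>carrier = carrier D,
     mult = (\<lambda>(p, m, r) (p', m', r'). (\<zero>\<^bsub>A\<^esub>, pt [p, p' \<oplus>\<^bsub>A\<^esub> mult_map m'] \<oplus>\<^bsub>T 2\<^esub> right_mult (p' \<oplus>\<^bsub>A\<^esub> mult_map m') m, \<zero>\<^bsub>T 2\<^esub>)),
     one = undefined, zero = zero D, add = add D, smult = smult D,
     bracket = (\<lambda>(p, m, r) (p', m', r'). (bracket A p (p' \<oplus>\<^bsub>A\<^esub> mult_map m'),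
       derive_by (p' \<oplus>\<^bsub>A\<^esub> mult_map m') m, pt [p, p' \<oplus>\<^bsub>A\<^esub> mult_map m']))\<rparr>)"

definition split_value :: "'c \<times> ('c list \<Rightarrow> 'a) set \<times> ('c list \<Rightarrow> 'a) set \<Rightarrow> 'c"
  where "split_value = (\<lambda>(p, m, r). p \<oplus>\<^bsub>A\<^esub> mult_map m)"

lemma split_ext_simps:
  "z \<in> carrier split_ext \<longleftrightarrow> (\<exists>p m r. z = (p, m, r) \<and> p \<in> carrier A \<and> m \<in> carrier (T 2) \<and> r \<in> carrier (T 2))"
  "(p, m, r) \<oplus>\<^bsub>split_ext\<^esub> (p', m', r') = (p \<oplus>\<^bsub>A\<^esub> p', m \<oplus>\<^bsub>T 2\<^esub> m', r \<oplus>\<^bsub>T 2\<^esub> r')"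
  "k \<odot>\<^bsub>split_ext\<^esub> (p, m, r) = (k \<odot>\<^bsub>A\<^esub> p, k \<odot>\<^bsub>T 2\<^esub> m, k \<odot>\<^bsub>T 2\<^esub> r)"
  "(p, m, r) \<otimes>\<^bsub>split_ext\<^esub> (p', m', r') =
    (\<zero>\<^bsub>A\<^esub>, pt [p, p' \<oplus>\<^bsub>A\<^esub> mult_map m'] \<oplus>\<^bsub>T 2\<^esub> right_mult (p' \<oplus>\<^bsub>A\<^esub> mult_map m') m, \<zero>\<^bsub>T 2\<^esub>)"
  "bracket split_ext (p, m, r) (p', m', r') = (bracket A p (p' \<oplus>\<^bsub>A\<^esub> mult_map m'),
    derive_by (p' \<oplus>\<^bsub>A\<^esub> mult_map m') m, pt [p, p' \<oplus>\<^bsub>A\<^esub> mult_map m'])"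
  by (auto simp: split_ext_def Let_def dsum_simps)

lemmas split_calc = tensor_op_simps ops_pure ops_closed ops_linear pure_add2 pure_smult2 pure2_closed pure2_zero
  right_mult_add right_mult_smult right_mult_assoc mult_map_right_mult
  derive_by_add derive_by_smult derive_by_right_mult mult_map_derive_by
  T.smult_r_distr smult_r_distr T.a_assoc M.a_assoc

lemma split_ext_awb: "awb K split_ext"
proof -
  have "module K split_ext"
    by (rule module_transfer[OF dsum_module[OF module_axioms dsum_module[OF T.module_axioms T.module_axioms]]])
      (simp_all add: split_ext_def Let_def)
  then show ?thesis
    by (intro awb.intro bilinear_pair.intro bilinear_pair_axioms.intro awb_axioms.intro field_axioms)
      (auto simp: split_ext_simps split_calc mult_assoc bracket_mult T.a_ac M.a_ac)
qed

lemma split_value_hom: "split_value \<in> awb_hom K split_ext A"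
proof -
  have "split_value \<in> lin_hom K split_ext A"
    by (rule lin_homI) (auto simp: split_ext_simps split_value_def split_calc M.a_ac)
  then show ?thesis
    by (auto simp: awb_hom_def split_ext_simps split_value_def split_calc M.a_ac)
qed

end

text \<open>
  The components of a section of \<open>split_value\<close>.  In the free algebra on \<open>S\<close>, the section with value
  \<open>(s, 0, 0)\<close> at the generator \<open>s\<close> has as \<open>\<pi>\<close> the projection to the space of letters, its \<open>\<sigma>\<close> splits the
  first letter off a word of length at least \<open>2\<close>, and \<open>\<tau>\<close> sends a letter \<open>[w, x]\<close> to \<open>w \<otimes> x\<close> and the
  letters from \<open>S\<close> to zero.
\<close>

locale split_awb = awb +
  fixes \<pi> and \<sigma> and \<tau>
  assumes \<pi>_hom: "\<pi> \<in> lin_hom K A A" and \<sigma>_hom: "\<sigma> \<in> lin_hom K A (T 2)" and \<tau>_hom: "\<tau> \<in> lin_hom K A (T 2)"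
    and \<pi>_\<sigma>: "a \<in> carrier A \<Longrightarrow> \<pi> a \<oplus>\<^bsub>A\<^esub> mult_map (\<sigma> a) = a"
    and \<pi>_mult: "\<lbrakk>a \<in> carrier A; b \<in> carrier A\<rbrakk> \<Longrightarrow> \<pi> (a \<otimes>\<^bsub>A\<^esub> b) = \<zero>\<^bsub>A\<^esub>"
    and \<sigma>_mult: "\<lbrakk>a \<in> carrier A; b \<in> carrier A\<rbrakk> \<Longrightarrow> \<sigma> (a \<otimes>\<^bsub>A\<^esub> b) = pt [\<pi> a, b] \<oplus>\<^bsub>T 2\<^esub> right_mult b (\<sigma> a)"
    and \<tau>_mult: "\<lbrakk>a \<in> carrier A; b \<in> carrier A\<rbrakk> \<Longrightarrow> \<tau> (a \<otimes>\<^bsub>A\<^esub> b) = \<zero>\<^bsub>T 2\<^esub>"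
    and \<pi>_bracket: "\<lbrakk>a \<in> carrier A; b \<in> carrier A\<rbrakk> \<Longrightarrow> \<pi> (bracket A a b) = bracket A (\<pi> a) b"
    and \<sigma>_bracket: "\<lbrakk>a \<in> carrier A; b \<in> carrier A\<rbrakk> \<Longrightarrow> \<sigma> (bracket A a b) = derive_by b (\<sigma> a)"
    and \<tau>_bracket: "\<lbrakk>a \<in> carrier A; b \<in> carrier A\<rbrakk> \<Longrightarrow> \<tau> (bracket A a b) = pt [\<pi> a, b]"

lemma free_awb_split:
  assumes A: "awb K A" and free: "is_free_awb K A"
  shows "\<exists>\<pi> \<sigma> \<tau>. split_awb K A \<pi> \<sigma> \<tau>"
proof -
  interpret A: awb K A by fact
  have "\<exists>z\<in>carrier A.split_ext. A.split_value z = x" if "x \<in> carrier A" for x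
    using that A.T.zero_closed[of 2]
    by (intro bexI[of _ "(x, \<zero>\<^bsub>A.T 2\<^esub>, \<zero>\<^bsub>A.T 2\<^esub>)"]) (simp_all add: A.split_value_def A.split_ext_simps A.tensor_op_simps)
  then obtain s where s: "s \<in> awb_hom K A A.split_ext" "\<And>x. x \<in> carrier A \<Longrightarrow> A.split_value (s x) = x"
    using free_awb_projective[OF free A A.split_ext_awb A.split_value_hom] by blast
  define \<pi> where "\<pi> x = fst (s x)" for x
  define \<sigma> where "\<sigma> x = fst (snd (s x))" for x
  define \<tau> where "\<tau> x = snd (snd (s x))" for x
  have se: "s x = (\<pi> x, \<sigma> x, \<tau> x)" for x by (simp add: \<pi>_def \<sigma>_def \<tau>_def)
  note sl = awb_hom_lin[OF s(1)]
  have c: "\<pi> x \<in> carrier A" "\<sigma> x \<in> carrier (A.T 2)" "\<tau> x \<in> carrier (A.T 2)" if "x \<in> carrier A" for x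
    using lin_hom_closed[OF sl that] by (simp_all add: se A.split_ext_simps)
  have v: "\<pi> x \<oplus>\<^bsub>A\<^esub> A.mult_map (\<sigma> x) = x" if "x \<in> carrier A" for x
    using s(2)[OF that] by (simp add: se A.split_value_def)
  have m: "s (x \<otimes>\<^bsub>A\<^esub> y) = s x \<otimes>\<^bsub>A.split_ext\<^esub> s y" "s (bracket A x y) = bracket A.split_ext (s x) (s y)"
    if "x \<in> carrier A" "y \<in> carrier A" for x y
    using s(1) that by (auto simp: awb_hom_def)
  have lin: "\<pi> \<in> lin_hom K A A" "\<sigma> \<in> lin_hom K A (A.T 2)" "\<tau> \<in> lin_hom K A (A.T 2)"
    using lin_hom_add[OF sl] lin_hom_smult[OF sl] c
    by (intro lin_homI; simp add: se A.split_ext_simps)+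
  have "split_awb K A \<pi> \<sigma> \<tau>"
    by (intro split_awb.intro split_awb_axioms.intro A lin v)
      (use m in \<open>simp_all add: se A.split_ext_simps v\<close>)
  then show ?thesis by blast
qed

subsection \<open>The contraction\<close>

lemma (in abelian_monoid) finsum_lessThan_Suc_shift:
  assumes "\<And>i. i < Suc n \<Longrightarrow> f i \<in> carrier G"
  shows "(\<Oplus>i\<in>{..<Suc n}. f i) = f 0 \<oplus> (\<Oplus>i\<in>{..<n}. f (Suc i))"
  using assms
proof (induction n)
  case (Suc n)
  have "(\<Oplus>i\<in>{..<Suc (Suc n)}. f i) = f (Suc n) \<oplus> (\<Oplus>i\<in>{..<Suc n}. f i)"
    unfolding lessThan_Suc[of "Suc n"] using Suc.prems by (intro finsum_insert) auto
  also have "\<dots> = f (Suc n) \<oplus> (f 0 \<oplus> (\<Oplus>i\<in>{..<n}. f (Suc i)))" using Suc by simp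
  also have "\<dots> = f 0 \<oplus> (f (Suc n) \<oplus> (\<Oplus>i\<in>{..<n}. f (Suc i)))"
    using Suc.prems by (intro a_lcomm finsum_closed) auto
  also have "f (Suc n) \<oplus> (\<Oplus>i\<in>{..<n}. f (Suc i)) = (\<Oplus>i\<in>{..<Suc n}. f (Suc i))"
    unfolding lessThan_Suc[of n] using Suc.prems by (intro finsum_insert[symmetric]) auto
  finally show ?case .
qed (simp add: lessThan_Suc)

lemma linear_map_finsum:
  fixes K (structure)
  assumes V: "module K V" and W: "module K W" and I: "finite I" and f: "\<And>i. i \<in> I \<Longrightarrow> linear_map K V W (f i)"
  shows "linear_map K V W (\<lambda>x. \<Oplus>\<^bsub>W\<^esub>i\<in>I. f i x)"
proof (intro linear_mapI V W lin_homI)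
  interpret W: module K W by (rule W)
  note cl = linear_map.closed[OF f]
  fix x assume x: "x \<in> carrier V"
  show "(\<Oplus>\<^bsub>W\<^esub>i\<in>I. f i x) \<in> carrier W" using cl[OF _ x] by (intro W.finsum_closed) auto
  show "(\<Oplus>\<^bsub>W\<^esub>i\<in>I. f i (x \<oplus>\<^bsub>V\<^esub> y)) = (\<Oplus>\<^bsub>W\<^esub>i\<in>I. f i x) \<oplus>\<^bsub>W\<^esub> (\<Oplus>\<^bsub>W\<^esub>i\<in>I. f i y)" if y: "y \<in> carrier V" for y
  proof -
    have "(\<Oplus>\<^bsub>W\<^esub>i\<in>I. f i (x \<oplus>\<^bsub>V\<^esub> y)) = (\<Oplus>\<^bsub>W\<^esub>i\<in>I. f i x \<oplus>\<^bsub>W\<^esub> f i y)"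
      using cl[OF _ x] cl[OF _ y] linear_map.add[OF f x y] by (intro W.finsum_cong') (auto intro!: W.a_closed)
    also have "\<dots> = (\<Oplus>\<^bsub>W\<^esub>i\<in>I. f i x) \<oplus>\<^bsub>W\<^esub> (\<Oplus>\<^bsub>W\<^esub>i\<in>I. f i y)"
      using cl[OF _ x] cl[OF _ y] by (intro W.finsum_addf) auto
    finally show ?thesis .
  qed
  show "(\<Oplus>\<^bsub>W\<^esub>i\<in>I. f i (c \<odot>\<^bsub>V\<^esub> x)) = c \<odot>\<^bsub>W\<^esub> (\<Oplus>\<^bsub>W\<^esub>i\<in>I. f i x)" if c: "c \<in> carrier K" for c
  proof -
    have "(\<Oplus>\<^bsub>W\<^esub>i\<in>I. f i (c \<odot>\<^bsub>V\<^esub> x)) = (\<Oplus>\<^bsub>W\<^esub>i\<in>I. c \<odot>\<^bsub>W\<^esub> f i x)"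
      using cl[OF _ x] linear_map.smult[OF f c x] c by (intro W.finsum_cong') (auto intro!: W.smult_closed)
    also have "\<dots> = c \<odot>\<^bsub>W\<^esub> (\<Oplus>\<^bsub>W\<^esub>i\<in>I. f i x)"
      using cl[OF _ x] c I by (intro W.finsum_smult_ldistr[symmetric]) auto
    finally show ?thesis .
  qed
qed

lemma linear_map_scale:
  fixes K (structure)
  assumes f: "linear_map K V W f" and c: "c \<in> carrier K"
  shows "linear_map K V W (\<lambda>x. c \<odot>\<^bsub>W\<^esub> f x)"
proof -
  interpret f: linear_map K V W f by (rule f)
  show ?thesis
    using c by (intro linear_mapI f.V.module_axioms f.W.module_axioms lin_homI)
      (simp_all add: f.W.smult_r_distr f.W.smult_assoc1[symmetric] f.V.m_comm)
qed

context awb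
begin

lemma T2_eq: "T 2 = T (Suc (Suc 0))"
  by (simp add: numeral_2_eq_2)

lemma merge_Cons: "merge A 0 (a # b # zs) = (a \<otimes>\<^bsub>A\<^esub> b) # zs" "merge A (Suc i) (a # zs) = a # merge A i zs"
  by (simp_all add: merge_def)

lemma act_Cons:
  "zs \<noteq> [] \<Longrightarrow> act A 0 (a # zs) = bracket A a (last zs) # butlast zs"
  "zs \<noteq> [] \<Longrightarrow> act A (Suc j) (a # zs) = a # act A j zs"
  by (simp_all add: act_def)

text \<open>The bar differential of \<open>m \<otimes> y \<otimes> z\<^sub>1 \<otimes> \<cdots> \<otimes> z\<^sub>k\<close> with \<open>m \<in> A \<otimes> A\<close>: merging inside \<open>m\<close>, merging \<open>m\<close>
  with \<open>y\<close>, and merging to the right of \<open>m\<close>, in this order.\<close>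

lemma bar_append:
  assumes r: "r \<le> k" and y: "y \<in> carrier A" and zs: "zs \<in> tuples A k" and m: "m \<in> carrier (T 2)"
  shows "bar_map K A (Suc (Suc r)) (Suc (Suc k)) (append_map (Suc k) (y # zs) m) =
    pt (mult_map m # y # zs) \<ominus>\<^bsub>T (Suc (Suc k))\<^esub> append_map k zs (right_mult y m) \<oplus>\<^bsub>T (Suc (Suc k))\<^esub>
    (\<Oplus>\<^bsub>T (Suc (Suc k))\<^esub>i\<in>{..<r}. sgn_pow K i \<odot>\<^bsub>T (Suc (Suc k))\<^esub> append_map k (merge A i (y # zs)) m)"
proof -
  let ?N = "Suc (Suc k)" and ?w = "y # zs"
  have w: "?w \<in> tuples A (Suc k)" using y zs by simp
  have mw: "merge A i ?w \<in> tuples A k" if "i < r" for i using merge_tuples'[OF w, of i] that r by simp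
  have "Suc (Suc r) \<le> ?N" using r by simp
  note b = bar_linear[OF this]
  note a = append_linear[OF w] and az = append_linear[OF zs] and rm = right_mult_linear[OF y]
  have p: "linear_map K A (T ?N) (\<lambda>x. pt (x # ?w))"
    using w by (intro linear_mapI module_axioms T.module_axioms lin_homI)
      (simp_all add: pure_head_add[of _ _ _ "Suc k"] pure_head_smult[of _ _ _ "Suc k"] pure_closed)
  have f: "linear_map K (T 2) (T ?N) (\<lambda>m. sgn_pow K i \<odot>\<^bsub>T ?N\<^esub> append_map k (merge A i ?w) m)" if "i < r" for i
    by (intro linear_map_scale append_linear mw that sgn_closed)
  have rhs: "linear_map K (T 2) (T ?N) (\<lambda>m. \<Oplus>\<^bsub>T ?N\<^esub>i\<in>{..<r}. sgn_pow K i \<odot>\<^bsub>T ?N\<^esub> append_map k (merge A i ?w) m)"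
    using f by (intro linear_map_finsum T.module_axioms) auto
  note lm = linear_map.closed linear_map.add linear_map.smult
  note s = lm[OF b] lm[OF a] lm[OF az] lm[OF rm] lm[OF p] lm[OF rhs] lm[OF mult_map_linear]
  show ?thesis using m
  proof (induction rule: tensor2_induct)
    case (pure a b)
    let ?f = "\<lambda>i. sgn_pow K i \<odot>\<^bsub>T ?N\<^esub> pt (merge A i (a # b # ?w))"
    have t: "a # b # ?w \<in> tuples A (Suc ?N)" using pure w by simp
    have fc: "?f i \<in> carrier (T ?N)" if "i < Suc (Suc r)" for i
      using merge_tuples'[OF t, of i] that r by (intro T.smult_closed pure_closed) auto
    have c: "pt (a # (b \<otimes>\<^bsub>A\<^esub> y) # zs) \<in> carrier (T ?N)" "pt ((a \<otimes>\<^bsub>A\<^esub> b) # ?w) \<in> carrier (T ?N)"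
      using pure y zs w by (auto intro!: pure_closed simp: ops_closed)
    have "bar_map K A (Suc (Suc r)) ?N (append_map (Suc k) ?w (pt [a, b])) = (\<Oplus>\<^bsub>T ?N\<^esub>i\<in>{..<Suc (Suc r)}. ?f i)"
      using pure w t r by (simp add: append_pure bar_pure del: tuples_Cons)
    also have "\<dots> = ?f 0 \<oplus>\<^bsub>T ?N\<^esub> (?f (Suc 0) \<oplus>\<^bsub>T ?N\<^esub> (\<Oplus>\<^bsub>T ?N\<^esub>i\<in>{..<r}. ?f (Suc (Suc i))))"
      using fc by (subst T.finsum_lessThan_Suc_shift, simp, subst T.finsum_lessThan_Suc_shift) auto
    also have "(\<Oplus>\<^bsub>T ?N\<^esub>i\<in>{..<r}. ?f (Suc (Suc i))) =
        (\<Oplus>\<^bsub>T ?N\<^esub>i\<in>{..<r}. sgn_pow K i \<odot>\<^bsub>T ?N\<^esub> append_map k (merge A i ?w) (pt [a, b]))"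
    proof (intro T.finsum_cong' refl)
      show "(\<lambda>i. sgn_pow K i \<odot>\<^bsub>T ?N\<^esub> append_map k (merge A i ?w) (pt [a, b])) \<in> {..<r} \<rightarrow> carrier (T ?N)"
        using linear_map.closed[OF f] pure pure2_closed by auto
      fix i assume "i \<in> {..<r}"
      then show "?f (Suc (Suc i)) = sgn_pow K i \<odot>\<^bsub>T ?N\<^esub> append_map k (merge A i ?w) (pt [a, b])"
        using pure mw[of i] append_pure by (simp add: merge_Cons sgn_pow_Suc[OF field_axioms])
    qed
    also have "?f 0 = pt (mult_map (pt [a, b]) # ?w)" using pure c by (simp add: merge_Cons ops_pure sgn_pow_0[OF field_axioms])
    also have "?f (Suc 0) = \<ominus>\<^bsub>T ?N\<^esub> append_map k zs (right_mult y (pt [a, b]))"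
      using pure y zs c
      by (simp add: merge_Cons ops_pure append_pure ops_closed sgn_pow_Suc[OF field_axioms] sgn_pow_0[OF field_axioms] T.smult_l_minus)
    finally show ?case
      using lm(1)[OF p, of "mult_map (pt [a, b])"] lm(1)[OF az, of "right_mult y (pt [a, b])"] lm(1)[OF rhs, of "pt [a, b]"]
        pure y ops_pure pure2_closed lm(1)[OF rm, of "pt [a, b]"]
      by (simp add: a_minus_def T.a_assoc ops_closed)
  next
    case (add x x')
    then show ?case using y by (simp add: s a_minus_def T.a_ac T.minus_add)
  next
    case (smult c x)
    then show ?case using y by (simp add: s a_minus_def T.smult_r_distr T.smult_r_minus)
  qed
qed

lemma bar_append_Nil:
  assumes zs: "zs \<in> tuples A k" and m: "m \<in> carrier (T 2)"
  shows "bar_map K A (Suc 0) (Suc k) (append_map k zs m) = pt (mult_map m # zs)"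
proof -
  have "Suc 0 \<le> Suc k" by simp
  note b = bar_linear[OF this] and a = append_linear[OF zs]
  have p: "linear_map K A (T (Suc k)) (\<lambda>x. pt (x # zs))"
    using zs by (intro linear_mapI module_axioms T.module_axioms lin_homI)
      (simp_all add: pure_head_add pure_head_smult pure_closed)
  note lm = linear_map.closed linear_map.add linear_map.smult
  note s = lm[OF b] lm[OF a] lm[OF p] lm[OF mult_map_linear]
  show ?thesis using m
  proof (induction rule: tensor2_induct)
    case (pure a b)
    have "bar_map K A (Suc 0) (Suc k) (pt (a # b # zs)) = (\<Oplus>\<^bsub>T (Suc k)\<^esub>i\<in>{..<Suc 0}. sgn_pow K i \<odot>\<^bsub>T (Suc k)\<^esub> pt (merge A i (a # b # zs)))"
      using pure zs by (intro bar_pure) auto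
    then show ?case using pure zs pure_closed[of "(a \<otimes>\<^bsub>A\<^esub> b) # zs" "Suc k"]
      by (simp add: append_pure merge_Cons ops_pure sgn_pow_0[OF field_axioms] ops_closed lessThan_Suc)
  qed (simp_all add: s)
qed

lemma bracket_append:
  assumes ws: "ws \<in> tuples A (Suc n)" and m: "m \<in> carrier (T 2)"
  shows "bracket_map K A (Suc (Suc n)) (append_map (Suc n) ws m) =
    append_map n (butlast ws) (derive_by (last ws) m) \<oplus>\<^bsub>T (Suc (Suc n))\<^esub>
    (\<Oplus>\<^bsub>T (Suc (Suc n))\<^esub>j\<in>{..<n}. append_map n (act A j ws) m)"
proof -
  let ?N = "Suc (Suc n)"
  have ne: "ws \<noteq> []" using ws by (auto simp: tuples_def)
  have bl: "butlast ws \<in> tuples A n" using ws by (auto simp: tuples_def dest: in_set_butlastD)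
  have la: "last ws \<in> carrier A" using ws ne by (auto simp: tuples_def)
  have aw: "act A j ws \<in> tuples A n" if "j < n" for j using act_tuples'[OF ws that] .
  note b = bracket_linear[of ?N] and a = append_linear[OF ws] and az = append_linear[OF bl] and d = derive_by_linear[OF la]
  note f = append_linear[OF aw]
  have rhs: "linear_map K (T 2) (T ?N) (\<lambda>m. \<Oplus>\<^bsub>T ?N\<^esub>j\<in>{..<n}. append_map n (act A j ws) m)"
    using f by (intro linear_map_finsum T.module_axioms) auto
  note lm = linear_map.closed linear_map.add linear_map.smult
  note s = lm[OF b] lm[OF a] lm[OF az] lm[OF d] lm[OF rhs]
  show ?thesis using m
  proof (induction rule: tensor2_induct)
    case (pure a b)
    let ?f = "\<lambda>i. pt (act A i (a # b # ws))"
    have t: "a # b # ws \<in> tuples A (Suc ?N)" using pure ws by simp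
    have fc: "?f i \<in> carrier (T ?N)" if "i < Suc (Suc n)" for i
      using act_tuples'[OF t, of i] that by (intro pure_closed) auto
    have "bracket_map K A ?N (append_map (Suc n) ws (pt [a, b])) = (\<Oplus>\<^bsub>T ?N\<^esub>i\<in>{..<?N}. ?f i)"
      using pure ws t by (simp add: append_pure bracket_pure del: tuples_Cons)
    also have "\<dots> = ?f 0 \<oplus>\<^bsub>T ?N\<^esub> (?f (Suc 0) \<oplus>\<^bsub>T ?N\<^esub> (\<Oplus>\<^bsub>T ?N\<^esub>i\<in>{..<n}. ?f (Suc (Suc i))))"
      using fc by (subst T.finsum_lessThan_Suc_shift, simp, subst T.finsum_lessThan_Suc_shift) auto
    also have "\<dots> = (?f 0 \<oplus>\<^bsub>T ?N\<^esub> ?f (Suc 0)) \<oplus>\<^bsub>T ?N\<^esub> (\<Oplus>\<^bsub>T ?N\<^esub>i\<in>{..<n}. ?f (Suc (Suc i)))"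
      using fc by (intro T.a_assoc[symmetric] T.finsum_closed) auto
    also have "(\<Oplus>\<^bsub>T ?N\<^esub>i\<in>{..<n}. ?f (Suc (Suc i))) = (\<Oplus>\<^bsub>T ?N\<^esub>j\<in>{..<n}. append_map n (act A j ws) (pt [a, b]))"
      using pure aw ne linear_map.closed[OF f] pure2_closed
      by (intro T.finsum_cong') (auto simp: act_Cons append_pure intro!: pure_closed)
    also have "?f 0 \<oplus>\<^bsub>T ?N\<^esub> ?f (Suc 0) = append_map n (butlast ws) (derive_by (last ws) (pt [a, b]))"
      using pure ne la bl by (simp add: act_Cons ops_pure lm(2)[OF az] pure2_closed append_pure ops_closed)
    finally show ?case .
  next
    case (add x x')
    then show ?case by (simp add: s T.a_ac)
  next
    case (smult c x)
    then show ?case by (simp add: s T.smult_r_distr)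
  qed
qed

end

context split_awb
begin

text \<open>The contracting homotopy splits the first factor by \<open>\<sigma>\<close>.  On the complex of \<open>A\<close> it is
  \<open>(u, v) \<mapsto> (split_first u, - split_first v)\<close> in positive degrees and \<open>u \<mapsto> (split_first u,
  split_bracket u)\<close> in degree \<open>0\<close>.\<close>

definition split_first :: "nat \<Rightarrow> ('c list \<Rightarrow> 'a) set \<Rightarrow> ('c list \<Rightarrow> 'a) set"
  where "split_first k = tensor_lift K (T (Suc (Suc k))) (\<lambda>xs. append_map k (tl xs) (\<sigma> (hd xs)))"

definition split_bracket :: "('c list \<Rightarrow> 'a) set \<Rightarrow> ('c list \<Rightarrow> 'a) set"
  where "split_bracket = tensor_lift K (T 2) (\<lambda>xs. \<tau> (xs ! 0))"

lemma \<sigma>_closed: "a \<in> carrier A \<Longrightarrow> \<sigma> a \<in> carrier (T 2)" by (rule lin_hom_closed[OF \<sigma>_hom])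
lemma \<tau>_closed: "a \<in> carrier A \<Longrightarrow> \<tau> a \<in> carrier (T 2)" by (rule lin_hom_closed[OF \<tau>_hom])
lemma \<pi>_closed: "a \<in> carrier A \<Longrightarrow> \<pi> a \<in> carrier A" by (rule lin_hom_closed[OF \<pi>_hom])

lemma multilinear_split_first: "multilinear K A (Suc k) (T (Suc (Suc k))) (\<lambda>xs. append_map k (tl xs) (\<sigma> (hd xs)))"
proof (rule multilinearI)
  have d: "\<exists>x zs. xs = x # zs \<and> x \<in> carrier A \<and> zs \<in> tuples A k" if "xs \<in> tuples A (Suc k)" for xs
    using that by (cases xs) (auto simp: tuples_def)
  show "append_map k (tl xs) (\<sigma> (hd xs)) \<in> carrier (T (Suc (Suc k)))" if "xs \<in> tuples A (Suc k)" for xs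
    using d[OF that] linear_map.closed[OF append_linear \<sigma>_closed] by auto
  fix xs i assume "xs \<in> tuples A (Suc k)" and i: "i < Suc k"
  then obtain x zs where x: "xs = x # zs" "x \<in> carrier A" "zs \<in> tuples A k" using d by blast
  note m = multilinear_append[OF \<sigma>_closed[OF x(2)], of k]
  show "append_map k (tl (xs[i := a \<oplus>\<^bsub>A\<^esub> b])) (\<sigma> (hd (xs[i := a \<oplus>\<^bsub>A\<^esub> b]))) =
      append_map k (tl (xs[i := a])) (\<sigma> (hd (xs[i := a]))) \<oplus>\<^bsub>T (Suc (Suc k))\<^esub>
      append_map k (tl (xs[i := b])) (\<sigma> (hd (xs[i := b])))" if "a \<in> carrier A" "b \<in> carrier A" for a b
    using i that linear_map.add[OF append_linear[OF x(3)] \<sigma>_closed \<sigma>_closed] multilinear_addD[OF m x(3)]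
    by (cases i) (simp_all add: x lin_hom_add[OF \<sigma>_hom])
  show "append_map k (tl (xs[i := c \<odot>\<^bsub>A\<^esub> a])) (\<sigma> (hd (xs[i := c \<odot>\<^bsub>A\<^esub> a]))) =
      c \<odot>\<^bsub>T (Suc (Suc k))\<^esub> append_map k (tl (xs[i := a])) (\<sigma> (hd (xs[i := a])))"
    if "c \<in> carrier K" "a \<in> carrier A" for c a
    using i that linear_map.smult[OF append_linear[OF x(3)] _ \<sigma>_closed] multilinear_smultD[OF m x(3)]
    by (cases i) (simp_all add: x lin_hom_smult[OF \<sigma>_hom])
qed

lemma split_first_linear: "linear_map K (T (Suc k)) (T (Suc (Suc k))) (split_first k)"
  unfolding split_first_def by (rule tensor_lift_map[OF T.module_axioms multilinear_split_first])

lemma split_first_pure: "\<lbrakk>a \<in> carrier A; zs \<in> tuples A k\<rbrakk> \<Longrightarrow> split_first k (pt (a # zs)) = append_map k zs (\<sigma> a)"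
  unfolding split_first_def using tensor_lift_pure[OF T.module_axioms multilinear_split_first, of "a # zs" k] by simp

lemma multilinear_split_bracket: "multilinear K A (Suc 0) (T 2) (\<lambda>xs. \<tau> (xs ! 0))"
  by (rule multilinear_lin_hom[OF _ \<tau>_hom]) (auto intro!: multilinearI simp: tuples_def length_Suc_conv)

lemma split_bracket_linear: "linear_map K (T (Suc 0)) (T 2) split_bracket"
  unfolding split_bracket_def by (rule tensor_lift_map[OF T.module_axioms multilinear_split_bracket])

lemma split_bracket_pure: "a \<in> carrier A \<Longrightarrow> split_bracket (pt [a]) = \<tau> a"
  unfolding split_bracket_def using tensor_lift_pure[OF T.module_axioms multilinear_split_bracket, of "[a]"] by simp

lemma tuples_SucE:
  assumes "xs \<in> tuples A (Suc k)"
  obtains x zs where "xs = x # zs" "x \<in> carrier A" "zs \<in> tuples A k"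
  using assms by (cases xs) (auto simp: tuples_def)

text \<open>On \<open>a \<otimes> y \<otimes> \<cdots>\<close>, merging \<open>\<sigma>(a)\<close> with \<open>y\<close> on the left and splitting \<open>a y\<close> on the right differ by
  \<open>\<pi>(a) \<otimes> y\<close>, the terms that merge later factors cancel, and \<open>\<pi>(a) + \<mu>(\<sigma>(a)) = a\<close>.\<close>

lemma bar_split_first:
  assumes r: "r \<le> k" and u: "u \<in> carrier (T (Suc (Suc k)))"
  shows "bar_map K A (Suc (Suc r)) (Suc (Suc k)) (split_first (Suc k) u) \<oplus>\<^bsub>T (Suc (Suc k))\<^esub> split_first k (bar_map K A (Suc r) (Suc k) u) = u"
proof -
  let ?N = "Suc (Suc k)"
  have "Suc (Suc r) \<le> ?N" "Suc r \<le> Suc k" using r by simp_all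
  then interpret b: linear_map K "T (Suc ?N)" "T ?N" "bar_map K A (Suc (Suc r)) ?N"
    by (intro bar_linear)
  interpret b': linear_map K "T ?N" "T (Suc k)" "bar_map K A (Suc r) (Suc k)"
    using r by (intro bar_linear) simp
  interpret h: linear_map K "T ?N" "T (Suc ?N)" "split_first (Suc k)" by (rule split_first_linear)
  interpret h': linear_map K "T (Suc k)" "T ?N" "split_first k" by (rule split_first_linear)
  show ?thesis using u
  proof (induction rule: tensor_induct)
    case (pure xs)
    obtain a ws where xs: "xs = a # ws" "a \<in> carrier A" and w: "ws \<in> tuples A (Suc k)"
      using pure by (rule tuples_SucE)
    obtain y zs where ws: "ws = y # zs" "y \<in> carrier A" "zs \<in> tuples A k" using w by (rule tuples_SucE)
    let ?S = "\<Oplus>\<^bsub>T ?N\<^esub>i\<in>{..<r}. sgn_pow K i \<odot>\<^bsub>T ?N\<^esub> append_map k (merge A i ws) (\<sigma> a)"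
    have mw: "merge A i ws \<in> tuples A k" if "i < r" for i using merge_tuples'[OF w, of i] that r by simp
    have sc: "append_map k (merge A i ws) (\<sigma> a) \<in> carrier (T ?N)" if "i < r" for i
      using linear_map.closed[OF append_linear[OF mw[OF that]] \<sigma>_closed] xs by blast
    have Sc: "?S \<in> carrier (T ?N)" using sc by (intro T.finsum_closed) auto
    have c: "append_map k zs (right_mult y (\<sigma> a)) \<in> carrier (T ?N)"
      using linear_map.closed[OF append_linear[OF ws(3)]] tensor_op_simps ws xs \<sigma>_closed by simp
    have pc: "pt (mult_map (\<sigma> a) # ws) \<in> carrier (T ?N)" "pt (\<pi> a # ws) \<in> carrier (T ?N)"
      using w xs \<sigma>_closed \<pi>_closed tensor_op_simps by (auto intro!: pure_closed)
    have 1: "bar_map K A (Suc (Suc r)) ?N (split_first (Suc k) (pt xs)) =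
        pt (mult_map (\<sigma> a) # ws) \<ominus>\<^bsub>T ?N\<^esub> append_map k zs (right_mult y (\<sigma> a)) \<oplus>\<^bsub>T ?N\<^esub> ?S"
      using bar_append[OF r ws(2,3) \<sigma>_closed[OF xs(2)]] split_first_pure[OF xs(2) w] xs(1) ws(1) by simp
    have mx: "merge A i xs \<in> tuples A (Suc k)" if "i < Suc r" for i using merge_tuples'[OF pure, of i] that r by simp
    have "split_first k (bar_map K A (Suc r) (Suc k) (pt xs)) =
        (\<Oplus>\<^bsub>T ?N\<^esub>i\<in>{..<Suc r}. split_first k (sgn_pow K i \<odot>\<^bsub>T (Suc k)\<^esub> pt (merge A i xs)))"
      using bar_pure[OF \<open>Suc r \<le> Suc k\<close> pure] mx by (simp only:) (intro h'.finsum; auto intro!: pure_closed)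
    also have "\<dots> = split_first k (sgn_pow K 0 \<odot>\<^bsub>T (Suc k)\<^esub> pt (merge A 0 xs)) \<oplus>\<^bsub>T ?N\<^esub>
        (\<Oplus>\<^bsub>T ?N\<^esub>i\<in>{..<r}. split_first k (sgn_pow K (Suc i) \<odot>\<^bsub>T (Suc k)\<^esub> pt (merge A (Suc i) xs)))"
      using mx by (intro T.finsum_lessThan_Suc_shift h'.closed T.smult_closed pure_closed) auto
    also have "split_first k (sgn_pow K 0 \<odot>\<^bsub>T (Suc k)\<^esub> pt (merge A 0 xs)) =
        pt (\<pi> a # ws) \<oplus>\<^bsub>T ?N\<^esub> append_map k zs (right_mult y (\<sigma> a))"
    proof -
      have "pt ((a \<otimes>\<^bsub>A\<^esub> y) # zs) \<in> carrier (T (Suc k))" using xs ws by (intro pure_closed) (simp add: ops_closed)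
      then have "split_first k (sgn_pow K 0 \<odot>\<^bsub>T (Suc k)\<^esub> pt (merge A 0 xs)) = append_map k zs (\<sigma> (a \<otimes>\<^bsub>A\<^esub> y))"
        using xs ws by (simp add: merge_Cons sgn_pow_0[OF field_axioms] split_first_pure ops_closed)
      then show ?thesis
        using xs ws linear_map.add[OF append_linear[OF ws(3)], of "pt [\<pi> a, y]" "right_mult y (\<sigma> a)"]
        by (simp add: \<sigma>_mult \<pi>_closed \<sigma>_closed pure2_closed tensor_op_simps append_pure)
    qed
    also have "(\<Oplus>\<^bsub>T ?N\<^esub>i\<in>{..<r}. split_first k (sgn_pow K (Suc i) \<odot>\<^bsub>T (Suc k)\<^esub> pt (merge A (Suc i) xs))) =
        (\<Oplus>\<^bsub>T ?N\<^esub>i\<in>{..<r}. (\<ominus> \<one>) \<odot>\<^bsub>T ?N\<^esub> (sgn_pow K i \<odot>\<^bsub>T ?N\<^esub> append_map k (merge A i ws) (\<sigma> a)))"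
      \<comment> \<open>As a scalar, the sign of the index shift can be moved out of the sum.\<close>
    proof (intro T.finsum_cong' refl)
      show "(\<lambda>i. (\<ominus> \<one>) \<odot>\<^bsub>T ?N\<^esub> (sgn_pow K i \<odot>\<^bsub>T ?N\<^esub> append_map k (merge A i ws) (\<sigma> a))) \<in> {..<r} \<rightarrow> carrier (T ?N)"
        using sc by auto
      fix i assume "i \<in> {..<r}"
      then have i: "i < r" by simp
      have "pt (a # merge A i ws) \<in> carrier (T (Suc k))" using xs mw[OF i] by (intro pure_closed) simp
      then show "split_first k (sgn_pow K (Suc i) \<odot>\<^bsub>T (Suc k)\<^esub> pt (merge A (Suc i) xs)) =
          (\<ominus> \<one>) \<odot>\<^bsub>T ?N\<^esub> (sgn_pow K i \<odot>\<^bsub>T ?N\<^esub> append_map k (merge A i ws) (\<sigma> a))"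
        using xs mw[OF i] sc[OF i]
        by (simp add: merge_Cons sgn_pow_Suc[OF field_axioms] split_first_pure T.smult_l_minus)
    qed
    also have "\<dots> = \<ominus>\<^bsub>T ?N\<^esub> ?S"
    proof -
      have "(\<Oplus>\<^bsub>T ?N\<^esub>i\<in>{..<r}. (\<ominus> \<one>) \<odot>\<^bsub>T ?N\<^esub> (sgn_pow K i \<odot>\<^bsub>T ?N\<^esub> append_map k (merge A i ws) (\<sigma> a))) = (\<ominus> \<one>) \<odot>\<^bsub>T ?N\<^esub> ?S"
        using sc by (intro T.finsum_smult_ldistr[symmetric]) auto
      then show ?thesis using Sc by (simp add: T.smult_l_minus)
    qed
    finally have 2: "split_first k (bar_map K A (Suc r) (Suc k) (pt xs)) =
        pt (\<pi> a # ws) \<oplus>\<^bsub>T ?N\<^esub> append_map k zs (right_mult y (\<sigma> a)) \<oplus>\<^bsub>T ?N\<^esub> \<ominus>\<^bsub>T ?N\<^esub> ?S" .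
    have "(p \<ominus>\<^bsub>T ?N\<^esub> q \<oplus>\<^bsub>T ?N\<^esub> s) \<oplus>\<^bsub>T ?N\<^esub> (p' \<oplus>\<^bsub>T ?N\<^esub> q \<oplus>\<^bsub>T ?N\<^esub> \<ominus>\<^bsub>T ?N\<^esub> s) = p' \<oplus>\<^bsub>T ?N\<^esub> p"
      if "p \<in> carrier (T ?N)" "q \<in> carrier (T ?N)" "s \<in> carrier (T ?N)" "p' \<in> carrier (T ?N)" for p q s p'
    proof -
      have "(p \<ominus>\<^bsub>T ?N\<^esub> q \<oplus>\<^bsub>T ?N\<^esub> s) \<oplus>\<^bsub>T ?N\<^esub> (p' \<oplus>\<^bsub>T ?N\<^esub> q \<oplus>\<^bsub>T ?N\<^esub> \<ominus>\<^bsub>T ?N\<^esub> s) =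
          (p' \<oplus>\<^bsub>T ?N\<^esub> p) \<oplus>\<^bsub>T ?N\<^esub> ((q \<oplus>\<^bsub>T ?N\<^esub> \<ominus>\<^bsub>T ?N\<^esub> q) \<oplus>\<^bsub>T ?N\<^esub> (s \<oplus>\<^bsub>T ?N\<^esub> \<ominus>\<^bsub>T ?N\<^esub> s))"
        using that by (simp only: a_minus_def T.a_ac T.a_closed T.a_inv_closed)
      then show ?thesis using that by (simp add: T.r_neg)
    qed
    from this[OF pc(1) c Sc pc(2)]
    have "bar_map K A (Suc (Suc r)) ?N (split_first (Suc k) (pt xs)) \<oplus>\<^bsub>T ?N\<^esub> split_first k (bar_map K A (Suc r) (Suc k) (pt xs)) =
        pt (\<pi> a # ws) \<oplus>\<^bsub>T ?N\<^esub> pt (mult_map (\<sigma> a) # ws)"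
      unfolding 1 2 .
    also have "\<dots> = pt xs"
      using pure_head_add[OF \<pi>_closed[OF xs(2)] tensor_op_simps(1)[OF \<sigma>_closed[OF xs(2)]] w] xs by (simp add: \<pi>_\<sigma>)
    finally show ?case .
  next
    case (add x y)
    have "bar_map K A (Suc (Suc r)) ?N (split_first (Suc k) (x \<oplus>\<^bsub>T ?N\<^esub> y)) \<oplus>\<^bsub>T ?N\<^esub> split_first k (bar_map K A (Suc r) (Suc k) (x \<oplus>\<^bsub>T ?N\<^esub> y)) =
      (bar_map K A (Suc (Suc r)) ?N (split_first (Suc k) x) \<oplus>\<^bsub>T ?N\<^esub> split_first k (bar_map K A (Suc r) (Suc k) x)) \<oplus>\<^bsub>T ?N\<^esub>
      (bar_map K A (Suc (Suc r)) ?N (split_first (Suc k) y) \<oplus>\<^bsub>T ?N\<^esub> split_first k (bar_map K A (Suc r) (Suc k) y))"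
      using add(1,2) by (simp add: T.a_ac)
    then show ?case using add(3,4) by simp
  next
    case (smult c x)
    have "bar_map K A (Suc (Suc r)) ?N (split_first (Suc k) (c \<odot>\<^bsub>T ?N\<^esub> x)) \<oplus>\<^bsub>T ?N\<^esub> split_first k (bar_map K A (Suc r) (Suc k) (c \<odot>\<^bsub>T ?N\<^esub> x)) =
      c \<odot>\<^bsub>T ?N\<^esub> (bar_map K A (Suc (Suc r)) ?N (split_first (Suc k) x) \<oplus>\<^bsub>T ?N\<^esub> split_first k (bar_map K A (Suc r) (Suc k) x))"
      using smult(1,2) by (simp add: T.smult_r_distr)
    then show ?case using smult(3) by simp
  qed
qed

text \<open>Splitting commutes with the derivations \<open>[-, c]\<close>, since \<open>\<sigma>([a, c])\<close> is the derivative of \<open>\<sigma>(a)\<close>.\<close>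

lemma bracket_split_first:
  assumes v: "v \<in> carrier (T (Suc (Suc n)))"
  shows "bracket_map K A (Suc (Suc n)) (split_first (Suc n) v) = split_first n (bracket_map K A (Suc n) v)"
proof -
  let ?N = "Suc (Suc n)"
  interpret b: linear_map K "T (Suc ?N)" "T ?N" "bracket_map K A ?N" by (rule bracket_linear)
  interpret b': linear_map K "T ?N" "T (Suc n)" "bracket_map K A (Suc n)" by (rule bracket_linear)
  interpret h: linear_map K "T ?N" "T (Suc ?N)" "split_first (Suc n)" by (rule split_first_linear)
  interpret h': linear_map K "T (Suc n)" "T ?N" "split_first n" by (rule split_first_linear)
  show ?thesis using v
  proof (induction rule: tensor_induct)
    case (pure xs)
    obtain a ws where xs: "xs = a # ws" "a \<in> carrier A" and w: "ws \<in> tuples A (Suc n)"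
      using pure by (rule tuples_SucE)
    have ne: "ws \<noteq> []" using w by (auto simp: tuples_def)
    have bl: "butlast ws \<in> tuples A n" using w by (auto simp: tuples_def dest: in_set_butlastD)
    have la: "last ws \<in> carrier A" using w ne by (auto simp: tuples_def)
    have aw: "act A j ws \<in> tuples A n" if "j < n" for j using act_tuples'[OF w that] .
    have ax: "act A j xs \<in> tuples A (Suc n)" if "j < Suc n" for j using act_tuples'[OF pure that] .
    have "split_first n (bracket_map K A (Suc n) (pt xs)) = (\<Oplus>\<^bsub>T ?N\<^esub>j\<in>{..<Suc n}. split_first n (pt (act A j xs)))"
      unfolding bracket_pure[OF pure] using ax by (intro h'.finsum) (auto intro!: pure_closed)
    also have "\<dots> = split_first n (pt (act A 0 xs)) \<oplus>\<^bsub>T ?N\<^esub> (\<Oplus>\<^bsub>T ?N\<^esub>j\<in>{..<n}. split_first n (pt (act A (Suc j) xs)))"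
      using ax by (intro T.finsum_lessThan_Suc_shift h'.closed pure_closed) auto
    also have "split_first n (pt (act A 0 xs)) = append_map n (butlast ws) (derive_by (last ws) (\<sigma> a))"
      using xs ne bl la by (simp add: act_Cons split_first_pure ops_closed \<sigma>_bracket)
    also have "(\<Oplus>\<^bsub>T ?N\<^esub>j\<in>{..<n}. split_first n (pt (act A (Suc j) xs))) = (\<Oplus>\<^bsub>T ?N\<^esub>j\<in>{..<n}. append_map n (act A j ws) (\<sigma> a))"
      using xs ne aw linear_map.closed[OF append_linear[OF aw] \<sigma>_closed]
      by (intro T.finsum_cong') (auto simp: act_Cons split_first_pure)
    also have "append_map n (butlast ws) (derive_by (last ws) (\<sigma> a)) \<oplus>\<^bsub>T ?N\<^esub> \<dots> =
        bracket_map K A ?N (split_first (Suc n) (pt xs))"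
      using bracket_append[OF w \<sigma>_closed[OF xs(2)]] split_first_pure[OF xs(2) w] xs(1) by simp
    finally show ?case by simp
  qed simp_all
qed

lemma bar_T2:
  assumes m: "m \<in> carrier (T 2)"
  shows "bar_map K A (Suc 0) (Suc 0) m = pt [mult_map m]" and "bracket_map K A (Suc 0) m = pt [brk_map m]"
proof -
  interpret b: linear_map K "T 2" "T (Suc 0)" "bar_map K A (Suc 0) (Suc 0)" unfolding T2_eq by (rule bar_linear) simp
  interpret d: linear_map K "T 2" "T (Suc 0)" "bracket_map K A (Suc 0)" unfolding T2_eq by (rule bracket_linear)
  note p = pure_head_add[of _ _ "[]" 0, simplified] pure_head_smult[of _ _ "[]" 0, simplified]
  have t: "[a, b] \<in> tuples A (Suc (Suc 0))" if "a \<in> carrier A" "b \<in> carrier A" for a b using that by simp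
  show "bar_map K A (Suc 0) (Suc 0) m = pt [mult_map m]" using m
  proof (induction rule: tensor2_induct)
    case (pure a b)
    then show ?case using pure_closed[of "[a \<otimes>\<^bsub>A\<^esub> b]" "Suc 0"]
      by (simp add: bar_pure[OF _ t] merge_Cons ops_pure sgn_pow_0[OF field_axioms] ops_closed lessThan_Suc)
  qed (simp_all add: tensor_op_simps p)
  show "bracket_map K A (Suc 0) m = pt [brk_map m]" using m
  proof (induction rule: tensor2_induct)
    case (pure a b)
    then show ?case using pure_closed[of "[bracket A a b]" "Suc 0"]
      by (simp add: bracket_pure[OF t] act_Cons ops_pure ops_closed lessThan_Suc)
  qed (simp_all add: linear_map.closed[OF brk_map_linear] linear_map.add[OF brk_map_linear] linear_map.smult[OF brk_map_linear] p)
qed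

text \<open>In degree \<open>1\<close> the \<open>\<circ>\<close>-part has no bar differential, so \<open>bar_split_first\<close> does not apply there; the
  missing term \<open>\<pi>(a) \<circ> c\<close> is supplied by \<open>\<tau>([a, c]) = \<pi>(a) \<otimes> c\<close>.\<close>

lemma split_bracket_bar: "u \<in> carrier (T 2) \<Longrightarrow> split_bracket (bar_map K A (Suc 0) (Suc 0) u) = \<zero>\<^bsub>T 2\<^esub>"
  and bar_split_first_split_bracket: "v \<in> carrier (T 2) \<Longrightarrow>
    bar_map K A (Suc 0) (Suc (Suc 0)) (split_first (Suc 0) v) \<oplus>\<^bsub>T 2\<^esub> split_bracket (bracket_map K A (Suc 0) v) = v"
proof -
  interpret split_bracket: linear_map K "T (Suc 0)" "T 2" split_bracket by (rule split_bracket_linear)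
  interpret b: linear_map K "T 2" "T (Suc 0)" "bar_map K A (Suc 0) (Suc 0)" unfolding T2_eq by (rule bar_linear) simp
  interpret d: linear_map K "T 2" "T (Suc 0)" "bracket_map K A (Suc 0)" unfolding T2_eq by (rule bracket_linear)
  interpret h: linear_map K "T 2" "T (Suc (Suc (Suc 0)))" "split_first (Suc 0)" unfolding T2_eq by (rule split_first_linear)
  interpret b': linear_map K "T (Suc (Suc (Suc 0)))" "T 2" "bar_map K A (Suc 0) (Suc (Suc 0))"
    unfolding T2_eq by (rule bar_linear) simp
  show "split_bracket (bar_map K A (Suc 0) (Suc 0) u) = \<zero>\<^bsub>T 2\<^esub>" if "u \<in> carrier (T 2)" for u
    using that
  proof (induction rule: tensor2_induct)
    case (pure a b)
    then show ?case using pure2_closed by (simp add: bar_T2 ops_pure split_bracket_pure ops_closed \<tau>_mult)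
  qed simp_all
  show "bar_map K A (Suc 0) (Suc (Suc 0)) (split_first (Suc 0) v) \<oplus>\<^bsub>T 2\<^esub> split_bracket (bracket_map K A (Suc 0) v) = v" if "v \<in> carrier (T 2)"
    using that
  proof (induction rule: tensor2_induct)
    case (pure a b)
    have "bar_map K A (Suc 0) (Suc (Suc 0)) (split_first (Suc 0) (pt [a, b])) = pt [mult_map (\<sigma> a), b]"
      using pure bar_append_Nil[of "[b]" "Suc 0" "\<sigma> a"] \<sigma>_closed by (simp add: split_first_pure)
    moreover have "split_bracket (bracket_map K A (Suc 0) (pt [a, b])) = pt [\<pi> a, b]"
      using pure pure2_closed by (simp add: bar_T2 ops_pure split_bracket_pure ops_closed \<tau>_bracket)
    ultimately show ?case
      using pure pure_add2(1)[OF tensor_op_simps(1)[OF \<sigma>_closed] \<pi>_closed, of a a b] \<pi>_\<sigma>[of a]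
        M.a_comm[OF tensor_op_simps(1)[OF \<sigma>_closed] \<pi>_closed, of a a] by simp
  next
    case (add x y)
    have "bar_map K A (Suc 0) (Suc (Suc 0)) (split_first (Suc 0) (x \<oplus>\<^bsub>T 2\<^esub> y)) \<oplus>\<^bsub>T 2\<^esub> split_bracket (bracket_map K A (Suc 0) (x \<oplus>\<^bsub>T 2\<^esub> y)) =
      (bar_map K A (Suc 0) (Suc (Suc 0)) (split_first (Suc 0) x) \<oplus>\<^bsub>T 2\<^esub> split_bracket (bracket_map K A (Suc 0) x)) \<oplus>\<^bsub>T 2\<^esub>
      (bar_map K A (Suc 0) (Suc (Suc 0)) (split_first (Suc 0) y) \<oplus>\<^bsub>T 2\<^esub> split_bracket (bracket_map K A (Suc 0) y))"
      using add(1,2) by (simp add: T.a_ac)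
    then show ?case using add(3,4) by simp
  next
    case (smult c x)
    have "bar_map K A (Suc 0) (Suc (Suc 0)) (split_first (Suc 0) (c \<odot>\<^bsub>T 2\<^esub> x)) \<oplus>\<^bsub>T 2\<^esub> split_bracket (bracket_map K A (Suc 0) (c \<odot>\<^bsub>T 2\<^esub> x)) =
      c \<odot>\<^bsub>T 2\<^esub> (bar_map K A (Suc 0) (Suc (Suc 0)) (split_first (Suc 0) x) \<oplus>\<^bsub>T 2\<^esub> split_bracket (bracket_map K A (Suc 0) x))"
      using smult(1,2) by (simp add: T.smult_r_distr)
    then show ?case using smult(3) by simp
  qed
qed

text \<open>For a cycle, the homotopy identity reduces to \<open>d (h x) = x\<close>.\<close>

lemma cycle_is_boundary:
  assumes u: "u \<in> carrier (T (Suc (Suc m)))" and v: "v \<in> carrier (T (Suc (Suc m)))"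
    and cyc: "awb_boundary K A (Suc m) (u, v) = (\<zero>\<^bsub>T (Suc m)\<^esub>, \<zero>\<^bsub>T (Suc m)\<^esub>)"
  shows "\<exists>u'\<in>carrier (T (Suc (Suc (Suc m)))). \<exists>v'\<in>carrier (T (Suc (Suc (Suc m)))).
    awb_boundary K A (Suc (Suc m)) (u', v') = (u, v)"
proof -
  let ?N = "Suc (Suc m)"
  interpret b: linear_map K "T ?N" "T (Suc m)" "bar_map K A (Suc m) (Suc m)" by (rule bar_linear) simp
  interpret c: linear_map K "T ?N" "T (Suc m)" "bar_map K A m (Suc m)" by (rule bar_linear) simp
  interpret d: linear_map K "T ?N" "T (Suc m)" "bracket_map K A (Suc m)" by (rule bracket_linear)
  interpret h: linear_map K "T ?N" "T (Suc ?N)" "split_first (Suc m)" by (rule split_first_linear)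
  interpret h': linear_map K "T (Suc m)" "T ?N" "split_first m" by (rule split_first_linear)
  interpret b': linear_map K "T (Suc ?N)" "T ?N" "bar_map K A ?N ?N" by (rule bar_linear) simp
  interpret c': linear_map K "T (Suc ?N)" "T ?N" "bar_map K A (Suc m) ?N" by (rule bar_linear) simp
  interpret d': linear_map K "T (Suc ?N)" "T ?N" "bracket_map K A ?N" by (rule bracket_linear)
  have 1: "bar_map K A (Suc m) (Suc m) u \<oplus>\<^bsub>T (Suc m)\<^esub> bracket_map K A (Suc m) v = \<zero>\<^bsub>T (Suc m)\<^esub>"
    and "\<ominus>\<^bsub>T (Suc m)\<^esub> bar_map K A m (Suc m) v = \<zero>\<^bsub>T (Suc m)\<^esub>"
    using cyc awb_boundary_Suc[OF u v] by simp_all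
  then have 2: "bar_map K A m (Suc m) v = \<zero>\<^bsub>T (Suc m)\<^esub>" using v T.minus_minus T.neg_zero c.closed by metis
  have hv: "split_first (Suc m) v \<in> carrier (T (Suc ?N))" "split_first (Suc m) u \<in> carrier (T (Suc ?N))" using u v by auto
  have "bar_map K A ?N ?N (split_first (Suc m) u) \<oplus>\<^bsub>T ?N\<^esub> \<ominus>\<^bsub>T ?N\<^esub> bracket_map K A ?N (split_first (Suc m) v) =
      bar_map K A ?N ?N (split_first (Suc m) u) \<oplus>\<^bsub>T ?N\<^esub> split_first m (\<ominus>\<^bsub>T (Suc m)\<^esub> bracket_map K A (Suc m) v)"
    using v by (simp add: bracket_split_first)
  also have "\<ominus>\<^bsub>T (Suc m)\<^esub> bracket_map K A (Suc m) v = bar_map K A (Suc m) (Suc m) u"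
    using 1 u v T.minus_equality by simp
  also have "bar_map K A ?N ?N (split_first (Suc m) u) \<oplus>\<^bsub>T ?N\<^esub> split_first m (bar_map K A (Suc m) (Suc m) u) = u"
    using bar_split_first[OF le_refl u] .
  finally have fst: "bar_map K A ?N ?N (split_first (Suc m) u) \<oplus>\<^bsub>T ?N\<^esub> \<ominus>\<^bsub>T ?N\<^esub> bracket_map K A ?N (split_first (Suc m) v) = u" .
  have snd: "bar_map K A (Suc m) ?N (split_first (Suc m) v) = v"
  proof (cases m)
    case (Suc k)
    then have "bar_map K A (Suc m) ?N (split_first (Suc m) v) \<oplus>\<^bsub>T ?N\<^esub> split_first m (bar_map K A m (Suc m) v) = v"
      using bar_split_first[of k m v] v by simp
    then show ?thesis using 2 hv by simp
  next
    case 0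
    have uv: "u \<in> carrier (T 2)" "v \<in> carrier (T 2)" using u v 0 by (simp_all add: T2_eq)
    interpret split_bracket: linear_map K "T (Suc 0)" "T 2" split_bracket by (rule split_bracket_linear)
    have cl: "bar_map K A (Suc 0) (Suc 0) u \<in> carrier (T (Suc 0))" "bracket_map K A (Suc 0) v \<in> carrier (T (Suc 0))"
      using b.closed d.closed u v 0 by auto
    have "split_bracket (bar_map K A (Suc 0) (Suc 0) u \<oplus>\<^bsub>T (Suc 0)\<^esub> bracket_map K A (Suc 0) v) = \<zero>\<^bsub>T 2\<^esub>" using 1 0 by simp
    then have "split_bracket (bracket_map K A (Suc 0) v) = \<zero>\<^bsub>T 2\<^esub>" using cl split_bracket_bar[OF uv(1)] by simp
    moreover have "bar_map K A (Suc 0) (Suc (Suc 0)) (split_first (Suc 0) v) \<in> carrier (T 2)" using c'.closed hv 0 by (simp add: T2_eq)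
    ultimately show ?thesis using bar_split_first_split_bracket[OF uv(2)] 0 by simp
  qed
  have "awb_boundary K A ?N (split_first (Suc m) u, \<ominus>\<^bsub>T (Suc ?N)\<^esub> split_first (Suc m) v) = (u, v)"
    using awb_boundary_Suc[of "split_first (Suc m) u" "Suc m" "\<ominus>\<^bsub>T (Suc ?N)\<^esub> split_first (Suc m) v"] hv fst snd v by (simp add: T.minus_minus)
  then show ?thesis using hv by blast
qed

text \<open>With \<open>\<beta>(x \<otimes> y) = [x, y]\<close>, the boundary of \<open>(\<sigma>(a), \<tau>(a))\<close> is \<open>\<mu>(\<sigma>(a)) + \<beta>(\<tau>(a)) = a - (\<pi>(a) - \<beta>(\<tau>(a)))\<close>,
  and \<open>\<pi> - \<beta> \<circ> \<tau>\<close> vanishes on products and on brackets, hence on the ideal that they generate.\<close>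

lemma commutator_is_boundary:
  assumes a: "a \<in> awb_commutator K A"
  shows "\<exists>u\<in>carrier (T 2). \<exists>v\<in>carrier (T 2). awb_boundary K A 1 (u, v) = (pt [a], \<zero>\<^bsub>T 1\<^esub>)"
proof -
  interpret brk: linear_map K "T 2" A brk_map by (rule brk_map_linear)
  interpret \<pi>: linear_map K A A \<pi> by (intro linear_mapI module_axioms \<pi>_hom)
  interpret \<tau>: linear_map K A "T 2" \<tau> by (intro linear_mapI module_axioms T.module_axioms \<tau>_hom)
  define g where "g x = \<pi> x \<ominus>\<^bsub>A\<^esub> brk_map (\<tau> x)" for x
  have g: "g \<in> lin_hom K A A" unfolding g_def
    by (rule lin_homI) (simp_all add: a_minus_def M.minus_add M.a_ac smult_r_distr smult_r_minus)
  have z: "g (x \<otimes>\<^bsub>A\<^esub> y) = \<zero>\<^bsub>A\<^esub>" "g (bracket A x y) = \<zero>\<^bsub>A\<^esub>" if "x \<in> carrier A" "y \<in> carrier A" for x y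
    using that \<pi>_closed by (simp_all add: g_def \<pi>_mult \<tau>_mult \<pi>_bracket \<tau>_bracket ops_pure ops_closed M.minus_zero_iff)
  have "awb_ideal K A {x \<in> carrier A. g x = \<zero>\<^bsub>A\<^esub>}"
    using lin_kernel_submodule[OF module_axioms module_axioms g] z by (auto simp: awb_ideal_def ops_closed)
  then have "awb_commutator K A \<subseteq> {x \<in> carrier A. g x = \<zero>\<^bsub>A\<^esub>}"
    unfolding awb_commutator_def by (rule genideal_least) (use z in \<open>auto simp: ops_closed\<close>)
  then have a': "a \<in> carrier A" "\<pi> a = brk_map (\<tau> a)"
    using a \<pi>_closed \<tau>_closed by (auto simp: g_def M.minus_zero_iff)
  have c: "\<sigma> a \<in> carrier (T 2)" "\<tau> a \<in> carrier (T 2)" "mult_map (\<sigma> a) \<in> carrier A" "brk_map (\<tau> a) \<in> carrier A"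
    using a' \<sigma>_closed \<tau>_closed tensor_op_simps by auto
  have "awb_boundary K A 1 (\<sigma> a, \<tau> a) =
      (bar_map K A (Suc 0) (Suc 0) (\<sigma> a) \<oplus>\<^bsub>T (Suc 0)\<^esub> bracket_map K A (Suc 0) (\<tau> a), \<zero>\<^bsub>T (Suc 0)\<^esub>)"
    using awb_boundary_Suc[of "\<sigma> a" 0 "\<tau> a"] c bar_zero[of "\<tau> a" "Suc 0"] by (simp add: T2_eq)
  also have "\<dots> = (pt [mult_map (\<sigma> a) \<oplus>\<^bsub>A\<^esub> \<pi> a], \<zero>\<^bsub>T (Suc 0)\<^esub>)"
    using c a' pure_head_add[of "mult_map (\<sigma> a)" "\<pi> a" "[]" 0] by (simp add: bar_T2)
  also have "mult_map (\<sigma> a) \<oplus>\<^bsub>A\<^esub> \<pi> a = a"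
    using \<pi>_\<sigma>[OF a'(1)] M.a_comm[OF c(3) \<pi>_closed[OF a'(1)]] by simp
  finally show ?thesis using c by auto
qed

end

section \<open>The double complex of a free simplicial resolution\<close>

definition chain_map ::
  "('k, 'r) ring_scheme \<Rightarrow> ('k, 'w, 'n) module_scheme \<Rightarrow> nat \<Rightarrow> ('v \<Rightarrow> 'w) \<Rightarrow>
   ('v list \<Rightarrow> 'k) set \<times> ('v list \<Rightarrow> 'k) set \<Rightarrow> ('w list \<Rightarrow> 'k) set \<times> ('w list \<Rightarrow> 'k) set"
  where "chain_map K W p g = map_prod (tensor_map K W (Suc p) g) (tensor_map K W (Suc p) g)"

definition ab_proj ::
  "('k, 'r) ring_scheme \<Rightarrow> ('k, 'a, 'm) awb_scheme \<Rightarrow> ('a list \<Rightarrow> 'k) set \<times> ('a list \<Rightarrow> 'k) set \<Rightarrow> 'a set"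
  where "ab_proj K A z = tensor_lift K (awb_ab K A) (\<lambda>xs. awb_commutator K A +>\<^bsub>A\<^esub> (xs ! 0)) (fst z)"

context awb
begin

lemma chain_module: "module K (awb_chain K A m)"
  by (rule awb_chain_module[OF field_axioms module_axioms])

lemma chain_simps:
  "\<zero>\<^bsub>awb_chain K A m\<^esub> = (\<zero>\<^bsub>T (Suc m)\<^esub>, \<zero>\<^bsub>T (Suc m)\<^esub>)"
  "(x, y) \<oplus>\<^bsub>awb_chain K A m\<^esub> (x', y') = (x \<oplus>\<^bsub>T (Suc m)\<^esub> x', y \<oplus>\<^bsub>T (Suc m)\<^esub> y')"
  "k \<odot>\<^bsub>awb_chain K A m\<^esub> (x, y) = (k \<odot>\<^bsub>T (Suc m)\<^esub> x, k \<odot>\<^bsub>T (Suc m)\<^esub> y)"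
  "(x, y) \<in> carrier (awb_chain K A m) \<longleftrightarrow> x \<in> carrier (T (Suc m)) \<and> y \<in> carrier (T (Suc m)) \<and>
      (m = 0 \<longrightarrow> y = \<zero>\<^bsub>T (Suc m)\<^esub>)"
  using awb_chain_simps[of K A m] T.module_axioms[of "Suc m"] by simp_all

lemma awb_boundary_hom: "awb_boundary K A (Suc m) \<in> lin_hom K (awb_chain K A (Suc m)) (awb_chain K A m)"
proof -
  interpret b: linear_map K "T (Suc (Suc m))" "T (Suc m)" "bar_map K A (Suc m) (Suc m)" by (rule bar_linear) simp
  interpret c: linear_map K "T (Suc (Suc m))" "T (Suc m)" "bar_map K A m (Suc m)" by (rule bar_linear) simp
  interpret d: linear_map K "T (Suc (Suc m))" "T (Suc m)" "bracket_map K A (Suc m)" by (rule bracket_linear)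
  show ?thesis
  proof (rule lin_homI)
    fix x assume "x \<in> carrier (awb_chain K A (Suc m))"
    then obtain u v where x: "x = (u, v)" "u \<in> carrier (T (Suc (Suc m)))" "v \<in> carrier (T (Suc (Suc m)))"
      by (cases x) (simp add: chain_simps)
    have "\<ominus>\<^bsub>T (Suc m)\<^esub> bar_map K A m (Suc m) v = \<zero>\<^bsub>T (Suc m)\<^esub>" if "m = 0"
      using bar_zero[OF x(3)] that by simp
    then show "awb_boundary K A (Suc m) x \<in> carrier (awb_chain K A m)"
      unfolding x(1) awb_boundary_Suc[OF x(2,3)] chain_simps
      by (intro conjI impI T.a_closed T.a_inv_closed b.closed c.closed d.closed x) blast
    show "awb_boundary K A (Suc m) (x \<oplus>\<^bsub>awb_chain K A (Suc m)\<^esub> y) =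
        awb_boundary K A (Suc m) x \<oplus>\<^bsub>awb_chain K A m\<^esub> awb_boundary K A (Suc m) y"
      if yc: "y \<in> carrier (awb_chain K A (Suc m))" for y
    proof -
      obtain u' v' where y: "y = (u', v')" "u' \<in> carrier (T (Suc (Suc m)))" "v' \<in> carrier (T (Suc (Suc m)))"
        using yc by (cases y) (simp add: chain_simps)
      show ?thesis using x y by (simp add: awb_boundary_Suc chain_simps T.a_ac T.minus_add)
    qed
    show "awb_boundary K A (Suc m) (k \<odot>\<^bsub>awb_chain K A (Suc m)\<^esub> x) = k \<odot>\<^bsub>awb_chain K A m\<^esub> awb_boundary K A (Suc m) x"
      if "k \<in> carrier K" for k
      using x that by (simp add: awb_boundary_Suc chain_simps T.smult_r_distr T.smult_r_minus)
  qed
qed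

lemma awb_boundary_boundary:
  assumes z: "z \<in> carrier (awb_chain K A (Suc (Suc m)))"
  shows "awb_boundary K A (Suc m) (awb_boundary K A (Suc (Suc m)) z) = \<zero>\<^bsub>awb_chain K A m\<^esub>"
proof -
  let ?N = "Suc (Suc m)"
  obtain u v where x: "z = (u, v)" and u: "u \<in> carrier (T (Suc ?N))" and v: "v \<in> carrier (T (Suc ?N))"
    using z by (cases z) (simp add: chain_simps)
  interpret b: linear_map K "T ?N" "T (Suc m)" "bar_map K A (Suc m) (Suc m)" by (rule bar_linear) simp
  interpret c: linear_map K "T ?N" "T (Suc m)" "bar_map K A m (Suc m)" by (rule bar_linear) simp
  interpret d: linear_map K "T ?N" "T (Suc m)" "bracket_map K A (Suc m)" by (rule bracket_linear)
  interpret b': linear_map K "T (Suc ?N)" "T ?N" "bar_map K A ?N ?N" by (rule bar_linear) simp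
  interpret c': linear_map K "T (Suc ?N)" "T ?N" "bar_map K A (Suc m) ?N" by (rule bar_linear) simp
  interpret d': linear_map K "T (Suc ?N)" "T ?N" "bracket_map K A ?N" by (rule bracket_linear)
  show ?thesis
    using u v bar_bar[of "Suc m" "Suc m" u] bar_bar[of m "Suc m" v] bar_bracket[of v "Suc m"]
    by (simp add: x awb_boundary_Suc chain_simps T.r_neg T.minus_minus)
qed

lemma commutator_submodule: "submodule (awb_commutator K A) K A"
  and mult_in_commutator: "\<lbrakk>x \<in> carrier A; y \<in> carrier A\<rbrakk> \<Longrightarrow> x \<otimes>\<^bsub>A\<^esub> y \<in> awb_commutator K A"
  and bracket_in_commutator: "\<lbrakk>x \<in> carrier A; y \<in> carrier A\<rbrakk> \<Longrightarrow> bracket A x y \<in> awb_commutator K A"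
proof -
  have "awb_ideal K A (awb_commutator K A)"
    unfolding awb_commutator_def by (rule Defs.genideal_ideal[OF bilinear_pair_axioms]) (auto simp: ops_closed)
  then show "submodule (awb_commutator K A) K A" by (simp add: awb_ideal_def)
  show "x \<otimes>\<^bsub>A\<^esub> y \<in> awb_commutator K A" if "x \<in> carrier A" "y \<in> carrier A"
    unfolding awb_commutator_def by (rule subsetD[OF genideal_superset], rule UnI1) (use that in blast)
  show "bracket A x y \<in> awb_commutator K A" if "x \<in> carrier A" "y \<in> carrier A"
    unfolding awb_commutator_def by (rule subsetD[OF genideal_superset], rule UnI2) (use that in blast)
qed

lemma awb_ab_module: "module K (awb_ab K A)"
  unfolding awb_ab_def by (rule quot_space_module[OF field_axioms module_axioms commutator_submodule])

lemma ab_coset_hom: "(\<lambda>x. awb_commutator K A +>\<^bsub>A\<^esub> x) \<in> lin_hom K A (awb_ab K A)"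
  unfolding awb_ab_def by (rule quot_proj[OF field_axioms module_axioms commutator_submodule])

lemma ab_coset_zero: "x \<in> carrier A \<Longrightarrow> awb_commutator K A +>\<^bsub>A\<^esub> x = \<zero>\<^bsub>awb_ab K A\<^esub> \<longleftrightarrow> x \<in> awb_commutator K A"
  unfolding awb_ab_def by (rule quot_zero_iff[OF module_axioms commutator_submodule])

lemma multilinear_ab: "multilinear K A (Suc 0) (awb_ab K A) (\<lambda>xs. awb_commutator K A +>\<^bsub>A\<^esub> (xs ! 0))"
  by (rule multilinear_lin_hom[OF _ ab_coset_hom]) (auto intro!: multilinearI simp: tuples_def length_Suc_conv)

lemma ab_proj_pure: "x \<in> carrier A \<Longrightarrow> ab_proj K A (pt [x], v) = awb_commutator K A +>\<^bsub>A\<^esub> x"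
  unfolding ab_proj_def using tensor_lift_pure[OF awb_ab_module multilinear_ab, of "[x]"] by simp

lemma ab_proj_hom: "ab_proj K A \<in> lin_hom K (awb_chain K A 0) (awb_ab K A)"
proof -
  interpret l: linear_map K "T (Suc 0)" "awb_ab K A" "tensor_lift K (awb_ab K A) (\<lambda>xs. awb_commutator K A +>\<^bsub>A\<^esub> (xs ! 0))"
    by (rule tensor_lift_map[OF awb_ab_module multilinear_ab])
  show ?thesis
    by (rule lin_homI) (auto simp: ab_proj_def chain_simps)
qed

lemma chain_0E:
  assumes "z \<in> carrier (awb_chain K A 0)"
  obtains x where "x \<in> carrier A" "z = (pt [x], \<zero>\<^bsub>T 1\<^esub>)"
proof -
  obtain u where u: "u \<in> carrier (T 1)" "z = (u, \<zero>\<^bsub>T 1\<^esub>)" using assms by (cases z) (simp add: chain_simps)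
  have "u \<in> (\<lambda>x. pt [x]) ` carrier A"
    using tensor_power_1(2)[OF field_axioms module_axioms] u(1) by (simp only: bij_betw_def)
  then show ?thesis using u that by blast
qed

lemma pure_in_chain_0: "x \<in> carrier A \<Longrightarrow> (pt [x], \<zero>\<^bsub>T 1\<^esub>) \<in> carrier (awb_chain K A 0)"
  by (simp add: chain_simps pure_closed)

lemma ab_proj_surj:
  assumes "y \<in> carrier (awb_ab K A)"
  shows "\<exists>z\<in>carrier (awb_chain K A 0). ab_proj K A z = y"
proof -
  obtain x where "x \<in> carrier A" "y = awb_commutator K A +>\<^bsub>A\<^esub> x"
    using assms by (auto simp: awb_ab_def quot_space_carrier)
  then show ?thesis using ab_proj_pure pure_in_chain_0 by blast
qed

end

context split_awb
begin

lemma ab_proj_boundary: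
  assumes z: "z \<in> carrier (awb_chain K A (Suc 0))"
  shows "ab_proj K A (awb_boundary K A (Suc 0) z) = \<zero>\<^bsub>awb_ab K A\<^esub>"
proof -
  obtain u v where x: "z = (u, v)" and u: "u \<in> carrier (T 2)" and v: "v \<in> carrier (T 2)"
    using z by (cases z) (simp add: chain_simps T2_eq)
  interpret c: submodule "awb_commutator K A" K A by (rule commutator_submodule)
  note br = linear_map.closed[OF brk_map_linear] linear_map.add[OF brk_map_linear] linear_map.smult[OF brk_map_linear]
  note sub = submoduleE(4,5)[OF commutator_submodule]
  have 1: "mult_map u \<in> awb_commutator K A"
    using u by (induction rule: tensor2_induct) (simp_all add: ops_pure mult_in_commutator tensor_op_simps sub)
  have 2: "brk_map v \<in> awb_commutator K A"
    using v by (induction rule: tensor2_induct) (simp_all add: ops_pure bracket_in_commutator br sub)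
  have c: "mult_map u \<in> carrier A" "brk_map v \<in> carrier A" using u v tensor_op_simps br by auto
  have "bar_map K A (Suc 0) (Suc 0) u \<oplus>\<^bsub>T (Suc 0)\<^esub> bracket_map K A (Suc 0) v = pt [mult_map u \<oplus>\<^bsub>A\<^esub> brk_map v]"
    using u v c pure_head_add[of "mult_map u" "brk_map v" "[]" 0] by (simp add: bar_T2)
  then have "ab_proj K A (awb_boundary K A (Suc 0) z) = awb_commutator K A +>\<^bsub>A\<^esub> (mult_map u \<oplus>\<^bsub>A\<^esub> brk_map v)"
    using awb_boundary_Suc[of u 0 v] u v c by (simp add: x T2_eq ab_proj_pure)
  then show ?thesis using ab_coset_zero[of "mult_map u \<oplus>\<^bsub>A\<^esub> brk_map v"] sub(2)[OF 1 2] c by simp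
qed

lemma rows_exact:
  assumes z: "z \<in> carrier (awb_chain K A (Suc m))" and cyc: "awb_boundary K A (Suc m) z = \<zero>\<^bsub>awb_chain K A m\<^esub>"
  shows "\<exists>y\<in>carrier (awb_chain K A (Suc (Suc m))). awb_boundary K A (Suc (Suc m)) y = z"
proof -
  obtain u v where x: "z = (u, v)" "u \<in> carrier (T (Suc (Suc m)))" "v \<in> carrier (T (Suc (Suc m)))"
    using z by (cases z) (simp add: chain_simps)
  obtain u' v' where "u' \<in> carrier (T (Suc (Suc (Suc m))))" "v' \<in> carrier (T (Suc (Suc (Suc m))))"
    "awb_boundary K A (Suc (Suc m)) (u', v') = z"
    using cycle_is_boundary[OF x(2,3)] cyc x(1) by (auto simp: chain_simps)
  then show ?thesis by (intro bexI[of _ "(u', v')"]) (auto simp: chain_simps)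
qed

lemma rows_exact_0:
  assumes z: "z \<in> carrier (awb_chain K A 0)" and cyc: "ab_proj K A z = \<zero>\<^bsub>awb_ab K A\<^esub>"
  shows "\<exists>y\<in>carrier (awb_chain K A (Suc 0)). awb_boundary K A (Suc 0) y = z"
proof -
  obtain x where x: "x \<in> carrier A" "z = (pt [x], \<zero>\<^bsub>T 1\<^esub>)" using z by (rule chain_0E)
  then have "x \<in> awb_commutator K A" using cyc ab_coset_zero by (simp add: ab_proj_pure)
  from commutator_is_boundary[OF this] obtain u v where
    "u \<in> carrier (T 2)" "v \<in> carrier (T 2)" "awb_boundary K A (Suc 0) (u, v) = z" using x by auto
  then show ?thesis by (intro bexI[of _ "(u, v)"]) (auto simp: chain_simps T2_eq)
qed

end

lemma chain_map_linear:
  assumes A: "awb K A" and B: "awb K B" and g: "g \<in> lin_hom K A B"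
  shows "linear_map K (awb_chain K A p) (awb_chain K B p) (chain_map K B p g)"
proof -
  interpret A: awb K A by fact
  interpret B: awb K B by fact
  interpret t: linear_map K "A.T (Suc p)" "B.T (Suc p)" "tensor_map K B (Suc p) g"
    by (rule tensor_map_map[OF A.field_axioms A.module_axioms B.module_axioms g])
  show ?thesis
  proof (intro linear_mapI A.chain_module B.chain_module lin_homI)
    fix x assume "x \<in> carrier (awb_chain K A p)"
    then obtain u v where x: "x = (u, v)" "u \<in> carrier (A.T (Suc p))" "v \<in> carrier (A.T (Suc p))"
        "p = 0 \<Longrightarrow> v = \<zero>\<^bsub>A.T (Suc p)\<^esub>"
      by (cases x) (simp add: A.chain_simps)
    have "tensor_map K B (Suc p) g v = \<zero>\<^bsub>B.T (Suc p)\<^esub>" if "p = 0" using x(4)[OF that] by simp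
    then show "chain_map K B p g x \<in> carrier (awb_chain K B p)"
      unfolding x(1) chain_map_def map_prod_simp B.chain_simps using x by blast
    show "chain_map K B p g (x \<oplus>\<^bsub>awb_chain K A p\<^esub> y) = chain_map K B p g x \<oplus>\<^bsub>awb_chain K B p\<^esub> chain_map K B p g y"
      if "y \<in> carrier (awb_chain K A p)" for y
      using that x by (cases y) (simp add: chain_map_def B.chain_simps A.chain_simps)
    show "chain_map K B p g (k \<odot>\<^bsub>awb_chain K A p\<^esub> x) = k \<odot>\<^bsub>awb_chain K B p\<^esub> chain_map K B p g x"
      if "k \<in> carrier K" for k
      using that x by (simp add: chain_map_def B.chain_simps A.chain_simps)
  qed
qed

lemma chain_map_compose:
  assumes A: "awb K A" and B: "awb K B" and C: "awb K C"
    and f: "f \<in> lin_hom K A B" and g: "g \<in> lin_hom K B C" and h: "h \<in> lin_hom K A C"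
    and eq: "\<And>x. x \<in> carrier A \<Longrightarrow> g (f x) = h x" and z: "z \<in> carrier (awb_chain K A p)"
  shows "chain_map K C p g (chain_map K B p f z) = chain_map K C p h z"
proof -
  interpret A: awb K A by fact
  show ?thesis
    using tensor_map_compose[OF A.field_axioms A.module_axioms awb_module[OF B] awb_module[OF C] f g h eq] z
    by (cases z) (simp add: chain_map_def A.chain_simps)
qed

lemma chain_map_square:
  assumes A: "awb K A" and B: "awb K B" and B': "awb K B'" and C: "awb K C"
    and f: "f \<in> lin_hom K A B" and g: "g \<in> lin_hom K B C" and f': "f' \<in> lin_hom K A B'" and g': "g' \<in> lin_hom K B' C"
    and eq: "\<And>x. x \<in> carrier A \<Longrightarrow> g (f x) = g' (f' x)" and z: "z \<in> carrier (awb_chain K A p)"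
  shows "chain_map K C p g (chain_map K B p f z) = chain_map K C p g' (chain_map K B' p f' z)"
proof -
  note h = lin_hom_compose[OF f' g']
  show ?thesis
    using chain_map_compose[OF A B C f g h eq z] chain_map_compose[OF A B' C f' g' h refl z] by simp
qed

lemma chain_map_id:
  assumes A: "awb K A" and B: "awb K B" and f: "f \<in> lin_hom K A B" and g: "g \<in> lin_hom K B A"
    and eq: "\<And>x. x \<in> carrier A \<Longrightarrow> g (f x) = x" and z: "z \<in> carrier (awb_chain K A p)"
  shows "chain_map K A p g (chain_map K B p f z) = z"
proof -
  interpret A: awb K A by fact
  have i: "(\<lambda>x. x) \<in> lin_hom K A A" by (simp add: lin_hom_def)
  have "chain_map K A p (\<lambda>x. x) z = z"
    using tensor_map_id[OF A.field_axioms A.module_axioms, of "\<lambda>x. x"] z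
    by (cases z) (simp add: chain_map_def A.chain_simps)
  then show ?thesis using chain_map_compose[OF A B A f g i eq z] by simp
qed

lemma chain_map_boundary:
  assumes A: "awb K A" and B: "awb K B" and g: "g \<in> awb_hom K A B" and z: "z \<in> carrier (awb_chain K A (Suc m))"
  shows "chain_map K B m g (awb_boundary K A (Suc m) z) = awb_boundary K B (Suc m) (chain_map K B (Suc m) g z)"
proof -
  interpret A: awb K A by fact
  interpret B: awb K B by fact
  let ?N = "Suc (Suc m)"
  obtain u v where x: "z = (u, v)" "u \<in> carrier (A.T ?N)" "v \<in> carrier (A.T ?N)"
    using z by (cases z) (simp add: A.chain_simps)
  note tm = tensor_map_map[OF A.field_axioms A.module_axioms B.module_axioms awb_hom_lin[OF g]]
  interpret t: linear_map K "A.T (Suc m)" "B.T (Suc m)" "tensor_map K B (Suc m) g" by (rule tm)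
  interpret t': linear_map K "A.T ?N" "B.T ?N" "tensor_map K B ?N g" by (rule tm)
  interpret b: linear_map K "A.T ?N" "A.T (Suc m)" "bar_map K A (Suc m) (Suc m)" by (rule A.bar_linear) simp
  interpret c: linear_map K "A.T ?N" "A.T (Suc m)" "bar_map K A m (Suc m)" by (rule A.bar_linear) simp
  interpret d: linear_map K "A.T ?N" "A.T (Suc m)" "bracket_map K A (Suc m)" by (rule A.bracket_linear)
  show ?thesis using x
    by (simp add: chain_map_def A.awb_boundary_Suc B.awb_boundary_Suc
        tensor_map_bar[OF A B g] tensor_map_bracket[OF A B g])
qed

lemma
  assumes A: "awb K A" and B: "awb K B" and g: "g \<in> awb_hom K A B"
  shows awb_ab_map_hom: "awb_ab_map K B g \<in> lin_hom K (awb_ab K A) (awb_ab K B)"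
    and ab_proj_chain_map: "z \<in> carrier (awb_chain K A 0) \<Longrightarrow>
      ab_proj K B (chain_map K B 0 g z) = awb_ab_map K B g (ab_proj K A z)"
proof -
  interpret A: awb K A by fact
  interpret B: awb K B by fact
  note gl = awb_hom_lin[OF g]
  let ?h = "\<lambda>x. awb_commutator K B +>\<^bsub>B\<^esub> g x"
  have h: "?h \<in> lin_hom K A (awb_ab K B)" by (rule lin_hom_compose[OF gl B.ab_coset_hom])
  have gc: "g x \<in> carrier B" if "x \<in> carrier A" for x using lin_hom_closed[OF gl that] .
  have z: "?h (x \<otimes>\<^bsub>A\<^esub> y) = \<zero>\<^bsub>awb_ab K B\<^esub>" "?h (bracket A x y) = \<zero>\<^bsub>awb_ab K B\<^esub>" if "x \<in> carrier A" "y \<in> carrier A" for x y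
  proof -
    have "g (x \<otimes>\<^bsub>A\<^esub> y) = g x \<otimes>\<^bsub>B\<^esub> g y" "g (bracket A x y) = bracket B (g x) (g y)"
      using g that by (auto simp: awb_hom_def)
    then show "?h (x \<otimes>\<^bsub>A\<^esub> y) = \<zero>\<^bsub>awb_ab K B\<^esub>" "?h (bracket A x y) = \<zero>\<^bsub>awb_ab K B\<^esub>"
      using gc that by (simp_all add: B.ab_coset_zero B.ops_closed B.mult_in_commutator B.bracket_in_commutator)
  qed
  have "awb_ideal K A {x \<in> carrier A. ?h x = \<zero>\<^bsub>awb_ab K B\<^esub>}"
    using lin_kernel_submodule[OF A.module_axioms B.awb_ab_module h] z by (auto simp: awb_ideal_def A.ops_closed)
  then have "awb_commutator K A \<subseteq> {x \<in> carrier A. ?h x = \<zero>\<^bsub>awb_ab K B\<^esub>}"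
    unfolding awb_commutator_def[of K A] by (rule genideal_least) (use z in \<open>auto simp: A.ops_closed\<close>)
  then have ker: "\<And>x. x \<in> awb_commutator K A \<Longrightarrow> ?h x = \<zero>\<^bsub>awb_ab K B\<^esub>" by blast
  show "awb_ab_map K B g \<in> lin_hom K (awb_ab K A) (awb_ab K B)"
    unfolding awb_ab_map_def awb_ab_def[of K A]
    by (rule lin_hom_quot_lift[OF A.field_axioms A.module_axioms A.commutator_submodule B.awb_ab_module h ker])
  assume "z \<in> carrier (awb_chain K A 0)"
  then obtain x where x: "x \<in> carrier A" "z = (A.pt [x], \<zero>\<^bsub>A.T 1\<^esub>)" by (rule A.chain_0E)
  have "ab_proj K B (chain_map K B 0 g z) = awb_commutator K B +>\<^bsub>B\<^esub> g x"
    using x gc tensor_map_pure[OF A.field_axioms A.module_axioms B.module_axioms gl, of "[x]" "Suc 0"]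
    by (simp add: chain_map_def B.ab_proj_pure)
  also have "\<dots> = awb_ab_map K B g (awb_commutator K A +>\<^bsub>A\<^esub> x)"
    unfolding awb_ab_map_def
    using quot_lift_coset[OF A.module_axioms A.commutator_submodule B.awb_ab_module h ker x(1)] by simp
  finally show "ab_proj K B (chain_map K B 0 g z) = awb_ab_map K B g (ab_proj K A z)"
    using x by (simp add: A.ab_proj_pure)
qed

context free_simplicial_resolution
begin

lemma K_field: "field K"
  by (rule awb_field[OF target_awb])

abbreviation "E p q \<equiv> awb_chain K (level F q) p"

definition column_boundary :: "nat \<Rightarrow> nat \<Rightarrow> ('f list \<Rightarrow> 'k) set \<times> ('f list \<Rightarrow> 'k) set \<Rightarrow> ('f list \<Rightarrow> 'k) set \<times> ('f list \<Rightarrow> 'k) set"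
  where "column_boundary p q z = (\<Oplus>\<^bsub>E p q\<^esub> i\<in>{..<Suc (Suc q)}.
    sgn_pow K i \<odot>\<^bsub>E p q\<^esub> chain_map K (level F q) p (face F (Suc q) i) z)"

lemma face_awb_hom: "i \<le> Suc q \<Longrightarrow> face F (Suc q) i \<in> awb_hom K (level F (Suc q)) (level F q)"
  using face_hom[of "Suc q" i] by simp

lemma face_lin: "i \<le> Suc q \<Longrightarrow> face F (Suc q) i \<in> lin_hom K (level F (Suc q)) (level F q)"
  by (intro awb_hom_lin face_awb_hom)

lemma C_module: "module K (E p q)"
  by (rule awb.chain_module[OF level_awb])

lemma face_chain_linear:
  "i \<le> Suc q \<Longrightarrow> linear_map K (E p (Suc q)) (E p q) (chain_map K (level F q) p (face F (Suc q) i))"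
  by (intro chain_map_linear level_awb face_lin)

lemma column_boundary_linear: "linear_map K (E p (Suc q)) (E p q) (column_boundary p q)"
  unfolding column_boundary_def
  by (intro linear_map_finsum linear_map_scale C_module face_chain_linear sgn_pow_closed[OF K_field]) auto

text \<open>Reduces the values of linear maps at \<open>column_boundary p q z\<close> to their values at the single faces of
  \<open>z\<close>.  Below, \<open>f\<close> is the boundary of the rows or of the columns, an augmentation of either, or the
  contraction of a column.\<close>

lemma linear_map_column_boundary:
  assumes f: "linear_map K (E p q) W f" and z: "z \<in> carrier (E p (Suc q))"
    and g: "\<And>i. i \<le> Suc q \<Longrightarrow> f (chain_map K (level F q) p (face F (Suc q) i) z) = g i"
  shows "f (column_boundary p q z) = (\<Oplus>\<^bsub>W\<^esub> i\<in>{..<Suc (Suc q)}. sgn_pow K i \<odot>\<^bsub>W\<^esub> g i)"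
proof -
  interpret f: linear_map K "E p q" W f by (rule f)
  note c = linear_map.closed[OF face_chain_linear z] and s = sgn_pow_closed[OF K_field]
  have "f (column_boundary p q z) = (\<Oplus>\<^bsub>W\<^esub> i\<in>{..<Suc (Suc q)}.
      f (sgn_pow K i \<odot>\<^bsub>E p q\<^esub> chain_map K (level F q) p (face F (Suc q) i) z))"
    unfolding column_boundary_def using c s by (intro f.finsum) auto
  also have "\<dots> = (\<Oplus>\<^bsub>W\<^esub> i\<in>{..<Suc (Suc q)}. sgn_pow K i \<odot>\<^bsub>W\<^esub> g i)"
    using c s g f.closed[OF c] by (intro f.W.finsum_cong') (auto simp: less_Suc_eq_le)
  finally show ?thesis .
qed

lemma column_boundary_column_boundary:
  assumes z: "z \<in> carrier (E p (Suc (Suc q)))"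
  shows "column_boundary p q (column_boundary p (Suc q) z) = \<zero>\<^bsub>E p q\<^esub>"
proof -
  let ?C = "E p q"
  define f where "f i j = chain_map K (level F q) p (face F (Suc q) i) (chain_map K (level F (Suc q)) p (face F (Suc (Suc q)) j) z)" for i j
  have "column_boundary p q (column_boundary p (Suc q) z) = (\<Oplus>\<^bsub>?C\<^esub> j\<in>{..<Suc (Suc (Suc q))}. sgn_pow K j \<odot>\<^bsub>?C\<^esub>
      (\<Oplus>\<^bsub>?C\<^esub> i\<in>{..<Suc (Suc q)}. sgn_pow K i \<odot>\<^bsub>?C\<^esub> f i j))"
    by (rule linear_map_column_boundary[OF column_boundary_linear z]) (simp add: column_boundary_def f_def)
  also have "\<dots> = \<zero>\<^bsub>?C\<^esub>"
  proof (rule presimplicial_sum[OF K_field C_module])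
    show "f i j \<in> carrier ?C" if "i < Suc (Suc q)" "j \<le> Suc (Suc q)" for i j
      unfolding f_def using that
      by (intro linear_map.closed[OF face_chain_linear] z) auto
    show "f i j = f (j - 1) i" if "i < j" "j \<le> Suc (Suc q)" for i j
      unfolding f_def using that face_face'[of i j q]
      by (intro chain_map_square[OF level_awb level_awb level_awb level_awb]) (auto intro!: face_lin z)
  qed
  finally show ?thesis .
qed

lemma boundary_column_boundary:
  assumes z: "z \<in> carrier (E (Suc p) (Suc q))"
  shows "awb_boundary K (level F q) (Suc p) (column_boundary (Suc p) q z) = column_boundary p q (awb_boundary K (level F (Suc q)) (Suc p) z)"
proof -
  note b = linear_mapI[OF C_module C_module awb.awb_boundary_hom[OF level_awb]]
  show ?thesis
    unfolding column_boundary_def[of p q]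
    using chain_map_boundary[OF level_awb level_awb face_awb_hom z]
    by (intro linear_map_column_boundary[OF b z]) simp
qed

definition aug :: "nat \<Rightarrow> ('f list \<Rightarrow> 'k) set \<times> ('f list \<Rightarrow> 'k) set \<Rightarrow> ('a list \<Rightarrow> 'k) set \<times> ('a list \<Rightarrow> 'k) set"
  where "aug p = chain_map K A p \<epsilon>"

lemma aug_linear: "linear_map K (E p 0) (awb_chain K A p) (aug p)"
  unfolding aug_def by (rule chain_map_linear[OF level_awb target_awb augmentation_lin])

lemma aug_column_boundary:
  assumes z: "z \<in> carrier (E p 1)"
  shows "aug p (column_boundary p 0 z) = \<zero>\<^bsub>awb_chain K A p\<^esub>"
proof -
  interpret X: module K "awb_chain K A p" by (rule awb.chain_module[OF target_awb])
  interpret a: linear_map K "E p 0" "awb_chain K A p" "aug p" by (rule aug_linear)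
  define w where "w = aug p (chain_map K (level F 0) p (face F 1 0) z)"
  have w: "w \<in> carrier (awb_chain K A p)"
    unfolding w_def using linear_map.closed[OF face_chain_linear[of 0 0 p]] z by simp
  have "aug p (chain_map K (level F 0) p (face F (Suc 0) i) z) = w" if "i \<le> Suc 0" for i
    unfolding w_def aug_def
    using that z face_lin[of _ 0] augmentation
    by (intro chain_map_square[OF level_awb[of 1] level_awb level_awb target_awb] augmentation_lin)
      (auto simp: le_Suc_eq)
  then have "aug p (column_boundary p 0 z) = (\<Oplus>\<^bsub>awb_chain K A p\<^esub> i\<in>{..<Suc (Suc 0)}. sgn_pow K i \<odot>\<^bsub>awb_chain K A p\<^esub> w)"
    using z by (intro linear_map_column_boundary[OF aug_linear]) auto
  also have "\<dots> = \<zero>\<^bsub>awb_chain K A p\<^esub>"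
    using w sgn_pow_closed[OF K_field]
    by (simp add: lessThan_Suc sgn_pow_Suc[OF K_field] sgn_pow_0[OF K_field] X.smult_l_minus X.l_neg)
  finally show ?thesis .
qed

lemma aug_boundary:
  assumes z: "z \<in> carrier (E (Suc p) 0)"
  shows "aug p (awb_boundary K (level F 0) (Suc p) z) = awb_boundary K A (Suc p) (aug (Suc p) z)"
  unfolding aug_def by (rule chain_map_boundary[OF level_awb target_awb augmentation_hom z])

text \<open>The extra degeneracy induces a contraction: of the alternating sum of the faces of \<open>C\<^sub>p(h)(z)\<close>, face \<open>0\<close>
  contributes \<open>z\<close>, and the other faces contribute minus \<open>C\<^sub>p(h)\<close> of the boundary of \<open>z\<close>.\<close>

lemma columns_exact:
  shows "\<lbrakk>z \<in> carrier (E p (Suc q)); column_boundary p q z = \<zero>\<^bsub>E p q\<^esub>\<rbrakk> \<Longrightarrow>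
      \<exists>y\<in>carrier (E p (Suc (Suc q))). column_boundary p (Suc q) y = z"
    and "\<lbrakk>z' \<in> carrier (E p 0); aug p z' = \<zero>\<^bsub>awb_chain K A p\<^esub>\<rbrakk> \<Longrightarrow>
      \<exists>y\<in>carrier (E p (Suc 0)). column_boundary p 0 y = z'"
    and "x \<in> carrier (awb_chain K A p) \<Longrightarrow> \<exists>y\<in>carrier (E p 0). aug p y = x"
proof -
  obtain e h where "e \<in> lin_hom K A (level F 0) \<and> (\<forall>x\<in>carrier A. \<epsilon> (e x) = x) \<and>
    (\<forall>n. h n \<in> lin_hom K (level F n) (level F (Suc n))) \<and>
    (\<forall>n. \<forall>x\<in>carrier (level F n). face F (Suc n) 0 (h n x) = x) \<and>
    (\<forall>x\<in>carrier (level F 0). face F 1 1 (h 0 x) = e (\<epsilon> x)) \<and>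
    (\<forall>n. \<forall>x\<in>carrier (level F (Suc n)). \<forall>i\<le>Suc n.
      face F (Suc (Suc n)) (Suc i) (h (Suc n) x) = h n (face F (Suc n) i x))"
    using extra_degeneracy by (elim exE)
  then have e: "e \<in> lin_hom K A (level F 0)" "\<And>x. x \<in> carrier A \<Longrightarrow> \<epsilon> (e x) = x"
    and h: "\<And>n. h n \<in> lin_hom K (level F n) (level F (Suc n))"
      "\<And>n x. x \<in> carrier (level F n) \<Longrightarrow> face F (Suc n) 0 (h n x) = x"
    and h0: "\<And>x. x \<in> carrier (level F 0) \<Longrightarrow> face F 1 1 (h 0 x) = e (\<epsilon> x)"
    and hS: "\<And>n i x. \<lbrakk>x \<in> carrier (level F (Suc n)); i \<le> Suc n\<rbrakk> \<Longrightarrow>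
      face F (Suc (Suc n)) (Suc i) (h (Suc n) x) = h n (face F (Suc n) i x)"
    by simp_all
  note s = sgn_pow_closed[OF K_field] sgn_pow_Suc[OF K_field] sgn_pow_0[OF K_field]
  show "\<exists>y\<in>carrier (E p 0). aug p y = x" if x: "x \<in> carrier (awb_chain K A p)"
    using chain_map_id[OF target_awb level_awb e(1) augmentation_lin e(2) x]
      linear_map.closed[OF chain_map_linear[OF target_awb level_awb e(1)] x] unfolding aug_def by blast
  show "\<exists>y\<in>carrier (E p (Suc (Suc q))). column_boundary p (Suc q) y = z"
    if z: "z \<in> carrier (E p (Suc q))" and cyc: "column_boundary p q z = \<zero>\<^bsub>E p q\<^esub>"
  proof -
    let ?C = "E p (Suc q)"
    interpret C: module K ?C by (rule C_module)
    define y where "y = chain_map K (level F (Suc (Suc q))) p (h (Suc q)) z"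
    have hl: "linear_map K (E p n) (E p (Suc n)) (chain_map K (level F (Suc n)) p (h n))" for n
      by (rule chain_map_linear[OF level_awb level_awb h(1)])
    have y: "y \<in> carrier (E p (Suc (Suc q)))"
      unfolding y_def using linear_map.closed[OF hl z] .
    let ?g = "\<lambda>i. chain_map K (level F (Suc q)) p (h q) (chain_map K (level F q) p (face F (Suc q) i) z)"
    have d: "chain_map K (level F (Suc q)) p (face F (Suc (Suc q)) i) y = (case i of 0 \<Rightarrow> z | Suc j \<Rightarrow> ?g j)"
      if i: "i \<le> Suc (Suc q)" for i
    proof (cases i)
      case 0
      then show ?thesis unfolding y_def
        using chain_map_id[OF level_awb level_awb h(1) face_lin h(2) z] by simp
    next
      case (Suc j)
      have "chain_map K (level F (Suc q)) p (face F (Suc (Suc q)) (Suc j)) y = ?g j"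
        unfolding y_def using i Suc hS
        by (intro chain_map_square[OF level_awb level_awb level_awb level_awb]) (auto intro!: h(1) face_lin z)
      then show ?thesis using Suc by simp
    qed
    have gc: "?g j \<in> carrier ?C" if "j < Suc (Suc q)" for j
      using that linear_map.closed[OF hl linear_map.closed[OF face_chain_linear z]] by simp
    have "column_boundary p (Suc q) y = (\<Oplus>\<^bsub>?C\<^esub> i\<in>{..<Suc (Suc (Suc q))}. sgn_pow K i \<odot>\<^bsub>?C\<^esub> (case i of 0 \<Rightarrow> z | Suc j \<Rightarrow> ?g j))"
      unfolding column_boundary_def using d z gc s(1) by (intro C.finsum_cong') (auto split: nat.split simp: less_Suc_eq_le)
    also have "\<dots> = z \<oplus>\<^bsub>?C\<^esub> (\<Oplus>\<^bsub>?C\<^esub> i\<in>{..<Suc (Suc q)}. sgn_pow K (Suc i) \<odot>\<^bsub>?C\<^esub> ?g i)"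
      using z gc s by (subst C.finsum_lessThan_Suc_shift) (auto split: nat.split)
    also have "(\<Oplus>\<^bsub>?C\<^esub> i\<in>{..<Suc (Suc q)}. sgn_pow K (Suc i) \<odot>\<^bsub>?C\<^esub> ?g i) =
        (\<Oplus>\<^bsub>?C\<^esub> i\<in>{..<Suc (Suc q)}. (\<ominus>\<^bsub>K\<^esub> \<one>\<^bsub>K\<^esub>) \<odot>\<^bsub>?C\<^esub> (sgn_pow K i \<odot>\<^bsub>?C\<^esub> ?g i))"
      using gc s by (intro C.finsum_cong') (auto simp: C.smult_l_minus)
    also have "\<dots> = (\<ominus>\<^bsub>K\<^esub> \<one>\<^bsub>K\<^esub>) \<odot>\<^bsub>?C\<^esub> (\<Oplus>\<^bsub>?C\<^esub> i\<in>{..<Suc (Suc q)}. sgn_pow K i \<odot>\<^bsub>?C\<^esub> ?g i)"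
      using gc s by (intro C.finsum_smult_ldistr[symmetric]) auto
    also have "(\<Oplus>\<^bsub>?C\<^esub> i\<in>{..<Suc (Suc q)}. sgn_pow K i \<odot>\<^bsub>?C\<^esub> ?g i) = chain_map K (level F (Suc q)) p (h q) (column_boundary p q z)"
      by (rule linear_map_column_boundary[OF hl z, symmetric]) simp
    also have "\<dots> = \<zero>\<^bsub>?C\<^esub>" unfolding cyc using linear_map.zero[OF hl] .
    finally have "column_boundary p (Suc q) y = z" using z by simp
    then show ?thesis using y by blast
  qed
  show "\<exists>y\<in>carrier (E p (Suc 0)). column_boundary p 0 y = z"
    if z: "z \<in> carrier (E p 0)" and cyc: "aug p z = \<zero>\<^bsub>awb_chain K A p\<^esub>" for z
  proof -
    let ?C = "E p 0"
    interpret C: module K ?C by (rule C_module)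
    define y where "y = chain_map K (level F (Suc 0)) p (h 0) z"
    have y: "y \<in> carrier (E p (Suc 0))"
      unfolding y_def using linear_map.closed[OF chain_map_linear[OF level_awb level_awb h(1)] z] .
    have "chain_map K (level F 0) p (face F (Suc 0) 0) y = z"
      unfolding y_def using chain_map_id[OF level_awb level_awb h(1) face_lin h(2) z] by simp
    moreover have "chain_map K (level F 0) p (face F (Suc 0) (Suc 0)) y = chain_map K (level F 0) p e (aug p z)"
      unfolding y_def aug_def using h0 face_lin[of "Suc 0" 0]
      by (intro chain_map_square[OF level_awb level_awb target_awb level_awb]) (auto intro!: h(1) e(1) augmentation_lin z)
    moreover have "\<dots> = \<zero>\<^bsub>?C\<^esub>"
      unfolding cyc by (rule linear_map.zero[OF chain_map_linear[OF target_awb level_awb e(1)]])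
    ultimately have "column_boundary p 0 y = z"
      unfolding column_boundary_def using z s by (simp add: lessThan_Suc)
    then show ?thesis using y by blast
  qed
qed

abbreviation "ab q \<equiv> awb_ab K (level F q)"
abbreviation "ab_boundary \<equiv> alternating_boundary K ab (\<lambda>n i. awb_ab_map K (level F (n - 1)) (face F n i))"

lemma level_split: "\<exists>\<pi> \<sigma> \<tau>. split_awb K (level F q) \<pi> \<sigma> \<tau>"
  by (rule free_awb_split[OF level_awb level_free])

lemma ab_module: "module K (ab q)"
  by (rule awb.awb_ab_module[OF level_awb])

lemma ab_boundary_Suc: "ab_boundary (Suc q) y =
    (\<Oplus>\<^bsub>ab q\<^esub> i\<in>{..<Suc (Suc q)}. sgn_pow K i \<odot>\<^bsub>ab q\<^esub> awb_ab_map K (level F q) (face F (Suc q) i) y)"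
  by (simp add: alternating_boundary_def lessThan_Suc_atMost)

lemma ab_boundary_hom: "ab_boundary (Suc q) \<in> lin_hom K (ab (Suc q)) (ab q)"
proof -
  have "linear_map K (ab (Suc q)) (ab q) (awb_ab_map K (level F q) (face F (Suc q) i))" if "i \<le> Suc q" for i
    by (intro linear_mapI ab_module awb_ab_map_hom level_awb face_awb_hom that)
  then have "linear_map K (ab (Suc q)) (ab q) (\<lambda>y. \<Oplus>\<^bsub>ab q\<^esub> i\<in>{..<Suc (Suc q)}. sgn_pow K i \<odot>\<^bsub>ab q\<^esub> awb_ab_map K (level F q) (face F (Suc q) i) y)"
    by (intro linear_map_finsum linear_map_scale ab_module sgn_pow_closed[OF K_field]) auto
  then show ?thesis unfolding ab_boundary_Suc[abs_def] by (rule linear_map.lin)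
qed

lemma ab_proj_column_boundary:
  assumes z: "z \<in> carrier (E 0 (Suc q))"
  shows "ab_proj K (level F q) (column_boundary 0 q z) = ab_boundary (Suc q) (ab_proj K (level F (Suc q)) z)"
  unfolding ab_boundary_Suc
  using ab_proj_chain_map[OF level_awb level_awb face_awb_hom z]
  by (intro linear_map_column_boundary[OF linear_mapI[OF C_module ab_module awb.ab_proj_hom[OF level_awb]] z]) simp

lemma columns: "resolved_double_complex K (\<lambda>p q. E p q) (awb_chain K A)
    (\<lambda>p q. awb_boundary K (level F q) (Suc p)) column_boundary (\<lambda>p. awb_boundary K A (Suc p)) aug"
proof (rule resolved_double_complex.intro)
  fix p q
  show "module K (E p q)" "module K (awb_chain K A p)"
    by (rule C_module awb.chain_module[OF target_awb])+
  show "awb_boundary K (level F q) (Suc p) \<in> lin_hom K (E (Suc p) q) (E p q)"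
    by (rule awb.awb_boundary_hom[OF level_awb])
  show "column_boundary p q \<in> lin_hom K (E p (Suc q)) (E p q)"
    by (rule linear_map.lin[OF column_boundary_linear])
  show "aug p \<in> lin_hom K (E p 0) (awb_chain K A p)" by (rule linear_map.lin[OF aug_linear])
qed (simp_all add: awb.awb_boundary_boundary[OF level_awb] boundary_column_boundary columns_exact aug_boundary)

lemma rows: "resolved_double_complex K (\<lambda>q p. E p q) ab
    (\<lambda>q p. column_boundary p q) (\<lambda>q p. awb_boundary K (level F q) (Suc p)) (\<lambda>q. ab_boundary (Suc q)) (\<lambda>q. ab_proj K (level F q))"
proof (rule resolved_double_complex.intro)
  fix p q
  show "module K (E p q)" "module K (ab q)"
    by (rule C_module ab_module)+
  show "awb_boundary K (level F q) (Suc p) \<in> lin_hom K (E (Suc p) q) (E p q)"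
    by (rule awb.awb_boundary_hom[OF level_awb])
  show "column_boundary p q \<in> lin_hom K (E p (Suc q)) (E p q)"
    by (rule linear_map.lin[OF column_boundary_linear])
  show "ab_proj K (level F q) \<in> lin_hom K (E 0 q) (ab q)" by (rule awb.ab_proj_hom[OF level_awb])
next
  fix q p x assume x: "x \<in> carrier (E (Suc p) q)"
    "awb_boundary K (level F q) (Suc p) x = \<zero>\<^bsub>E p q\<^esub>"
  show "\<exists>y\<in>carrier (awb_chain K (level F q) (Suc (Suc p))). awb_boundary K (level F q) (Suc (Suc p)) y = x"
    using level_split[of q] split_awb.rows_exact x by blast
next
  fix q x assume x: "x \<in> carrier (E 0 q)" "ab_proj K (level F q) x = \<zero>\<^bsub>ab q\<^esub>"
  show "\<exists>y\<in>carrier (E (Suc 0) q). awb_boundary K (level F q) (Suc 0) y = x"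
    using level_split[of q] split_awb.rows_exact_0 x by blast
next
  fix q y assume "y \<in> carrier (ab q)"
  then show "\<exists>x\<in>carrier (E 0 q). ab_proj K (level F q) x = y"
    by (rule awb.ab_proj_surj[OF level_awb])
qed (simp_all add: column_boundary_column_boundary boundary_column_boundary ab_proj_column_boundary)

lemma homology_iso: "lin_iso K (awb_homology K A n) (quillen_homology K F n)"
proof -
  have row_zero: "ab_proj K (level F q) (awb_boundary K (level F q) (Suc 0) z) = \<zero>\<^bsub>ab q\<^esub>"
    if "z \<in> carrier (E 1 q)" for q z
    using level_split[of q] split_awb.ab_proj_boundary that by fastforce
  have X0: "awb_boundary K A 0 x = \<zero>\<^bsub>awb_chain K A 0\<^esub>" for x
    by (cases x) (simp add: awb_boundary_def)
  have Y0: "ab_boundary 0 y = \<zero>\<^bsub>ab 0\<^esub>" for y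
    by (simp add: alternating_boundary_def)
  have "lin_iso K (homology (awb_chain K A) (awb_boundary K A) n) (homology ab ab_boundary n)"
  proof (rule lin_iso_homology_of_double_complex[OF K_field columns rows])
    show "awb_boundary K A (Suc n) \<in> lin_hom K (awb_chain K A (Suc n)) (awb_chain K A n)" for n
      by (rule awb.awb_boundary_hom[OF target_awb])
    show "ab_boundary (Suc n) \<in> lin_hom K (ab (Suc n)) (ab n)" for n by (rule ab_boundary_hom)
  qed (use row_zero aug_column_boundary X0 Y0 in \<open>auto split: nat.split\<close>)
  then show ?thesis by (simp add: awb_homology_def quillen_homology_def Let_def)
qed

end

theorem theorem2p6:
  fixes K :: "('k, 'r) ring_scheme"
    and A :: "('k, 'a) awb"
    and F :: "('k, 'f) simplicial_awb"
    and \<epsilon> :: "'f \<Rightarrow> 'a"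
  assumes "field K" and "awb K A" and "free_simplicial_resolution K F A \<epsilon>"
  shows "\<forall>n. lin_iso K (awb_homology K A n) (quillen_homology K F n)"
  using free_simplicial_resolution.homology_iso[OF assms(3)] by blast

end
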